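(* Let $\Theta\subseteq\mathbb R$, $\mathcal X\subseteq\mathbb R^d$, $\alpha\in(0,\infty)$, and let $\mathcal P=(P_\theta)_{\theta\in\Theta}$ be a model on $(\mathcal X,\mathcal F)$ with $\sigma$-finite dominating measure $\mu$ and densities $p_\theta$ such that: (C1) $\mathcal P$ is DQM at every $\theta\in\Theta$ with score $s_\theta$; (C2) $(x,\theta)\mapsto p_\theta(x)$ and $(x,\theta)\mapsto s_\theta(x)$ are measurable on $\mathcal X\times\Theta$; (C3) $\theta\mapsto s_\theta\sqrt{p_\theta}$ is continuous from $\Theta$ to $L_2(\mu)$. Moreover, suppose that $p_\theta(x)$ is three times continuously differentiable with respect to $\theta$ for every $x\in\mathcal X$, with derivatives $\dot p_\theta,\ddot p_\theta,\dddot p_\theta$ such that $\theta\mapsto\|\dot p_\theta\|_{L_1(\mu)}$, $\theta\mapsto\|\ddot p_\theta\|_{L_1(\mu)}$ and $\theta\mapsto\|\dddot p_\theta\|_{L_1(\mu)}$ are continuous and finite and $\theta\mapsto\dddot p_\theta$ is continuous as a function from $\Theta$ to $L_1(\mu)$. Let $Q^{(n)}$ be the two-step $\alpha$-sequentially interactive mechanism generating $Z_1,\dots,Z_n$, and $\hat\theta_{n_2}$ the two-step MLE, as described in the context. If $I^*_{\alpha,\theta_0}:=\sup_{Q\in\mathcal Q_\alpha(\mathcal X)}I_{\theta_0}(Q\mathcal P)>0$ for some $\theta_0\in\Theta$, $n_1=n_1(n)\to\infty$, $n_1/n\to0$ and $\hat\theta_{n_2}$ converges to $\theta_0$ in $Q^{(n)}P_{\theta_0}^n$-probability,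 then $\hat\theta_{n_2}$ is also regular and efficient at $\theta_0$, that is, for every $h\in\mathbb R$, $$\sqrt n\left(\hat\theta_{n_2}-[\theta_0+h/\sqrt n]\right)\ \text{converges weakly to}\ N\left(0,\left[I^*_{\alpha,\theta_0}\right]^{-1}\right)\ \text{under}\ Q^{(n)}P^n_{\theta_0+h/\sqrt n}.$$
   Context: $\mathbb N=\{1,2,\dots\}$, $[k]=\{1,\dots,k\}$. DQM. $\mathcal P=(P_\theta)_{\theta\in\Theta}$, $\Theta\subseteq\mathbb R$, with $\mu$-densities $p_\theta$ is DQM at $\theta$ if $\theta$ is interior to $\Theta$ and there is a measurable $s_\theta:\mathcal X\to\mathbb R$ (the score) with $\int(\sqrt{p_{\theta+h}}-\sqrt{p_\theta}-\frac12hs_\theta\sqrt{p_\theta})^2d\mu=o(h^2)$ as $h\to0$; then $I_\theta(\mathcal P)=\mathbb E_\theta[s_\theta^2]<\infty$. Channels. For a Markov kernel $Q$, $[QP](A)=\int Q(A|x)P(dx)$ and $Q\mathcal P=(QP_\theta)_{\theta\in\Theta}$; for measurable $T$, $[QT](dz|x)=Q(dz|T(x))$ and $QT\mathcal P=[QT]\mathcal P$. $\mathcal Q_\alpha(\mathcal X\to\mathcal Z)$ is the set of Markov kernels from $(\mathcal X,\mathcal F)$ to $(\mathcal Z,\mathcal G)$ with $Q(A|x)\le e^\alpha Q(A|x')$ for all $A\in\mathcal G$, $x,x'\in\mathcal X$; $\mathcal Q_\alpha(\mathcal X)$ is the union over all measurable output spaces (a supremum over it is the supremum of all real numbers so attained).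 For $\mathcal P$ DQM at $\theta$ and $Q\in\mathcal Q_\alpha(\mathcal X)$ the model $Q\mathcal P$ is DQM at $\theta$, so $I_\theta(Q\mathcal P)$ is well defined. $\mathcal M_\alpha(\ell,k)$ is the set of $\ell\times k$ matrices with $Q_{ij}\ge0$, $\sum_{i=1}^\ell Q_{ij}=1$ and $e^{-\alpha}Q_{ij'}\le Q_{ij}\le e^\alpha Q_{ij'}$ for all $i,j,j'$; it is identified with $\mathcal Q_\alpha([k]\to[\ell])$ via $Q(C|y)=\sum_{i\in C}Q_{iy}$. Consistent quantizer. A sequence of measurable maps $T_m:\mathcal X\times\Theta\to\mathbb N$ is a consistent quantizer of $\mathcal P$, with associated sequence $(k_m)$ of measurable maps $k_m:\Theta\to\mathbb N$, if: (a) $T_m(x,\theta)\in[k_m(\theta)]$ for all $m,\theta,x$; (b) with $T_{m,\theta}(x)=T_m(x,\theta)$, $B_j=T_{m,\theta}^{-1}(\{j\})$, $J=\{l\in[k_m(\theta)]:0<\mu(B_l)<\infty\}$, $K(\theta)=\bigcup_{j\in J}B_j$, $\dot p_\theta=s_\theta p_\theta$, $\bar p_\theta=\sum_{j\in J}\frac{\int_{B_j}p_\theta d\mu}{\mu(B_j)}\mathbf 1_{B_j}$, $\bar{\dot p}_\theta=\sum_{j\in J}\frac{\int_{B_j}\dot p_\theta d\mu}{\mu(B_j)}\mathbf 1_{B_j}$ and $\Delta_m(\theta):=\|(p_\theta-\bar p_\theta)\mathbf 1_{K(\theta)}\|_{L_1(\mu)}+\|(\dot p_\theta-\bar{\dot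 p}_\theta)\mathbf 1_{K(\theta)}\|_{L_1(\mu)}+\sqrt{P_\theta(K(\theta)^c)}$, one has $\Delta_m(\theta_m)\to0$ for every sequence $(\theta_m)$ in $\Theta$ whose limit is also in $\Theta$. Two-step procedure. The sensitive data are $X_1,\dots,X_n$ iid from $P_\theta$; $n=n_1+n_2$. 1. Fix $Q_0\in\mathcal Q_\alpha(\mathcal X\to\mathcal Z_0)$ such that the model $Q_0\mathcal P$ is identifiable. 2. $Z_1,\dots,Z_{n_1}$ are generated independently with $Z_i\sim Q_0(dz|X_i)$, and $\tilde\theta_{n_1}=\tilde\theta_{n_1}(Z_1,\dots,Z_{n_1})\in\Theta$ is a (measurable) preliminary estimator with $[Q_0P_\theta]^{n_1}(|\tilde\theta_{n_1}-\theta|>\varepsilon)\to0$ as $n_1\to\infty$, for all $\varepsilon>0$ and all $\theta\in\Theta$. 3. Fix a consistent quantizer $(T_m)$ with associated sequence $(k_m)$ and set $\hat T_{n_1}(x)=T_{n_1}(x,\tilde\theta_{n_1})$, $\hat k_{n_1}=k_{n_1}(\tilde\theta_{n_1})$. 4. Let $\hat Q_{n_1}\in\arg\max_{Q\in\mathcal M_\alpha(\hat k_{n_1},\hat k_{n_1})}I_{\tilde\theta_{n_1}}(Q\hat T_{n_1}\mathcal P)$ be a measurable maximizer, i.e. $\hat Q_{n_1}(C|y)=Q(C|y,\tilde\theta_{n_1})$ for a Markov kernel $Q$ from $\mathbb N\times\Theta$ to $\mathbb N$ (depending on $n_1$) such that for every $\theta\in\Theta$ the kernel $Q(\cdot|\cdot,\theta)$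 restricted to $[k_{n_1}(\theta)]$ lies in $\mathcal Q_\alpha([k_{n_1}(\theta)]\to[k_{n_1}(\theta)])$ and maximizes $Q'\mapsto I_\theta(Q'T_{n_1,\theta}\mathcal P)$ over that set (such a kernel exists). 5. Given $Z_1,\dots,Z_{n_1}$, for $i=n_1+1,\dots,n$ the $Z_i\in[\hat k_{n_1}]$ are generated independently with $Z_i\sim\hat Q_{n_1}(dz|\hat T_{n_1}(X_i))$. The resulting overall kernel from $\mathcal X^n$ is $Q^{(n)}(dz_{1:n}|x_{1:n})=\left[\bigotimes_{i=n_1+1}^n[\hat Q_{n_1}\hat T_{n_1}](dz_i|x_i,z_{1:n_1})\right]\left[\bigotimes_{j=1}^{n_1}Q_0(dz_j|x_j)\right]$. 6. $\hat\theta_{n_2}$ is an MLE in the model $[\hat Q_{n_1}\hat T_{n_1}\mathcal P]^{n_2}$, that is, a measurable maximizer over $\Theta$ (where it exists, and defined arbitrarily otherwise) of the conditional log-likelihood $\theta\mapsto\ell_{n_2}(\theta)=\frac1{n_2}\sum_{i=n_1+1}^n\log\hat q_\theta(Z_i)$, where $\hat q_\theta(z)=\sum_{j=1}^{\hat k_{n_1}}[\hat Q_{n_1}]_{z,j}P_\theta(\hat T_{n_1}^{-1}(\{j\}))$.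
   Formalization: Added: a maximizer of the log-likelihood exists with probability tending to one under the law at θ0 (else an arbitrary value could be the "consistent MLE" and the claim fails). The supremum I* is over output spaces inside an arbitrary fixed infinite set. *)

theory Defs
  imports "HOL-Probability.Probability"
begin

section \<open>Dominated models, differentiability in quadratic mean, Fisher information\<close>

definition dominated_model ::
    "'a measure \<Rightarrow> real set \<Rightarrow> (real \<Rightarrow> 'a \<Rightarrow> real) \<Rightarrow> (real \<Rightarrow> 'a measure) \<Rightarrow> bool" where
  "dominated_model \<mu> \<Theta> p P \<longleftrightarrow>
     sigma_finite_measure \<mu> \<and>
     (\<forall>\<theta>\<in>\<Theta>. p \<theta> \<in> borel_measurable \<mu> \<and> (\<forall>x\<in>space \<mu>. 0 \<le> p \<theta> x) \<and>
        P \<theta> = density \<mu> (\<lambda>x. ennreal (p \<theta> x)) \<and> prob_space (P \<theta>))"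

text \<open>The remainder is a nonnegative integral: the Bochner integral would be \<open>0\<close> for
  a remainder that is not square integrable.\<close>

definition dqm_at ::
    "'a measure \<Rightarrow> real set \<Rightarrow> (real \<Rightarrow> 'a \<Rightarrow> real) \<Rightarrow> ('a \<Rightarrow> real) \<Rightarrow> real \<Rightarrow> bool" where
  "dqm_at \<mu> \<Theta> p s \<theta> \<longleftrightarrow>
     \<theta> \<in> interior \<Theta> \<and> s \<in> borel_measurable \<mu> \<and>
     ((\<lambda>h. (\<integral>\<^sup>+x. ennreal ((sqrt (p (\<theta> + h) x) - sqrt (p \<theta> x) - 1/2 * h * s x * sqrt (p \<theta> x))\<^sup>2) \<partial>\<mu>)
            / ennreal (h\<^sup>2)) \<longlongrightarrow> 0) (at 0)"

text \<open>The Fisher information of a family of probability measures does not depend on the choice of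
  the dominating measure, of the densities or of the score.  It is only meaningful
  where such a choice exists, i.e. where the family is differentiable in quadratic mean.\<close>

definition fisher_info :: "real set \<Rightarrow> (real \<Rightarrow> 'a measure) \<Rightarrow> real \<Rightarrow> real" where
  "fisher_info \<Theta> P \<theta> =
     (THE I. \<exists>\<nu> p s. dominated_model \<nu> \<Theta> p P \<and> dqm_at \<nu> \<Theta> p s \<theta> \<and>
        I = (\<integral>x. (s x)\<^sup>2 \<partial>(P \<theta>)))"


section \<open>Locally differentially private channels\<close>

text \<open>Only the \<open>\<sigma>\<close>-algebras of \<open>M\<close> and \<open>N\<close> matter.  The model \<open>Q P\<close> is \<open>\<lambda>\<theta>. P \<theta> \<bind> Q\<close>, and
  the channel \<open>Q T\<close> is \<open>Q \<circ> T\<close>.\<close>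

definition private_kernels :: "real \<Rightarrow> 'a measure \<Rightarrow> 'b measure \<Rightarrow> ('a \<Rightarrow> 'b measure) set" where
  "private_kernels \<alpha> M N =
     {Q \<in> M \<rightarrow>\<^sub>M prob_algebra N.
        \<forall>A\<in>sets N. \<forall>x\<in>space M. \<forall>x'\<in>space M. measure (Q x) A \<le> exp \<alpha> * measure (Q x') A}"

text \<open>HOL cannot range over all output spaces at once, so the supremum is over all measurable
  spaces with points in a type \<open>'w\<close>, which is kept arbitrary.  A finite \<open>'w\<close> is too small in
  general.  If \<open>'w\<close> has at least the cardinality of the continuum, every value is attained:
  post-processing the output of \<open>Q\<close> by the score of \<open>Q P\<close> at \<open>\<theta>\<close>, which is real-valued, keeps the
  Fisher information at \<open>\<theta>\<close>.\<close>

definition optimal_info ::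
    "'w itself \<Rightarrow> real \<Rightarrow> 'a measure \<Rightarrow> real set \<Rightarrow> (real \<Rightarrow> 'a measure) \<Rightarrow> real \<Rightarrow> real" where
  "optimal_info _ \<alpha> M \<Theta> P \<theta> =
     Sup {fisher_info \<Theta> (\<lambda>t. P t \<bind> Q) \<theta> | (N :: 'w measure) Q. Q \<in> private_kernels \<alpha> M N}"


section \<open>Consistent quantizers\<close>

abbreviation pos_nats :: "nat measure" where
  "pos_nats \<equiv> count_space {1..}"

abbreviation param_space :: "real set \<Rightarrow> real measure" where
  "param_space \<Theta> \<equiv> restrict_space borel \<Theta>"

text \<open>In the following definitions \<open>T\<close> is one of the maps \<open>T\<^sub>m\<close>, and \<open>k\<close> stands for \<open>k\<^sub>m(\<theta>)\<close>.\<close>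

definition quant_cell :: "'a measure \<Rightarrow> ('a \<times> real \<Rightarrow> nat) \<Rightarrow> real \<Rightarrow> nat \<Rightarrow> 'a set" where
  "quant_cell \<mu> T \<theta> j = {x \<in> space \<mu>. T (x, \<theta>) = j}"

definition regular_cells :: "'a measure \<Rightarrow> ('a \<times> real \<Rightarrow> nat) \<Rightarrow> nat \<Rightarrow> real \<Rightarrow> nat set" where
  "regular_cells \<mu> T k \<theta> =
     {l \<in> {1..k}. 0 < emeasure \<mu> (quant_cell \<mu> T \<theta> l) \<and> emeasure \<mu> (quant_cell \<mu> T \<theta> l) < \<infinity>}"

definition regular_part :: "'a measure \<Rightarrow> ('a \<times> real \<Rightarrow> nat) \<Rightarrow> nat \<Rightarrow> real \<Rightarrow> 'a set" where
  "regular_part \<mu> T k \<theta> = (\<Union>j\<in>regular_cells \<mu> T k \<theta>. quant_cell \<mu> T \<theta> j)"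

definition cell_average ::
    "'a measure \<Rightarrow> ('a \<times> real \<Rightarrow> nat) \<Rightarrow> nat \<Rightarrow> real \<Rightarrow> ('a \<Rightarrow> real) \<Rightarrow> 'a \<Rightarrow> real" where
  "cell_average \<mu> T k \<theta> f x =
     (\<Sum>j\<in>regular_cells \<mu> T k \<theta>.
        (LINT y:quant_cell \<mu> T \<theta> j|\<mu>. f y) / measure \<mu> (quant_cell \<mu> T \<theta> j)
        * indicator (quant_cell \<mu> T \<theta> j) x)"

definition quant_error ::
    "'a measure \<Rightarrow> (real \<Rightarrow> 'a measure) \<Rightarrow> (real \<Rightarrow> 'a \<Rightarrow> real) \<Rightarrow> (real \<Rightarrow> 'a \<Rightarrow> real) \<Rightarrow>
     ('a \<times> real \<Rightarrow> nat) \<Rightarrow> nat \<Rightarrow> real \<Rightarrow> real" where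
  "quant_error \<mu> P p s T k \<theta> =
     (LINT x:regular_part \<mu> T k \<theta>|\<mu>. \<bar>p \<theta> x - cell_average \<mu> T k \<theta> (p \<theta>) x\<bar>)
   + (LINT x:regular_part \<mu> T k \<theta>|\<mu>.
        \<bar>s \<theta> x * p \<theta> x - cell_average \<mu> T k \<theta> (\<lambda>y. s \<theta> y * p \<theta> y) x\<bar>)
   + sqrt (measure (P \<theta>) (space \<mu> - regular_part \<mu> T k \<theta>))"

text \<open>Sequences are indexed by \<open>{1, 2, \<dots>}\<close>; the entry at \<open>0\<close> is junk.\<close>

definition consistent_quantizer ::
    "'a measure \<Rightarrow> real set \<Rightarrow> (real \<Rightarrow> 'a measure) \<Rightarrow> (real \<Rightarrow> 'a \<Rightarrow> real) \<Rightarrow> (real \<Rightarrow> 'a \<Rightarrow> real) \<Rightarrow>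
     (nat \<Rightarrow> 'a \<times> real \<Rightarrow> nat) \<Rightarrow> (nat \<Rightarrow> real \<Rightarrow> nat) \<Rightarrow> bool" where
  "consistent_quantizer \<mu> \<Theta> P p s T k \<longleftrightarrow>
     (\<forall>m\<ge>1. T m \<in> \<mu> \<Otimes>\<^sub>M param_space \<Theta> \<rightarrow>\<^sub>M pos_nats) \<and>
     (\<forall>m\<ge>1. k m \<in> param_space \<Theta> \<rightarrow>\<^sub>M pos_nats) \<and>
     (\<forall>m\<ge>1. \<forall>\<theta>\<in>\<Theta>. \<forall>x\<in>space \<mu>. T m (x, \<theta>) \<in> {1..k m \<theta>}) \<and>
     (\<forall>\<theta>s \<theta>. (\<forall>m. \<theta>s m \<in> \<Theta>) \<longrightarrow> \<theta> \<in> \<Theta> \<longrightarrow> \<theta>s \<longlonglongrightarrow> \<theta> \<longrightarrow>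
        (\<lambda>m. quant_error \<mu> P p s (T m) (k m (\<theta>s m)) (\<theta>s m)) \<longlonglongrightarrow> 0)"


section \<open>The two-step procedure\<close>

definition consistent_preliminary_estimator ::
    "real set \<Rightarrow> 'z measure \<Rightarrow> (real \<Rightarrow> 'z measure) \<Rightarrow> (nat \<Rightarrow> (nat \<Rightarrow> 'z) \<Rightarrow> real) \<Rightarrow> bool" where
  "consistent_preliminary_estimator \<Theta> Z0 R est \<longleftrightarrow>
     (\<forall>m\<ge>1. est m \<in> PiM {1..m} (\<lambda>_. Z0) \<rightarrow>\<^sub>M param_space \<Theta>) \<and>
     (\<forall>\<theta>\<in>\<Theta>. \<forall>\<epsilon>>0.
        (\<lambda>m. measure (PiM {1..m} (\<lambda>_. R \<theta>))
               {z \<in> space (PiM {1..m} (\<lambda>_. R \<theta>)). \<bar>est m z - \<theta>\<bar> > \<epsilon>}) \<longlonglongrightarrow> 0)"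

text \<open>Stochastic \<open>k \<times> k\<close> matrices are identified with kernels from \<open>{1..k}\<close> to \<open>{1..k}\<close>,
  where \<open>measure (Q j) {i}\<close> is the entry in row \<open>i\<close> and column \<open>j\<close>.\<close>

definition measurable_info_maximizer ::
    "real \<Rightarrow> real set \<Rightarrow> (real \<Rightarrow> 'a measure) \<Rightarrow> ('a \<times> real \<Rightarrow> nat) \<Rightarrow> (real \<Rightarrow> nat) \<Rightarrow>
     (nat \<times> real \<Rightarrow> nat measure) \<Rightarrow> bool" where
  "measurable_info_maximizer \<alpha> \<Theta> P T k Q \<longleftrightarrow>
     Q \<in> pos_nats \<Otimes>\<^sub>M param_space \<Theta> \<rightarrow>\<^sub>M prob_algebra pos_nats \<and>
     (\<forall>\<theta>\<in>\<Theta>.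
        is_arg_max (\<lambda>Q'. fisher_info \<Theta> (\<lambda>t. P t \<bind> (Q' \<circ> (\<lambda>x. T (x, \<theta>)))) \<theta>)
          (\<lambda>Q'. Q' \<in> private_kernels \<alpha> (count_space {1..k \<theta>}) (count_space {1..k \<theta>}))
          (\<lambda>y. restrict_space (Q (y, \<theta>)) {1..k \<theta>}))"

text \<open>In the following definitions \<open>m = n\<^sub>1\<close> is the size of the first sample, \<open>n\<close> is the total sample
  size, and \<open>T\<close>, \<open>k\<close>, \<open>Q\<close> and \<open>est\<close> are the entries at \<open>m\<close> of the corresponding sequences.
  A point of the sample space is a pair of \<open>(z\<^sub>1, \<dots>, z\<^sub>m)\<close> and \<open>(z\<^sub>m\<^sub>+\<^sub>1, \<dots>, z\<^sub>n)\<close>, because the two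
  stages have different output spaces.\<close>

definition two_step_space :: "'z measure \<Rightarrow> nat \<Rightarrow> nat \<Rightarrow> ((nat \<Rightarrow> 'z) \<times> (nat \<Rightarrow> nat)) measure" where
  "two_step_space Z0 m n = PiM {1..m} (\<lambda>_. Z0) \<Otimes>\<^sub>M PiM {m+1..n} (\<lambda>_. pos_nats)"

definition two_step_kernel ::
    "'z measure \<Rightarrow> ('a \<Rightarrow> 'z measure) \<Rightarrow> ((nat \<Rightarrow> 'z) \<Rightarrow> real) \<Rightarrow> ('a \<times> real \<Rightarrow> nat) \<Rightarrow>
     (nat \<times> real \<Rightarrow> nat measure) \<Rightarrow> nat \<Rightarrow> nat \<Rightarrow> (nat \<Rightarrow> 'a) \<Rightarrow>
     ((nat \<Rightarrow> 'z) \<times> (nat \<Rightarrow> nat)) measure" where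
  "two_step_kernel Z0 Q0 est T Q m n x =
     PiM {1..m} (\<lambda>j. Q0 (x j)) \<bind>
       (\<lambda>z. distr (PiM {m+1..n} (\<lambda>i. Q (T (x i, est z), est z)))
              (two_step_space Z0 m n) (\<lambda>w. (z, w)))"

definition two_step_law ::
    "'z measure \<Rightarrow> ('a \<Rightarrow> 'z measure) \<Rightarrow> ((nat \<Rightarrow> 'z) \<Rightarrow> real) \<Rightarrow> ('a \<times> real \<Rightarrow> nat) \<Rightarrow>
     (nat \<times> real \<Rightarrow> nat measure) \<Rightarrow> nat \<Rightarrow> nat \<Rightarrow> 'a measure \<Rightarrow>
     ((nat \<Rightarrow> 'z) \<times> (nat \<Rightarrow> nat)) measure" where
  "two_step_law Z0 Q0 est T Q m n P\<theta> =
     PiM {1..n} (\<lambda>_. P\<theta>) \<bind> two_step_kernel Z0 Q0 est T Q m n"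

text \<open>The second-stage probability of the output \<open>i\<close> under \<open>P\<theta>\<close> when the preliminary estimate is
  \<open>\<tau>\<close>.\<close>

definition stage2_prob ::
    "('a \<times> real \<Rightarrow> nat) \<Rightarrow> (real \<Rightarrow> nat) \<Rightarrow> (nat \<times> real \<Rightarrow> nat measure) \<Rightarrow> real \<Rightarrow>
     'a measure \<Rightarrow> nat \<Rightarrow> real" where
  "stage2_prob T k Q \<tau> P\<theta> i =
     (\<Sum>j=1..k \<tau>. measure (Q (j, \<tau>)) {i} * measure P\<theta> (quant_cell P\<theta> T \<tau> j))"

text \<open>In HOL \<open>ln 0 = 0\<close>, whereas the log-likelihood of an impossible observation is \<open>-\<infinity>\<close>.\<close>

definition ext_ln :: "real \<Rightarrow> ereal" where
  "ext_ln y = (if 0 < y then ereal (ln y) else -\<infinity>)"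

definition two_step_loglik ::
    "(real \<Rightarrow> 'a measure) \<Rightarrow> ((nat \<Rightarrow> 'z) \<Rightarrow> real) \<Rightarrow> ('a \<times> real \<Rightarrow> nat) \<Rightarrow> (real \<Rightarrow> nat) \<Rightarrow>
     (nat \<times> real \<Rightarrow> nat measure) \<Rightarrow> nat \<Rightarrow> nat \<Rightarrow> (nat \<Rightarrow> 'z) \<times> (nat \<Rightarrow> nat) \<Rightarrow> real \<Rightarrow> ereal" where
  "two_step_loglik P est T k Q m n zw \<theta> =
     ereal (1 / real (n - m)) *
       (\<Sum>i=m+1..n. ext_ln (stage2_prob T k Q (est (fst zw)) (P \<theta>) (snd zw i)))"

definition two_step_mle_exists ::
    "real set \<Rightarrow> (real \<Rightarrow> 'a measure) \<Rightarrow> ((nat \<Rightarrow> 'z) \<Rightarrow> real) \<Rightarrow> ('a \<times> real \<Rightarrow> nat) \<Rightarrow>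
     (real \<Rightarrow> nat) \<Rightarrow> (nat \<times> real \<Rightarrow> nat measure) \<Rightarrow> nat \<Rightarrow> nat \<Rightarrow>
     (nat \<Rightarrow> 'z) \<times> (nat \<Rightarrow> nat) \<Rightarrow> bool" where
  "two_step_mle_exists \<Theta> P est T k Q m n zw \<longleftrightarrow>
     (\<exists>\<theta>. is_arg_max (two_step_loglik P est T k Q m n zw) (\<lambda>\<theta>. \<theta> \<in> \<Theta>) \<theta>)"

text \<open>A two-step MLE is arbitrary on the observations for which no maximizer exists.  Its
  consistency is therefore informative about the likelihood only together with the condition
  that maximizers exist with probability tending to one.\<close>

definition two_step_mle ::
    "real set \<Rightarrow> (real \<Rightarrow> 'a measure) \<Rightarrow> 'z measure \<Rightarrow> ((nat \<Rightarrow> 'z) \<Rightarrow> real) \<Rightarrow>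
     ('a \<times> real \<Rightarrow> nat) \<Rightarrow> (real \<Rightarrow> nat) \<Rightarrow> (nat \<times> real \<Rightarrow> nat measure) \<Rightarrow> nat \<Rightarrow> nat \<Rightarrow>
     ((nat \<Rightarrow> 'z) \<times> (nat \<Rightarrow> nat) \<Rightarrow> real) \<Rightarrow> bool" where
  "two_step_mle \<Theta> P Z0 est T k Q m n \<theta>hat \<longleftrightarrow>
     \<theta>hat \<in> borel_measurable (two_step_space Z0 m n) \<and>
     (\<forall>zw\<in>space (two_step_space Z0 m n).
        two_step_mle_exists \<Theta> P est T k Q m n zw \<longrightarrow>
        is_arg_max (two_step_loglik P est T k Q m n zw) (\<lambda>\<theta>. \<theta> \<in> \<Theta>) (\<theta>hat zw))"

end

theory Submission
  imports Defs
begin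

text \<open>Privacy makes all regularity uniform. If \<open>K\<close> is an \<open>\<alpha>\<close>-private channel and \<open>M\<^sub>t\<close> is its
  output law under \<open>P\<^sub>t\<close>, then \<open>K x A \<le> e\<^sup>\<alpha> M\<^sub>t A\<close> for every \<open>x\<close>. Hence, for \<open>f\<close> in \<open>L\<^sub>1(\<mu>)\<close>, the
  signed measure \<open>A \<mapsto> \<integral> K x A f x d\<mu>\<close> has a density with respect to \<open>M\<^sub>t\<close> that is bounded by \<open>e\<^sup>\<alpha>\<close>
  times the \<open>L\<^sub>1\<close>-norm of \<open>f\<close> (\<open>adjoint_density_exists\<close>). As this density is linear in \<open>f\<close>, a
  Taylor expansion of \<open>t \<mapsto> p\<^sub>t\<close> in \<open>L\<^sub>1(\<mu>)\<close> turns into a Taylor expansion of the output densities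
  that is uniform in the output. Its constants depend neither on the channel nor on the number of
  its outputs, which is essential because the quantizer may have more and more cells. The
  expansion identifies the Fisher information of the output model as the second moment of the
  density of the derivative of \<open>p\<close> (\<open>fisher_info_channel\<close>), bounds the chi-square divergence of
  output laws (\<open>channel_chi_square\<close>), and makes the scores of the second stage and their
  derivatives bounded and Lipschitz.

  The information of the second-stage channel tends to the optimal information when the first
  sample grows and the preliminary estimate approaches \<open>\<theta>0\<close> (\<open>stage2_info_limit\<close>). It cannot be
  larger, as the channel has finitely many outputs and can be relabelled to have its outputs in
  the given type. It cannot be much smaller, because a nearly optimal channel can be imitated on
  the quantized data: merging outputs with nearly equal scores leaves a finite channel
  (\<open>fisher_info_le_partition\<close>); averaging its rows over the cells of the quantizer changes the
  information by an amount that the quantization error controls (\<open>quantized_info_close\<close>); and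
  among the resulting rows, at most \<open>k\<close> suffice, after rescaling, to form a channel from \<open>k\<close> cells
  with at least the same information (\<open>row_reweighting\<close>). That channel is a competitor of the
  maximizer.

  Given the first sample, the observations of the second stage are independent and identically
  distributed (\<open>two_step_law_structure\<close>), and their scores have mean zero and variance equal to
  the information above. Expanding the score equation of the maximum likelihood estimator gives
  \<open>\<surd>n(\<theta>hat - t) = \<surd>n S / (N I) + small\<close>, with \<open>S\<close> the sum of the scores at \<open>t\<close> and \<open>N\<close> the size of
  the second sample. This yields a bound on the distance between the characteristic function of
  the left-hand side under the law with parameter \<open>t\<close> and the Gaussian one, for fixed sample sizes
  and every \<open>t\<close> near \<open>\<theta>0\<close> (\<open>char_bound\<close>). Taking \<open>t = \<theta>0 + h/\<surd>n\<close> in it gives the limit under local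
  alternatives directly. The only property to transfer from \<open>\<theta>0\<close> to \<open>t\<close> is that the exceptional
  events are improbable: the preliminary estimate or the maximum likelihood estimate is far from
  \<open>\<theta>0\<close>, or the latter does not exist. This is what the chi-square bound gives, as it tensorizes
  over both stages to \<open>(1 + c h\<^sup>2/n)\<^sup>n\<close>, which stays bounded (\<open>law_contiguous\<close>).\<close>

section \<open>Differentiation in L1\<close>

text \<open>The derivative is a pointwise limit of difference quotients along the steps \<open>1/(n+1)\<close>. A
  quotient whose right end leaves \<open>U\<close> is set to \<open>0\<close>; as \<open>U\<close> is open, this happens only finitely
  often at each point.\<close>

lemma measurable_partial_derivative:
  fixes G G1 :: "real \<Rightarrow> 'a \<Rightarrow> real"
  assumes U: "open U"
    and G[measurable]: "(\<lambda>(x, t). G t x) \<in> borel_measurable (\<mu> \<Otimes>\<^sub>M restrict_space borel U)"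
    and deriv: "\<And>x t. x \<in> space \<mu> \<Longrightarrow> t \<in> U \<Longrightarrow> ((\<lambda>t. G t x) has_real_derivative G1 t x) (at t)"
  shows "(\<lambda>(x, t). G1 t x) \<in> borel_measurable (\<mu> \<Otimes>\<^sub>M restrict_space borel U)"
proof -
  let ?M = "\<mu> \<Otimes>\<^sub>M restrict_space borel U"
  have [measurable]: "U \<in> sets borel" using U by simp
  define h :: "nat \<Rightarrow> real" where "h n = 1 / real (Suc n)" for n
  define D where "D n y = (if snd y + h n \<in> U then (G (snd y + h n) (fst y) - G (snd y) (fst y)) / h n else 0)"
    for n and y :: "'a \<times> real"
  have sp: "space ?M = space \<mu> \<times> U" by (simp add: space_pair_measure space_restrict_space)
  have snd_b[measurable]: "snd \<in> borel_measurable ?M"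
    using measurable_snd[of \<mu> "restrict_space borel U"] by (simp add: measurable_restrict_space2_iff)
  have meas: "D n \<in> borel_measurable ?M" for n
  proof -
    let ?A = "{y \<in> space ?M. snd y + h n \<in> U}"
    have A[measurable]: "?A \<in> sets ?M" by measurable
    have "(\<lambda>y. (fst y, snd y + h n)) \<in> restrict_space ?M ?A \<rightarrow>\<^sub>M ?M"
    proof (rule measurable_Pair)
      show "(\<lambda>y. fst y) \<in> restrict_space ?M ?A \<rightarrow>\<^sub>M \<mu>"
        by (auto intro!: measurable_restrict_space1)
      show "(\<lambda>y. snd y + h n) \<in> restrict_space ?M ?A \<rightarrow>\<^sub>M restrict_space borel U"
        by (rule measurable_restrict_space2) (auto intro: measurable_restrict_space1 simp: space_restrict_space)
    qed
    from measurable_compose[OF this G]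
    have 1: "(\<lambda>y. G (snd y + h n) (fst y)) \<in> borel_measurable (restrict_space ?M ?A)" by simp
    have "(\<lambda>y. G (snd y) (fst y)) \<in> borel_measurable ?M"
      using G by (simp add: split_def)
    hence 2: "(\<lambda>y. G (snd y) (fst y)) \<in> borel_measurable (restrict_space ?M ?A)"
      by (rule measurable_restrict_space1)
    have "(\<lambda>y. if y \<in> ?A then (G (snd y + h n) (fst y) - G (snd y) (fst y)) / h n else 0)
          \<in> borel_measurable ?M"
      using 1 2 A by (subst measurable_If_restrict_space_iff) auto
    then show ?thesis
      by (rule measurable_cong[THEN iffD1, rotated]) (auto simp: D_def)
  qed
  have lim: "(\<lambda>n. D n y) \<longlonglongrightarrow> (case y of (x, t) \<Rightarrow> G1 t x)" if ysp: "y \<in> space ?M" for y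
  proof -
    obtain x t where y: "y = (x, t)" and x: "x \<in> space \<mu>" and t: "t \<in> U"
      using ysp unfolding sp by (cases y) auto
    have h0: "h \<longlonglongrightarrow> 0" unfolding h_def by (rule LIMSEQ_inverse_real_of_nat[unfolded inverse_eq_divide])
    have hne: "h n \<noteq> 0" for n by (simp add: h_def)
    have "filterlim h (at 0) sequentially"
      by (rule filterlim_atI[OF h0]) (simp add: hne)
    moreover have "((\<lambda>h. (G (t + h) x - G t x) / h) \<longlongrightarrow> G1 t x) (at 0)"
      using deriv[OF x t] by (simp add: DERIV_def)
    ultimately have L: "(\<lambda>n. (G (t + h n) x - G t x) / h n) \<longlonglongrightarrow> G1 t x"
      by (rule filterlim_compose[rotated])
    have "(\<lambda>n. t + h n) \<longlonglongrightarrow> t" using tendsto_add[OF tendsto_const h0, of t] by simp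
    hence "\<forall>\<^sub>F n in sequentially. t + h n \<in> U" using U t by (rule topological_tendstoD)
    hence "\<forall>\<^sub>F n in sequentially. (G (t + h n) x - G t x) / h n = D n y"
      by eventually_elim (simp add: D_def y)
    from Lim_transform_eventually[OF L this] show ?thesis by (simp add: y)
  qed
  show ?thesis by (rule borel_measurable_LIMSEQ_real[OF lim meas])
qed

text \<open>The mean value inequality for the path \<open>t \<mapsto> G t\<close> in \<open>L\<^sub>1(\<mu>)\<close>: for fixed \<open>x\<close> the increment
  is the integral of the derivative, and Tonelli interchanges this integral with the one over \<open>x\<close>.
  The joint measurability of the derivative is needed for Tonelli.\<close>

lemma L1_mean_value:
  fixes G G1 :: "real \<Rightarrow> 'a \<Rightarrow> real"
  assumes sf: "sigma_finite_measure \<mu>" and U: "open U" and seg: "closed_segment a b \<subseteq> U"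
    and G1[measurable]: "(\<lambda>(x, t). G1 t x) \<in> borel_measurable (\<mu> \<Otimes>\<^sub>M restrict_space borel U)"
    and deriv: "\<And>x t. x \<in> space \<mu> \<Longrightarrow> t \<in> U \<Longrightarrow> ((\<lambda>t. G t x) has_real_derivative G1 t x) (at t)"
    and cont: "\<And>x. x \<in> space \<mu> \<Longrightarrow> continuous_on U (\<lambda>t. G1 t x)"
    and bound: "\<And>t. t \<in> closed_segment a b \<Longrightarrow> (\<integral>\<^sup>+x. ennreal \<bar>G1 t x\<bar> \<partial>\<mu>) \<le> ennreal C"
    and C: "0 \<le> C"
  shows "(\<integral>\<^sup>+x. ennreal \<bar>G b x - G a x\<bar> \<partial>\<mu>) \<le> ennreal (C * \<bar>b - a\<bar>)"
proof -
  interpret sigma_finite_measure \<mu> by fact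
  define l where "l = min a b"
  define u where "u = max a b"
  have lu: "l \<le> u" and seg': "closed_segment a b = {l..u}"
    by (auto simp: l_def u_def closed_segment_eq_real_ivl min_def max_def)
  have inU: "{l..u} \<subseteq> U" using seg seg' by simp
  have [measurable]: "U \<in> sets borel" using U by simp
  interpret pair_sigma_finite \<mu> lborel ..
  let ?g = "\<lambda>x t. ennreal (\<bar>G1 t x\<bar> * indicator {l..u} t)"
  have abs_eq: "\<bar>G b x - G a x\<bar> = \<bar>G u x - G l x\<bar>" for x
    by (auto simp: l_def u_def min_def max_def)
  have point: "ennreal \<bar>G b x - G a x\<bar> \<le> (\<integral>\<^sup>+t. ?g x t \<partial>lborel)" if x: "x \<in> space \<mu>" for x
  proof -
    have ic: "isCont (\<lambda>t. G1 t x) t" if "l \<le> t" "t \<le> u" for t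
      using cont[OF x] U that inU by (auto simp: continuous_on_eq_continuous_at)
    have FTC: "has_bochner_integral lborel (\<lambda>t. G1 t x * indicator {l..u} t) (G u x - G l x)"
      using has_bochner_integral_FTC_Icc_real[OF lu, of "\<lambda>t. G t x" "\<lambda>t. G1 t x"]
        deriv[OF x] inU ic by (force simp: mult.commute)
    have "\<bar>G b x - G a x\<bar> = norm (\<integral>t. G1 t x * indicator {l..u} t \<partial>lborel)"
      using FTC abs_eq by (simp add: has_bochner_integral_iff)
    also have "\<dots> \<le> (\<integral>t. norm (G1 t x * indicator {l..u} t) \<partial>lborel)"
      by (rule integral_norm_bound)
    also have "\<dots> = (\<integral>t. \<bar>G1 t x\<bar> * indicator {l..u} t \<partial>lborel)"
      by (simp add: abs_mult)
    finally have "ennreal \<bar>G b x - G a x\<bar> \<le> ennreal (\<integral>t. \<bar>G1 t x\<bar> * indicator {l..u} t \<partial>lborel)"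
      by (rule ennreal_leI)
    also have "\<dots> = (\<integral>\<^sup>+t. ?g x t \<partial>lborel)"
    proof (rule nn_integral_eq_integral[symmetric])
      have "integrable lborel (\<lambda>t. norm (G1 t x * indicator {l..u} t))"
        using FTC by (intro integrable_norm) (simp add: has_bochner_integral_iff)
      thus "integrable lborel (\<lambda>t. \<bar>G1 t x\<bar> * indicator {l..u} t)" by (simp add: abs_mult)
    qed auto
    finally show ?thesis .
  qed
  have m: "(\<lambda>(x, t). ?g x t) \<in> borel_measurable (\<mu> \<Otimes>\<^sub>M lborel)"
  proof -
    let ?M = "\<mu> \<Otimes>\<^sub>M (borel :: real measure)"
    let ?A = "{y \<in> space ?M. snd y \<in> U}"
    have A[measurable]: "?A \<in> sets ?M" by measurable
    have "(\<lambda>y. (fst y, snd y)) \<in> restrict_space ?M ?A \<rightarrow>\<^sub>M \<mu> \<Otimes>\<^sub>M restrict_space borel U"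
    proof (rule measurable_Pair)
      show "(\<lambda>y. fst y) \<in> restrict_space ?M ?A \<rightarrow>\<^sub>M \<mu>"
        by (auto intro!: measurable_restrict_space1)
      show "(\<lambda>y. snd y) \<in> restrict_space ?M ?A \<rightarrow>\<^sub>M restrict_space borel U"
        by (rule measurable_restrict_space2) (auto intro: measurable_restrict_space1 simp: space_restrict_space)
    qed
    from measurable_compose[OF this G1]
    have "(\<lambda>y. G1 (snd y) (fst y)) \<in> borel_measurable (restrict_space ?M ?A)"
      by (simp add: split_def)
    hence "(\<lambda>y. if y \<in> ?A then G1 (snd y) (fst y) else 0) \<in> borel_measurable ?M"
      using A by (subst measurable_If_restrict_space_iff) auto
    hence "(\<lambda>y. ennreal (\<bar>if y \<in> ?A then G1 (snd y) (fst y) else 0\<bar> * indicator {l..u} (snd y)))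
      \<in> borel_measurable ?M" by measurable
    hence "(\<lambda>(x, t). ?g x t) \<in> borel_measurable ?M"
      apply (rule measurable_cong[THEN iffD1, rotated])
      using inU by (auto simp: space_pair_measure indicator_def split: if_splits)
    thus ?thesis by (simp cong: measurable_cong_sets)
  qed
  have "(\<integral>\<^sup>+x. ennreal \<bar>G b x - G a x\<bar> \<partial>\<mu>) \<le> (\<integral>\<^sup>+x. \<integral>\<^sup>+t. ?g x t \<partial>lborel \<partial>\<mu>)"
    by (rule nn_integral_mono) (rule point)
  also have "\<dots> = (\<integral>\<^sup>+t. \<integral>\<^sup>+x. ?g x t \<partial>\<mu> \<partial>lborel)"
    using Fubini'[OF m] by simp
  also have "\<dots> \<le> (\<integral>\<^sup>+t. ennreal C * indicator {l..u} t \<partial>lborel)"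
  proof (rule nn_integral_mono)
    fix t :: real
    show "(\<integral>\<^sup>+x. ?g x t \<partial>\<mu>) \<le> ennreal C * indicator {l..u} t"
      using bound[of t] by (cases "t \<in> {l..u}") (auto simp: seg')
  qed
  also have "\<dots> = ennreal C * ennreal (u - l)"
    using lu by (simp add: nn_integral_cmult_indicator)
  also have "\<dots> = ennreal (C * \<bar>b - a\<bar>)"
    using C lu by (subst ennreal_mult[symmetric]) (auto simp: l_def u_def min_def max_def)
  finally show ?thesis .
qed

text \<open>Where \<open>p \<theta> x > 0\<close>, the square root of \<open>p\<close> has a pointwise derivative, and by Fatou's lemma
  it must agree almost everywhere with the derivative \<open>s \<surd>p / 2\<close> in quadratic mean. Where \<open>p \<theta> x =
  0\<close>, the density has a minimum at \<open>\<theta>\<close>, so that its derivative vanishes.\<close>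

lemma dqm_score_eq_derivative:
  assumes model: "dominated_model \<mu> \<Theta> p P" and dqm: "dqm_at \<mu> \<Theta> p s \<theta>"
    and deriv: "\<And>x. x \<in> space \<mu> \<Longrightarrow> ((\<lambda>t. p t x) has_real_derivative p1 x) (at \<theta>)"
    and p1[measurable]: "p1 \<in> borel_measurable \<mu>"
  shows "AE x in \<mu>. s x * p \<theta> x = p1 x"
proof -
  from dqm have int: "\<theta> \<in> interior \<Theta>" and s[measurable]: "s \<in> borel_measurable \<mu>"
    and lim: "((\<lambda>h. (\<integral>\<^sup>+x. ennreal ((sqrt (p (\<theta> + h) x) - sqrt (p \<theta> x) - 1/2 * h * s x * sqrt (p \<theta> x))\<^sup>2) \<partial>\<mu>)
            / ennreal (h\<^sup>2)) \<longlongrightarrow> 0) (at 0)"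
    by (auto simp: dqm_at_def)
  have th: "\<theta> \<in> \<Theta>" using int interior_subset by auto
  have pm: "p t \<in> borel_measurable \<mu>" and p0: "\<And>x. x \<in> space \<mu> \<Longrightarrow> 0 \<le> p t x" if "t \<in> \<Theta>" for t
    using model that by (auto simp: dominated_model_def)
  obtain r where r: "0 < r" "cball \<theta> r \<subseteq> \<Theta>" using int by (auto simp: mem_interior_cball)
  define h where "h n = r / real (Suc n)" for n
  have hpos: "0 < h n" for n using r by (simp add: h_def)
  have hr: "h n \<le> r" for n using r by (simp add: h_def divide_le_eq mult_le_cancel_left1)
  have thh: "\<theta> + h n \<in> \<Theta>" for n
    using r hpos[of n] hr[of n] by (auto simp: subset_eq dist_real_def)
  have h0: "h \<longlonglongrightarrow> 0"
    using tendsto_mult[OF tendsto_const LIMSEQ_inverse_real_of_nat, of r]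
    by (simp add: h_def[abs_def] divide_inverse)
  have hat: "filterlim h (at 0) sequentially"
    by (rule filterlim_atI[OF h0]) (use hpos in \<open>simp add: less_imp_neq[symmetric]\<close>)
  have [measurable]: "p \<theta> \<in> borel_measurable \<mu>" "p (\<theta> + h n) \<in> borel_measurable \<mu>" for n
    using pm th thh by auto
  define e where "e n x = ((sqrt (p (\<theta> + h n) x) - sqrt (p \<theta> x) - 1/2 * h n * s x * sqrt (p \<theta> x)) / h n)\<^sup>2"
    for n x
  have em[measurable]: "e n \<in> borel_measurable \<mu>" for n unfolding e_def by measurable
  have elim: "(\<lambda>n. \<integral>\<^sup>+x. ennreal (e n x) \<partial>\<mu>) \<longlonglongrightarrow> 0"
  proof -
    have "(\<integral>\<^sup>+x. ennreal (e n x) \<partial>\<mu>) = (\<integral>\<^sup>+x. ennreal ((sqrt (p (\<theta> + h n) x) - sqrt (p \<theta> x) - 1/2 * h n * s x * sqrt (p \<theta> x))\<^sup>2) \<partial>\<mu>)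
            / ennreal ((h n)\<^sup>2)" for n
    proof -
      have "(\<integral>\<^sup>+x. ennreal (e n x) \<partial>\<mu>)
        = (\<integral>\<^sup>+x. ennreal ((sqrt (p (\<theta> + h n) x) - sqrt (p \<theta> x) - 1/2 * h n * s x * sqrt (p \<theta> x))\<^sup>2) / ennreal ((h n)\<^sup>2) \<partial>\<mu>)"
        unfolding e_def using hpos[of n] by (intro nn_integral_cong) (simp add: divide_ennreal power_divide)
      also have "\<dots> = (\<integral>\<^sup>+x. ennreal ((sqrt (p (\<theta> + h n) x) - sqrt (p \<theta> x) - 1/2 * h n * s x * sqrt (p \<theta> x))\<^sup>2) \<partial>\<mu>)
            / ennreal ((h n)\<^sup>2)"
        by (rule nn_integral_divide) measurable
      finally show ?thesis .
    qed
    with filterlim_compose[OF lim hat] show ?thesis by simp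
  qed
  \<comment> \<open>the pointwise limit of the normalized squared remainder where \<open>p \<theta> x > 0\<close>\<close>
  define L where "L x = (if p \<theta> x > 0 then (p1 x / (2 * sqrt (p \<theta> x)) - 1/2 * s x * sqrt (p \<theta> x))\<^sup>2 else 0)" for x
  have Lm[measurable]: "L \<in> borel_measurable \<mu>" unfolding L_def by measurable
  have pt: "ennreal (L x) \<le> liminf (\<lambda>n. ennreal (e n x))" if x: "x \<in> space \<mu>" for x
  proof (cases "p \<theta> x > 0")
    case True
    have "((\<lambda>t. sqrt (p t x)) has_real_derivative (inverse (sqrt (p \<theta> x)) / 2) * p1 x) (at \<theta>)"
      by (rule DERIV_chain2[OF DERIV_real_sqrt[OF True] deriv[OF x]])
    hence "((\<lambda>h. (sqrt (p (\<theta> + h) x) - sqrt (p \<theta> x)) / h) \<longlongrightarrow> (inverse (sqrt (p \<theta> x)) / 2) * p1 x) (at 0)"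
      by (simp add: DERIV_def)
    from filterlim_compose[OF this hat]
    have l: "(\<lambda>n. (sqrt (p (\<theta> + h n) x) - sqrt (p \<theta> x)) / h n) \<longlonglongrightarrow> (inverse (sqrt (p \<theta> x)) / 2) * p1 x" .
    have "(\<lambda>n. ((sqrt (p (\<theta> + h n) x) - sqrt (p \<theta> x)) / h n - 1/2 * s x * sqrt (p \<theta> x))\<^sup>2)
       \<longlonglongrightarrow> ((inverse (sqrt (p \<theta> x)) / 2) * p1 x - 1/2 * s x * sqrt (p \<theta> x))\<^sup>2"
      by (intro tendsto_intros l)
    moreover have "((sqrt (p (\<theta> + h n) x) - sqrt (p \<theta> x)) / h n - 1/2 * s x * sqrt (p \<theta> x))\<^sup>2 = e n x" for n
      using hpos[of n] by (simp add: e_def diff_divide_distrib)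
    moreover have "((inverse (sqrt (p \<theta> x)) / 2) * p1 x - 1/2 * s x * sqrt (p \<theta> x))\<^sup>2 = L x"
      using True by (simp add: L_def field_simps)
    ultimately have "(\<lambda>n. e n x) \<longlonglongrightarrow> L x" by simp
    hence "(\<lambda>n. ennreal (e n x)) \<longlonglongrightarrow> ennreal (L x)" by (rule tendsto_ennrealI)
    thus ?thesis by (simp add: lim_imp_Liminf)
  qed (simp add: L_def)
  have "(\<integral>\<^sup>+x. ennreal (L x) \<partial>\<mu>) \<le> (\<integral>\<^sup>+x. liminf (\<lambda>n. ennreal (e n x)) \<partial>\<mu>)"
    by (rule nn_integral_mono) (rule pt)
  also have "\<dots> \<le> liminf (\<lambda>n. \<integral>\<^sup>+x. ennreal (e n x) \<partial>\<mu>)"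
    by (rule nn_integral_liminf) measurable
  also have "\<dots> = 0" using elim by (simp add: lim_imp_Liminf)
  finally have "(\<integral>\<^sup>+x. ennreal (L x) \<partial>\<mu>) = 0" by simp
  hence "AE x in \<mu>. ennreal (L x) = 0" by (subst (asm) nn_integral_0_iff_AE) auto
  thus ?thesis
  proof (rule AE_mp, intro AE_I2 impI)
    fix x assume x: "x \<in> space \<mu>" and L0: "ennreal (L x) = 0"
    show "s x * p \<theta> x = p1 x"
    proof (cases "p \<theta> x > 0")
      case True
      have "0 \<le> L x" by (simp add: L_def)
      with L0 have "L x = 0" by (simp add: ennreal_eq_0_iff)
      with True have "p1 x / (2 * sqrt (p \<theta> x)) = 1/2 * s x * sqrt (p \<theta> x)" by (simp add: L_def)
      hence "p1 x = s x * (sqrt (p \<theta> x) * sqrt (p \<theta> x))" using True by (simp add: field_simps)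
      thus ?thesis using True by simp
    next
      case False
      with p0[OF th x] have p0': "p \<theta> x = 0" by simp
      have "p1 x = 0"
      proof (rule DERIV_local_min[OF deriv[OF x] r(1)], intro allI impI)
        fix y assume "\<bar>\<theta> - y\<bar> < r"
        hence "y \<in> \<Theta>" using r(2) by (auto simp: subset_eq dist_real_def)
        thus "p \<theta> x \<le> p y x" using p0[OF _ x] p0' by simp
      qed
      thus ?thesis using p0' by simp
    qed
  qed
qed

lemma integral_abs_le_of_nn_integral:
  fixes f :: "'a \<Rightarrow> real"
  assumes "(\<integral>\<^sup>+x. ennreal \<bar>f x\<bar> \<partial>M) \<le> ennreal c" "0 \<le> c"
  shows "(\<integral>x. \<bar>f x\<bar> \<partial>M) \<le> c"
proof (cases "integrable M (\<lambda>x. \<bar>f x\<bar>)")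
  case True
  hence "ennreal (\<integral>x. \<bar>f x\<bar> \<partial>M) \<le> ennreal c"
    using assms nn_integral_eq_integral[of M "\<lambda>x. \<bar>f x\<bar>"] by simp
  thus ?thesis using assms by simp
qed (simp add: not_integrable_integral_eq assms)

text \<open>All estimates in \<open>L\<^sub>1(\<mu>)\<close> that the proof needs, on one ball around \<open>\<theta>0\<close> and with one
  constant. By the normalization \<open>1 \<le> C\<close>, this constant also dominates the norm of the densities,
  and smaller powers of it can be replaced by larger ones.\<close>

locale l1_smooth_model =
  fixes \<mu> :: "'a measure" and \<Theta> :: "real set" and P :: "real \<Rightarrow> 'a measure"
    and p p1 p2 :: "real \<Rightarrow> 'a \<Rightarrow> real" and \<theta>0 r C :: real
  assumes model: "dominated_model \<mu> \<Theta> p P"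
    and r: "0 < r" and ball: "ball \<theta>0 r \<subseteq> \<Theta>" and C1: "1 \<le> C"
    and int1: "t \<in> ball \<theta>0 r \<Longrightarrow> integrable \<mu> (p1 t)"
    and int2: "t \<in> ball \<theta>0 r \<Longrightarrow> integrable \<mu> (p2 t)"
    and norm1: "t \<in> ball \<theta>0 r \<Longrightarrow> (\<integral>x. \<bar>p1 t x\<bar> \<partial>\<mu>) \<le> C"
    and norm2: "t \<in> ball \<theta>0 r \<Longrightarrow> (\<integral>x. \<bar>p2 t x\<bar> \<partial>\<mu>) \<le> C"
    and lip0: "t \<in> ball \<theta>0 r \<Longrightarrow> u \<in> ball \<theta>0 r \<Longrightarrow> (\<integral>x. \<bar>p u x - p t x\<bar> \<partial>\<mu>) \<le> C * \<bar>u - t\<bar>"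
    and lip1: "t \<in> ball \<theta>0 r \<Longrightarrow> u \<in> ball \<theta>0 r \<Longrightarrow> (\<integral>x. \<bar>p1 u x - p1 t x\<bar> \<partial>\<mu>) \<le> C * \<bar>u - t\<bar>"
    and lip2: "t \<in> ball \<theta>0 r \<Longrightarrow> u \<in> ball \<theta>0 r \<Longrightarrow> (\<integral>x. \<bar>p2 u x - p2 t x\<bar> \<partial>\<mu>) \<le> C * \<bar>u - t\<bar>"
    and expand0: "t \<in> ball \<theta>0 r \<Longrightarrow> u \<in> ball \<theta>0 r \<Longrightarrow>
        (\<integral>x. \<bar>p u x - p t x - (u - t) * p1 t x\<bar> \<partial>\<mu>) \<le> C * (u - t)\<^sup>2"
    and expand1: "t \<in> ball \<theta>0 r \<Longrightarrow> u \<in> ball \<theta>0 r \<Longrightarrow>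
        (\<integral>x. \<bar>p1 u x - p1 t x - (u - t) * p2 t x\<bar> \<partial>\<mu>) \<le> C * (u - t)\<^sup>2"

text \<open>Continuity of the \<open>L\<^sub>1\<close>-norms on a compact ball gives the constant. The quadratic
  expansions are the mean value inequality for \<open>v \<mapsto> G v - v G'(t)\<close>, whose derivative is small by
  the Lipschitz bound.\<close>

lemma l1_smooth_model_near:
  assumes model: "dominated_model \<mu> \<Theta> p P" and op: "open \<Theta>" and th0: "\<theta>0 \<in> \<Theta>"
    and pm: "(\<lambda>(x, \<theta>). p \<theta> x) \<in> borel_measurable (\<mu> \<Otimes>\<^sub>M restrict_space borel \<Theta>)"
    and d1: "\<And>x t. x \<in> space \<mu> \<Longrightarrow> t \<in> \<Theta> \<Longrightarrow> ((\<lambda>t. p t x) has_real_derivative p1 t x) (at t)"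
    and d2: "\<And>x t. x \<in> space \<mu> \<Longrightarrow> t \<in> \<Theta> \<Longrightarrow> ((\<lambda>t. p1 t x) has_real_derivative p2 t x) (at t)"
    and d3: "\<And>x t. x \<in> space \<mu> \<Longrightarrow> t \<in> \<Theta> \<Longrightarrow> ((\<lambda>t. p2 t x) has_real_derivative p3 t x) (at t)"
    and c3: "\<And>x. x \<in> space \<mu> \<Longrightarrow> continuous_on \<Theta> (\<lambda>t. p3 t x)"
    and i1: "\<And>t. t \<in> \<Theta> \<Longrightarrow> integrable \<mu> (p1 t)" and i2: "\<And>t. t \<in> \<Theta> \<Longrightarrow> integrable \<mu> (p2 t)"
    and i3: "\<And>t. t \<in> \<Theta> \<Longrightarrow> integrable \<mu> (p3 t)"
    and n1: "continuous_on \<Theta> (\<lambda>t. \<integral>x. \<bar>p1 t x\<bar> \<partial>\<mu>)"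
    and n2: "continuous_on \<Theta> (\<lambda>t. \<integral>x. \<bar>p2 t x\<bar> \<partial>\<mu>)"
    and n3: "continuous_on \<Theta> (\<lambda>t. \<integral>x. \<bar>p3 t x\<bar> \<partial>\<mu>)"
  obtains r C where "l1_smooth_model \<mu> \<Theta> P p p1 p2 \<theta>0 r C"
proof -
  have sf: "sigma_finite_measure \<mu>" using model by (simp add: dominated_model_def)
  obtain r where r: "0 < r" "cball \<theta>0 r \<subseteq> \<Theta>"
    using op th0 open_contains_cball by blast
  have bound: "\<exists>c\<ge>0. \<forall>t\<in>cball \<theta>0 r. f t \<le> c" if "continuous_on \<Theta> f" for f :: "real \<Rightarrow> real"
  proof -
    have "compact (f ` cball \<theta>0 r)"
      using that r(2) by (intro compact_continuous_image) (auto intro: continuous_on_subset)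
    hence "bounded (f ` cball \<theta>0 r)" by (rule compact_imp_bounded)
    then obtain B where "\<forall>y\<in>f ` cball \<theta>0 r. norm y \<le> B" by (auto simp: bounded_iff)
    hence "\<forall>t\<in>cball \<theta>0 r. f t \<le> max B 0" by (auto simp: max_def abs_le_iff)
    thus ?thesis by (intro exI[of _ "max B 0"]) auto
  qed
  obtain a1 a2 a3 where a: "a1 \<ge> 0" "a2 \<ge> 0" "a3 \<ge> 0"
    "\<And>t. t \<in> cball \<theta>0 r \<Longrightarrow> (\<integral>x. \<bar>p1 t x\<bar> \<partial>\<mu>) \<le> a1"
    "\<And>t. t \<in> cball \<theta>0 r \<Longrightarrow> (\<integral>x. \<bar>p2 t x\<bar> \<partial>\<mu>) \<le> a2"
    "\<And>t. t \<in> cball \<theta>0 r \<Longrightarrow> (\<integral>x. \<bar>p3 t x\<bar> \<partial>\<mu>) \<le> a3"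
    using bound[OF n1] bound[OF n2] bound[OF n3] by blast
  define C where "C = 1 + a1 + a2 + a3"
  have C: "1 \<le> C" "0 \<le> C" "a1 \<le> C" "a2 \<le> C" "a3 \<le> C" using a by (auto simp: C_def)
  have b_in: "t \<in> cball \<theta>0 r" "t \<in> \<Theta>" if "t \<in> ball \<theta>0 r" for t using that r by (auto simp: subset_eq)
  have seg: "closed_segment t u \<subseteq> ball \<theta>0 r" if "t \<in> ball \<theta>0 r" "u \<in> ball \<theta>0 r" for t u :: real
    using that convex_ball[of \<theta>0 r] by (simp add: closed_segment_subset)
  have m1: "(\<lambda>(x, t). p1 t x) \<in> borel_measurable (\<mu> \<Otimes>\<^sub>M restrict_space borel \<Theta>)"
    by (rule measurable_partial_derivative[OF op pm d1])
  have m2: "(\<lambda>(x, t). p2 t x) \<in> borel_measurable (\<mu> \<Otimes>\<^sub>M restrict_space borel \<Theta>)"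
    by (rule measurable_partial_derivative[OF op m1 d2])
  have m3: "(\<lambda>(x, t). p3 t x) \<in> borel_measurable (\<mu> \<Otimes>\<^sub>M restrict_space borel \<Theta>)"
    by (rule measurable_partial_derivative[OF op m2 d3])
  have c1: "continuous_on \<Theta> (\<lambda>t. p1 t x)" if "x \<in> space \<mu>" for x
    using d2[OF that] by (meson DERIV_continuous continuous_at_imp_continuous_on)
  have c2: "continuous_on \<Theta> (\<lambda>t. p2 t x)" if "x \<in> space \<mu>" for x
    using d3[OF that] by (meson DERIV_continuous continuous_at_imp_continuous_on)
  have mv: "(\<integral>x. \<bar>G u x - G t x\<bar> \<partial>\<mu>) \<le> c * \<bar>u - t\<bar>"
    if tu: "t \<in> ball \<theta>0 r" "u \<in> ball \<theta>0 r"
      and m: "(\<lambda>(x, t). G1 t x) \<in> borel_measurable (\<mu> \<Otimes>\<^sub>M restrict_space borel \<Theta>)"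
      and d: "\<And>x t. x \<in> space \<mu> \<Longrightarrow> t \<in> \<Theta> \<Longrightarrow> ((\<lambda>t. G t x) has_real_derivative G1 t x) (at t)"
      and co: "\<And>x. x \<in> space \<mu> \<Longrightarrow> continuous_on \<Theta> (\<lambda>t. G1 t x)"
      and i: "\<And>t. t \<in> \<Theta> \<Longrightarrow> integrable \<mu> (G1 t)"
      and n: "\<And>v. v \<in> closed_segment t u \<Longrightarrow> (\<integral>x. \<bar>G1 v x\<bar> \<partial>\<mu>) \<le> c" and c: "0 \<le> c"
    for G G1 :: "real \<Rightarrow> 'a \<Rightarrow> real" and t u c
  proof (rule integral_abs_le_of_nn_integral)
    have sg: "closed_segment t u \<subseteq> \<Theta>" using seg[OF tu] b_in by auto
    show "(\<integral>\<^sup>+x. ennreal \<bar>G u x - G t x\<bar> \<partial>\<mu>) \<le> ennreal (c * \<bar>u - t\<bar>)"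
    proof (rule L1_mean_value[OF sf op sg m d co _ c])
      fix v assume v: "v \<in> closed_segment t u"
      hence "v \<in> \<Theta>" using sg by auto
      hence "(\<integral>\<^sup>+x. ennreal \<bar>G1 v x\<bar> \<partial>\<mu>) = ennreal (\<integral>x. \<bar>G1 v x\<bar> \<partial>\<mu>)"
        using i by (intro nn_integral_eq_integral) auto
      thus "(\<integral>\<^sup>+x. ennreal \<bar>G1 v x\<bar> \<partial>\<mu>) \<le> ennreal c" using n[OF v] by (simp add: ennreal_leI)
    qed
  qed (use c in simp)
  have mv2: "(\<integral>x. \<bar>G u x - G t x - (u - t) * G1 t x\<bar> \<partial>\<mu>) \<le> C * (u - t)\<^sup>2"
    if tu: "t \<in> ball \<theta>0 r" "u \<in> ball \<theta>0 r"
      and m: "(\<lambda>(x, t). G1 t x) \<in> borel_measurable (\<mu> \<Otimes>\<^sub>M restrict_space borel \<Theta>)"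
      and d: "\<And>x t. x \<in> space \<mu> \<Longrightarrow> t \<in> \<Theta> \<Longrightarrow> ((\<lambda>t. G t x) has_real_derivative G1 t x) (at t)"
      and co: "\<And>x. x \<in> space \<mu> \<Longrightarrow> continuous_on \<Theta> (\<lambda>t. G1 t x)"
      and i: "\<And>t. t \<in> \<Theta> \<Longrightarrow> integrable \<mu> (G1 t)"
      and l: "\<And>t u. t \<in> ball \<theta>0 r \<Longrightarrow> u \<in> ball \<theta>0 r \<Longrightarrow> (\<integral>x. \<bar>G1 u x - G1 t x\<bar> \<partial>\<mu>) \<le> C * \<bar>u - t\<bar>"
    for G G1 :: "real \<Rightarrow> 'a \<Rightarrow> real" and t u
  proof -
    \<comment> \<open>subtracting the linear part at \<open>t\<close> reduces the second-order estimate to the first-order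
    one\<close>
    let ?H = "\<lambda>v x. G v x - v * G1 t x"
    have t: "t \<in> \<Theta>" using tu b_in by auto
    have [measurable]: "G1 t \<in> borel_measurable \<mu>" using i[OF t] by simp
    have "(\<integral>x. \<bar>?H u x - ?H t x\<bar> \<partial>\<mu>) \<le> (C * \<bar>u - t\<bar>) * \<bar>u - t\<bar>"
    proof (rule mv[OF tu, of "\<lambda>v x. G1 v x - G1 t x"])
      show "(\<lambda>(x, v). G1 v x - G1 t x) \<in> borel_measurable (\<mu> \<Otimes>\<^sub>M restrict_space borel \<Theta>)"
        using borel_measurable_diff[OF m, of "\<lambda>y. G1 t (fst y)"] by (simp add: split_def)
    next
      fix x v assume "x \<in> space \<mu>" "v \<in> \<Theta>"
      from d[OF this] show "((\<lambda>v. G v x - v * G1 t x) has_real_derivative G1 v x - G1 t x) (at v)"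
        by (auto intro!: derivative_eq_intros)
    next
      fix x assume "x \<in> space \<mu>"
      from co[OF this] show "continuous_on \<Theta> (\<lambda>v. G1 v x - G1 t x)" by (intro continuous_intros)
    next
      fix v assume v: "v \<in> closed_segment t u"
      hence vb: "v \<in> ball \<theta>0 r" using seg[OF tu] by auto
      have "\<bar>v - t\<bar> \<le> \<bar>u - t\<bar>" using v by (auto simp: closed_segment_eq_real_ivl split: if_splits)
      hence "C * \<bar>v - t\<bar> \<le> C * \<bar>u - t\<bar>" using C by (simp add: mult_left_mono)
      with l[OF tu(1) vb] show "(\<integral>x. \<bar>G1 v x - G1 t x\<bar> \<partial>\<mu>) \<le> C * \<bar>u - t\<bar>" by simp
    qed (use i t C in auto)
    moreover have "?H u x - ?H t x = G u x - G t x - (u - t) * G1 t x" for x by (simp add: algebra_simps)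
    ultimately show ?thesis by (simp add: power2_eq_square mult.assoc)
  qed
  have nb1: "(\<integral>x. \<bar>p1 t x\<bar> \<partial>\<mu>) \<le> C" if "t \<in> ball \<theta>0 r" for t
    using a(4)[OF b_in(1)[OF that]] C by simp
  have nb2: "(\<integral>x. \<bar>p2 t x\<bar> \<partial>\<mu>) \<le> C" if "t \<in> ball \<theta>0 r" for t
    using a(5)[OF b_in(1)[OF that]] C by simp
  have nb3: "(\<integral>x. \<bar>p3 t x\<bar> \<partial>\<mu>) \<le> C" if "t \<in> ball \<theta>0 r" for t
    using a(6)[OF b_in(1)[OF that]] C by simp
  have L0: "(\<integral>x. \<bar>p u x - p t x\<bar> \<partial>\<mu>) \<le> C * \<bar>u - t\<bar>" if "t \<in> ball \<theta>0 r" "u \<in> ball \<theta>0 r" for t u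
    using nb1 C seg[OF that] by (intro mv[OF that m1 d1 c1 i1]) auto
  have L1: "(\<integral>x. \<bar>p1 u x - p1 t x\<bar> \<partial>\<mu>) \<le> C * \<bar>u - t\<bar>" if "t \<in> ball \<theta>0 r" "u \<in> ball \<theta>0 r" for t u
    using nb2 C seg[OF that] by (intro mv[OF that m2 d2 c2 i2]) auto
  have L2: "(\<integral>x. \<bar>p2 u x - p2 t x\<bar> \<partial>\<mu>) \<le> C * \<bar>u - t\<bar>" if "t \<in> ball \<theta>0 r" "u \<in> ball \<theta>0 r" for t u
    using nb3 C seg[OF that] by (intro mv[OF that m3 d3 c3 i3]) auto
  have "l1_smooth_model \<mu> \<Theta> P p p1 p2 \<theta>0 r C"
  proof
    show "ball \<theta>0 r \<subseteq> \<Theta>" using b_in by auto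
    show "(\<integral>x. \<bar>p1 t x\<bar> \<partial>\<mu>) \<le> C" if "t \<in> ball \<theta>0 r" for t by (rule nb1[OF that])
    show "(\<integral>x. \<bar>p2 t x\<bar> \<partial>\<mu>) \<le> C" if "t \<in> ball \<theta>0 r" for t by (rule nb2[OF that])
    show "(\<integral>x. \<bar>p u x - p t x - (u - t) * p1 t x\<bar> \<partial>\<mu>) \<le> C * (u - t)\<^sup>2"
      if "t \<in> ball \<theta>0 r" "u \<in> ball \<theta>0 r" for t u by (rule mv2[OF that m1 d1 c1 i1 L1])
    show "(\<integral>x. \<bar>p1 u x - p1 t x - (u - t) * p2 t x\<bar> \<partial>\<mu>) \<le> C * (u - t)\<^sup>2"
      if "t \<in> ball \<theta>0 r" "u \<in> ball \<theta>0 r" for t u by (rule mv2[OF that m2 d2 c2 i2 L2])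
  qed (use model r C b_in i1 i2 L0 L1 L2 in auto)
  thus ?thesis by (rule that)
qed

section \<open>Densities of channel outputs\<close>

text \<open>The point of the bound is that \<open>u\<close> is compared with an approximation \<open>v\<close>: the square root
  of a density ratio \<open>1 + u\<close> inherits an expansion of the ratio.\<close>

lemma sqrt_taylor_bound:
  fixes u v :: real
  assumes "-1 \<le> u"
  shows "\<bar>sqrt (1 + u) - 1 - v / 2\<bar> \<le> \<bar>u - v\<bar> / 2 + u\<^sup>2 / 2"
proof -
  define w where "w = sqrt (1 + u)"
  have w: "0 \<le> w" "u = w\<^sup>2 - 1" using assms by (auto simp: w_def)
  have "u / 2 - (w - 1) = (w - 1)\<^sup>2 / 2" by (simp add: w(2) power2_eq_square field_simps)
  moreover have "\<bar>w - 1\<bar> \<le> \<bar>u\<bar>"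
  proof -
    have "u = (w - 1) * (w + 1)" by (simp add: w(2) power2_eq_square algebra_simps)
    hence "\<bar>u\<bar> = \<bar>w - 1\<bar> * (w + 1)" using w(1) by (simp add: abs_mult)
    thus ?thesis using w(1) mult_left_mono[of 1 "w + 1" "\<bar>w - 1\<bar>"] by simp
  qed
  hence "(w - 1)\<^sup>2 \<le> u\<^sup>2" by (simp add: abs_le_square_iff)
  ultimately show ?thesis unfolding w_def[symmetric]
    by (smt (verit) zero_le_power2 field_sum_of_halves)
qed

lemma density_le_const:
  assumes h[measurable]: "h \<in> borel_measurable M" and fin: "finite_measure M" and c: "0 \<le> c"
    and le: "\<And>A. A \<in> sets M \<Longrightarrow> emeasure (density M h) A \<le> ennreal c * emeasure M A"
  shows "AE x in M. h x \<le> ennreal c"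
proof -
  interpret finite_measure M by fact
  let ?A = "{x \<in> space M. ennreal c < h x}"
  have [measurable]: "?A \<in> sets M" by measurable
  have cA: "(\<integral>\<^sup>+x. ennreal c * indicator ?A x \<partial>M) = ennreal c * emeasure M ?A"
    by (rule nn_integral_cmult_indicator) measurable
  have "(\<integral>\<^sup>+x. h x * indicator ?A x - ennreal c * indicator ?A x \<partial>M)
      = (\<integral>\<^sup>+x. h x * indicator ?A x \<partial>M) - (\<integral>\<^sup>+x. ennreal c * indicator ?A x \<partial>M)"
    using cA by (intro nn_integral_diff) (auto simp: ennreal_mult_eq_top_iff indicator_def[abs_def])
  also have "\<dots> = 0"
  proof -
    have "ennreal c * emeasure M ?A < \<top>"
      using emeasure_finite[of ?A] by (intro ennreal_mult_less_top[THEN iffD2]) (auto simp: less_top[symmetric])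
    moreover have "(\<integral>\<^sup>+x. h x * indicator ?A x \<partial>M) \<le> ennreal c * emeasure M ?A"
      using le[of ?A] by (simp add: emeasure_density)
    ultimately show ?thesis unfolding cA by (intro diff_eq_0_ennreal) (rule le_less_trans)
  qed
  finally have "AE x in M. h x * indicator ?A x - ennreal c * indicator ?A x = 0"
    by (subst (asm) nn_integral_0_iff_AE) auto
  thus ?thesis
  proof (rule AE_mp, intro AE_I2 impI)
    fix x assume x: "x \<in> space M" and d: "h x * indicator ?A x - ennreal c * indicator ?A x = 0"
    show "h x \<le> ennreal c"
    proof (rule ccontr)
      assume "\<not> h x \<le> ennreal c"
      hence "x \<in> ?A" using x by auto
      hence "h x - ennreal c = 0" using d by simp
      thus False using \<open>\<not> h x \<le> ennreal c\<close> by (simp add: diff_eq_0_iff_ennreal not_le less_top)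
    qed
  qed
qed

context l1_smooth_model
begin

lemma sf: "sigma_finite_measure \<mu>" using model by (simp add: dominated_model_def)

lemma in_ball_Theta: "t \<in> ball \<theta>0 r \<Longrightarrow> t \<in> \<Theta>" using ball by auto
lemma center: "\<theta>0 \<in> ball \<theta>0 r" using r by simp

lemma p_meas: "t \<in> \<Theta> \<Longrightarrow> p t \<in> borel_measurable \<mu>"
  and p_nonneg: "t \<in> \<Theta> \<Longrightarrow> x \<in> space \<mu> \<Longrightarrow> 0 \<le> p t x"
  and P_eq: "t \<in> \<Theta> \<Longrightarrow> P t = density \<mu> (\<lambda>x. ennreal (p t x))"
  and P_prob: "t \<in> \<Theta> \<Longrightarrow> prob_space (P t)"
  using model by (auto simp: dominated_model_def)

lemma P_sets: "t \<in> \<Theta> \<Longrightarrow> sets (P t) = sets \<mu>" and P_space: "t \<in> \<Theta> \<Longrightarrow> space (P t) = space \<mu>"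
  by (simp_all add: P_eq)

lemma P_alg: "t \<in> \<Theta> \<Longrightarrow> P t \<in> space (prob_algebra \<mu>)"
  by (simp add: space_prob_algebra P_sets P_prob)

lemma space_ne: "space \<mu> \<noteq> {}"
  using prob_space.not_empty[OF P_prob[OF in_ball_Theta[OF center]]] P_space[OF in_ball_Theta[OF center]] by simp

lemma assumes "t \<in> \<Theta>" shows p_int: "integrable \<mu> (p t)" and p_total: "(\<integral>x. p t x \<partial>\<mu>) = 1"
proof -
  have "(\<integral>\<^sup>+x. ennreal (p t x) \<partial>\<mu>) = emeasure (P t) (space \<mu>)"
    using assms p_meas[OF assms] by (simp add: P_eq emeasure_density cong: nn_integral_cong)
  hence 1: "(\<integral>\<^sup>+x. ennreal (p t x) \<partial>\<mu>) = 1"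
    using prob_space.emeasure_space_1[OF P_prob[OF assms]] P_space[OF assms] by simp
  show i: "integrable \<mu> (p t)"
    using p_nonneg[OF assms] by (intro integrableI_nonneg) (auto simp: p_meas[OF assms] 1)
  show "(\<integral>x. p t x \<partial>\<mu>) = 1"
    using nn_integral_eq_integral[OF i] p_nonneg[OF assms] 1 by (simp add: integral_nonneg_AE)
qed

lemma p_norm: "t \<in> \<Theta> \<Longrightarrow> (\<integral>x. \<bar>p t x\<bar> \<partial>\<mu>) = 1"
  using p_total p_nonneg by (simp cong: Bochner_Integration.integral_cong)

lemma integral_P:
  fixes f :: "'a \<Rightarrow> real"
  assumes "t \<in> \<Theta>" "f \<in> borel_measurable \<mu>"
  shows "(\<integral>x. f x \<partial>P t) = (\<integral>x. f x * p t x \<partial>\<mu>)"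
  using assms p_nonneg by (simp add: P_eq integral_density p_meas mult.commute)

lemma bounded_mult_int:
  fixes f g :: "'a \<Rightarrow> real"
  assumes "integrable \<mu> f" "g \<in> borel_measurable \<mu>" "\<And>x. x \<in> space \<mu> \<Longrightarrow> \<bar>g x\<bar> \<le> c"
  shows "integrable \<mu> (\<lambda>x. g x * f x)"
proof (rule Bochner_Integration.integrable_bound[of _ "\<lambda>x. c * f x"])
  show "AE x in \<mu>. norm (g x * f x) \<le> norm (c * f x)"
    using assms(3) by (intro AE_I2) (force simp: abs_mult intro!: mult_right_mono)
qed (use assms in auto)

lemma bounded_mult_abs:
  fixes f g :: "'a \<Rightarrow> real"
  assumes f: "integrable \<mu> f" and g: "g \<in> borel_measurable \<mu>" "\<And>x. x \<in> space \<mu> \<Longrightarrow> \<bar>g x\<bar> \<le> c"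
  shows "\<bar>\<integral>x. g x * f x \<partial>\<mu>\<bar> \<le> c * (\<integral>x. \<bar>f x\<bar> \<partial>\<mu>)"
proof -
  have "\<bar>\<integral>x. g x * f x \<partial>\<mu>\<bar> \<le> (\<integral>x. \<bar>g x * f x\<bar> \<partial>\<mu>)" by (rule integral_abs_bound)
  also have "\<dots> \<le> (\<integral>x. c * \<bar>f x\<bar> \<partial>\<mu>)"
    using integrable_abs[OF bounded_mult_int[OF assms]] f g
    by (intro integral_mono) (auto simp: abs_mult intro!: mult_right_mono)
  finally show ?thesis by simp
qed

end

lemma private_kernelsD:
  assumes "K \<in> private_kernels \<alpha> M N"
  shows "K \<in> M \<rightarrow>\<^sub>M prob_algebra N" "K \<in> M \<rightarrow>\<^sub>M subprob_algebra N"
    "x \<in> space M \<Longrightarrow> prob_space (K x)" "x \<in> space M \<Longrightarrow> sets (K x) = sets N"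
    "A \<in> sets N \<Longrightarrow> (\<lambda>x. measure (K x) A) \<in> borel_measurable M"
    "A \<in> sets N \<Longrightarrow> x \<in> space M \<Longrightarrow> y \<in> space M \<Longrightarrow> measure (K x) A \<le> exp \<alpha> * measure (K y) A"
    "x \<in> space M \<Longrightarrow> measure (K x) A \<le> 1"
    "x \<in> space M \<Longrightarrow> emeasure (K x) A = ennreal (measure (K x) A)"
proof -
  show K: "K \<in> M \<rightarrow>\<^sub>M prob_algebra N" using assms by (simp add: private_kernels_def)
  thus "K \<in> M \<rightarrow>\<^sub>M subprob_algebra N" by (rule measurable_prob_algebraD)
  show p: "prob_space (K x)" if "x \<in> space M" for x using measurable_space[OF K that] by (simp add: space_prob_algebra)
  show "sets (K x) = sets N" if "x \<in> space M" using measurable_space[OF K that] by (simp add: space_prob_algebra)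
  show "(\<lambda>x. measure (K x) A) \<in> borel_measurable M" if "A \<in> sets N"
    using measurable_compose[OF K measurable_measure_prob_algebra[OF that]] .
  show "measure (K x) A \<le> exp \<alpha> * measure (K y) A" if "A \<in> sets N" "x \<in> space M" "y \<in> space M"
    using assms that by (simp add: private_kernels_def)
  show "measure (K x) A \<le> 1" if "x \<in> space M" using prob_space.prob_le_1[OF p[OF that]] .
  show "emeasure (K x) A = ennreal (measure (K x) A)" if "x \<in> space M"
    using finite_measure.emeasure_eq_measure[OF prob_space.finite_measure[OF p[OF that]]] .
qed

context l1_smooth_model
begin

lemma bind_alg:
  assumes "K \<in> private_kernels \<alpha> \<mu> N" "t \<in> \<Theta>"
  shows "P t \<bind> K \<in> space (prob_algebra N)" "prob_space (P t \<bind> K)" "sets (P t \<bind> K) = sets N"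
    "space (P t \<bind> K) = space N"
proof -
  note K = private_kernelsD(1)[OF assms(1)]
  show a: "prob_space (P t \<bind> K)" by (rule prob_space_bind'[OF P_alg[OF assms(2)] K])
  show b: "sets (P t \<bind> K) = sets N" by (rule sets_bind'[OF P_alg[OF assms(2)] K])
  show "P t \<bind> K \<in> space (prob_algebra N)" using a b by (simp add: space_prob_algebra)
  show "space (P t \<bind> K) = space N" using b by (rule sets_eq_imp_space_eq)
qed

lemma measure_bind_kernel:
  assumes K: "K \<in> private_kernels \<alpha> \<mu> N" and t: "t \<in> \<Theta>" and A: "A \<in> sets N"
  shows "measure (P t \<bind> K) A = (\<integral>x. measure (K x) A * p t x \<partial>\<mu>)"
proof -
  note D = private_kernelsD[OF K]
  interpret Pt: prob_space "P t" by (rule P_prob[OF t])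
  have "emeasure (P t \<bind> K) A = (\<integral>\<^sup>+x. emeasure (K x) A \<partial>P t)"
    by (rule emeasure_bind_prob_algebra[OF P_alg[OF t] D(1) A])
  also have "\<dots> = (\<integral>\<^sup>+x. ennreal (measure (K x) A) \<partial>P t)"
    using P_space[OF t] D(8) by (intro nn_integral_cong) simp
  also have "\<dots> = ennreal (\<integral>x. measure (K x) A \<partial>P t)"
  proof (rule nn_integral_eq_integral)
    show "integrable (P t) (\<lambda>x. measure (K x) A)"
      using D(5)[OF A] D(7) P_space[OF t] P_sets[OF t]
      by (intro Pt.integrable_const_bound[of _ 1]) (auto cong: measurable_cong_sets)
  qed auto
  finally have "measure (P t \<bind> K) A = (\<integral>x. measure (K x) A \<partial>P t)"
    by (simp add: measure_def)
  thus ?thesis using integral_P[OF t D(5)[OF A]] by simp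
qed

text \<open>Privacy compares \<open>K x\<close> with every \<open>K y\<close>; the output law is the average of the latter. This
  inequality is the source of all uniform bounds.\<close>

lemma kernel_le_bind:
  assumes K: "K \<in> private_kernels \<alpha> \<mu> N" and t: "t \<in> \<Theta>" and A: "A \<in> sets N" and x: "x \<in> space \<mu>"
  shows "measure (K x) A \<le> exp \<alpha> * measure (P t \<bind> K) A"
proof -
  note D = private_kernelsD[OF K]
  have i: "integrable \<mu> (\<lambda>y. measure (K y) A * p t y)"
    by (rule bounded_mult_int[OF p_int[OF t] D(5)[OF A], of 1]) (simp add: D(7))
  have "measure (K x) A = (\<integral>y. measure (K x) A * p t y \<partial>\<mu>)" using p_total[OF t] by simp
  also have "\<dots> \<le> (\<integral>y. exp \<alpha> * (measure (K y) A * p t y) \<partial>\<mu>)"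
  proof (rule integral_mono)
    fix y assume y: "y \<in> space \<mu>"
    show "measure (K x) A * p t y \<le> exp \<alpha> * (measure (K y) A * p t y)"
      using mult_right_mono[OF D(6)[OF A x y] p_nonneg[OF t y]] by (simp add: mult.assoc)
  qed (use i p_int[OF t] in auto)
  also have "\<dots> = exp \<alpha> * measure (P t \<bind> K) A" by (simp add: measure_bind_kernel[OF K t A])
  finally show ?thesis .
qed

text \<open>By the previous inequality, the measure \<open>A \<mapsto> \<integral> K x A f x d\<mu>\<close> is dominated by a constant
  multiple of the output law. So it has a Radon-Nikodym density below that constant, which is cut
  off to obey the bound everywhere and not only almost everywhere.\<close>

lemma kernel_adjoint_nonneg:
  assumes K: "K \<in> private_kernels \<alpha> \<mu> N" and t: "t \<in> \<Theta>"
    and f: "integrable \<mu> f" "\<And>x. x \<in> space \<mu> \<Longrightarrow> 0 \<le> f x"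
  obtains g where "g \<in> borel_measurable N" "\<And>z. 0 \<le> g z" "\<And>z. g z \<le> exp \<alpha> * (\<integral>x. f x \<partial>\<mu>)"
    "\<And>A. A \<in> sets N \<Longrightarrow> (\<integral>\<^sup>+z. ennreal (g z) * indicator A z \<partial>(P t \<bind> K)) = ennreal (\<integral>x. measure (K x) A * f x \<partial>\<mu>)"
proof -
  note D = private_kernelsD[OF K]
  define M where "M = P t \<bind> K"
  interpret M: prob_space M unfolding M_def by (rule bind_alg[OF K t])
  have sM: "sets M = sets N" unfolding M_def by (rule bind_alg[OF K t])
  define c where "c = exp \<alpha> * (\<integral>x. f x \<partial>\<mu>)"
  have c0: "0 \<le> c" using f by (simp add: c_def integral_nonneg_AE)
  have [measurable]: "f \<in> borel_measurable \<mu>" using f by simp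
  define B where "B = density \<mu> (\<lambda>x. ennreal (f x)) \<bind> K"
  have ne: "space (density \<mu> (\<lambda>x. ennreal (f x))) \<noteq> {}" using space_ne by simp
  have K': "K \<in> density \<mu> (\<lambda>x. ennreal (f x)) \<rightarrow>\<^sub>M subprob_algebra N" using D(2) by simp
  have sB: "sets B = sets N" unfolding B_def by (rule sets_bind_measurable[OF K' ne])
  have Bm: "emeasure B A = ennreal (\<integral>x. measure (K x) A * f x \<partial>\<mu>)" if A: "A \<in> sets N" for A
  proof -
    note [measurable] = D(5)[OF A]
    have "emeasure B A = (\<integral>\<^sup>+x. emeasure (K x) A \<partial>density \<mu> (\<lambda>x. ennreal (f x)))"
      unfolding B_def by (rule emeasure_bind[OF ne K' A])
    also have "\<dots> = (\<integral>\<^sup>+x. ennreal (measure (K x) A) \<partial>density \<mu> (\<lambda>x. ennreal (f x)))"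
      using D(8) by (intro nn_integral_cong) simp
    also have "\<dots> = (\<integral>\<^sup>+x. ennreal (measure (K x) A * f x) \<partial>\<mu>)"
      by (subst nn_integral_density) (auto intro!: nn_integral_cong simp: ennreal_mult f(2) mult.commute)
    also have "\<dots> = ennreal (\<integral>x. measure (K x) A * f x \<partial>\<mu>)"
      using D(7) f(2) by (intro nn_integral_eq_integral bounded_mult_int[OF f(1), of _ 1]) auto
    finally show ?thesis .
  qed
  have Ble: "emeasure B A \<le> ennreal c * emeasure M A" if A: "A \<in> sets N" for A
  proof -
    have "(\<integral>x. measure (K x) A * f x \<partial>\<mu>) \<le> (\<integral>x. (exp \<alpha> * measure M A) * f x \<partial>\<mu>)"
    proof (rule integral_mono)
      show "integrable \<mu> (\<lambda>x. measure (K x) A * f x)"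
        using D(7) D(5)[OF A] by (intro bounded_mult_int[OF f(1), of _ 1]) auto
    qed (use f kernel_le_bind[OF K t A] in \<open>auto intro!: mult_right_mono simp: M_def\<close>)
    also have "\<dots> = c * measure M A" by (simp add: c_def)
    finally show ?thesis
      using c0 by (simp add: Bm[OF A] M.emeasure_eq_measure ennreal_mult[symmetric] ennreal_leI)
  qed
  have "absolutely_continuous M B"
    unfolding absolutely_continuous_def null_sets_def
  proof safe
    fix A assume "A \<in> sets M" "emeasure M A = 0"
    thus "emeasure B A = 0" using Ble[of A] sM by simp
  qed (simp add: sB sM)
  then obtain h where h[measurable]: "h \<in> borel_measurable M" and hB: "density M h = B"
    using M.Radon_Nikodym[of B] sB sM by auto
  have hc: "AE z in M. h z \<le> ennreal c"
    by (rule density_le_const[OF h M.finite_measure_axioms c0]) (simp add: hB Ble sM)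
  define g where "g z = min (enn2real (h z)) c" for z
  show thesis
  proof (rule that[of g])
    show gm: "g \<in> borel_measurable N"
    proof -
      have [measurable]: "h \<in> borel_measurable N" using h by (simp add: measurable_cong_sets[OF sM refl])
      show ?thesis unfolding g_def by measurable
    qed
    show "0 \<le> g z" for z using c0 by (simp add: g_def)
    show "g z \<le> exp \<alpha> * (\<integral>x. f x \<partial>\<mu>)" for z by (simp add: g_def c_def)
    fix A assume A: "A \<in> sets N"
    have "(\<integral>\<^sup>+z. ennreal (g z) * indicator A z \<partial>M) = (\<integral>\<^sup>+z. h z * indicator A z \<partial>M)"
    proof (rule nn_integral_cong_AE, use hc in eventually_elim)
      fix z assume "h z \<le> ennreal c"
      hence "ennreal (g z) = h z" unfolding g_def using c0
        by (cases "h z") (auto simp: min_def top_unique)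
      thus "ennreal (g z) * indicator A z = h z * indicator A z" by simp
    qed
    also have "\<dots> = emeasure B A" using A sM by (subst hB[symmetric], subst emeasure_density) auto
    finally show "(\<integral>\<^sup>+z. ennreal (g z) * indicator A z \<partial>(P t \<bind> K)) = ennreal (\<integral>x. measure (K x) A * f x \<partial>\<mu>)"
      using Bm[OF A] by (simp add: M_def)
  qed
qed

text \<open>The operator \<open>f \<mapsto> g\<close> is the adjoint of the channel, as an operator from \<open>L\<^sub>1(\<mu>)\<close> to \<open>L\<^sub>\<infinity>\<close>
  of the output law. It is a relation because \<open>g\<close> is determined only up to null sets.\<close>

definition adjoint_density :: "('a \<Rightarrow> 'b measure) \<Rightarrow> 'b measure \<Rightarrow> real \<Rightarrow> ('a \<Rightarrow> real) \<Rightarrow> ('b \<Rightarrow> real) \<Rightarrow> bool" where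
  "adjoint_density K N t f g \<longleftrightarrow> g \<in> borel_measurable N \<and> (\<exists>c. \<forall>z. \<bar>g z\<bar> \<le> c) \<and>
     (\<forall>A\<in>sets N. (\<integral>z. g z * indicator A z \<partial>(P t \<bind> K)) = (\<integral>x. measure (K x) A * f x \<partial>\<mu>))"

lemma adjoint_density_exists_nonneg:
  assumes K: "K \<in> private_kernels \<alpha> \<mu> N" and t: "t \<in> \<Theta>"
    and f: "integrable \<mu> f" "\<And>x. x \<in> space \<mu> \<Longrightarrow> 0 \<le> f x"
  obtains g where "adjoint_density K N t f g" "\<And>z. 0 \<le> g z" "\<And>z. g z \<le> exp \<alpha> * (\<integral>x. \<bar>f x\<bar> \<partial>\<mu>)"
    "\<And>A. A \<in> sets N \<Longrightarrow> emeasure (density (P t \<bind> K) (\<lambda>z. ennreal (g z))) A = ennreal (\<integral>x. measure (K x) A * f x \<partial>\<mu>)"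
proof -
  note D = private_kernelsD[OF K]
  note B = bind_alg[OF K t]
  obtain g where g: "g \<in> borel_measurable N" "\<And>z. 0 \<le> g z" "\<And>z. g z \<le> exp \<alpha> * (\<integral>x. f x \<partial>\<mu>)"
    "\<And>A. A \<in> sets N \<Longrightarrow> (\<integral>\<^sup>+z. ennreal (g z) * indicator A z \<partial>(P t \<bind> K)) = ennreal (\<integral>x. measure (K x) A * f x \<partial>\<mu>)"
    using kernel_adjoint_nonneg[OF assms] by blast
  have g': "g \<in> borel_measurable (P t \<bind> K)" using g(1) B(3) by (simp cong: measurable_cong_sets)
  have "adjoint_density K N t f g"
    unfolding adjoint_density_def
  proof (intro conjI ballI)
    show "g \<in> borel_measurable N" by fact
    show "\<exists>c. \<forall>z. \<bar>g z\<bar> \<le> c" using g(2,3) by (intro exI[of _ "exp \<alpha> * (\<integral>x. f x \<partial>\<mu>)"]) simp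
    fix A assume A: "A \<in> sets N"
    hence A': "A \<in> sets (P t \<bind> K)" using B by simp
    have "ennreal (\<integral>x. measure (K x) A * f x \<partial>\<mu>) = (\<integral>\<^sup>+z. ennreal (g z * indicator A z) \<partial>(P t \<bind> K))"
      using g(4)[OF A] by (simp add: ennreal_mult' g(2) ennreal_indicator)
    hence "enn2real (\<integral>\<^sup>+z. ennreal (g z * indicator A z) \<partial>(P t \<bind> K)) = enn2real (ennreal (\<integral>x. measure (K x) A * f x \<partial>\<mu>))"
      by simp
    moreover have "0 \<le> (\<integral>x. measure (K x) A * f x \<partial>\<mu>)" using f by (intro integral_nonneg_AE) auto
    ultimately show "(\<integral>z. g z * indicator A z \<partial>(P t \<bind> K)) = (\<integral>x. measure (K x) A * f x \<partial>\<mu>)"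
      using A' g' g(2) by (subst integral_eq_nn_integral) (auto simp del: ennreal_mult')
  qed
  moreover have "(\<integral>x. \<bar>f x\<bar> \<partial>\<mu>) = (\<integral>x. f x \<partial>\<mu>)" using f(2) by (intro Bochner_Integration.integral_cong) auto
  ultimately show thesis using g g' B(3)
    by (intro that[of g]) (auto simp: emeasure_density)
qed

text \<open>Split \<open>f\<close> into its positive and negative parts.\<close>

lemma adjoint_density_exists:
  assumes K: "K \<in> private_kernels \<alpha> \<mu> N" and t: "t \<in> \<Theta>" and f: "integrable \<mu> f"
  obtains g where "adjoint_density K N t f g" "\<And>z. \<bar>g z\<bar> \<le> exp \<alpha> * (\<integral>x. \<bar>f x\<bar> \<partial>\<mu>)"
proof -
  note D = private_kernelsD[OF K]
  note B = bind_alg[OF K t]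
  interpret M: prob_space "P t \<bind> K" by (rule B)
  let ?c = "exp \<alpha> * (\<integral>x. \<bar>f x\<bar> \<partial>\<mu>)"
  have f1: "integrable \<mu> (\<lambda>x. max (f x) 0)" and f2: "integrable \<mu> (\<lambda>x. max (- f x) 0)" using f by auto
  obtain g1 where g1: "adjoint_density K N t (\<lambda>x. max (f x) 0) g1" "\<And>z. 0 \<le> g1 z"
     "\<And>z. g1 z \<le> exp \<alpha> * (\<integral>x. \<bar>max (f x) 0\<bar> \<partial>\<mu>)"
  proof (rule adjoint_density_exists_nonneg[OF K t f1])
    show "\<And>x. 0 \<le> max (f x) 0" by simp
  qed (rule that)
  obtain g2 where g2: "adjoint_density K N t (\<lambda>x. max (- f x) 0) g2" "\<And>z. 0 \<le> g2 z"
     "\<And>z. g2 z \<le> exp \<alpha> * (\<integral>x. \<bar>max (- f x) 0\<bar> \<partial>\<mu>)"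
  proof (rule adjoint_density_exists_nonneg[OF K t f2])
    show "\<And>x. 0 \<le> max (- f x) 0" by simp
  qed (rule that)
  have l1: "g1 z \<le> ?c" for z
    by (rule order_trans[OF g1(3)]) (use f in \<open>auto intro!: mult_left_mono integral_mono\<close>)
  have l2: "g2 z \<le> ?c" for z
    by (rule order_trans[OF g2(3)]) (use f in \<open>auto intro!: mult_left_mono integral_mono\<close>)
  have bd: "\<bar>g1 z - g2 z\<bar> \<le> ?c" for z using l1[of z] l2[of z] g1(2)[of z] g2(2)[of z] by linarith
  have "adjoint_density K N t f (\<lambda>z. g1 z - g2 z)"
    unfolding adjoint_density_def
  proof (intro conjI ballI)
    have m: "g1 \<in> borel_measurable N" "g2 \<in> borel_measurable N"
      using g1(1) g2(1) by (auto simp: adjoint_density_def)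
    thus "(\<lambda>z. g1 z - g2 z) \<in> borel_measurable N" by simp
    show "\<exists>c. \<forall>z. \<bar>g1 z - g2 z\<bar> \<le> c" using bd by blast
    fix A assume A: "A \<in> sets N"
    have mm: "(\<lambda>z. g1 z * indicator A z) \<in> borel_measurable (P t \<bind> K)"
       "(\<lambda>z. g2 z * indicator A z) \<in> borel_measurable (P t \<bind> K)"
      using m A B(3) by (auto cong: measurable_cong_sets)
    have i1: "integrable (P t \<bind> K) (\<lambda>z. g1 z * indicator A z)"
      using mm l1 g1(2) by (intro M.integrable_const_bound[of _ ?c]) (auto simp: indicator_def intro: order_trans)
    have i2: "integrable (P t \<bind> K) (\<lambda>z. g2 z * indicator A z)"
      using mm l2 g2(2) by (intro M.integrable_const_bound[of _ ?c]) (auto simp: indicator_def intro: order_trans)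
    have "(\<integral>z. (g1 z - g2 z) * indicator A z \<partial>(P t \<bind> K))
      = (\<integral>x. measure (K x) A * max (f x) 0 \<partial>\<mu>) - (\<integral>x. measure (K x) A * max (- f x) 0 \<partial>\<mu>)"
      using g1(1) g2(1) A i1 i2 by (simp add: left_diff_distrib adjoint_density_def)
    also have "\<dots> = (\<integral>x. measure (K x) A * max (f x) 0 - measure (K x) A * max (- f x) 0 \<partial>\<mu>)"
      by (rule Bochner_Integration.integral_diff[symmetric]; rule bounded_mult_int[of _ _ 1])
        (use D f1 f2 A in auto)
    also have "\<dots> = (\<integral>x. measure (K x) A * f x \<partial>\<mu>)"
      by (rule Bochner_Integration.integral_cong) (auto simp: max_def)
    finally show "(\<integral>z. (g1 z - g2 z) * indicator A z \<partial>(P t \<bind> K)) = (\<integral>x. measure (K x) A * f x \<partial>\<mu>)" .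
  qed
  thus thesis using bd by (rule that)
qed

lemma adjoint_densityD:
  assumes K: "K \<in> private_kernels \<alpha> \<mu> N" and t: "t \<in> \<Theta>" and g: "adjoint_density K N t f g"
  shows "g \<in> borel_measurable (P t \<bind> K)" "integrable (P t \<bind> K) g"
    "A \<in> sets N \<Longrightarrow> (\<integral>z. g z * indicator A z \<partial>(P t \<bind> K)) = (\<integral>x. measure (K x) A * f x \<partial>\<mu>)"
proof -
  interpret M: prob_space "P t \<bind> K" by (rule bind_alg[OF K t])
  show m: "g \<in> borel_measurable (P t \<bind> K)"
    using g bind_alg(3)[OF K t] by (simp add: adjoint_density_def cong: measurable_cong_sets)
  obtain c where "\<forall>z. \<bar>g z\<bar> \<le> c" using g by (auto simp: adjoint_density_def)
  with m show "integrable (P t \<bind> K) g" by (intro M.integrable_const_bound[of _ c]) auto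
  show "A \<in> sets N \<Longrightarrow> (\<integral>z. g z * indicator A z \<partial>(P t \<bind> K)) = (\<integral>x. measure (K x) A * f x \<partial>\<mu>)"
    using g by (simp add: adjoint_density_def)
qed

lemma adjoint_density_unique:
  assumes K: "K \<in> private_kernels \<alpha> \<mu> N" and t: "t \<in> \<Theta>"
    and g: "adjoint_density K N t f g" "adjoint_density K N t f h"
  shows "AE z in P t \<bind> K. g z = h z"
proof (rule density_unique_real)
  fix A assume "A \<in> sets (P t \<bind> K)"
  hence "A \<in> sets N" using bind_alg[OF K t] by simp
  thus "(\<integral>z\<in>A. g z \<partial>(P t \<bind> K)) = (\<integral>z\<in>A. h z \<partial>(P t \<bind> K))"
    using adjoint_densityD(3)[OF K t g(1)] adjoint_densityD(3)[OF K t g(2)]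
    by (simp add: set_lebesgue_integral_def mult.commute)
qed (use adjoint_densityD[OF K t g(1)] adjoint_densityD[OF K t g(2)] in auto)

lemma adjoint_density_add_scaled:
  assumes K: "K \<in> private_kernels \<alpha> \<mu> N" and t: "t \<in> \<Theta>"
    and f: "integrable \<mu> f1" "integrable \<mu> f2"
    and g: "adjoint_density K N t f1 g1" "adjoint_density K N t f2 g2"
  shows "adjoint_density K N t (\<lambda>x. f1 x + a * f2 x) (\<lambda>z. g1 z + a * g2 z)"
  unfolding adjoint_density_def
proof (intro conjI ballI)
  note D = private_kernelsD[OF K]
  show "(\<lambda>z. g1 z + a * g2 z) \<in> borel_measurable N" using g by (auto simp: adjoint_density_def)
  obtain c1 c2 where "\<forall>z. \<bar>g1 z\<bar> \<le> c1" "\<forall>z. \<bar>g2 z\<bar> \<le> c2" using g by (auto simp: adjoint_density_def)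
  hence "\<bar>g1 z + a * g2 z\<bar> \<le> c1 + \<bar>a\<bar> * c2" for z
    by (intro order_trans[OF abs_triangle_ineq] add_mono) (auto simp: abs_mult intro: mult_left_mono)
  thus "\<exists>c. \<forall>z. \<bar>g1 z + a * g2 z\<bar> \<le> c" by blast
  fix A assume A: "A \<in> sets N"
  hence A': "A \<in> sets (P t \<bind> K)" using bind_alg[OF K t] by simp
  have i: "integrable (P t \<bind> K) (\<lambda>z. g1 z * indicator A z)" "integrable (P t \<bind> K) (\<lambda>z. g2 z * indicator A z)"
    using adjoint_densityD(2)[OF K t g(1)] adjoint_densityD(2)[OF K t g(2)] A'
    by (auto intro: integrable_real_mult_indicator)
  have j: "integrable \<mu> (\<lambda>x. measure (K x) A * f1 x)" "integrable \<mu> (\<lambda>x. measure (K x) A * f2 x)"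
    using D A f by (auto intro!: bounded_mult_int[of _ _ 1])
  have "(\<integral>z. (g1 z + a * g2 z) * indicator A z \<partial>(P t \<bind> K))
    = (\<integral>z. g1 z * indicator A z + a * (g2 z * indicator A z) \<partial>(P t \<bind> K))"
    by (simp add: algebra_simps)
  also have "\<dots> = (\<integral>x. measure (K x) A * f1 x \<partial>\<mu>) + a * (\<integral>x. measure (K x) A * f2 x \<partial>\<mu>)"
    using i adjoint_densityD(3)[OF K t g(1) A] adjoint_densityD(3)[OF K t g(2) A] by simp
  also have "\<dots> = (\<integral>x. measure (K x) A * f1 x + a * (measure (K x) A * f2 x) \<partial>\<mu>)"
    using j by simp
  also have "\<dots> = (\<integral>x. measure (K x) A * (f1 x + a * f2 x) \<partial>\<mu>)" by (simp add: algebra_simps)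
  finally show "(\<integral>z. (g1 z + a * g2 z) * indicator A z \<partial>(P t \<bind> K)) = (\<integral>x. measure (K x) A * (f1 x + a * f2 x) \<partial>\<mu>)" .
qed

lemma adjoint_density_one:
  assumes K: "K \<in> private_kernels \<alpha> \<mu> N" and t: "t \<in> \<Theta>"
  shows "adjoint_density K N t (p t) (\<lambda>z. 1)"
  using measure_bind_kernel[OF K t] bind_alg(3)[OF K t]
  by (auto simp: adjoint_density_def)

text \<open>For \<open>f = p u\<close>, the measure that the adjoint density represents is the output law at \<open>u\<close>.\<close>

lemma channel_density_exists:
  assumes K: "K \<in> private_kernels \<alpha> \<mu> N" and t: "t \<in> \<Theta>" and u: "u \<in> \<Theta>"
  obtains q where "adjoint_density K N t (p u) q" "\<And>z. 0 \<le> q z"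
    "P u \<bind> K = density (P t \<bind> K) (\<lambda>z. ennreal (q z))"
proof -
  obtain q where q: "adjoint_density K N t (p u) q" "\<And>z. 0 \<le> q z"
    "\<And>A. A \<in> sets N \<Longrightarrow> emeasure (density (P t \<bind> K) (\<lambda>z. ennreal (q z))) A = ennreal (\<integral>x. measure (K x) A * p u x \<partial>\<mu>)"
    using adjoint_density_exists_nonneg[OF K t p_int[OF u] p_nonneg[OF u]] by metis
  have "P u \<bind> K = density (P t \<bind> K) (\<lambda>z. ennreal (q z))"
  proof (rule measure_eqI)
    show "sets (P u \<bind> K) = sets (density (P t \<bind> K) (\<lambda>z. ennreal (q z)))"
      using bind_alg(3)[OF K t] bind_alg(3)[OF K u] by simp
    fix A assume "A \<in> sets (P u \<bind> K)"
    hence A: "A \<in> sets N" using bind_alg(3)[OF K u] by simp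
    interpret U: prob_space "P u \<bind> K" by (rule bind_alg[OF K u])
    show "emeasure (P u \<bind> K) A = emeasure (density (P t \<bind> K) (\<lambda>z. ennreal (q z))) A"
      by (simp add: q(3)[OF A] U.emeasure_eq_measure measure_bind_kernel[OF K u A])
  qed
  thus thesis using q by (intro that[of q])
qed

end

section \<open>Fisher information and chi-square divergence of channel outputs\<close>

lemma sq_diff_le: "((a::real) - b)\<^sup>2 \<le> 2 * a\<^sup>2 + 2 * b\<^sup>2"
  using zero_le_power2[of "a + b"] by (simp add: power2_sum power2_diff)

text \<open>The second moment of \<open>s - s'\<close> is at most \<open>8\<close> times the sum of the two remainders, which
  tends to zero.\<close>

lemma score_unique:
  assumes [measurable]: "s \<in> borel_measurable M" "s' \<in> borel_measurable M" "\<And>h. f h \<in> borel_measurable M"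
    and l: "((\<lambda>h. (\<integral>\<^sup>+z. ennreal ((f h z - 1/2 * h * s z)\<^sup>2) \<partial>M) / ennreal (h\<^sup>2)) \<longlongrightarrow> 0) (at (0::real))"
    and l': "((\<lambda>h. (\<integral>\<^sup>+z. ennreal ((f h z - 1/2 * h * s' z)\<^sup>2) \<partial>M) / ennreal (h\<^sup>2)) \<longlongrightarrow> 0) (at (0::real))"
  shows "AE z in M. s z = s' z"
proof -
  let ?R = "\<lambda>s h. (\<integral>\<^sup>+z. ennreal ((f h z - 1/2 * h * s z)\<^sup>2) \<partial>M) / ennreal (h\<^sup>2)"
  define D where "D = (\<integral>\<^sup>+z. ennreal ((s z - s' z)\<^sup>2) \<partial>M)"
  \<comment> \<open>\<open>s - s'\<close> is \<open>2/h\<close> times the difference of the two remainders, and \<open>(a - b)\<^sup>2 \<le> 2 a\<^sup>2 + 2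
  b\<^sup>2\<close>\<close>
  have le: "D \<le> 8 * (?R s h + ?R s' h)" if h: "h \<noteq> 0" for h
  proof -
    have h2: "0 < h\<^sup>2" using h by simp
    have R: "?R u h = (\<integral>\<^sup>+z. ennreal ((f h z - 1/2 * h * u z)\<^sup>2 / h\<^sup>2) \<partial>M)"
      if [measurable]: "u \<in> borel_measurable M" for u
    proof -
      have "(\<integral>\<^sup>+z. ennreal ((f h z - 1/2 * h * u z)\<^sup>2 / h\<^sup>2) \<partial>M)
         = (\<integral>\<^sup>+z. ennreal ((f h z - 1/2 * h * u z)\<^sup>2) / ennreal (h\<^sup>2) \<partial>M)"
        using h2 by (intro nn_integral_cong) (simp add: divide_ennreal)
      also have "\<dots> = ?R u h" by (rule nn_integral_divide) measurable
      finally show ?thesis by simp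
    qed
    have "ennreal ((s z - s' z)\<^sup>2) \<le> 8 * (ennreal ((f h z - 1/2 * h * s z)\<^sup>2 / h\<^sup>2) + ennreal ((f h z - 1/2 * h * s' z)\<^sup>2 / h\<^sup>2))" for z
    proof -
      define a where "a = f h z - 1/2 * h * s z"
      define b where "b = f h z - 1/2 * h * s' z"
      have e: "s z - s' z = 2 / h * (b - a)" using h by (simp add: a_def b_def field_simps)
      have "(s z - s' z)\<^sup>2 = 4 * ((b - a)\<^sup>2 / h\<^sup>2)" by (simp only: e power_mult_distrib) (simp add: power_divide)
      also have "\<dots> \<le> 4 * ((2 * b\<^sup>2 + 2 * a\<^sup>2) / h\<^sup>2)"
        using sq_diff_le[of b a] by (intro mult_left_mono divide_right_mono) auto
      also have "\<dots> = 8 * (a\<^sup>2 / h\<^sup>2 + b\<^sup>2 / h\<^sup>2)" by (simp add: add_divide_distrib)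
      finally have "ennreal ((s z - s' z)\<^sup>2) \<le> ennreal (8 * (a\<^sup>2 / h\<^sup>2 + b\<^sup>2 / h\<^sup>2))" by (rule ennreal_leI)
      also have "\<dots> = 8 * (ennreal (a\<^sup>2 / h\<^sup>2) + ennreal (b\<^sup>2 / h\<^sup>2))"
        by (subst ennreal_mult) auto
      finally show ?thesis by (simp add: a_def b_def)
    qed
    hence "D \<le> (\<integral>\<^sup>+z. 8 * (ennreal ((f h z - 1/2 * h * s z)\<^sup>2 / h\<^sup>2) + ennreal ((f h z - 1/2 * h * s' z)\<^sup>2 / h\<^sup>2)) \<partial>M)"
      unfolding D_def by (intro nn_integral_mono)
    also have "\<dots> = 8 * (?R s h + ?R s' h)"
      by (subst nn_integral_cmult, measurable, subst nn_integral_add, measurable) (simp only: R[OF assms(1)] R[OF assms(2)])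
    finally show ?thesis .
  qed
  have "((\<lambda>h. 8 * (?R s h + ?R s' h)) \<longlongrightarrow> 8 * (0 + 0)) (at 0)"
    by (intro tendsto_mult_ennreal tendsto_add tendsto_const l l') auto
  moreover have "\<forall>\<^sub>F h in at 0. D \<le> 8 * (?R s h + ?R s' h)"
    using le by (simp add: eventually_at_filter)
  ultimately have "D \<le> 8 * (0 + 0)"
    by (intro tendsto_lowerbound) auto
  hence "D = 0" by simp
  hence "AE z in M. ennreal ((s z - s' z)\<^sup>2) = 0"
    unfolding D_def by (subst (asm) nn_integral_0_iff_AE) auto
  thus ?thesis by eventually_elim (simp add: ennreal_eq_0_iff)
qed

context l1_smooth_model
begin

text \<open>The remainder is the adjoint density of the remainder of \<open>p\<close>, up to a null set, because
  adjoint densities are linear and unique.\<close>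

lemma channel_density_expansion:
  assumes K: "K \<in> private_kernels \<alpha> \<mu> N" and t: "t \<in> ball \<theta>0 r" and u: "u \<in> ball \<theta>0 r"
    and q: "adjoint_density K N t (p u) q" and g: "adjoint_density K N t (p1 t) g"
  shows "AE z in P t \<bind> K. \<bar>q z - 1 - (u - t) * g z\<bar> \<le> exp \<alpha> * (C * (u - t)\<^sup>2)"
proof -
  have tT: "t \<in> \<Theta>" "u \<in> \<Theta>" using t u in_ball_Theta by auto
  let ?f = "\<lambda>x. p u x - p t x - (u - t) * p1 t x"
  have fi: "integrable \<mu> ?f" using p_int tT int1[OF t] by auto
  obtain w where w: "adjoint_density K N t ?f w" "\<And>z. \<bar>w z\<bar> \<le> exp \<alpha> * (\<integral>x. \<bar>?f x\<bar> \<partial>\<mu>)"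
    using adjoint_density_exists[OF K tT(1) fi] by blast
  have wb: "\<bar>w z\<bar> \<le> exp \<alpha> * (C * (u - t)\<^sup>2)" for z
    using expand0[OF t u] by (intro order_trans[OF w(2)] mult_left_mono) auto
  have "adjoint_density K N t (\<lambda>x. p t x + (u - t) * p1 t x) (\<lambda>z. 1 + (u - t) * g z)"
    by (rule adjoint_density_add_scaled[OF K tT(1) p_int[OF tT(1)] int1[OF t] adjoint_density_one[OF K tT(1)] g])
  from adjoint_density_add_scaled[OF K tT(1) _ fi this w(1), of 1]
  have "adjoint_density K N t (p u) (\<lambda>z. 1 + (u - t) * g z + w z)"
    using p_int[OF tT(1)] int1[OF t] by simp
  from adjoint_density_unique[OF K tT(1) q this]
  have "AE z in P t \<bind> K. q z = 1 + (u - t) * g z + w z" .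
  thus ?thesis by eventually_elim (use wb in auto)
qed

text \<open>With respect to the dominating measure \<open>M\<^sub>t\<close>, the density at \<open>t\<close> is \<open>1\<close>, and the uniform
  expansion of the densities gives differentiability in quadratic mean with the bounded score \<open>g\<close>.
  For any other choice of dominating measure and densities, the remainder at \<open>t\<close> is the same
  integral after factoring out the root of the density at \<open>t\<close>, so that its score agrees with \<open>g\<close>
  almost everywhere and the description in the definition of the Fisher information is unique.\<close>

lemma fisher_info_channel:
  assumes K: "K \<in> private_kernels \<alpha> \<mu> N" and t: "t \<in> ball \<theta>0 r"
    and g: "adjoint_density K N t (p1 t) g"
  shows "fisher_info \<Theta> (\<lambda>u. P u \<bind> K) t = (\<integral>z. (g z)\<^sup>2 \<partial>(P t \<bind> K))"
proof -
  have tT: "t \<in> \<Theta>" using t in_ball_Theta by auto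
  let ?M = "P t \<bind> K"
  interpret M: prob_space ?M by (rule bind_alg[OF K tT])
  have sM: "sets ?M = sets N" by (rule bind_alg[OF K tT])
  have gm[measurable]: "g \<in> borel_measurable ?M" by (rule adjoint_densityD[OF K tT g])
  obtain B where B: "\<And>z. \<bar>g z\<bar> \<le> B" using g by (auto simp: adjoint_density_def)
  have B0: "0 \<le> B" using B[of undefined] by linarith
  have "\<forall>u\<in>\<Theta>. \<exists>q. adjoint_density K N t (p u) q \<and> (\<forall>z. 0 \<le> q z) \<and> P u \<bind> K = density ?M (\<lambda>z. ennreal (q z))"
  proof
    fix u assume u: "u \<in> \<Theta>"
    obtain q where "adjoint_density K N t (p u) q" "\<And>z. 0 \<le> q z" "P u \<bind> K = density ?M (\<lambda>z. ennreal (q z))"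
      using channel_density_exists[OF K tT u] by blast
    thus "\<exists>q. adjoint_density K N t (p u) q \<and> (\<forall>z. 0 \<le> q z) \<and> P u \<bind> K = density ?M (\<lambda>z. ennreal (q z))"
      by (intro exI[of _ q]) auto
  qed
  from bchoice[OF this] obtain q
    where q_all: "\<forall>u\<in>\<Theta>. adjoint_density K N t (p u) (q u) \<and> (\<forall>z. 0 \<le> q u z) \<and> P u \<bind> K = density ?M (\<lambda>z. ennreal (q u z))" ..
  have q: "adjoint_density K N t (p u) (q u)" "0 \<le> q u z" "P u \<bind> K = density ?M (\<lambda>z. ennreal (q u z))"
    if "u \<in> \<Theta>" for u z using q_all[rule_format, OF that] by auto
  \<comment> \<open>outside \<open>\<Theta>\<close> the family is meaningless; the value \<open>0\<close> makes the densities measurable for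
  every index\<close>
  define q' where "q' u = (if u \<in> \<Theta> then q u else (\<lambda>z. 0))" for u
  have q'm[measurable]: "q' u \<in> borel_measurable ?M" for u
    using adjoint_densityD(1)[OF K tT q(1)] by (auto simp: q'_def)
  have qt: "AE z in ?M. q' t z = 1"
    using adjoint_density_unique[OF K tT q(1)[OF tT] adjoint_density_one[OF K tT]] by (simp add: q'_def tT)
  obtain d where d: "0 < d" "d \<le> 1" "\<And>h. \<bar>h\<bar> < d \<Longrightarrow> t + h \<in> ball \<theta>0 r"
  proof -
    obtain e where e: "0 < e" "ball t e \<subseteq> ball \<theta>0 r"
      using t open_contains_ball[of "ball \<theta>0 r"] open_ball by blast
    show thesis
      by (rule that[of "min e 1"]) (use e in \<open>auto simp: subset_eq dist_real_def\<close>)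
  qed
  have model': "dominated_model ?M \<Theta> q' (\<lambda>u. P u \<bind> K)"
    unfolding dominated_model_def
  proof (intro conjI ballI)
    fix u assume u: "u \<in> \<Theta>"
    show "q' u \<in> borel_measurable ?M" by (rule q'm)
    show "0 \<le> q' u z" for z using q(2)[OF u] u by (simp add: q'_def)
    show "P u \<bind> K = density ?M (\<lambda>x. ennreal (q' u x))" using q(3)[OF u] u by (simp add: q'_def)
    show "prob_space (P u \<bind> K)" by (rule bind_alg(2)[OF K u])
  qed (rule M.sigma_finite_measure_axioms)
  define f where "f h z = sqrt (q' (t + h) z) - 1" for h z
  have fm[measurable]: "f h \<in> borel_measurable ?M" for h unfolding f_def by measurable
  define c where "c = exp \<alpha> * C"
  have c0: "0 \<le> c" using C1 by (simp add: c_def)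
  define D where "D = c / 2 + (B + c)\<^sup>2 / 2"
  have D0: "0 \<le> D" using c0 by (simp add: D_def)
  \<comment> \<open>one factor \<open>h\<^sup>2\<close> more than differentiability in quadratic mean requires\<close>
  have fb: "AE z in ?M. (f h z - 1/2 * h * g z)\<^sup>2 \<le> D\<^sup>2 * h^4" if h: "\<bar>h\<bar> < d" for h
  proof -
    have u: "t + h \<in> ball \<theta>0 r" "t + h \<in> \<Theta>" using d(3)[OF h] in_ball_Theta by auto
    have "AE z in ?M. \<bar>q (t + h) z - 1 - h * g z\<bar> \<le> c * h\<^sup>2"
      using channel_density_expansion[OF K t u(1) q(1)[OF u(2)] g] by (simp add: c_def mult.assoc)
    thus ?thesis
    proof eventually_elim
      fix z assume e: "\<bar>q (t + h) z - 1 - h * g z\<bar> \<le> c * h\<^sup>2"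
      define v where "v = q (t + h) z - 1"
      have v: "-1 \<le> v" using q(2)[OF u(2), of z] by (simp add: v_def)
      have "c * h\<^sup>2 \<le> c * \<bar>h\<bar>"
      proof -
        have "\<bar>h\<bar> * \<bar>h\<bar> \<le> \<bar>h\<bar> * 1" using h d(2) by (intro mult_left_mono) auto
        thus ?thesis using c0 by (intro mult_left_mono) (auto simp: power2_eq_square)
      qed
      moreover have "\<bar>h * g z\<bar> \<le> \<bar>h\<bar> * B" using B[of z] by (simp add: abs_mult mult_left_mono)
      ultimately have "\<bar>v\<bar> \<le> (B + c) * \<bar>h\<bar>" using e by (simp add: v_def algebra_simps)
      hence "\<bar>v\<bar>\<^sup>2 \<le> ((B + c) * \<bar>h\<bar>)\<^sup>2" by (intro power_mono) auto
      hence v2: "v\<^sup>2 \<le> (B + c)\<^sup>2 * h\<^sup>2" by (simp add: power_mult_distrib)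
      have "\<bar>f h z - 1/2 * h * g z\<bar> \<le> \<bar>v - h * g z\<bar> / 2 + v\<^sup>2 / 2"
        using sqrt_taylor_bound[OF v, of "h * g z"] u(2) by (simp add: f_def q'_def v_def)
      also have "\<dots> \<le> c * h\<^sup>2 / 2 + (B + c)\<^sup>2 * h\<^sup>2 / 2"
        using e v2 by (intro add_mono divide_right_mono) (auto simp: v_def)
      also have "\<dots> = D * h\<^sup>2" by (simp add: D_def algebra_simps)
      finally have "\<bar>f h z - 1/2 * h * g z\<bar>\<^sup>2 \<le> (D * h\<^sup>2)\<^sup>2" by (intro power_mono) auto
      thus "(f h z - 1/2 * h * g z)\<^sup>2 \<le> D\<^sup>2 * h^4" by (simp add: power_mult_distrib flip: power_mult)
    qed
  qed
  have lim: "((\<lambda>h. (\<integral>\<^sup>+z. ennreal ((f h z - 1/2 * h * g z)\<^sup>2) \<partial>?M) / ennreal (h\<^sup>2)) \<longlongrightarrow> 0) (at 0)"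
  proof (rule tendsto_sandwich[OF _ _ tendsto_const])
    show "\<forall>\<^sub>F h in at 0. (\<integral>\<^sup>+z. ennreal ((f h z - 1/2 * h * g z)\<^sup>2) \<partial>?M) / ennreal (h\<^sup>2) \<le> ennreal (D\<^sup>2 * h\<^sup>2)"
      unfolding eventually_at
    proof (intro exI[of _ d] conjI ballI impI)
      fix h :: real assume "h \<noteq> 0 \<and> dist h 0 < d"
      hence h: "h \<noteq> 0" "\<bar>h\<bar> < d" by auto
      have "(\<integral>\<^sup>+z. ennreal ((f h z - 1/2 * h * g z)\<^sup>2) \<partial>?M) \<le> (\<integral>\<^sup>+z. ennreal (D\<^sup>2 * h^4) \<partial>?M)"
        by (rule nn_integral_mono_AE) (use fb[OF h(2)] in \<open>eventually_elim, auto intro: ennreal_leI\<close>)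
      also have "\<dots> = ennreal (D\<^sup>2 * h^4)" using M.emeasure_space_1 by simp
      finally have "(\<integral>\<^sup>+z. ennreal ((f h z - 1/2 * h * g z)\<^sup>2) \<partial>?M) / ennreal (h\<^sup>2) \<le> ennreal (D\<^sup>2 * h^4) / ennreal (h\<^sup>2)"
        by (rule divide_right_mono_ennreal)
      moreover have "ennreal (D\<^sup>2 * h^4) / ennreal (h\<^sup>2) = ennreal (D\<^sup>2 * h\<^sup>2)"
      proof -
        have "D\<^sup>2 * h^4 / h\<^sup>2 = D\<^sup>2 * h\<^sup>2" using h(1) by (simp add: power4_eq_xxxx power2_eq_square)
        thus ?thesis using h(1) by (subst divide_ennreal) auto
      qed
      ultimately show "(\<integral>\<^sup>+z. ennreal ((f h z - 1/2 * h * g z)\<^sup>2) \<partial>?M) / ennreal (h\<^sup>2) \<le> ennreal (D\<^sup>2 * h\<^sup>2)"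
        by (simp only:)
    qed (rule d(1))
    have "((\<lambda>h. D\<^sup>2 * h\<^sup>2) \<longlongrightarrow> D\<^sup>2 * 0\<^sup>2) (at (0::real))" by (intro tendsto_intros)
    from tendsto_ennrealI[OF this] show "((\<lambda>h. ennreal (D\<^sup>2 * h\<^sup>2)) \<longlongrightarrow> 0) (at (0::real))" by simp
  qed simp
  have interior: "t \<in> interior \<Theta>"
    using t ball by (meson interior_maximal open_ball subsetD)
  have dqm: "dqm_at ?M \<Theta> q' g t"
    unfolding dqm_at_def
  proof (intro conjI)
    have "(\<integral>\<^sup>+z. ennreal ((sqrt (q' (t + h) z) - sqrt (q' t z) - 1/2 * h * g z * sqrt (q' t z))\<^sup>2) \<partial>?M)
       = (\<integral>\<^sup>+z. ennreal ((f h z - 1/2 * h * g z)\<^sup>2) \<partial>?M)" for h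
      by (rule nn_integral_cong_AE) (use qt in \<open>eventually_elim, simp add: f_def\<close>)
    thus "((\<lambda>h. (\<integral>\<^sup>+z. ennreal ((sqrt (q' (t + h) z) - sqrt (q' t z) - 1/2 * h * g z * sqrt (q' t z))\<^sup>2) \<partial>?M)
            / ennreal (h\<^sup>2)) \<longlongrightarrow> 0) (at 0)" using lim by simp
  qed (use interior gm in auto)
  have uniq: "(\<integral>z. (s z)\<^sup>2 \<partial>?M) = (\<integral>z. (g z)\<^sup>2 \<partial>?M)"
    if m: "dominated_model \<nu> \<Theta> q0 (\<lambda>u. P u \<bind> K)" and dq: "dqm_at \<nu> \<Theta> q0 s t" for \<nu> q0 s
  proof -
    interpret \<nu>: sigma_finite_measure \<nu> using m by (simp add: dominated_model_def)
    have qm: "q0 u \<in> borel_measurable \<nu>" and q0: "\<And>x. x \<in> space \<nu> \<Longrightarrow> 0 \<le> q0 u x"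
      and Mu: "P u \<bind> K = density \<nu> (\<lambda>x. ennreal (q0 u x))" if "u \<in> \<Theta>" for u
      using m that by (auto simp: dominated_model_def)
    have sets_eq: "sets ?M = sets \<nu>" using Mu[OF tT] by simp
    have [measurable]: "q0 t \<in> borel_measurable \<nu>" by (rule qm[OF tT])
    have q'n[measurable]: "q' u \<in> borel_measurable \<nu>" for u using q'm[of u] by (simp only: measurable_cong_sets[OF sets_eq refl])
    have fn[measurable]: "f h \<in> borel_measurable \<nu>" for h using fm[of h] by (simp only: measurable_cong_sets[OF sets_eq refl])
    have sn[measurable]: "s \<in> borel_measurable \<nu>" using dq by (simp add: dqm_at_def)
    have sm[measurable]: "s \<in> borel_measurable ?M" using sn by (simp only: measurable_cong_sets[OF sets_eq refl])
    \<comment> \<open>in any dominating measure, the densities are those at \<open>t\<close> times the ratios \<open>q'\<close>\<close>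
    have ratio: "AE x in \<nu>. q0 u x = q0 t x * q' u x" if u: "u \<in> \<Theta>" for u
    proof -
      have [measurable]: "q0 u \<in> borel_measurable \<nu>" by (rule qm[OF u])
      have "density \<nu> (\<lambda>x. ennreal (q0 u x)) = density ?M (\<lambda>z. ennreal (q' u z))"
        using q(3)[OF u] Mu[OF u] u by (simp add: q'_def)
      also have "\<dots> = density \<nu> (\<lambda>x. ennreal (q0 t x) * ennreal (q' u x))"
        by (subst Mu[OF tT], rule density_density_eq) measurable
      finally have "AE x in \<nu>. ennreal (q0 u x) = ennreal (q0 t x) * ennreal (q' u x)"
        by (intro \<nu>.density_unique) auto
      thus ?thesis
      proof (rule AE_mp, intro AE_I2 impI)
        fix x assume x: "x \<in> space \<nu>" and e: "ennreal (q0 u x) = ennreal (q0 t x) * ennreal (q' u x)"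
        have nn: "0 \<le> q' u x" using q(2)[OF u] u by (simp add: q'_def)
        thus "q0 u x = q0 t x * q' u x"
          using e q0[OF u x] q0[OF tT x] by (simp add: ennreal_mult[symmetric])
      qed
    qed
    have key: "(\<integral>\<^sup>+x. ennreal ((sqrt (q0 (t + h) x) - sqrt (q0 t x) - 1/2 * h * s x * sqrt (q0 t x))\<^sup>2) \<partial>\<nu>)
       = (\<integral>\<^sup>+z. ennreal ((f h z - 1/2 * h * s z)\<^sup>2) \<partial>?M)" if h: "t + h \<in> \<Theta>" for h
    proof -
      have "(\<integral>\<^sup>+z. ennreal ((f h z - 1/2 * h * s z)\<^sup>2) \<partial>?M)
         = (\<integral>\<^sup>+x. ennreal (q0 t x) * ennreal ((f h x - 1/2 * h * s x)\<^sup>2) \<partial>\<nu>)"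
        by (subst Mu[OF tT], rule nn_integral_density) measurable
      also have "\<dots> = (\<integral>\<^sup>+x. ennreal ((sqrt (q0 (t + h) x) - sqrt (q0 t x) - 1/2 * h * s x * sqrt (q0 t x))\<^sup>2) \<partial>\<nu>)"
      proof (rule nn_integral_cong_AE, rule AE_mp[OF ratio[OF h]], intro AE_I2 impI)
        fix x assume x: "x \<in> space \<nu>" and e: "q0 (t + h) x = q0 t x * q' (t + h) x"
        have sq: "sqrt (q0 (t + h) x) = sqrt (q0 t x) * sqrt (q' (t + h) x)"
          by (simp only: e real_sqrt_mult)
        have fac: "sqrt (q0 (t + h) x) - sqrt (q0 t x) - 1/2 * h * s x * sqrt (q0 t x)
          = sqrt (q0 t x) * (f h x - 1/2 * h * s x)"
          unfolding sq f_def by (simp only: algebra_simps)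
        have "(sqrt (q0 (t + h) x) - sqrt (q0 t x) - 1/2 * h * s x * sqrt (q0 t x))\<^sup>2
          = q0 t x * (f h x - 1/2 * h * s x)\<^sup>2"
          unfolding fac power_mult_distrib using q0[OF tT x] by simp
        thus "ennreal (q0 t x) * ennreal ((f h x - 1/2 * h * s x)\<^sup>2) =
           ennreal ((sqrt (q0 (t + h) x) - sqrt (q0 t x) - 1/2 * h * s x * sqrt (q0 t x))\<^sup>2)"
          using q0[OF tT x] by (simp add: ennreal_mult)
      qed
      finally show ?thesis by simp
    qed
    have "((\<lambda>h. (\<integral>\<^sup>+z. ennreal ((f h z - 1/2 * h * s z)\<^sup>2) \<partial>?M) / ennreal (h\<^sup>2)) \<longlongrightarrow> 0) (at 0)"
    proof (rule Lim_transform_eventually)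
      show "((\<lambda>h. (\<integral>\<^sup>+x. ennreal ((sqrt (q0 (t + h) x) - sqrt (q0 t x) - 1/2 * h * s x * sqrt (q0 t x))\<^sup>2) \<partial>\<nu>)
            / ennreal (h\<^sup>2)) \<longlongrightarrow> 0) (at 0)" using dq by (simp add: dqm_at_def)
      show "\<forall>\<^sub>F h in at 0. (\<integral>\<^sup>+x. ennreal ((sqrt (q0 (t + h) x) - sqrt (q0 t x) - 1/2 * h * s x * sqrt (q0 t x))\<^sup>2) \<partial>\<nu>)
            / ennreal (h\<^sup>2) = (\<integral>\<^sup>+z. ennreal ((f h z - 1/2 * h * s z)\<^sup>2) \<partial>?M) / ennreal (h\<^sup>2)"
        unfolding eventually_at using d key in_ball_Theta by (intro exI[of _ d]) auto
    qed
    from score_unique[OF sm gm fm this lim]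
    have "AE z in ?M. s z = g z" .
    thus ?thesis by (intro integral_cong_AE) auto
  qed
  show ?thesis
    unfolding fisher_info_def
  proof (rule the_equality)
    show "\<exists>\<nu> q0 s. dominated_model \<nu> \<Theta> q0 (\<lambda>u. P u \<bind> K) \<and> dqm_at \<nu> \<Theta> q0 s t \<and>
        (\<integral>z. (g z)\<^sup>2 \<partial>?M) = (\<integral>z. (s z)\<^sup>2 \<partial>?M)"
      by (intro exI conjI, rule model', rule dqm, rule refl)
  next
    fix I assume "\<exists>\<nu> q0 s. dominated_model \<nu> \<Theta> q0 (\<lambda>u. P u \<bind> K) \<and> dqm_at \<nu> \<Theta> q0 s t \<and>
        I = (\<integral>z. (s z)\<^sup>2 \<partial>?M)"
    then obtain \<nu> q0 s where "dominated_model \<nu> \<Theta> q0 (\<lambda>u. P u \<bind> K)" "dqm_at \<nu> \<Theta> q0 s t"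
      and I: "I = (\<integral>z. (s z)\<^sup>2 \<partial>?M)" by (elim exE conjE)
    thus "I = (\<integral>z. (g z)\<^sup>2 \<partial>?M)" using uniq by (simp only:)
  qed
qed

text \<open>Cauchy-Schwarz for the density ratio \<open>q = 1 + w\<close>: its second moment is \<open>1 + \<integral> w\<^sup>2\<close>, as \<open>w\<close>
  has mean zero. Stated for a function \<open>f\<close>, and not for events, the inequality passes to products
  and mixtures by iteration.\<close>

lemma channel_chi_square:
  assumes K: "K \<in> private_kernels \<alpha> \<mu> N" and t: "t \<in> ball \<theta>0 r" and u: "u \<in> ball \<theta>0 r"
    and f[measurable]: "f \<in> borel_measurable N"
  shows "(\<integral>\<^sup>+z. f z \<partial>(P u \<bind> K))\<^sup>2 \<le> ennreal (1 + (exp \<alpha> * C * (u - t))\<^sup>2) * (\<integral>\<^sup>+z. (f z)\<^sup>2 \<partial>(P t \<bind> K))"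
proof -
  have tT: "t \<in> \<Theta>" "u \<in> \<Theta>" using t u in_ball_Theta by auto
  let ?M = "P t \<bind> K"
  interpret M: prob_space ?M by (rule bind_alg[OF K tT(1)])
  interpret U: prob_space "P u \<bind> K" by (rule bind_alg[OF K tT(2)])
  have sM: "sets ?M = sets N" by (rule bind_alg[OF K tT(1)])
  have [measurable]: "f \<in> borel_measurable ?M" using f by (simp only: measurable_cong_sets[OF sM refl])
  obtain q where q: "adjoint_density K N t (p u) q" "\<And>z. 0 \<le> q z"
    and Pu: "P u \<bind> K = density ?M (\<lambda>z. ennreal (q z))"
    using channel_density_exists[OF K tT] by blast
  have qm[measurable]: "q \<in> borel_measurable ?M" and qi: "integrable ?M q"
    using adjoint_densityD[OF K tT(1) q(1)] by auto
  have fi: "integrable \<mu> (\<lambda>x. p u x - p t x)" using p_int tT by auto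
  obtain w where w: "adjoint_density K N t (\<lambda>x. p u x - p t x) w" "\<And>z. \<bar>w z\<bar> \<le> exp \<alpha> * (\<integral>x. \<bar>p u x - p t x\<bar> \<partial>\<mu>)"
    using adjoint_density_exists[OF K tT(1) fi] by blast
  have wm[measurable]: "w \<in> borel_measurable ?M" and wi: "integrable ?M w"
    using adjoint_densityD[OF K tT(1) w(1)] by auto
  have wb: "\<bar>w z\<bar> \<le> exp \<alpha> * (C * \<bar>u - t\<bar>)" for z
    using lip0[OF t u] by (intro order_trans[OF w(2)] mult_left_mono) auto
  have "(exp \<alpha> * (C * \<bar>u - t\<bar>))\<^sup>2 = (exp \<alpha> * C * (u - t))\<^sup>2" by (simp add: power_mult_distrib)
  with wb have w2: "(w z)\<^sup>2 \<le> (exp \<alpha> * C * (u - t))\<^sup>2" for z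
    using power_mono[OF wb[of z] abs_ge_zero, of 2] by simp
  from adjoint_density_add_scaled[OF K tT(1) p_int[OF tT(1)] fi adjoint_density_one[OF K tT(1)] w(1), of 1]
  have "adjoint_density K N t (p u) (\<lambda>z. 1 + w z)" by simp
  from adjoint_density_unique[OF K tT(1) q(1) this]
  have qw: "AE z in ?M. q z = 1 + w z" .
  have wi2: "integrable ?M (\<lambda>z. (w z)\<^sup>2)"
    using w2 by (intro M.integrable_const_bound[of _ "(exp \<alpha> * C * (u - t))\<^sup>2"]) auto
  have q1: "(\<integral>z. q z \<partial>?M) = 1"
  proof -
    have "(\<integral>\<^sup>+z. ennreal (q z) \<partial>?M) = emeasure (P u \<bind> K) (space (P u \<bind> K))"
      by (subst (1 2) Pu) (simp add: emeasure_density cong: nn_integral_cong)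
    hence "(\<integral>\<^sup>+z. ennreal (q z) \<partial>?M) = 1" using U.emeasure_space_1 by simp
    thus ?thesis using nn_integral_eq_integral[OF qi] q(2) by (simp add: integral_nonneg_AE)
  qed
  have "(\<integral>z. q z \<partial>?M) = (\<integral>z. 1 + w z \<partial>?M)" by (rule integral_cong_AE) (use qw in auto)
  also have "\<dots> = 1 + (\<integral>z. w z \<partial>?M)" using wi by (simp add: M.prob_space)
  finally have w0: "(\<integral>z. w z \<partial>?M) = 0" using q1 by simp
  have "(\<integral>z. (q z)\<^sup>2 \<partial>?M) = (\<integral>z. 1 + 2 * w z + (w z)\<^sup>2 \<partial>?M)"
    by (rule integral_cong_AE) (use qw in \<open>auto simp: power2_sum elim!: eventually_mono\<close>)
  also have "\<dots> = 1 + (\<integral>z. (w z)\<^sup>2 \<partial>?M)" using wi wi2 w0 by (simp add: M.prob_space)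
  also have "(\<integral>z. (w z)\<^sup>2 \<partial>?M) \<le> (\<integral>z. (exp \<alpha> * C * (u - t))\<^sup>2 \<partial>?M)"
    by (rule integral_mono[OF wi2]) (use w2 in auto)
  finally have q2: "(\<integral>z. (q z)\<^sup>2 \<partial>?M) \<le> 1 + (exp \<alpha> * C * (u - t))\<^sup>2" by (simp add: M.prob_space)
  have qi2: "integrable ?M (\<lambda>z. (q z)\<^sup>2)"
  proof -
    have "integrable ?M (\<lambda>z. 1 + 2 * w z + (w z)\<^sup>2)" using wi wi2 by auto
    thus ?thesis by (rule integrable_cong_AE_imp) (use qw in \<open>auto simp: power2_sum elim!: eventually_mono\<close>)
  qed
  have "(\<integral>\<^sup>+z. f z \<partial>(P u \<bind> K)) = (\<integral>\<^sup>+z. ennreal (q z) * f z \<partial>?M)"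
    by (subst Pu, rule nn_integral_density) measurable
  hence "(\<integral>\<^sup>+z. f z \<partial>(P u \<bind> K))\<^sup>2 \<le> (\<integral>\<^sup>+z. (ennreal (q z))\<^sup>2 \<partial>?M) * (\<integral>\<^sup>+z. (f z)\<^sup>2 \<partial>?M)"
    using Cauchy_Schwarz_nn_integral[of "\<lambda>z. ennreal (q z)" ?M f] by simp
  also have "(\<integral>\<^sup>+z. (ennreal (q z))\<^sup>2 \<partial>?M) = ennreal (\<integral>z. (q z)\<^sup>2 \<partial>?M)"
    using nn_integral_eq_integral[OF qi2] q(2) by (simp add: ennreal_power)
  also have "\<dots> * (\<integral>\<^sup>+z. (f z)\<^sup>2 \<partial>?M) \<le> ennreal (1 + (exp \<alpha> * C * (u - t))\<^sup>2) * (\<integral>\<^sup>+z. (f z)\<^sup>2 \<partial>?M)"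
    using q2 by (intro mult_right_mono ennreal_leI) auto
  finally show ?thesis .
qed

end

section \<open>Reducing the number of rows of a channel\<close>

lemma linear_dependence_of_many_rows:
  fixes v :: "'i \<Rightarrow> nat \<Rightarrow> real"
  assumes "finite I" "k < card I"
  shows "\<exists>d. (\<exists>i\<in>I. d i \<noteq> 0) \<and> (\<forall>j\<in>{1..k}. (\<Sum>i\<in>I. d i * v i j) = 0)"
  using assms
proof (induction k arbitrary: I v)
  case 0
  then obtain i where "i \<in> I" by (metis card_gt_0_iff ex_in_conv)
  thus ?case by (intro exI[of _ "\<lambda>_. 1"]) auto
next
  case (Suc k)
  show ?case
  proof (cases "\<forall>i\<in>I. v i (Suc k) = 0")
    case True
    obtain d where "\<exists>i\<in>I. d i \<noteq> 0" "\<forall>j\<in>{1..k}. (\<Sum>i\<in>I. d i * v i j) = 0"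
      using Suc.IH[of I v] Suc.prems by auto
    thus ?thesis using True by (intro exI[of _ d]) (auto simp: le_Suc_eq)
  next
    case False
    then obtain a where a: "a \<in> I" "v a (Suc k) \<noteq> 0" by blast
    define \<rho> where "\<rho> i = v i (Suc k) / v a (Suc k)" for i
    obtain d where d: "\<exists>i\<in>I - {a}. d i \<noteq> 0"
      "\<forall>j\<in>{1..k}. (\<Sum>i\<in>I - {a}. d i * (v i j - \<rho> i * v a j)) = 0"
    proof -
      have "finite (I - {a})" "k < card (I - {a})" using Suc.prems a by auto
      from Suc.IH[OF this, of "\<lambda>i j. v i j - \<rho> i * v a j"] show ?thesis using that by blast
    qed
    define d' where "d' i = (if i = a then - (\<Sum>i\<in>I - {a}. d i * \<rho> i) else d i)" for i
    have s: "(\<Sum>i\<in>I. d' i * v i j) = (\<Sum>i\<in>I - {a}. d i * (v i j - \<rho> i * v a j))" for j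
    proof -
      have "(\<Sum>i\<in>I. d' i * v i j) = d' a * v a j + (\<Sum>i\<in>I - {a}. d' i * v i j)"
        using Suc.prems(1) a(1) by (rule sum.remove)
      also have "(\<Sum>i\<in>I - {a}. d' i * v i j) = (\<Sum>i\<in>I - {a}. d i * v i j)"
        by (rule sum.cong) (auto simp: d'_def)
      finally show ?thesis
        by (simp add: d'_def sum_distrib_right right_diff_distrib sum_subtractf mult.assoc)
    qed
    have "(\<Sum>i\<in>I. d' i * v i j) = 0" if "j \<in> {1..Suc k}" for j
    proof (cases "j = Suc k")
      case True thus ?thesis unfolding s using a(2) by (simp add: \<rho>_def)
    next
      case False thus ?thesis unfolding s using d(2) that by simp
    qed
    moreover have "\<exists>i\<in>I. d' i \<noteq> 0" using d(1) by (auto simp: d'_def)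
    ultimately show ?thesis by blast
  qed
qed

text \<open>If there are more than \<open>k\<close> rows, they satisfy a linear relation with coefficients \<open>d i\<close>.
  Moving the weights along \<open>1 + t d i\<close> preserves all column sums, and with the right sign of \<open>d\<close>
  it does not decrease the weighted sum of \<open>g\<close>. The first \<open>t\<close> at which a weight vanishes removes a
  row; induction on the number of rows. Positivity of the entries ensures that some \<open>d i\<close> is
  negative, so that such a \<open>t\<close> exists.\<close>

lemma row_reweighting:
  fixes v :: "'i \<Rightarrow> nat \<Rightarrow> real" and g :: "'i \<Rightarrow> real"
  assumes "finite I" "1 \<le> k" "\<And>i j. i \<in> I \<Longrightarrow> j \<in> {1..k} \<Longrightarrow> 0 < v i j"
  shows "\<exists>c. (\<forall>i\<in>I. 0 \<le> c i) \<and> card {i\<in>I. c i \<noteq> 0} \<le> k \<and>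
    (\<forall>j\<in>{1..k}. (\<Sum>i\<in>I. c i * v i j) = (\<Sum>i\<in>I. v i j)) \<and> (\<Sum>i\<in>I. g i) \<le> (\<Sum>i\<in>I. c i * g i)"
  using assms
proof (induction "card I" arbitrary: I v g rule: less_induct)
  case less
  show ?case
  proof (cases "card I \<le> k")
    case True
    thus ?thesis by (intro exI[of _ "\<lambda>_. 1"]) auto
  next
    case False
    then obtain d0 where d0: "\<exists>i\<in>I. d0 i \<noteq> 0" "\<forall>j\<in>{1..k}. (\<Sum>i\<in>I. d0 i * v i j) = 0"
      using linear_dependence_of_many_rows[OF less.prems(1), of k v] by auto
    \<comment> \<open>the sign for which moving along \<open>d\<close> does not decrease the weighted sum of \<open>g\<close>\<close>
    define sg :: real where "sg = (if 0 \<le> (\<Sum>i\<in>I. d0 i * g i) then 1 else -1)"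
    define d where "d i = sg * d0 i" for i
    have sg: "sg \<noteq> 0" by (simp add: sg_def)
    have d: "\<exists>i\<in>I. d i \<noteq> 0" "\<And>j. j \<in> {1..k} \<Longrightarrow> (\<Sum>i\<in>I. d i * v i j) = 0"
      using d0 sg by (auto simp: d_def mult.assoc simp flip: sum_distrib_left)
    have dg: "0 \<le> (\<Sum>i\<in>I. d i * g i)"
      by (auto simp: d_def sg_def mult.assoc simp flip: sum_distrib_left)
    have neg: "\<exists>i\<in>I. d i < 0"
    proof (rule ccontr)
      assume "\<not> (\<exists>i\<in>I. d i < 0)"
      hence nn: "\<forall>i\<in>I. 0 \<le> d i * v i 1"
      proof (intro ballI mult_nonneg_nonneg)
        fix i assume i: "i \<in> I"
        show "0 \<le> d i" using i \<open>\<not> (\<exists>i\<in>I. d i < 0)\<close> by (auto simp: not_less)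
        show "0 \<le> v i 1" using less.prems(3)[OF i, of 1] less.prems(2) by simp
      qed
      have "(\<Sum>i\<in>I. d i * v i 1) = 0" using d(2)[of 1] less.prems(2) by simp
      with nn have "\<forall>i\<in>I. d i * v i 1 = 0" using less.prems(1) by (simp add: sum_nonneg_eq_0_iff)
      moreover have "v i 1 \<noteq> 0" if "i \<in> I" for i using less.prems(3)[OF that, of 1] less.prems(2) by simp
      ultimately show False using d(1) by auto
    qed
    \<comment> \<open>the first \<open>t\<close> at which some weight \<open>1 + t d i\<close> reaches zero\<close>
    define t where "t = Min ((\<lambda>i. - 1 / d i) ` {i\<in>I. d i < 0})"
    have fin: "finite ((\<lambda>i. - 1 / d i) ` {i\<in>I. d i < 0})" using less.prems(1) by simp
    have ne: "(\<lambda>i. - 1 / d i) ` {i\<in>I. d i < 0} \<noteq> {}" using neg by auto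
    have "t \<in> (\<lambda>i. - 1 / d i) ` {i\<in>I. d i < 0}" unfolding t_def by (rule Min_in[OF fin ne])
    then obtain a where a: "a \<in> I" "d a < 0" "t = - 1 / d a" by auto
    have tpos: "0 < t" using a by (simp add: divide_neg_neg)
    define c where "c i = 1 + t * d i" for i
    have c0: "0 \<le> c i" if "i \<in> I" for i
    proof (cases "d i < 0")
      case True
      hence "t \<le> - 1 / d i" unfolding t_def using that by (intro Min_le[OF fin]) auto
      hence "t * d i \<ge> - 1 / d i * d i" using True by (intro mult_right_mono_neg) auto
      thus ?thesis using True by (simp add: c_def)
    next
      case False thus ?thesis using tpos by (simp add: c_def)
    qed
    have ca: "c a = 0" using a by (simp add: c_def)
    define I' where "I' = {i\<in>I. c i \<noteq> 0}"
    have I': "I' \<subseteq> I" "finite I'" "card I' < card I"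
      using a(1) ca less.prems(1) by (auto simp: I'_def intro!: psubset_card_mono)
    have pos': "0 < c i * v i j" if "i \<in> I'" "j \<in> {1..k}" for i j
      using that c0[of i] less.prems(3)[of i j] by (auto simp: I'_def intro!: mult_pos_pos)
    obtain c' where c': "\<forall>i\<in>I'. 0 \<le> c' i" "card {i\<in>I'. c' i \<noteq> 0} \<le> k"
      "\<forall>j\<in>{1..k}. (\<Sum>i\<in>I'. c' i * (c i * v i j)) = (\<Sum>i\<in>I'. c i * v i j)"
      "(\<Sum>i\<in>I'. c i * g i) \<le> (\<Sum>i\<in>I'. c' i * (c i * g i))"
      using less.hyps[where I = I' and v = "\<lambda>i j. c i * v i j" and g = "\<lambda>i. c i * g i",
        OF I'(3) I'(2) less.prems(2) pos'] by blast
    have ext: "(\<Sum>i\<in>I'. f i * c i * h i) = (\<Sum>i\<in>I. f i * c i * h i)" for f h :: "'i \<Rightarrow> real"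
      by (rule sum.mono_neutral_left) (use less.prems(1) in \<open>auto simp: I'_def\<close>)
    have ext1: "(\<Sum>i\<in>I'. c i * h i) = (\<Sum>i\<in>I. c i * h i)" for h :: "'i \<Rightarrow> real"
      using ext[of "\<lambda>_. 1" h] by simp
    have cs: "(\<Sum>i\<in>I. c i * h i) = (\<Sum>i\<in>I. h i) + t * (\<Sum>i\<in>I. d i * h i)" for h :: "'i \<Rightarrow> real"
      by (simp add: c_def algebra_simps sum.distrib sum_distrib_left)
    show ?thesis
    proof (intro exI[of _ "\<lambda>i. c' i * c i"] conjI ballI)
      fix i assume "i \<in> I"
      thus "0 \<le> c' i * c i" using c0[of i] c'(1) by (cases "c i = 0") (auto simp: I'_def)
    next
      have "{i\<in>I. c' i * c i \<noteq> 0} = {i\<in>I'. c' i \<noteq> 0}" by (auto simp: I'_def)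
      thus "card {i\<in>I. c' i * c i \<noteq> 0} \<le> k" using c'(2) by simp
    next
      fix j assume j: "j \<in> {1..k}"
      have "(\<Sum>i\<in>I. c' i * c i * v i j) = (\<Sum>i\<in>I. c i * v i j)"
        using c'(3) j ext[of c' "\<lambda>i. v i j"] ext1[of "\<lambda>i. v i j"] by (simp add: mult.assoc)
      also have "\<dots> = (\<Sum>i\<in>I. v i j)" using cs[of "\<lambda>i. v i j"] d(2)[OF j] by simp
      finally show "(\<Sum>i\<in>I. c' i * c i * v i j) = (\<Sum>i\<in>I. v i j)" .
    next
      have "(\<Sum>i\<in>I. g i) \<le> (\<Sum>i\<in>I. c i * g i)" using cs[of g] dg tpos by simp
      also have "\<dots> \<le> (\<Sum>i\<in>I. c' i * c i * g i)"
        using c'(4) ext[of c' g] ext1[of g] by (simp add: mult.assoc)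
      finally show "(\<Sum>i\<in>I. g i) \<le> (\<Sum>i\<in>I. c' i * c i * g i)" .
    qed
  qed
qed

text \<open>The functional \<open>G\<close> stands for the information contributed by a row, which is homogeneous
  of degree one. The surviving rows are numbered by \<open>1, \<dots>, k\<close>, padded with zero multiples of an
  arbitrary row.\<close>

lemma square_channel_suffices:
  fixes v :: "'i \<Rightarrow> nat \<Rightarrow> real" and G :: "(nat \<Rightarrow> real) \<Rightarrow> real"
  assumes I: "finite I" "I \<noteq> {}" and k: "1 \<le> k" and pos: "\<And>i j. i \<in> I \<Longrightarrow> j \<in> {1..k} \<Longrightarrow> 0 < v i j"
    and G: "\<And>c i. i \<in> I \<Longrightarrow> 0 \<le> c \<Longrightarrow> G (\<lambda>j. c * v i j) = c * G (v i)"
  obtains c \<iota> where "\<And>l. 0 \<le> c l" "\<And>l. \<iota> l \<in> I"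
    "\<And>j. j \<in> {1..k} \<Longrightarrow> (\<Sum>l=1..k. c l * v (\<iota> l) j) = (\<Sum>i\<in>I. v i j)"
    "(\<Sum>i\<in>I. G (v i)) \<le> (\<Sum>l=1..k. G (\<lambda>j. c l * v (\<iota> l) j))"
proof -
  have "\<exists>c. (\<forall>i\<in>I. 0 \<le> c i) \<and> card {i\<in>I. c i \<noteq> 0} \<le> k \<and>
    (\<forall>j\<in>{1..k}. (\<Sum>i\<in>I. c i * v i j) = (\<Sum>i\<in>I. v i j)) \<and> (\<Sum>i\<in>I. G (v i)) \<le> (\<Sum>i\<in>I. c i * G (v i))"
    by (rule row_reweighting[OF I(1) k pos])
  then obtain a where a: "\<forall>i\<in>I. 0 \<le> a i" "card {i\<in>I. a i \<noteq> 0} \<le> k"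
    "\<forall>j\<in>{1..k}. (\<Sum>i\<in>I. a i * v i j) = (\<Sum>i\<in>I. v i j)" "(\<Sum>i\<in>I. G (v i)) \<le> (\<Sum>i\<in>I. a i * G (v i))"
    by (elim exE conjE) (rule that)
  define S where "S = {i\<in>I. a i \<noteq> 0}"
  have S: "finite S" "S \<subseteq> I" "card S \<le> card {1..k}" using I(1) a(2) by (auto simp: S_def)
  obtain e where e: "e ` S \<subseteq> {1..k}" "inj_on e S"
    using card_le_inj[OF S(1) finite_atLeastAtMost S(3)] by blast
  obtain i0 where i0: "i0 \<in> I" using I(2) by auto
  define \<iota> where "\<iota> l = (if l \<in> e ` S then inv_into S e l else i0)" for l
  define c where "c l = (if l \<in> e ` S then a (inv_into S e l) else 0)" for l
  \<comment> \<open>transfers sums over the surviving rows to sums over \<open>1, \<dots>, k\<close>\<close>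
  have tr: "(\<Sum>l=1..k. F (c l) (\<iota> l)) = (\<Sum>i\<in>I. F (a i) i)" if F0: "\<And>i. i \<in> I \<Longrightarrow> F 0 i = 0"
    for F :: "real \<Rightarrow> 'i \<Rightarrow> real"
  proof -
    have "(\<Sum>l=1..k. F (c l) (\<iota> l)) = (\<Sum>l\<in>e ` S. F (c l) (\<iota> l))"
      by (rule sum.mono_neutral_right) (use e F0[OF i0] in \<open>auto simp: c_def \<iota>_def\<close>)
    also have "\<dots> = (\<Sum>i\<in>S. F (a i) i)"
      using e(2) by (subst sum.reindex) (auto simp: c_def \<iota>_def intro!: sum.cong)
    also have "\<dots> = (\<Sum>i\<in>I. F (a i) i)"
      by (rule sum.mono_neutral_left) (use I(1) F0 in \<open>auto simp: S_def\<close>)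
    finally show ?thesis .
  qed
  show thesis
  proof (rule that[of c \<iota>])
    show "0 \<le> c l" for l using a(1) e(2) S(2) by (auto simp: c_def)
    show "\<iota> l \<in> I" for l using i0 S(2) e(2) by (auto simp: \<iota>_def)
    show "(\<Sum>l=1..k. c l * v (\<iota> l) j) = (\<Sum>i\<in>I. v i j)" if "j \<in> {1..k}" for j
      using tr[of "\<lambda>b i. b * v i j"] a(3) that by simp
    have "(\<Sum>l=1..k. G (\<lambda>j. c l * v (\<iota> l) j)) = (\<Sum>i\<in>I. G (\<lambda>j. a i * v i j))"
    proof (rule tr)
      fix i assume "i \<in> I"
      from G[OF this, of 0] show "G (\<lambda>j. 0 * v i j) = 0" by simp
    qed
    also have "\<dots> = (\<Sum>i\<in>I. a i * G (v i))" by (rule sum.cong) (use a(1) G in auto)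
    finally show "(\<Sum>i\<in>I. G (v i)) \<le> (\<Sum>l=1..k. G (\<lambda>j. c l * v (\<iota> l) j))" using a(4) by simp
  qed
qed

section \<open>Information of finite channels\<close>

text \<open>The map \<open>(a, b) \<mapsto> a\<^sup>2/b\<close> is Lipschitz where \<open>a\<close> and \<open>b\<close> are comparable to a common scale
  \<open>w\<close>. The bound is proportional to \<open>w\<close>, so that it can be summed over arbitrarily many rows with
  weights \<open>w\<close>.\<close>

lemma quadratic_over_linear_lipschitz:
  fixes a a' b b' :: real
  assumes c: "1 \<le> c" and w: "0 \<le> w" and e: "0 \<le> e"
    and a: "\<bar>a\<bar> \<le> c * w" "\<bar>a'\<bar> \<le> c * w" and b: "w \<le> c * b" "w \<le> c * b'"
    and d: "\<bar>a - a'\<bar> \<le> e * w" "\<bar>b - b'\<bar> \<le> e * w"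
  shows "\<bar>a\<^sup>2 / b - a'\<^sup>2 / b'\<bar> \<le> (c^4 + 2 * c\<^sup>2) * e * w"
proof (cases "w = 0")
  case True
  thus ?thesis using a by simp
next
  case False
  hence w0: "0 < w" using w by simp
  have b0: "0 < b" "0 < b'" using b w0 c by (auto simp: zero_less_mult_iff intro: ccontr dest: order_less_le_trans)
  have wb: "w / b \<le> c" "w / b' \<le> c" using b b0 by (auto simp: divide_le_eq mult.commute)
  have wb0: "0 \<le> w / b" "0 \<le> w / b'" using w0 b0 by auto
  have eq: "a\<^sup>2 / b - a'\<^sup>2 / b' = a\<^sup>2 * (b' - b) / (b * b') + (a - a') * (a + a') / b'"
    using b0 by (simp add: field_simps power2_eq_square)
  have "\<bar>a\<^sup>2 * (b' - b) / (b * b')\<bar> = \<bar>a\<bar>\<^sup>2 * \<bar>b - b'\<bar> / (b * b')"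
    using b0 by (simp add: abs_mult abs_minus_commute)
  also have "\<dots> \<le> (c * w)\<^sup>2 * (e * w) / (b * b')"
    using a d b0 c w0 e by (intro divide_right_mono mult_mono power_mono) auto
  also have "\<dots> = c\<^sup>2 * e * w * ((w / b) * (w / b'))" by (simp add: power2_eq_square)
  also have "\<dots> \<le> c\<^sup>2 * e * w * (c * c)"
    using wb wb0 c e w0 by (intro mult_left_mono mult_mono) auto
  finally have 1: "\<bar>a\<^sup>2 * (b' - b) / (b * b')\<bar> \<le> c^4 * e * w" by (simp add: power4_eq_xxxx power2_eq_square ac_simps)
  have "\<bar>(a - a') * (a + a') / b'\<bar> = \<bar>a - a'\<bar> * \<bar>a + a'\<bar> / b'" using b0 by (simp add: abs_mult)
  also have "\<dots> \<le> (e * w) * (2 * (c * w)) / b'"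
    using a d b0 c w0 e by (intro divide_right_mono mult_mono) auto
  also have "\<dots> = 2 * c * e * w * (w / b')" by simp
  also have "\<dots> \<le> 2 * c * e * w * c" using wb wb0 c e w0 by (intro mult_left_mono) auto
  finally have 2: "\<bar>(a - a') * (a + a') / b'\<bar> \<le> 2 * c\<^sup>2 * e * w" by (simp add: power2_eq_square ac_simps)
  show ?thesis unfolding eq
    using 1 2 abs_triangle_ineq[of "a\<^sup>2 * (b' - b) / (b * b')" "(a - a') * (a + a') / b'"]
    by (simp add: algebra_simps)
qed

lemma integral_finite_support:
  fixes f :: "'b \<Rightarrow> real"
  assumes fin: "finite S" and M: "finite_measure M" and S: "\<And>i. i \<in> S \<Longrightarrow> {i} \<in> sets M" and ae: "AE z in M. z \<in> S"
    and f: "f \<in> borel_measurable M"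
  shows "(\<integral>z. f z \<partial>M) = (\<Sum>i\<in>S. f i * measure M {i})"
proof -
  interpret finite_measure M by fact
  have "(\<integral>z. f z \<partial>M) = (\<integral>z. (\<Sum>i\<in>S. f i * indicator {i} z) \<partial>M)"
  proof (rule integral_cong_AE)
    show "AE z in M. f z = (\<Sum>i\<in>S. f i * indicator {i} z)"
      using ae
    proof eventually_elim
      fix z assume z: "z \<in> S"
      have "(\<Sum>i\<in>S. f i * indicator {i} z) = (\<Sum>i\<in>S. if i = z then f i else 0)"
        by (rule sum.cong) (auto simp: indicator_def)
      thus "f z = (\<Sum>i\<in>S. f i * indicator {i} z)" using z fin by simp
    qed
  qed (use f S in auto)
  also have "\<dots> = (\<Sum>i\<in>S. (\<integral>z. f i * indicator {i} z \<partial>M))"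
    by (rule Bochner_Integration.integral_sum) (use S in \<open>auto intro!: integrable_real_indicator simp: less_top[symmetric] emeasure_finite\<close>)
  also have "\<dots> = (\<Sum>i\<in>S. f i * measure M {i})"
    using S sets.sets_into_space by (intro sum.cong) (auto simp: Int_absorb2)
  finally show ?thesis .
qed

context l1_smooth_model
begin

text \<open>The contribution to the Fisher information at \<open>t\<close> of an output whose conditional
  probability given \<open>x\<close> is \<open>\<phi> x\<close>.\<close>

definition row_info :: "('a \<Rightarrow> real) \<Rightarrow> real \<Rightarrow> real" where
  "row_info \<phi> t = (\<integral>x. \<phi> x * p1 t x \<partial>\<mu>)\<^sup>2 / (\<integral>x. \<phi> x * p t x \<partial>\<mu>)"

text \<open>The conditional output probabilities of a private channel with finitely many outputs.\<close>

definition private_rows :: "real \<Rightarrow> 'i set \<Rightarrow> ('i \<Rightarrow> 'a \<Rightarrow> real) \<Rightarrow> bool" where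
  "private_rows \<alpha> I \<phi> \<longleftrightarrow> finite I \<and> (\<forall>i\<in>I. \<phi> i \<in> borel_measurable \<mu>) \<and>
     (\<forall>i\<in>I. \<forall>x\<in>space \<mu>. 0 \<le> \<phi> i x) \<and> (\<forall>i\<in>I. \<forall>x\<in>space \<mu>. \<forall>y\<in>space \<mu>. \<phi> i x \<le> exp \<alpha> * \<phi> i y) \<and>
     (\<forall>x\<in>space \<mu>. (\<Sum>i\<in>I. \<phi> i x) = 1)"

lemma fisher_info_discrete:
  fixes S :: "'b set"
  assumes K: "K \<in> private_kernels \<alpha> \<mu> (count_space S)" and S: "finite S" and t: "t \<in> ball \<theta>0 r"
  shows "fisher_info \<Theta> (\<lambda>u. P u \<bind> K) t = (\<Sum>i\<in>S. row_info (\<lambda>x. measure (K x) {i}) t)"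
proof -
  have tT: "t \<in> \<Theta>" using t in_ball_Theta by auto
  obtain g where g: "adjoint_density K (count_space S) t (p1 t) g"
    using adjoint_density_exists[OF K tT int1[OF t]] by blast
  let ?M = "P t \<bind> K"
  interpret M: prob_space ?M by (rule bind_alg[OF K tT])
  have sM: "sets ?M = Pow S" using bind_alg[OF K tT] by simp
  have finite_mean: "(\<integral>z. f z \<partial>?M) = (\<Sum>i\<in>S. f i * measure ?M {i})" for f :: "'b \<Rightarrow> real"
    using bind_alg(4)[OF K tT] sM
    by (intro integral_finite_support[OF S M.finite_measure_axioms]) (auto simp: measurable_def)
  have "fisher_info \<Theta> (\<lambda>u. P u \<bind> K) t = (\<integral>z. (g z)\<^sup>2 \<partial>?M)"
    by (rule fisher_info_channel[OF K t g])
  also have "\<dots> = (\<Sum>i\<in>S. (g i)\<^sup>2 * measure ?M {i})"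
    by (rule finite_mean)
  also have "\<dots> = (\<Sum>i\<in>S. row_info (\<lambda>x. measure (K x) {i}) t)"
  proof (rule sum.cong)
    fix i assume i: "i \<in> S"
    have "(\<integral>x. measure (K x) {i} * p1 t x \<partial>\<mu>) = (\<integral>z. g z * indicator {i} z \<partial>?M)"
      using adjoint_densityD(3)[OF K tT g, of "{i}"] i by simp
    also have "\<dots> = (\<Sum>z\<in>S. g z * indicator {i} z * measure ?M {z})"
      by (rule finite_mean)
    also have "\<dots> = (\<Sum>z\<in>S. if z = i then g z * measure ?M {z} else 0)"
      by (rule sum.cong) (auto simp: indicator_def)
    also have "\<dots> = g i * measure ?M {i}" using i S by simp
    finally have a: "(\<integral>x. measure (K x) {i} * p1 t x \<partial>\<mu>) = g i * measure ?M {i}" .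
    have b: "(\<integral>x. measure (K x) {i} * p t x \<partial>\<mu>) = measure ?M {i}"
      using measure_bind_kernel[OF K tT, of "{i}"] i by simp
    show "(g i)\<^sup>2 * measure ?M {i} = row_info (\<lambda>x. measure (K x) {i}) t"
      unfolding row_info_def a b by (cases "measure ?M {i} = 0") (auto simp: power2_eq_square)
  qed simp
  finally show ?thesis .
qed

text \<open>Partition the output space by the value of the score \<open>g\<close>, in steps of \<open>\<surd>e\<close>. On each part
  the loss of information is its probability times the conditional variance of \<open>g\<close>, which is at
  most \<open>e\<close>.\<close>

lemma fisher_info_le_partition:
  assumes K: "K \<in> private_kernels \<alpha> \<mu> N" and t: "t \<in> ball \<theta>0 r" and e: "0 < e"
  obtains A :: "nat \<Rightarrow> 'b set" and L :: nat where "\<And>i. A i \<in> sets N" "disjoint_family A" "(\<Union>i<L. A i) = space N"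
    "fisher_info \<Theta> (\<lambda>u. P u \<bind> K) t \<le> (\<Sum>i<L. row_info (\<lambda>x. measure (K x) (A i)) t) + e"
proof -
  have tT: "t \<in> \<Theta>" using t in_ball_Theta by auto
  obtain g where g: "adjoint_density K N t (p1 t) g"
    using adjoint_density_exists[OF K tT int1[OF t]] by blast
  have gm[measurable]: "g \<in> borel_measurable N" using g by (simp add: adjoint_density_def)
  obtain B where B: "\<And>z. \<bar>g z\<bar> \<le> B" using g by (auto simp: adjoint_density_def)
  have B0: "0 \<le> B" using B[of undefined] by linarith
  let ?M = "P t \<bind> K"
  interpret M: prob_space ?M by (rule bind_alg[OF K tT])
  have sM: "sets ?M = sets N" and spM: "space ?M = space N" using bind_alg[OF K tT] by auto
  have gM[measurable]: "g \<in> borel_measurable ?M" and gi: "integrable ?M g" using adjoint_densityD[OF K tT g] by auto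
  define \<eta> where "\<eta> = sqrt e"
  have \<eta>: "0 < \<eta>" "\<eta>\<^sup>2 = e" using e by (auto simp: \<eta>_def)
  \<comment> \<open>adding \<open>B\<close> makes the levels nonnegative, so that they are indexed by natural numbers\<close>
  define A where "A i = {z \<in> space N. \<lfloor>(g z + B) / \<eta>\<rfloor> = int i}" for i
  define L where "L = Suc (nat \<lfloor>2 * B / \<eta>\<rfloor>)"
  have As: "A i \<in> sets N" for i unfolding A_def by measurable
  have dj: "disjoint_family A" by (auto simp: disjoint_family_on_def A_def)
  have un: "(\<Union>i<L. A i) = space N"
  proof (intro equalityI subsetI)
    fix z assume z: "z \<in> space N"
    have "0 \<le> (g z + B) / \<eta>" using B[of z] \<eta> by (intro divide_nonneg_pos) (auto simp: abs_le_iff)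
    hence fl: "0 \<le> \<lfloor>(g z + B) / \<eta>\<rfloor>" by simp
    have "\<lfloor>(g z + B) / \<eta>\<rfloor> \<le> \<lfloor>2 * B / \<eta>\<rfloor>"
      using B[of z] \<eta> by (intro floor_mono divide_right_mono) (auto simp: abs_le_iff)
    hence "nat \<lfloor>(g z + B) / \<eta>\<rfloor> < L" unfolding L_def by linarith
    thus "z \<in> (\<Union>i<L. A i)" using z fl by (auto simp: A_def intro!: bexI[of _ "nat \<lfloor>(g z + B) / \<eta>\<rfloor>"])
  qed (auto simp: A_def)
  have bin: "(\<integral>z. (g z)\<^sup>2 * indicator (A i) z \<partial>?M) \<le> row_info (\<lambda>x. measure (K x) (A i)) t + e * measure ?M (A i)" for i
  proof -
    define c where "c = real i * \<eta> - B"
    have AM: "A i \<in> sets ?M" using As sM by simp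
    have gc: "(g z - c)\<^sup>2 \<le> \<eta>\<^sup>2" if "z \<in> A i" for z
    proof -
      have "real i \<le> (g z + B) / \<eta>" "(g z + B) / \<eta> \<le> real i + 1"
        using that unfolding A_def by (auto simp: floor_eq_iff)
      hence "real i * \<eta> \<le> g z + B" "g z + B \<le> (real i + 1) * \<eta>" using \<eta> by (auto simp: le_divide_eq divide_le_eq)
      hence "\<bar>g z - c\<bar> \<le> \<eta>" by (auto simp: c_def algebra_simps abs_le_iff)
      thus ?thesis by (metis abs_ge_zero power2_abs power_mono)
    qed
    have g2i: "integrable ?M (\<lambda>z. (g z)\<^sup>2)"
      using B by (intro M.integrable_const_bound[of _ "B\<^sup>2"]) (auto simp: abs_le_square_iff[symmetric] intro!: AE_I2 order_trans[OF B])
    have i1: "integrable ?M (\<lambda>z. (g z)\<^sup>2 * indicator (A i) z)" "integrable ?M (\<lambda>z. g z * indicator (A i) z)"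
      "integrable ?M (\<lambda>z. indicator (A i) z :: real)"
      using g2i gi AM by (auto intro!: integrable_real_mult_indicator simp: less_top[symmetric])
    define a where "a = (\<integral>z. g z * indicator (A i) z \<partial>?M)"
    define b where "b = measure ?M (A i)"
    have ri: "row_info (\<lambda>x. measure (K x) (A i)) t = a\<^sup>2 / b"
      using adjoint_densityD(3)[OF K tT g As[of i]] measure_bind_kernel[OF K tT As[of i]]
      by (simp add: row_info_def a_def b_def)
    have "(\<integral>z. (g z)\<^sup>2 * indicator (A i) z \<partial>?M) - 2 * c * a + c\<^sup>2 * b
       = (\<integral>z. (g z)\<^sup>2 * indicator (A i) z - 2 * c * (g z * indicator (A i) z) + c\<^sup>2 * indicator (A i) z \<partial>?M)"
      using i1 AM by (simp add: a_def b_def)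
    also have "\<dots> \<le> (\<integral>z. \<eta>\<^sup>2 * indicator (A i) z \<partial>?M)"
    proof (rule integral_mono)
      fix z
      show "(g z)\<^sup>2 * indicator (A i) z - 2 * c * (g z * indicator (A i) z) + c\<^sup>2 * indicator (A i) z \<le> \<eta>\<^sup>2 * indicator (A i) z"
        using gc[of z] by (auto simp: indicator_def power2_diff algebra_simps)
    qed (use i1 in auto)
    also have "\<dots> = e * b" using AM \<eta> by (simp add: b_def)
    finally have main: "(\<integral>z. (g z)\<^sup>2 * indicator (A i) z \<partial>?M) \<le> e * b + (2 * c * a - c\<^sup>2 * b)" by simp
    \<comment> \<open>completing the square in \<open>c\<close>: the second moment about \<open>c\<close> is least at the conditional
    mean \<open>a/b\<close>\<close>
    have "2 * c * a - c\<^sup>2 * b \<le> a\<^sup>2 / b"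
    proof (cases "b = 0")
      case True
      have "\<bar>a\<bar> \<le> (\<integral>z. \<bar>g z * indicator (A i) z\<bar> \<partial>?M)" unfolding a_def by (rule integral_abs_bound)
      also have "\<dots> \<le> (\<integral>z. B * indicator (A i) z \<partial>?M)"
        using i1 B by (intro integral_mono) (auto simp: indicator_def)
      also have "\<dots> = B * b" using AM by (simp add: b_def)
      finally have "a = 0" using True by simp
      thus ?thesis using True by simp
    next
      case False
      hence "0 < b" by (simp add: b_def zero_less_measure_iff)
      moreover have "0 \<le> (a - c * b)\<^sup>2 / b" using \<open>0 < b\<close> by simp
      ultimately show ?thesis by (simp add: power2_diff field_simps power2_eq_square)
    qed
    with main show ?thesis unfolding ri b_def by simp
  qed
  have g2: "(\<integral>z. (g z)\<^sup>2 \<partial>?M) = (\<Sum>i<L. (\<integral>z. (g z)\<^sup>2 * indicator (A i) z \<partial>?M))"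
  proof -
    have g2i: "integrable ?M (\<lambda>z. (g z)\<^sup>2)"
      using B by (intro M.integrable_const_bound[of _ "B\<^sup>2"]) (auto simp: abs_le_square_iff[symmetric] intro!: AE_I2 order_trans[OF B])
    have "(\<integral>z. (g z)\<^sup>2 \<partial>?M) = (\<integral>z. (\<Sum>i<L. (g z)\<^sup>2 * indicator (A i) z) \<partial>?M)"
    proof (rule Bochner_Integration.integral_cong)
      fix z assume "z \<in> space ?M"
      hence "z \<in> (\<Union>i<L. A i)" using un spM by simp
      moreover have "disjoint_family_on A {..<L}" using dj by (auto simp: disjoint_family_on_def)
      ultimately have "(\<Sum>i<L. indicator (A i) z :: real) = 1"
        by (subst indicator_UN_disjoint[symmetric]) (auto simp: indicator_def)
      thus "(g z)\<^sup>2 = (\<Sum>i<L. (g z)\<^sup>2 * indicator (A i) z)" by (simp flip: sum_distrib_left)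
    qed simp
    also have "\<dots> = (\<Sum>i<L. (\<integral>z. (g z)\<^sup>2 * indicator (A i) z \<partial>?M))"
      by (rule Bochner_Integration.integral_sum) (use g2i As sM in \<open>auto intro!: integrable_real_mult_indicator\<close>)
    finally show ?thesis .
  qed
  have M1: "(\<Sum>i<L. measure ?M (A i)) = 1"
  proof -
    have "measure ?M (\<Union>i<L. A i) = (\<Sum>i<L. measure ?M (A i))"
      by (rule M.finite_measure_finite_Union) (use As sM dj in \<open>auto simp: disjoint_family_on_def\<close>)
    thus ?thesis using un spM M.prob_space by simp
  qed
  have "fisher_info \<Theta> (\<lambda>u. P u \<bind> K) t = (\<Sum>i<L. (\<integral>z. (g z)\<^sup>2 * indicator (A i) z \<partial>?M))"
    using fisher_info_channel[OF K t g] g2 by simp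
  also have "\<dots> \<le> (\<Sum>i<L. row_info (\<lambda>x. measure (K x) (A i)) t + e * measure ?M (A i))"
    by (rule sum_mono) (rule bin)
  also have "\<dots> = (\<Sum>i<L. row_info (\<lambda>x. measure (K x) (A i)) t) + e"
    using M1 by (simp add: sum.distrib flip: sum_distrib_left)
  finally show thesis using As dj un by (intro that[of A L])
qed

end

section \<open>Comparing informations row by row\<close>

text \<open>The converse of reading off the rows of a channel.\<close>

lemma matrix_channel:
  fixes r :: "nat \<Rightarrow> nat \<Rightarrow> real"
  assumes k: "1 \<le> k" and nn: "\<And>l j. 0 \<le> r l j"
    and sum1: "\<And>j. j \<in> {1..k} \<Longrightarrow> (\<Sum>l=1..k. r l j) = 1"
    and ratio: "\<And>l j j'. l \<in> {1..k} \<Longrightarrow> j \<in> {1..k} \<Longrightarrow> j' \<in> {1..k} \<Longrightarrow> r l j \<le> exp \<alpha> * r l j'"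
  obtains R where "R \<in> private_kernels \<alpha> (count_space {1..k}) (count_space {1..k})"
    "\<And>j l. j \<in> {1..k} \<Longrightarrow> l \<in> {1..k} \<Longrightarrow> measure (R j) {l} = r l j"
proof -
  define R where "R j = density (count_space {1..k}) (\<lambda>l. ennreal (r l j))" for j
  have em: "emeasure (R j) A = ennreal (\<Sum>l\<in>A. r l j)" if "A \<subseteq> {1..k}" for A j
  proof -
    have "emeasure (R j) A = (\<integral>\<^sup>+l. ennreal (r l j) * indicator A l \<partial>count_space {1..k})"
      unfolding R_def using that by (subst emeasure_density) auto
    also have "\<dots> = (\<Sum>l\<in>{1..k}. ennreal (r l j) * indicator A l)"
      by (rule nn_integral_count_space_finite) simp
    also have "\<dots> = (\<Sum>l\<in>{1..k} \<inter> A. ennreal (r l j))"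
      by (simp add: sum.inter_restrict indicator_def if_distrib cong: if_cong)
    also have "{1..k} \<inter> A = A" using that by auto
    finally show ?thesis by (simp add: nn sum_ennreal)
  qed
  have me: "measure (R j) A = (\<Sum>l\<in>A. r l j)" if "A \<subseteq> {1..k}" for A j
    using em[OF that] nn by (simp add: measure_def sum_nonneg)
  have prob: "prob_space (R j)" if "j \<in> {1..k}" for j
    using em[of "{1..k}" j] sum1[OF that] by (intro prob_spaceI) (simp add: R_def)
  have "R \<in> private_kernels \<alpha> (count_space {1..k}) (count_space {1..k})"
    unfolding private_kernels_def
  proof (intro CollectI conjI ballI)
    show "R \<in> count_space {1..k} \<rightarrow>\<^sub>M prob_algebra (count_space {1..k})"
      using prob by (auto simp: measurable_count_space_eq1 space_prob_algebra R_def)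
    fix A j j' assume "A \<in> sets (count_space {1..k})" and j: "j \<in> space (count_space {1..k})" "j' \<in> space (count_space {1..k})"
    hence A: "A \<subseteq> {1..k}" by simp
    have "(\<Sum>l\<in>A. r l j) \<le> (\<Sum>l\<in>A. exp \<alpha> * r l j')" using A j by (intro sum_mono ratio) auto
    thus "measure (R j) A \<le> exp \<alpha> * measure (R j') A" unfolding me[OF A] by (simp add: sum_distrib_left)
  qed
  moreover have "measure (R j) {l} = r l j" if "l \<in> {1..k}" for j l using me[of "{l}" j] that by simp
  ultimately show thesis by (intro that[of R]) auto
qed

lemma private_kernels_comp:
  assumes "R \<in> private_kernels \<alpha> M N" "T \<in> L \<rightarrow>\<^sub>M M"
  shows "R \<circ> T \<in> private_kernels \<alpha> L N"
  using assms measurable_space[OF assms(2)] by (auto simp: private_kernels_def measurable_comp)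

context l1_smooth_model
begin

definition info :: "'i set \<Rightarrow> ('i \<Rightarrow> 'a \<Rightarrow> real) \<Rightarrow> real \<Rightarrow> real" where
  "info I \<phi> t = (\<Sum>i\<in>I. row_info (\<phi> i) t)"

definition info_const :: "real \<Rightarrow> real" where
  "info_const \<alpha> = (exp \<alpha> * C)^4 + 2 * (exp \<alpha> * C)\<^sup>2"

lemma info_const_nonneg: "0 \<le> info_const \<alpha>" by (simp add: info_const_def)

text \<open>Scale of the numerator and of the denominator in the information of a row. For private
  rows, \<open>w\<close> is the value of the row at an arbitrary point.\<close>

lemma row_integral_bounds:
  assumes m: "\<phi> \<in> borel_measurable \<mu>" and b: "\<And>x. x \<in> space \<mu> \<Longrightarrow> 0 \<le> \<phi> x" "\<And>x. x \<in> space \<mu> \<Longrightarrow> \<phi> x \<le> exp \<alpha> * w"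
      "\<And>x. x \<in> space \<mu> \<Longrightarrow> w \<le> exp \<alpha> * \<phi> x"
    and t: "t \<in> ball \<theta>0 r" and w: "0 \<le> w"
  shows "\<bar>\<integral>x. \<phi> x * p1 t x \<partial>\<mu>\<bar> \<le> exp \<alpha> * C * w" "w \<le> exp \<alpha> * C * (\<integral>x. \<phi> x * p t x \<partial>\<mu>)"
proof -
  have tT: "t \<in> \<Theta>" using t in_ball_Theta by auto
  have ab: "\<And>x. x \<in> space \<mu> \<Longrightarrow> \<bar>\<phi> x\<bar> \<le> exp \<alpha> * w" using b by auto
  have "\<bar>\<integral>x. \<phi> x * p1 t x \<partial>\<mu>\<bar> \<le> exp \<alpha> * w * (\<integral>x. \<bar>p1 t x\<bar> \<partial>\<mu>)"
    by (rule bounded_mult_abs[OF int1[OF t] m ab])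
  also have "\<dots> \<le> exp \<alpha> * w * C" using norm1[OF t] w by (intro mult_left_mono) auto
  finally show "\<bar>\<integral>x. \<phi> x * p1 t x \<partial>\<mu>\<bar> \<le> exp \<alpha> * C * w" by (simp add: ac_simps)
  have i: "integrable \<mu> (\<lambda>x. \<phi> x * p t x)" by (rule bounded_mult_int[OF p_int[OF tT] m ab])
  have nn: "0 \<le> (\<integral>x. \<phi> x * p t x \<partial>\<mu>)" using b p_nonneg[OF tT] by (intro integral_nonneg_AE) auto
  have "w = (\<integral>x. w * p t x \<partial>\<mu>)" using p_total[OF tT] by simp
  also have "\<dots> \<le> (\<integral>x. exp \<alpha> * (\<phi> x * p t x) \<partial>\<mu>)"
  proof (rule integral_mono)
    fix x assume x: "x \<in> space \<mu>"
    show "w * p t x \<le> exp \<alpha> * (\<phi> x * p t x)"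
      using mult_right_mono[OF b(3)[OF x] p_nonneg[OF tT x]] by (simp add: mult.assoc)
  qed (use i p_int[OF tT] in auto)
  also have "\<dots> = exp \<alpha> * (\<integral>x. \<phi> x * p t x \<partial>\<mu>)" by simp
  also have "\<dots> \<le> exp \<alpha> * C * (\<integral>x. \<phi> x * p t x \<partial>\<mu>)" using C1 nn by (intro mult_right_mono) auto
  finally show "w \<le> exp \<alpha> * C * (\<integral>x. \<phi> x * p t x \<partial>\<mu>)" .
qed

text \<open>Row by row, with the weights \<open>w i\<close> as scales. They sum to one, so that the number of rows
  does not enter.\<close>

lemma info_compare:
  assumes \<alpha>: "0 \<le> \<alpha>" and t: "t \<in> ball \<theta>0 r" and u: "u \<in> ball \<theta>0 r"
    and m: "\<And>i. i \<in> I \<Longrightarrow> \<phi> i \<in> borel_measurable \<mu>" "\<And>i. i \<in> I \<Longrightarrow> \<psi> i \<in> borel_measurable \<mu>"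
    and w: "\<And>i. i \<in> I \<Longrightarrow> 0 \<le> w i" "(\<Sum>i\<in>I. w i) = 1"
    and b: "\<And>i x. i \<in> I \<Longrightarrow> x \<in> space \<mu> \<Longrightarrow> 0 \<le> \<phi> i x \<and> \<phi> i x \<le> exp \<alpha> * w i \<and> w i \<le> exp \<alpha> * \<phi> i x"
    and b': "\<And>i x. i \<in> I \<Longrightarrow> x \<in> space \<mu> \<Longrightarrow> 0 \<le> \<psi> i x \<and> \<psi> i x \<le> exp \<alpha> * w i \<and> w i \<le> exp \<alpha> * \<psi> i x"
    and e: "0 \<le> e"
    and d1: "\<And>i. i \<in> I \<Longrightarrow> \<bar>(\<integral>x. \<phi> i x * p1 t x \<partial>\<mu>) - (\<integral>x. \<psi> i x * p1 u x \<partial>\<mu>)\<bar> \<le> e * w i"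
    and d0: "\<And>i. i \<in> I \<Longrightarrow> \<bar>(\<integral>x. \<phi> i x * p t x \<partial>\<mu>) - (\<integral>x. \<psi> i x * p u x \<partial>\<mu>)\<bar> \<le> e * w i"
  shows "\<bar>info I \<phi> t - info I \<psi> u\<bar> \<le> info_const \<alpha> * e"
proof -
  have c: "1 \<le> exp \<alpha> * C" using \<alpha> C1 mult_mono[of 1 "exp \<alpha>" 1 C] by simp
  have "\<bar>info I \<phi> t - info I \<psi> u\<bar> \<le> (\<Sum>i\<in>I. \<bar>row_info (\<phi> i) t - row_info (\<psi> i) u\<bar>)"
    unfolding info_def sum_subtractf[symmetric] by (rule sum_abs)
  also have "\<dots> \<le> (\<Sum>i\<in>I. info_const \<alpha> * e * w i)"
  proof (rule sum_mono)
    fix i assume i: "i \<in> I"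
    note B = row_integral_bounds[of "\<phi> i" \<alpha> "w i" t] row_integral_bounds[of "\<psi> i" \<alpha> "w i" u]
    show "\<bar>row_info (\<phi> i) t - row_info (\<psi> i) u\<bar> \<le> info_const \<alpha> * e * w i"
      unfolding row_info_def info_const_def
      by (rule quadratic_over_linear_lipschitz[OF c w(1)[OF i] e])
        (use B m i b b' t u w d1 d0 in auto)
  qed
  also have "\<dots> = info_const \<alpha> * e" by (simp add: w flip: sum_distrib_left)
  finally show ?thesis .
qed

lemma private_rowsD:
  assumes "private_rows \<alpha> I \<phi>"
  shows "finite I" "i \<in> I \<Longrightarrow> \<phi> i \<in> borel_measurable \<mu>" "i \<in> I \<Longrightarrow> x \<in> space \<mu> \<Longrightarrow> 0 \<le> \<phi> i x"
    "i \<in> I \<Longrightarrow> x \<in> space \<mu> \<Longrightarrow> y \<in> space \<mu> \<Longrightarrow> \<phi> i x \<le> exp \<alpha> * \<phi> i y"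
    "x \<in> space \<mu> \<Longrightarrow> (\<Sum>i\<in>I. \<phi> i x) = 1"
  using assms by (auto simp: private_rows_def)

lemma info_lipschitz:
  assumes \<alpha>: "0 \<le> \<alpha>" and \<phi>: "private_rows \<alpha> I \<phi>" and t: "t \<in> ball \<theta>0 r" and u: "u \<in> ball \<theta>0 r"
  shows "\<bar>info I \<phi> t - info I \<phi> u\<bar> \<le> info_const \<alpha> * (exp \<alpha> * C * \<bar>t - u\<bar>)"
proof -
  note D = private_rowsD[OF \<phi>]
  obtain x0 where x0: "x0 \<in> space \<mu>" using space_ne by auto
  have tT: "t \<in> \<Theta>" "u \<in> \<Theta>" using t u in_ball_Theta by auto
  have key: "\<bar>(\<integral>x. \<phi> i x * f x \<partial>\<mu>) - (\<integral>x. \<phi> i x * g x \<partial>\<mu>)\<bar> \<le> exp \<alpha> * C * \<bar>t - u\<bar> * \<phi> i x0"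
    if i: "i \<in> I" and f: "integrable \<mu> f" and g: "integrable \<mu> g" and l: "(\<integral>x. \<bar>f x - g x\<bar> \<partial>\<mu>) \<le> C * \<bar>t - u\<bar>" for i f g
  proof -
    have ab: "\<And>x. x \<in> space \<mu> \<Longrightarrow> \<bar>\<phi> i x\<bar> \<le> exp \<alpha> * \<phi> i x0" using D i x0 by simp
    have "(\<integral>x. \<phi> i x * f x \<partial>\<mu>) - (\<integral>x. \<phi> i x * g x \<partial>\<mu>) = (\<integral>x. \<phi> i x * (f x - g x) \<partial>\<mu>)"
      using bounded_mult_int[OF f D(2)[OF i] ab] bounded_mult_int[OF g D(2)[OF i] ab]
      by (simp add: right_diff_distrib)
    also have "\<bar>\<dots>\<bar> \<le> exp \<alpha> * \<phi> i x0 * (\<integral>x. \<bar>f x - g x\<bar> \<partial>\<mu>)"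
      using f g by (intro bounded_mult_abs D(2)[OF i] ab) auto
    also have "\<dots> \<le> exp \<alpha> * \<phi> i x0 * (C * \<bar>t - u\<bar>)" using l D(3)[OF i x0] by (intro mult_left_mono) auto
    finally show ?thesis by (simp add: ac_simps)
  qed
  show ?thesis
  proof (rule info_compare[OF \<alpha> t u, where w = "\<lambda>i. \<phi> i x0"])
    fix i assume i: "i \<in> I"
    show "\<bar>(\<integral>x. \<phi> i x * p1 t x \<partial>\<mu>) - (\<integral>x. \<phi> i x * p1 u x \<partial>\<mu>)\<bar> \<le> exp \<alpha> * C * \<bar>t - u\<bar> * \<phi> i x0"
      by (rule key[OF i int1[OF t] int1[OF u] lip1[OF u t]])
    show "\<bar>(\<integral>x. \<phi> i x * p t x \<partial>\<mu>) - (\<integral>x. \<phi> i x * p u x \<partial>\<mu>)\<bar> \<le> exp \<alpha> * C * \<bar>t - u\<bar> * \<phi> i x0"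
      by (rule key[OF i p_int[OF tT(1)] p_int[OF tT(2)] lip0[OF u t]])
  qed (use D x0 C1 in auto)
qed

lemma info_bound:
  assumes \<alpha>: "0 \<le> \<alpha>" and \<phi>: "private_rows \<alpha> I \<phi>" and t: "t \<in> ball \<theta>0 r"
  shows "0 \<le> info I \<phi> t" "info I \<phi> t \<le> (exp \<alpha> * C)^3"
proof -
  note D = private_rowsD[OF \<phi>]
  obtain x0 where x0: "x0 \<in> space \<mu>" using space_ne by auto
  have tT: "t \<in> \<Theta>" using t in_ball_Theta by auto
  let ?c = "exp \<alpha> * C"
  have c0: "0 \<le> ?c" using C1 by simp
  have pos: "0 \<le> (\<integral>x. \<phi> i x * p t x \<partial>\<mu>)" if "i \<in> I" for i
    using D(3)[OF that] p_nonneg[OF tT] by (intro integral_nonneg_AE) auto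
  thus "0 \<le> info I \<phi> t" unfolding info_def row_info_def by (intro sum_nonneg divide_nonneg_nonneg) auto
  have "info I \<phi> t \<le> (\<Sum>i\<in>I. ?c^3 * \<phi> i x0)"
    unfolding info_def
  proof (rule sum_mono)
    fix i assume i: "i \<in> I"
    define w where "w = \<phi> i x0"
    have w: "0 \<le> w" using D(3)[OF i x0] by (simp add: w_def)
    define a where "a = (\<integral>x. \<phi> i x * p1 t x \<partial>\<mu>)"
    define b where "b = (\<integral>x. \<phi> i x * p t x \<partial>\<mu>)"
    have ab: "\<bar>a\<bar> \<le> ?c * w" "w \<le> ?c * b" unfolding a_def b_def
      using row_integral_bounds[of "\<phi> i" \<alpha> w t] D i x0 t w by (auto simp: w_def)
    show "row_info (\<phi> i) t \<le> ?c^3 * \<phi> i x0"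
    proof (cases "b = 0")
      case True thus ?thesis using w c0 by (simp add: row_info_def b_def w_def)
    next
      case False
      hence b: "0 < b" using pos[OF i] by (simp add: b_def)
      have "\<bar>a\<bar>\<^sup>2 \<le> (?c * w)\<^sup>2" using ab by (intro power_mono) auto
      also have "\<dots> = ?c\<^sup>2 * w * w" by (simp add: power2_eq_square)
      also have "\<dots> \<le> ?c\<^sup>2 * w * (?c * b)" using ab w by (intro mult_left_mono) auto
      also have "\<dots> = ?c^3 * w * b" by (simp add: power3_eq_cube power2_eq_square)
      finally have "a\<^sup>2 / b \<le> ?c^3 * w" using b by (simp add: divide_le_eq)
      thus ?thesis by (simp add: row_info_def a_def b_def w_def)
    qed
  qed
  also have "\<dots> = ?c^3" using D(5)[OF x0] by (simp flip: sum_distrib_left)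
  finally show "info I \<phi> t \<le> ?c^3" .
qed

section \<open>Averaging over the cells of a quantizer\<close>

text \<open>The integral of \<open>\<omega> p\<^sub>u\<close> is nonnegative at \<open>u = t + h\<close> and at \<open>u = t - h\<close>. By Taylor
  expansion, this forces its derivative at \<open>t\<close> to be small when its value is small. It controls
  the derivative of \<open>p\<close> outside the regular cells, where the quantizer only controls the
  probability.\<close>

lemma nonneg_derivative_bound:
  assumes m: "\<omega> \<in> borel_measurable \<mu>" and b: "\<And>x. x \<in> space \<mu> \<Longrightarrow> 0 \<le> \<omega> x" "\<And>x. x \<in> space \<mu> \<Longrightarrow> \<omega> x \<le> b"
    and t: "t \<in> ball \<theta>0 r" "t + h \<in> ball \<theta>0 r" "t - h \<in> ball \<theta>0 r" and h: "0 < h" and b0: "0 \<le> b"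
  shows "\<bar>\<integral>x. \<omega> x * p1 t x \<partial>\<mu>\<bar> \<le> (\<integral>x. \<omega> x * p t x \<partial>\<mu>) / h + b * C * h"
proof -
  have ab: "\<And>x. x \<in> space \<mu> \<Longrightarrow> \<bar>\<omega> x\<bar> \<le> b" using b by auto
  have tT: "t \<in> \<Theta>" using t in_ball_Theta by auto
  have main: "- ((u - t) * (\<integral>x. \<omega> x * p1 t x \<partial>\<mu>)) \<le> (\<integral>x. \<omega> x * p t x \<partial>\<mu>) + b * (C * (u - t)\<^sup>2)"
    if u: "u \<in> ball \<theta>0 r" for u
  proof -
    have uT: "u \<in> \<Theta>" using u in_ball_Theta by auto
    note i = bounded_mult_int[OF p_int[OF tT] m ab] bounded_mult_int[OF p_int[OF uT] m ab]
       bounded_mult_int[OF int1[OF t(1)] m ab]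
    have "(\<integral>x. \<omega> x * p u x \<partial>\<mu>) - (\<integral>x. \<omega> x * p t x \<partial>\<mu>) - (u - t) * (\<integral>x. \<omega> x * p1 t x \<partial>\<mu>)
      = (\<integral>x. \<omega> x * p u x - \<omega> x * p t x - (u - t) * (\<omega> x * p1 t x) \<partial>\<mu>)" using i by simp
    also have "\<dots> = (\<integral>x. \<omega> x * (p u x - p t x - (u - t) * p1 t x) \<partial>\<mu>)" by (simp add: algebra_simps)
    also have "\<bar>\<dots>\<bar> \<le> b * (\<integral>x. \<bar>p u x - p t x - (u - t) * p1 t x\<bar> \<partial>\<mu>)"
      using p_int[OF tT] p_int[OF uT] int1[OF t(1)] by (intro bounded_mult_abs m ab) auto
    also have "\<dots> \<le> b * (C * (u - t)\<^sup>2)" using expand0[OF t(1) u] b0 by (intro mult_left_mono)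
    finally have "\<bar>(\<integral>x. \<omega> x * p u x \<partial>\<mu>) - (\<integral>x. \<omega> x * p t x \<partial>\<mu>) - (u - t) * (\<integral>x. \<omega> x * p1 t x \<partial>\<mu>)\<bar> \<le> b * (C * (u - t)\<^sup>2)" .
    moreover have "0 \<le> (\<integral>x. \<omega> x * p u x \<partial>\<mu>)" using b p_nonneg[OF uT] by (intro integral_nonneg_AE) auto
    ultimately show ?thesis by linarith
  qed
  have "h * \<bar>\<integral>x. \<omega> x * p1 t x \<partial>\<mu>\<bar> \<le> (\<integral>x. \<omega> x * p t x \<partial>\<mu>) + b * (C * h\<^sup>2)"
    using main[OF t(2)] main[OF t(3)] h by (auto simp: abs_if)
  hence "\<bar>\<integral>x. \<omega> x * p1 t x \<partial>\<mu>\<bar> \<le> ((\<integral>x. \<omega> x * p t x \<partial>\<mu>) + b * (C * h\<^sup>2)) / h"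
    using h by (simp add: le_divide_eq mult.commute)
  also have "\<dots> = (\<integral>x. \<omega> x * p t x \<partial>\<mu>) / h + b * C * h" using h by (simp add: add_divide_distrib power2_eq_square)
  finally show ?thesis .
qed

text \<open>The average of \<open>\<phi>\<close> over cell \<open>j\<close>. On irregular cells the value \<open>\<phi> x0\<close> is used, so that the
  averages of the rows of a channel again form the rows of a private channel.\<close>

definition cell_mean :: "('a \<times> real \<Rightarrow> nat) \<Rightarrow> nat \<Rightarrow> real \<Rightarrow> 'a \<Rightarrow> ('a \<Rightarrow> real) \<Rightarrow> nat \<Rightarrow> real" where
  "cell_mean T k \<tau> x0 \<phi> j = (if j \<in> regular_cells \<mu> T k \<tau>
     then (\<integral>x. indicator (quant_cell \<mu> T \<tau> j) x * \<phi> x \<partial>\<mu>) / measure \<mu> (quant_cell \<mu> T \<tau> j) else \<phi> x0)"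

context
  fixes T :: "'a \<times> real \<Rightarrow> nat" and k :: nat and \<tau> :: real
  assumes Tm: "(\<lambda>x. T (x, \<tau>)) \<in> \<mu> \<rightarrow>\<^sub>M count_space UNIV"
begin

lemma cell_sets: "quant_cell \<mu> T \<tau> j \<in> sets \<mu>"
  unfolding quant_cell_def using measurable_sets[OF Tm, of "{j}"] by (simp add: vimage_def Int_def conj_commute)

lemma cells_finite: "finite (regular_cells \<mu> T k \<tau>)"
  unfolding regular_cells_def by simp

lemma cell_measure:
  assumes "j \<in> regular_cells \<mu> T k \<tau>"
  shows "0 < measure \<mu> (quant_cell \<mu> T \<tau> j)" "emeasure \<mu> (quant_cell \<mu> T \<tau> j) < \<infinity>"
proof -
  show "emeasure \<mu> (quant_cell \<mu> T \<tau> j) < \<infinity>" using assms by (simp add: regular_cells_def)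
  thus "0 < measure \<mu> (quant_cell \<mu> T \<tau> j)" using assms
    by (simp add: regular_cells_def measure_def enn2real_positive_iff)
qed

lemma cell_mean_bounds:
  assumes m: "\<phi> \<in> borel_measurable \<mu>" and b: "\<And>x. x \<in> space \<mu> \<Longrightarrow> lo \<le> \<phi> x" "\<And>x. x \<in> space \<mu> \<Longrightarrow> \<phi> x \<le> hi"
    and x0: "x0 \<in> space \<mu>"
  shows "lo \<le> cell_mean T k \<tau> x0 \<phi> j" "cell_mean T k \<tau> x0 \<phi> j \<le> hi"
proof -
  have "lo \<le> cell_mean T k \<tau> x0 \<phi> j \<and> cell_mean T k \<tau> x0 \<phi> j \<le> hi"
  proof (cases "j \<in> regular_cells \<mu> T k \<tau>")
    case True
    let ?B = "quant_cell \<mu> T \<tau> j"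
    note B = cell_measure[OF True] cell_sets[of j]
    have ii: "integrable \<mu> (\<lambda>x. c * indicator ?B x :: real)" for c using B by (intro integrable_mult_right integrable_real_indicator)
    have ip: "integrable \<mu> (\<lambda>x. indicator ?B x * \<phi> x)"
    proof (rule Bochner_Integration.integrable_bound[OF ii[of "max \<bar>lo\<bar> \<bar>hi\<bar>"]])
      show "AE x in \<mu>. norm (indicator ?B x * \<phi> x) \<le> norm (max \<bar>lo\<bar> \<bar>hi\<bar> * indicator ?B x)"
        using b by (intro AE_I2) (force simp: indicator_def)
    qed (use m B in auto)
    have "lo * measure \<mu> ?B = (\<integral>x. lo * indicator ?B x \<partial>\<mu>)" using B by simp
    also have "\<dots> \<le> (\<integral>x. indicator ?B x * \<phi> x \<partial>\<mu>)" by (rule integral_mono[OF ii ip]) (use b in \<open>auto simp: indicator_def\<close>)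
    finally have 1: "lo * measure \<mu> ?B \<le> (\<integral>x. indicator ?B x * \<phi> x \<partial>\<mu>)" .
    have "(\<integral>x. indicator ?B x * \<phi> x \<partial>\<mu>) \<le> (\<integral>x. hi * indicator ?B x \<partial>\<mu>)"
      by (rule integral_mono[OF ip ii]) (use b in \<open>auto simp: indicator_def\<close>)
    also have "\<dots> = hi * measure \<mu> ?B" using B by simp
    finally show ?thesis using 1 B(1) True by (simp add: cell_mean_def le_divide_eq divide_le_eq)
  qed (use b x0 in \<open>simp add: cell_mean_def\<close>)
  thus "lo \<le> cell_mean T k \<tau> x0 \<phi> j" "cell_mean T k \<tau> x0 \<phi> j \<le> hi" by auto
qed

text \<open>Averaging over cells is self-adjoint on the regular part, so that averaging a row amounts
  to averaging the density.\<close>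

lemma cell_average_self_adjoint:
  assumes m: "\<phi> \<in> borel_measurable \<mu>" and b: "\<And>x. x \<in> space \<mu> \<Longrightarrow> \<bar>\<phi> x\<bar> \<le> c" and f: "integrable \<mu> f"
  shows "(\<integral>x. indicator (regular_part \<mu> T k \<tau>) x * cell_mean T k \<tau> x0 \<phi> (T (x, \<tau>)) * f x \<partial>\<mu>)
       = (\<integral>x. \<phi> x * cell_average \<mu> T k \<tau> f x \<partial>\<mu>)"
    and "integrable \<mu> (cell_average \<mu> T k \<tau> f)"
    and "x \<notin> regular_part \<mu> T k \<tau> \<Longrightarrow> cell_average \<mu> T k \<tau> f x = 0"
proof -
  let ?J = "regular_cells \<mu> T k \<tau>" and ?B = "quant_cell \<mu> T \<tau>"
  have iB: "integrable \<mu> (indicator (?B j) :: 'a \<Rightarrow> real)" if "j \<in> ?J" for j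
    using cell_measure[OF that] cell_sets by (intro integrable_real_indicator) auto
  have cav: "cell_average \<mu> T k \<tau> f x = (\<Sum>j\<in>?J. (\<integral>y. indicator (?B j) y * f y \<partial>\<mu>) / measure \<mu> (?B j) * indicator (?B j) x)" for x
    by (simp add: cell_average_def set_lebesgue_integral_def)
  show "integrable \<mu> (cell_average \<mu> T k \<tau> f)"
    unfolding cav by (intro Bochner_Integration.integrable_sum integrable_mult_right iB)
  show "x \<notin> regular_part \<mu> T k \<tau> \<Longrightarrow> cell_average \<mu> T k \<tau> f x = 0"
    unfolding cav by (intro sum.neutral) (auto simp: regular_part_def)
  have if1: "integrable \<mu> (\<lambda>x. indicator (?B j) x * f x)" for j
    using bounded_mult_int[OF f, of "indicator (?B j)" 1] cell_sets[of j] by (auto simp: indicator_def)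
  have ip1: "integrable \<mu> (\<lambda>x. \<phi> x * indicator (?B j) x)" if "j \<in> ?J" for j
    by (rule bounded_mult_int[OF iB[OF that] m b])
  have pt: "indicator (regular_part \<mu> T k \<tau>) x * cell_mean T k \<tau> x0 \<phi> (T (x, \<tau>)) * f x
     = (\<Sum>j\<in>?J. cell_mean T k \<tau> x0 \<phi> j * (indicator (?B j) x * f x))" if x: "x \<in> space \<mu>" for x
  proof -
    have "(\<Sum>j\<in>?J. cell_mean T k \<tau> x0 \<phi> j * (indicator (?B j) x * f x))
      = (\<Sum>j\<in>?J. if j = T (x, \<tau>) then cell_mean T k \<tau> x0 \<phi> j * f x else 0)"
      using x by (intro sum.cong) (auto simp: quant_cell_def)
    also have "\<dots> = (if T (x, \<tau>) \<in> ?J then cell_mean T k \<tau> x0 \<phi> (T (x, \<tau>)) * f x else 0)"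
      by (rule sum.delta[OF cells_finite])
    also have "\<dots> = indicator (regular_part \<mu> T k \<tau>) x * cell_mean T k \<tau> x0 \<phi> (T (x, \<tau>)) * f x"
      using x by (auto simp: regular_part_def quant_cell_def indicator_def)
    finally show ?thesis by simp
  qed
  have "(\<integral>x. indicator (regular_part \<mu> T k \<tau>) x * cell_mean T k \<tau> x0 \<phi> (T (x, \<tau>)) * f x \<partial>\<mu>)
    = (\<integral>x. (\<Sum>j\<in>?J. cell_mean T k \<tau> x0 \<phi> j * (indicator (?B j) x * f x)) \<partial>\<mu>)"
    by (rule Bochner_Integration.integral_cong[OF refl pt])
  also have "\<dots> = (\<Sum>j\<in>?J. cell_mean T k \<tau> x0 \<phi> j * (\<integral>x. indicator (?B j) x * f x \<partial>\<mu>))"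
    using if1 by (subst Bochner_Integration.integral_sum) auto
  also have "\<dots> = (\<Sum>j\<in>?J. (\<integral>y. indicator (?B j) y * f y \<partial>\<mu>) / measure \<mu> (?B j) * (\<integral>x. \<phi> x * indicator (?B j) x \<partial>\<mu>))"
    by (rule sum.cong) (auto simp: cell_mean_def mult.commute)
  also have "\<dots> = (\<integral>x. (\<Sum>j\<in>?J. (\<integral>y. indicator (?B j) y * f y \<partial>\<mu>) / measure \<mu> (?B j) * (\<phi> x * indicator (?B j) x)) \<partial>\<mu>)"
    using ip1 by (subst Bochner_Integration.integral_sum) auto
  also have "\<dots> = (\<integral>x. \<phi> x * cell_average \<mu> T k \<tau> f x \<partial>\<mu>)"
    unfolding cav by (simp add: sum_distrib_left mult.left_commute)
  finally show "(\<integral>x. indicator (regular_part \<mu> T k \<tau>) x * cell_mean T k \<tau> x0 \<phi> (T (x, \<tau>)) * f x \<partial>\<mu>)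
       = (\<integral>x. \<phi> x * cell_average \<mu> T k \<tau> f x \<partial>\<mu>)" .
qed

lemma regular_part_sets: "regular_part \<mu> T k \<tau> \<in> sets \<mu>"
  unfolding regular_part_def using cells_finite cell_sets by auto

text \<open>On the regular part, self-adjointness moves the averaging from \<open>\<phi>\<close> to \<open>f\<close>. The bound \<open>\<epsilon>\<close>
  takes care of the integrals over the complement, one for \<open>\<phi>\<close> and one for its average.\<close>

lemma cell_mean_pairing:
  assumes m: "\<phi> \<in> borel_measurable \<mu>" and b: "\<And>x. x \<in> space \<mu> \<Longrightarrow> 0 \<le> \<phi> x" "\<And>x. x \<in> space \<mu> \<Longrightarrow> \<phi> x \<le> c"
    and f: "integrable \<mu> f" and x0: "x0 \<in> space \<mu>"
    and E: "\<And>\<omega>. \<omega> \<in> borel_measurable \<mu> \<Longrightarrow> (\<And>x. x \<in> space \<mu> \<Longrightarrow> 0 \<le> \<omega> x) \<Longrightarrow>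
        (\<And>x. x \<in> space \<mu> \<Longrightarrow> \<omega> x \<le> c * indicator (space \<mu> - regular_part \<mu> T k \<tau>) x) \<Longrightarrow> \<bar>\<integral>x. \<omega> x * f x \<partial>\<mu>\<bar> \<le> \<epsilon>"
  shows "\<bar>(\<integral>x. cell_mean T k \<tau> x0 \<phi> (T (x, \<tau>)) * f x \<partial>\<mu>) - (\<integral>x. \<phi> x * f x \<partial>\<mu>)\<bar>
     \<le> c * (LINT x:regular_part \<mu> T k \<tau>|\<mu>. \<bar>f x - cell_average \<mu> T k \<tau> f x\<bar>) + 2 * \<epsilon>"
proof -
  let ?K = "regular_part \<mu> T k \<tau>"
  let ?g = "\<lambda>x. cell_mean T k \<tau> x0 \<phi> (T (x, \<tau>))"
  have Ks[measurable]: "?K \<in> sets \<mu>" by (rule regular_part_sets)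
  have gm[measurable]: "?g \<in> borel_measurable \<mu>" by (rule measurable_compose[OF Tm]) simp
  have [measurable]: "\<phi> \<in> borel_measurable \<mu>" by (rule m)
  have gb: "0 \<le> ?g x" "?g x \<le> c" for x using cell_mean_bounds[OF m b x0] by auto
  have gb': "\<And>x. x \<in> space \<mu> \<Longrightarrow> \<bar>?g x\<bar> \<le> c" and b': "\<And>x. x \<in> space \<mu> \<Longrightarrow> \<bar>\<phi> x\<bar> \<le> c" using gb b by auto
  have c0: "0 \<le> c" using b[OF x0] by simp
  have split: "(\<integral>x. h x * f x \<partial>\<mu>) = (\<integral>x. indicator ?K x * h x * f x \<partial>\<mu>) + (\<integral>x. (indicator (space \<mu> - ?K) x * h x) * f x \<partial>\<mu>)"
    if h[measurable]: "h \<in> borel_measurable \<mu>" and hb: "\<And>x. x \<in> space \<mu> \<Longrightarrow> \<bar>h x\<bar> \<le> c" for h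
  proof -
    have "integrable \<mu> (\<lambda>x. indicator ?K x * h x * f x)" "integrable \<mu> (\<lambda>x. (indicator (space \<mu> - ?K) x * h x) * f x)"
      using hb c0 by (intro bounded_mult_int[OF f, where c=c]; force simp: indicator_def)+
    hence "(\<integral>x. indicator ?K x * h x * f x \<partial>\<mu>) + (\<integral>x. (indicator (space \<mu> - ?K) x * h x) * f x \<partial>\<mu>)
       = (\<integral>x. indicator ?K x * h x * f x + (indicator (space \<mu> - ?K) x * h x) * f x \<partial>\<mu>)" by simp
    also have "\<dots> = (\<integral>x. h x * f x \<partial>\<mu>)" by (rule Bochner_Integration.integral_cong) (auto simp: indicator_def)
    finally show ?thesis by simp
  qed
  have E1: "\<bar>\<integral>x. (indicator (space \<mu> - ?K) x * h x) * f x \<partial>\<mu>\<bar> \<le> \<epsilon>"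
    if h[measurable]: "h \<in> borel_measurable \<mu>" and hb: "\<And>x. x \<in> space \<mu> \<Longrightarrow> 0 \<le> h x \<and> h x \<le> c" for h
    using hb by (intro E) (auto simp: indicator_def)
  note ci = cell_average_self_adjoint(2)[OF m b' f]
  have fi: "integrable \<mu> (\<lambda>x. cell_average \<mu> T k \<tau> f x - f x)" using ci f by auto
  have "(\<integral>x. indicator ?K x * ?g x * f x \<partial>\<mu>) - (\<integral>x. indicator ?K x * \<phi> x * f x \<partial>\<mu>)
    = (\<integral>x. \<phi> x * cell_average \<mu> T k \<tau> f x \<partial>\<mu>) - (\<integral>x. (indicator ?K x * \<phi> x) * f x \<partial>\<mu>)"
    using cell_average_self_adjoint(1)[OF m b' f] by simp
  also have "\<dots> = (\<integral>x. \<phi> x * cell_average \<mu> T k \<tau> f x - (indicator ?K x * \<phi> x) * f x \<partial>\<mu>)"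
  proof (rule Bochner_Integration.integral_diff[symmetric])
    show "integrable \<mu> (\<lambda>x. \<phi> x * cell_average \<mu> T k \<tau> f x)" by (rule bounded_mult_int[OF ci m b'])
    show "integrable \<mu> (\<lambda>x. (indicator ?K x * \<phi> x) * f x)"
      using b' c0 by (intro bounded_mult_int[OF f, where c=c]) (auto simp: indicator_def)
  qed
  also have "\<dots> = (\<integral>x. \<phi> x * (indicator ?K x * (cell_average \<mu> T k \<tau> f x - f x)) \<partial>\<mu>)"
    using cell_average_self_adjoint(3)[OF m b' f] by (intro Bochner_Integration.integral_cong) (auto simp: indicator_def algebra_simps)
  finally have e1: "(\<integral>x. indicator ?K x * ?g x * f x \<partial>\<mu>) - (\<integral>x. indicator ?K x * \<phi> x * f x \<partial>\<mu>) = \<dots>" .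
  have "\<bar>\<integral>x. \<phi> x * (indicator ?K x * (cell_average \<mu> T k \<tau> f x - f x)) \<partial>\<mu>\<bar>
      \<le> c * (\<integral>x. \<bar>indicator ?K x * (cell_average \<mu> T k \<tau> f x - f x)\<bar> \<partial>\<mu>)"
    using fi by (intro bounded_mult_abs m b' bounded_mult_int[OF fi, where c=1]) (auto simp: indicator_def)
  also have "(\<integral>x. \<bar>indicator ?K x * (cell_average \<mu> T k \<tau> f x - f x)\<bar> \<partial>\<mu>)
      = (LINT x:?K|\<mu>. \<bar>f x - cell_average \<mu> T k \<tau> f x\<bar>)"
    unfolding set_lebesgue_integral_def by (intro Bochner_Integration.integral_cong) (auto simp: indicator_def)
  finally have "\<bar>(\<integral>x. indicator ?K x * ?g x * f x \<partial>\<mu>) - (\<integral>x. indicator ?K x * \<phi> x * f x \<partial>\<mu>)\<bar>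
     \<le> c * (LINT x:?K|\<mu>. \<bar>f x - cell_average \<mu> T k \<tau> f x\<bar>)" unfolding e1 .
  moreover have "\<bar>\<integral>x. (indicator (space \<mu> - ?K) x * ?g x) * f x \<partial>\<mu>\<bar> \<le> \<epsilon>"
    by (rule E1[OF gm]) (use gb in auto)
  moreover have "\<bar>\<integral>x. (indicator (space \<mu> - ?K) x * \<phi> x) * f x \<partial>\<mu>\<bar> \<le> \<epsilon>"
    by (rule E1[OF m]) (use b in auto)
  ultimately show ?thesis using split[OF gm gb'] split[OF m b'] by linarith
qed

end

end

section \<open>Convergence of the quantized information\<close>

text \<open>Otherwise there are \<open>m\<close> strictly increasing and parameters tending to \<open>\<theta>0\<close> with large
  error; filled up with \<open>\<theta>0\<close>, they form a convergent sequence that contradicts the consistency of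
  the quantizer.\<close>

lemma quant_error_uniform:
  assumes q: "consistent_quantizer \<mu> \<Theta> P p s T k" and th: "\<theta>0 \<in> \<Theta>" and e: "0 < e"
  shows "\<exists>\<delta>>0. \<exists>M. \<forall>m\<ge>M. \<forall>\<tau>\<in>\<Theta>. \<bar>\<tau> - \<theta>0\<bar> < \<delta> \<longrightarrow> quant_error \<mu> P p s (T m) (k m \<tau>) \<tau> < e"
proof (rule ccontr)
  assume neg0: "\<not> ?thesis"
  have neg: "\<exists>m\<ge>M. \<exists>\<tau>\<in>\<Theta>. \<bar>\<tau> - \<theta>0\<bar> < \<delta> \<and> e \<le> quant_error \<mu> P p s (T m) (k m \<tau>) \<tau>" if "0 < \<delta>" for \<delta> M
    using neg0 that by (meson not_less)
  let ?bad = "\<lambda>j (m, \<tau>). \<tau> \<in> \<Theta> \<and> \<bar>\<tau> - \<theta>0\<bar> < 1 / real (Suc j) \<and> e \<le> quant_error \<mu> P p s (T m) (k m \<tau>) \<tau>"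
  \<comment> \<open>strictly increasing indices, so that the bad parameters can be placed in one sequence\<close>
  have "\<exists>f. \<forall>j. ?bad j (f j) \<and> fst (f j) < fst (f (Suc j))"
  proof (rule dependent_nat_choice)
    show "\<exists>x. ?bad 0 x" using neg[of 1 0] by auto
    fix x :: "nat \<times> real" and j assume "?bad j x"
    obtain m \<tau> where "m \<ge> Suc (fst x)" "\<tau> \<in> \<Theta>" "\<bar>\<tau> - \<theta>0\<bar> < 1 / real (Suc (Suc j))" "e \<le> quant_error \<mu> P p s (T m) (k m \<tau>) \<tau>"
      using neg[of "1 / real (Suc (Suc j))" "Suc (fst x)"] by auto
    thus "\<exists>y. ?bad (Suc j) y \<and> fst x < fst y" by (intro exI[of _ "(m, \<tau>)"]) auto
  qed
  then obtain f where f0: "\<forall>j. ?bad j (f j) \<and> fst (f j) < fst (f (Suc j))" by (elim exE)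
  have f: "\<And>j. ?bad j (f j)" "\<And>j. fst (f j) < fst (f (Suc j))" using f0 by auto
  define \<rho> where "\<rho> j = fst (f j)" for j
  have sm: "strict_mono \<rho>" using f(2) by (simp add: strict_mono_Suc_iff \<rho>_def)
  have inj: "inj \<rho>" using sm by (rule strict_mono_imp_inj_on)
  define \<theta>s where "\<theta>s m = (if m \<in> range \<rho> then snd (f (inv \<rho> m)) else \<theta>0)" for m
  have fs: "snd (f j) \<in> \<Theta>" "\<bar>snd (f j) - \<theta>0\<bar> < 1 / real (Suc j)"
    "e \<le> quant_error \<mu> P p s (T (\<rho> j)) (k (\<rho> j) (snd (f j))) (snd (f j))" for j
    using f(1)[of j] by (auto simp: \<rho>_def split: prod.splits)
  have s\<rho>: "\<theta>s (\<rho> j) = snd (f j)" for j using inj by (simp add: \<theta>s_def)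
  have lim: "\<theta>s \<longlonglongrightarrow> \<theta>0"
  proof (rule LIMSEQ_I)
    fix \<epsilon> :: real assume "0 < \<epsilon>"
    then obtain N where N: "1 / real (Suc N) < \<epsilon>" using nat_approx_posE by blast
    show "\<exists>no. \<forall>n\<ge>no. norm (\<theta>s n - \<theta>0) < \<epsilon>"
    proof (intro exI[of _ "\<rho> N"] allI impI)
      fix m assume m: "m \<ge> \<rho> N"
      show "norm (\<theta>s m - \<theta>0) < \<epsilon>"
      proof (cases "m \<in> range \<rho>")
        case True
        then obtain j where j: "m = \<rho> j" by auto
        hence "N \<le> j" using m sm by (simp add: strict_mono_less_eq)
        hence "1 / real (Suc j) \<le> 1 / real (Suc N)" by (simp add: frac_le)
        thus ?thesis using fs(2)[of j] N by (simp add: j s\<rho>)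
      qed (simp add: \<theta>s_def \<open>0 < \<epsilon>\<close>)
    qed
  qed
  have "\<forall>m. \<theta>s m \<in> \<Theta>" using fs th by (auto simp: \<theta>s_def)
  hence "(\<lambda>m. quant_error \<mu> P p s (T m) (k m (\<theta>s m)) (\<theta>s m)) \<longlonglongrightarrow> 0"
    using q th lim unfolding consistent_quantizer_def by blast
  hence "(\<lambda>j. quant_error \<mu> P p s (T (\<rho> j)) (k (\<rho> j) (\<theta>s (\<rho> j))) (\<theta>s (\<rho> j))) \<longlonglongrightarrow> 0"
    using LIMSEQ_subseq_LIMSEQ[OF _ sm] by (simp add: comp_def)
  moreover have "\<And>j. e \<le> quant_error \<mu> P p s (T (\<rho> j)) (k (\<rho> j) (\<theta>s (\<rho> j))) (\<theta>s (\<rho> j))"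
    using fs(3) s\<rho> by simp
  ultimately have "e \<le> 0" by (intro LIMSEQ_le_const) auto
  thus False using e by simp
qed

context l1_smooth_model
begin

text \<open>For the density, the complement of the regular part contributes its probability, which is
  at most \<open>\<Delta>\<^sup>2\<close>. For the derivative it contributes \<open>\<Delta>\<^sup>2/h + C h\<close> by \<open>nonneg_derivative_bound\<close>,
  with the step \<open>h\<close> still to be chosen.\<close>

lemma quantized_info_close:
  assumes \<alpha>: "0 \<le> \<alpha>" and \<phi>: "private_rows \<alpha> I \<phi>" and x0: "x0 \<in> space \<mu>"
    and Tm: "(\<lambda>x. T (x, \<tau>)) \<in> \<mu> \<rightarrow>\<^sub>M count_space UNIV"
    and t: "\<tau> \<in> ball \<theta>0 r" "\<tau> + h \<in> ball \<theta>0 r" "\<tau> - h \<in> ball \<theta>0 r" and h: "0 < h"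
    and s: "s \<tau> \<in> borel_measurable \<mu>" "AE x in \<mu>. s \<tau> x * p \<tau> x = p1 \<tau> x"
    and qe: "quant_error \<mu> P p s T k \<tau> \<le> \<Delta>"
  shows "\<bar>info I (\<lambda>i x. cell_mean T k \<tau> x0 (\<phi> i) (T (x, \<tau>))) \<tau> - info I \<phi> \<tau>\<bar>
     \<le> info_const \<alpha> * (exp \<alpha> * (\<Delta> + 2 * \<Delta>\<^sup>2 + 2 * \<Delta>\<^sup>2 / h + 2 * C * h))"
proof -
  note D = private_rowsD[OF \<phi>]
  let ?K = "regular_part \<mu> T k \<tau>"
  have tT: "\<tau> \<in> \<Theta>" using t in_ball_Theta by auto
  have [measurable]: "?K \<in> sets \<mu>" by (rule regular_part_sets[OF Tm])
  have [measurable]: "s \<tau> \<in> borel_measurable \<mu>" "p \<tau> \<in> borel_measurable \<mu>" "p1 \<tau> \<in> borel_measurable \<mu>"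
    using s p_meas[OF tT] int1[OF t(1)] by auto
  define d0 where "d0 = (LINT x:?K|\<mu>. \<bar>p \<tau> x - cell_average \<mu> T k \<tau> (p \<tau>) x\<bar>)"
  define d1 where "d1 = (LINT x:?K|\<mu>. \<bar>p1 \<tau> x - cell_average \<mu> T k \<tau> (p1 \<tau>) x\<bar>)"
  define E where "E = space \<mu> - ?K"
  have Es[measurable]: "E \<in> sets \<mu>" unfolding E_def by measurable
  have ca: "cell_average \<mu> T k \<tau> (\<lambda>y. s \<tau> y * p \<tau> y) x = cell_average \<mu> T k \<tau> (p1 \<tau>) x" for x
    unfolding cell_average_def set_lebesgue_integral_def
    using s(2) cell_sets[OF Tm] by (intro sum.cong refl arg_cong2[of _ _ _ _ "(*)"] arg_cong2[of _ _ _ _ "(/)"] integral_cong_AE) auto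
  have cm[measurable]: "cell_average \<mu> T k \<tau> (p1 \<tau>) \<in> borel_measurable \<mu>"
    using cell_average_self_adjoint(2)[OF Tm, of "\<lambda>_. 0" 0 "p1 \<tau>"] int1[OF t(1)] by auto
  have d1': "(LINT x:?K|\<mu>. \<bar>s \<tau> x * p \<tau> x - cell_average \<mu> T k \<tau> (\<lambda>y. s \<tau> y * p \<tau> y) x\<bar>) = d1"
    unfolding ca d1_def set_lebesgue_integral_def using s(2) by (intro integral_cong_AE) auto
  have dn: "0 \<le> d0" "0 \<le> d1" unfolding d0_def d1_def set_lebesgue_integral_def
    by (auto intro!: integral_nonneg_AE)
  have qe': "d0 + d1 + sqrt (measure (P \<tau>) E) \<le> \<Delta>"
    using qe unfolding quant_error_def d1' by (simp add: d0_def E_def)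
  have D0: "0 \<le> \<Delta>" "d0 \<le> \<Delta>" "d1 \<le> \<Delta>" "sqrt (measure (P \<tau>) E) \<le> \<Delta>"
    using qe' dn real_sqrt_ge_zero[of "measure (P \<tau>) E"] by (auto simp del: real_sqrt_ge_zero real_sqrt_ge_0_iff)
  have PE: "measure (P \<tau>) E \<le> \<Delta>\<^sup>2"
    using power_mono[OF D0(4), of 2] by simp
  have iE: "(\<integral>x. indicator E x * p \<tau> x \<partial>\<mu>) = measure (P \<tau>) E"
    using integral_P[OF tT, of "indicator E"] Es P_sets[OF tT] P_space[OF tT] by simp
  have Eb: "(\<integral>x. \<omega> x * p \<tau> x \<partial>\<mu>) \<le> c * \<Delta>\<^sup>2" "0 \<le> (\<integral>x. \<omega> x * p \<tau> x \<partial>\<mu>)"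
    if w: "\<omega> \<in> borel_measurable \<mu>" "\<And>x. x \<in> space \<mu> \<Longrightarrow> 0 \<le> \<omega> x" "\<And>x. x \<in> space \<mu> \<Longrightarrow> \<omega> x \<le> c * indicator E x" and c: "0 \<le> c" for \<omega> c
  proof -
    have "(\<integral>x. \<omega> x * p \<tau> x \<partial>\<mu>) \<le> (\<integral>x. c * (indicator E x * p \<tau> x) \<partial>\<mu>)"
    proof (rule integral_mono)
      show "integrable \<mu> (\<lambda>x. \<omega> x * p \<tau> x)"
      proof (rule bounded_mult_int[OF p_int[OF tT] w(1), of c])
        fix x assume "x \<in> space \<mu>"
        thus "\<bar>\<omega> x\<bar> \<le> c" using w(2)[of x] w(3)[of x] c by (cases "x \<in> E") auto
      qed
      show "integrable \<mu> (\<lambda>x. c * (indicator E x * p \<tau> x))"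
        by (intro integrable_mult_right bounded_mult_int[OF p_int[OF tT], of _ 1]) (auto simp: indicator_def)
      fix x assume x: "x \<in> space \<mu>"
      show "\<omega> x * p \<tau> x \<le> c * (indicator E x * p \<tau> x)"
        using mult_right_mono[OF w(3)[OF x] p_nonneg[OF tT x]] by (simp add: mult.assoc)
    qed
    also have "\<dots> \<le> c * \<Delta>\<^sup>2" using iE PE c by (simp add: mult_left_mono)
    finally show "(\<integral>x. \<omega> x * p \<tau> x \<partial>\<mu>) \<le> c * \<Delta>\<^sup>2" .
    show "0 \<le> (\<integral>x. \<omega> x * p \<tau> x \<partial>\<mu>)" using w p_nonneg[OF tT] by (intro integral_nonneg_AE) auto
  qed
  let ?e = "exp \<alpha> * (\<Delta> + 2 * \<Delta>\<^sup>2 + 2 * \<Delta>\<^sup>2 / h + 2 * C * h)"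
  have C0: "0 \<le> C" using C1 by simp
  have e0: "0 \<le> ?e" using D0 h C0 by simp
  show ?thesis
  proof (rule info_compare[OF \<alpha> t(1) t(1), where w = "\<lambda>i. \<phi> i x0"])
    fix i assume i: "i \<in> I"
    define c where "c = exp \<alpha> * \<phi> i x0"
    have c0: "0 \<le> c" using D(3)[OF i x0] by (simp add: c_def)
    have pb: "\<And>x. x \<in> space \<mu> \<Longrightarrow> 0 \<le> \<phi> i x" "\<And>x. x \<in> space \<mu> \<Longrightarrow> \<phi> i x \<le> c"
      using D i x0 by (auto simp: c_def)
    have "\<bar>(\<integral>x. cell_mean T k \<tau> x0 (\<phi> i) (T (x, \<tau>)) * p1 \<tau> x \<partial>\<mu>) - (\<integral>x. \<phi> i x * p1 \<tau> x \<partial>\<mu>)\<bar>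
      \<le> c * d1 + 2 * (c * \<Delta>\<^sup>2 / h + c * C * h)" unfolding d1_def
    proof (rule cell_mean_pairing[OF Tm D(2)[OF i] pb int1[OF t(1)] x0])
      fix \<omega> assume w: "\<omega> \<in> borel_measurable \<mu>" "\<And>x. x \<in> space \<mu> \<Longrightarrow> 0 \<le> \<omega> x"
         "\<And>x. x \<in> space \<mu> \<Longrightarrow> \<omega> x \<le> c * indicator (space \<mu> - ?K) x"
      have wc: "\<And>x. x \<in> space \<mu> \<Longrightarrow> \<omega> x \<le> c"
      proof -
        fix x assume "x \<in> space \<mu>"
        thus "\<omega> x \<le> c" using w(3)[of x] c0 by (cases "x \<in> ?K") auto
      qed
      have "\<bar>\<integral>x. \<omega> x * p1 \<tau> x \<partial>\<mu>\<bar> \<le> (\<integral>x. \<omega> x * p \<tau> x \<partial>\<mu>) / h + c * C * h"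
        by (rule nonneg_derivative_bound[OF w(1) w(2) wc t h c0])
      also have "\<dots> \<le> c * \<Delta>\<^sup>2 / h + c * C * h"
        using Eb(1)[OF w(1) w(2), of c] w(3) c0 h by (intro add_right_mono divide_right_mono) (auto simp: E_def)
      finally show "\<bar>\<integral>x. \<omega> x * p1 \<tau> x \<partial>\<mu>\<bar> \<le> c * \<Delta>\<^sup>2 / h + c * C * h" .
    qed
    also have "\<dots> = c * (d1 + 2 * \<Delta>\<^sup>2 / h + 2 * C * h)" by (simp add: algebra_simps)
    also have "\<dots> \<le> c * (\<Delta> + 2 * \<Delta>\<^sup>2 + 2 * \<Delta>\<^sup>2 / h + 2 * C * h)" using D0(3) zero_le_power2[of \<Delta>] by (intro mult_left_mono[OF _ c0]) linarith
    finally show "\<bar>(\<integral>x. cell_mean T k \<tau> x0 (\<phi> i) (T (x, \<tau>)) * p1 \<tau> x \<partial>\<mu>) - (\<integral>x. \<phi> i x * p1 \<tau> x \<partial>\<mu>)\<bar> \<le> ?e * \<phi> i x0"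
      by (simp add: c_def ac_simps)
    have "\<bar>(\<integral>x. cell_mean T k \<tau> x0 (\<phi> i) (T (x, \<tau>)) * p \<tau> x \<partial>\<mu>) - (\<integral>x. \<phi> i x * p \<tau> x \<partial>\<mu>)\<bar>
      \<le> c * d0 + 2 * (c * \<Delta>\<^sup>2)" unfolding d0_def
    proof (rule cell_mean_pairing[OF Tm D(2)[OF i] pb p_int[OF tT] x0])
      fix \<omega> assume w: "\<omega> \<in> borel_measurable \<mu>" "\<And>x. x \<in> space \<mu> \<Longrightarrow> 0 \<le> \<omega> x"
         "\<And>x. x \<in> space \<mu> \<Longrightarrow> \<omega> x \<le> c * indicator (space \<mu> - ?K) x"
      show "\<bar>\<integral>x. \<omega> x * p \<tau> x \<partial>\<mu>\<bar> \<le> c * \<Delta>\<^sup>2"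
        using Eb[OF w(1) w(2), of c] w(3) c0 by (simp add: E_def)
    qed
    also have "\<dots> = c * (d0 + 2 * \<Delta>\<^sup>2)" by (simp add: algebra_simps)
    also have "\<dots> \<le> c * (\<Delta> + 2 * \<Delta>\<^sup>2 + 2 * \<Delta>\<^sup>2 / h + 2 * C * h)"
      using D0(2) h C0 by (intro mult_left_mono[OF _ c0]) (simp add: add_increasing2)
    finally show "\<bar>(\<integral>x. cell_mean T k \<tau> x0 (\<phi> i) (T (x, \<tau>)) * p \<tau> x \<partial>\<mu>) - (\<integral>x. \<phi> i x * p \<tau> x \<partial>\<mu>)\<bar> \<le> ?e * \<phi> i x0"
      by (simp add: c_def ac_simps)
    show "(\<lambda>x. cell_mean T k \<tau> x0 (\<phi> i) (T (x, \<tau>))) \<in> borel_measurable \<mu>"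
      by (rule measurable_compose[OF Tm]) simp
    fix x assume x: "x \<in> space \<mu>"
    have lo: "\<phi> i x0 / exp \<alpha> \<le> \<phi> i y" if "y \<in> space \<mu>" for y
      using D(4)[OF i x0 that] by (simp add: divide_le_eq mult.commute)
    have "\<phi> i x0 / exp \<alpha> \<le> cell_mean T k \<tau> x0 (\<phi> i) (T (x, \<tau>))"
      by (rule cell_mean_bounds(1)[OF Tm D(2)[OF i] lo pb(2) x0])
    thus "0 \<le> cell_mean T k \<tau> x0 (\<phi> i) (T (x, \<tau>)) \<and> cell_mean T k \<tau> x0 (\<phi> i) (T (x, \<tau>)) \<le> exp \<alpha> * \<phi> i x0 \<and>
       \<phi> i x0 \<le> exp \<alpha> * cell_mean T k \<tau> x0 (\<phi> i) (T (x, \<tau>))"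
      using cell_mean_bounds[OF Tm D(2)[OF i] pb x0] by (auto simp: c_def divide_le_eq mult.commute)
  qed (use D x0 e0 in auto)
qed

lemma cell_mean_sum:
  assumes Tm: "(\<lambda>x. T (x, \<tau>)) \<in> \<mu> \<rightarrow>\<^sub>M count_space UNIV" and \<phi>: "private_rows \<alpha> I \<phi>" and x0: "x0 \<in> space \<mu>"
  shows "(\<Sum>i\<in>I. cell_mean T k \<tau> x0 (\<phi> i) j) = 1"
proof (cases "j \<in> regular_cells \<mu> T k \<tau>")
  case True
  note D = private_rowsD[OF \<phi>]
  let ?B = "quant_cell \<mu> T \<tau> j"
  note B = cell_measure[OF Tm True] cell_sets[OF Tm, of j]
  have iB: "integrable \<mu> (indicator ?B :: 'a \<Rightarrow> real)" using B by (intro integrable_real_indicator) auto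
  have ii: "integrable \<mu> (\<lambda>x. indicator ?B x * \<phi> i x)" if "i \<in> I" for i
    using bounded_mult_int[OF iB D(2)[OF that], of "exp \<alpha> * \<phi> i x0"] D that x0 by (simp add: mult.commute)
  have "(\<Sum>i\<in>I. cell_mean T k \<tau> x0 (\<phi> i) j) = (\<Sum>i\<in>I. (\<integral>x. indicator ?B x * \<phi> i x \<partial>\<mu>)) / measure \<mu> ?B"
    using True by (simp add: cell_mean_def sum_divide_distrib)
  also have "(\<Sum>i\<in>I. (\<integral>x. indicator ?B x * \<phi> i x \<partial>\<mu>)) = (\<integral>x. (\<Sum>i\<in>I. indicator ?B x * \<phi> i x) \<partial>\<mu>)"
    by (rule Bochner_Integration.integral_sum[symmetric]) (rule ii)
  also have "\<dots> = (\<integral>x. indicator ?B x \<partial>\<mu>)"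
    using D(5) by (intro Bochner_Integration.integral_cong) (auto simp flip: sum_distrib_left)
  also have "\<dots> = measure \<mu> ?B" using B by simp
  finally show ?thesis using B(1) by simp
qed (use private_rowsD[OF \<phi>] x0 in \<open>simp add: cell_mean_def\<close>)

text \<open>The cell averages of the rows have one entry per cell, that is \<open>k\<close> columns, and are
  reduced to \<open>k\<close> rows. Rows that vanish at \<open>x0\<close> are excluded because the reduction requires
  positive entries.\<close>

lemma square_quantized_channel_info:
  assumes \<phi>: "private_rows \<alpha> I \<phi>" and x0: "x0 \<in> space \<mu>" and pos: "\<And>i. i \<in> I \<Longrightarrow> 0 < \<phi> i x0"
    and Tm: "(\<lambda>x. T (x, \<tau>)) \<in> \<mu> \<rightarrow>\<^sub>M count_space UNIV" and t: "\<tau> \<in> ball \<theta>0 r"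
    and Tk: "\<And>x. x \<in> space \<mu> \<Longrightarrow> T (x, \<tau>) \<in> {1..k}"
  obtains R where "R \<in> private_kernels \<alpha> (count_space {1..k}) (count_space {1..k})"
    "info I (\<lambda>i x. cell_mean T k \<tau> x0 (\<phi> i) (T (x, \<tau>))) \<tau>
       \<le> fisher_info \<Theta> (\<lambda>u. P u \<bind> (R \<circ> (\<lambda>x. T (x, \<tau>)))) \<tau>"
proof -
  note D = private_rowsD[OF \<phi>]
  define v where "v i = cell_mean T k \<tau> x0 (\<phi> i)" for i
  have k: "1 \<le> k" using Tk[OF x0] by simp
  \<comment> \<open>averages lie between the extreme values of a row, so that they inherit its privacy bounds\<close>
  have cb: "\<phi> i y / exp \<alpha> \<le> v i j" "v i j \<le> exp \<alpha> * \<phi> i y" if i: "i \<in> I" and y: "y \<in> space \<mu>" for i j y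
  proof -
    have lo: "\<phi> i y / exp \<alpha> \<le> \<phi> i z" if "z \<in> space \<mu>" for z
      using D(4)[OF i y that] by (simp add: divide_le_eq mult.commute)
    have hi: "\<phi> i z \<le> exp \<alpha> * \<phi> i y" if "z \<in> space \<mu>" for z using D(4)[OF i that y] .
    show "\<phi> i y / exp \<alpha> \<le> v i j" "v i j \<le> exp \<alpha> * \<phi> i y"
      unfolding v_def using cell_mean_bounds[OF Tm D(2)[OF i] lo hi x0] by auto
  qed
  have vpos: "0 < v i j" if "i \<in> I" for i j
    using cb(1)[OF that x0, of j] pos[OF that] by (auto intro: less_le_trans[rotated])
  have vratio: "v i j \<le> exp \<alpha> * v i j'" if i: "i \<in> I" for i j j'
  proof -
    have lo: "v i j / exp \<alpha> \<le> \<phi> i y" if "y \<in> space \<mu>" for y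
      using cb(2)[OF i that, of j] by (simp add: divide_le_eq mult.commute)
    have hi: "\<phi> i z \<le> exp \<alpha> * \<phi> i x0" if "z \<in> space \<mu>" for z using D(4)[OF i that x0] .
    have "v i j / exp \<alpha> \<le> v i j'" using cell_mean_bounds(1)[OF Tm D(2)[OF i] lo hi x0] by (simp add: v_def)
    thus ?thesis by (simp add: divide_le_eq mult.commute)
  qed
  have Ine: "I \<noteq> {}" using D(5)[OF x0] by auto
  define G where "G u = row_info (\<lambda>x. u (T (x, \<tau>))) \<tau>" for u :: "nat \<Rightarrow> real"
  have G: "G (\<lambda>j. c * u j) = c * G u" for c u
    by (cases "c = 0") (simp_all add: G_def row_info_def mult.assoc power_mult_distrib power2_eq_square)
  have sum1: "(\<Sum>i\<in>I. v i j) = 1" for j unfolding v_def by (rule cell_mean_sum[OF Tm \<phi> x0])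
  obtain c \<iota> where c: "\<And>l. 0 \<le> c l" "\<And>l. \<iota> l \<in> I"
    "\<And>j. j \<in> {1..k} \<Longrightarrow> (\<Sum>l=1..k. c l * v (\<iota> l) j) = (\<Sum>i\<in>I. v i j)"
    "(\<Sum>i\<in>I. G (v i)) \<le> (\<Sum>l=1..k. G (\<lambda>j. c l * v (\<iota> l) j))"
    using square_channel_suffices[where v = v and G = G, OF D(1) Ine k vpos G] by auto
  obtain R where R: "R \<in> private_kernels \<alpha> (count_space {1..k}) (count_space {1..k})"
    "\<And>j l. j \<in> {1..k} \<Longrightarrow> l \<in> {1..k} \<Longrightarrow> measure (R j) {l} = c l * v (\<iota> l) j"
  proof (rule matrix_channel[OF k, of "\<lambda>l j. c l * v (\<iota> l) j" \<alpha>])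
    show "0 \<le> c l * v (\<iota> l) j" for l j using c(1,2) vpos by (simp add: less_imp_le)
    show "(\<Sum>l=1..k. c l * v (\<iota> l) j) = 1" if "j \<in> {1..k}" for j using c(3)[OF that] sum1 by simp
    show "c l * v (\<iota> l) j \<le> exp \<alpha> * (c l * v (\<iota> l) j')" for l j j'
      using mult_left_mono[OF vratio[OF c(2)[of l], of j j'] c(1)[of l]] by (simp add: ac_simps)
  qed (rule that)
  have T': "(\<lambda>x. T (x, \<tau>)) \<in> \<mu> \<rightarrow>\<^sub>M count_space {1..k}"
    using Tm Tk by (simp add: measurable_count_space_eq2_countable)
  have K: "R \<circ> (\<lambda>x. T (x, \<tau>)) \<in> private_kernels \<alpha> \<mu> (count_space {1..k})"
    by (rule private_kernels_comp[OF R(1) T'])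
  have "fisher_info \<Theta> (\<lambda>u. P u \<bind> (R \<circ> (\<lambda>x. T (x, \<tau>)))) \<tau>
     = (\<Sum>l\<in>{1..k}. row_info (\<lambda>x. measure ((R \<circ> (\<lambda>x. T (x, \<tau>))) x) {l}) \<tau>)"
    by (rule fisher_info_discrete[OF K _ t]) simp
  also have "\<dots> = (\<Sum>l\<in>{1..k}. G (\<lambda>j. c l * v (\<iota> l) j))"
  proof (rule sum.cong[OF refl])
    fix l assume l: "l \<in> {1..k}"
    have "(\<integral>x. measure ((R \<circ> (\<lambda>x. T (x, \<tau>))) x) {l} * f x \<partial>\<mu>) = (\<integral>x. (c l * v (\<iota> l) (T (x, \<tau>))) * f x \<partial>\<mu>)" for f
      using R(2) Tk l by (intro Bochner_Integration.integral_cong) auto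
    thus "row_info (\<lambda>x. measure ((R \<circ> (\<lambda>x. T (x, \<tau>))) x) {l}) \<tau> = G (\<lambda>j. c l * v (\<iota> l) j)"
      by (simp only: row_info_def G_def)
  qed
  finally have F: "fisher_info \<Theta> (\<lambda>u. P u \<bind> (R \<circ> (\<lambda>x. T (x, \<tau>)))) \<tau> = (\<Sum>l\<in>{1..k}. G (\<lambda>j. c l * v (\<iota> l) j))" .
  show thesis
    by (rule that[OF R(1)]) (use c(4) in \<open>simp add: F info_def G_def v_def\<close>)
qed

text \<open>By privacy, a row that vanishes at one point vanishes everywhere and can be dropped.\<close>

lemma info_of_partition:
  assumes K: "K \<in> private_kernels \<alpha> \<mu> N" and A: "\<And>i. A i \<in> sets N" "disjoint_family A" "(\<Union>i<L. A i) = space N"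
    and x0: "x0 \<in> space \<mu>"
  defines "\<phi> \<equiv> \<lambda>i x. measure (K x) (A i)"
  shows "private_rows \<alpha> {i. i < (L::nat) \<and> 0 < \<phi> i x0} \<phi>"
    and "t \<in> \<Theta> \<Longrightarrow> (\<Sum>i<L. row_info (\<phi> i) t) = info {i. i < L \<and> 0 < \<phi> i x0} \<phi> t"
    and "private_rows \<alpha> {..<L} \<phi>"
proof -
  note D = private_kernelsD[OF K]
  have zero: "\<phi> i x = 0" if "\<not> 0 < \<phi> i x0" "x \<in> space \<mu>" for i x
  proof -
    have "\<phi> i x0 = 0" using that(1) by (simp add: \<phi>_def zero_less_measure_iff)
    thus ?thesis using D(6)[OF A(1) that(2) x0, of i] by (simp add: \<phi>_def measure_le_0_iff)
  qed
  have sum1: "(\<Sum>i<L. \<phi> i x) = 1" if x: "x \<in> space \<mu>" for x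
  proof -
    interpret Kx: prob_space "K x" by (rule D(3)[OF x])
    have "measure (K x) (\<Union>i<L. A i) = (\<Sum>i<L. \<phi> i x)" unfolding \<phi>_def
      by (rule Kx.finite_measure_finite_Union) (use A D(4)[OF x] in \<open>auto simp: disjoint_family_on_def\<close>)
    thus ?thesis using Kx.prob_space A(3) sets_eq_imp_space_eq[OF D(4)[OF x]] by simp
  qed
  show rows: "private_rows \<alpha> {..<L} \<phi>"
    using D(5,6) A(1) sum1 by (auto simp: private_rows_def \<phi>_def)
  have "(\<Sum>i | i < L \<and> 0 < \<phi> i x0. \<phi> i x) = (\<Sum>i<L. \<phi> i x)" if "x \<in> space \<mu>" for x
    by (rule sum.mono_neutral_left) (use zero that in auto)
  with rows show "private_rows \<alpha> {i. i < L \<and> 0 < \<phi> i x0} \<phi>"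
    by (auto simp: private_rows_def)
  show "(\<Sum>i<L. row_info (\<phi> i) t) = info {i. i < L \<and> 0 < \<phi> i x0} \<phi> t"
    unfolding info_def
  proof (rule sum.mono_neutral_right)
    show "\<forall>i\<in>{..<L} - {i. i < L \<and> 0 < \<phi> i x0}. row_info (\<phi> i) t = 0"
    proof
      fix i assume "i \<in> {..<L} - {i. i < L \<and> 0 < \<phi> i x0}"
      hence "(\<integral>x. \<phi> i x * p1 t x \<partial>\<mu>) = (\<integral>x. 0 \<partial>\<mu>)" using zero by (intro Bochner_Integration.integral_cong) auto
      thus "row_info (\<phi> i) t = 0" by (simp add: row_info_def)
    qed
  qed auto
qed

text \<open>Ensures that the supremum in the definition of the optimal information is finite.\<close>

lemma fisher_info_upper:
  assumes \<alpha>: "0 \<le> \<alpha>" and K: "K \<in> private_kernels \<alpha> \<mu> N" and t: "t \<in> ball \<theta>0 r"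
  shows "fisher_info \<Theta> (\<lambda>u. P u \<bind> K) t \<le> (exp \<alpha> * C)^3 + 1"
proof -
  obtain x0 where x0: "x0 \<in> space \<mu>" using space_ne by auto
  obtain A and L :: nat where A: "\<And>i. A i \<in> sets N" "disjoint_family A" "(\<Union>i<L. A i) = space N"
    and le: "fisher_info \<Theta> (\<lambda>u. P u \<bind> K) t \<le> (\<Sum>i<L. row_info (\<lambda>x. measure (K x) (A i)) t) + 1"
    using fisher_info_le_partition[OF K t, of 1] by auto
  show ?thesis using le info_bound(2)[OF \<alpha> info_of_partition(3)[OF K A x0] t] by (simp add: info_def)
qed

text \<open>The channel \<open>R\<close> consists of the cell averages of the rows of a finite approximation of
  \<open>K\<close>, reduced to as many as there are cells. The constant \<open>\<delta>\<close> may depend on the channel \<open>K\<close>, but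
  not on the quantizer or on the number \<open>k\<close> of its cells.\<close>

lemma fisher_info_lower:
  assumes \<alpha>: "0 \<le> \<alpha>" and K: "K \<in> private_kernels \<alpha> \<mu> N" and e: "0 < e"
  shows "\<exists>\<delta>>0. \<forall>\<tau> T k s. \<bar>\<tau> - \<theta>0\<bar> < \<delta> \<longrightarrow> (\<lambda>x. T (x, \<tau>)) \<in> \<mu> \<rightarrow>\<^sub>M count_space UNIV \<longrightarrow>
     (\<forall>x\<in>space \<mu>. T (x, \<tau>) \<in> {1..k}) \<longrightarrow> s \<tau> \<in> borel_measurable \<mu> \<longrightarrow> (AE x in \<mu>. s \<tau> x * p \<tau> x = p1 \<tau> x) \<longrightarrow>
     quant_error \<mu> P p s T k \<tau> < \<delta> \<longrightarrow>
     (\<exists>R\<in>private_kernels \<alpha> (count_space {1..k}) (count_space {1..k}).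
        fisher_info \<Theta> (\<lambda>u. P u \<bind> K) \<theta>0 - e \<le> fisher_info \<Theta> (\<lambda>u. P u \<bind> (R \<circ> (\<lambda>x. T (x, \<tau>)))) \<tau>)"
proof -
  obtain x0 where x0: "x0 \<in> space \<mu>" using space_ne by auto
  obtain A and L :: nat where A: "\<And>i. A i \<in> sets N" "disjoint_family A" "(\<Union>i<L. A i) = space N"
    and le: "fisher_info \<Theta> (\<lambda>u. P u \<bind> K) \<theta>0 \<le> (\<Sum>i<L. row_info (\<lambda>x. measure (K x) (A i)) \<theta>0) + e / 4"
    using fisher_info_le_partition[OF K center, of "e / 4"] e by auto
  define \<phi> where "\<phi> i x = measure (K x) (A i)" for i x
  define I where "I = {i. i < L \<and> 0 < \<phi> i x0}"
  have rows: "private_rows \<alpha> I \<phi>"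
    using info_of_partition(1)[OF K A x0] by (simp add: I_def \<phi>_def[abs_def])
  have le': "fisher_info \<Theta> (\<lambda>u. P u \<bind> K) \<theta>0 \<le> info I \<phi> \<theta>0 + e / 4"
    using le info_of_partition(2)[OF K A x0 in_ball_Theta[OF center]] by (simp add: I_def \<phi>_def[abs_def])
  have pos: "0 < \<phi> i x0" if "i \<in> I" for i using that by (simp add: I_def)
  define c where "c = info_const \<alpha> * exp \<alpha>"
  have c0: "0 \<le> c" using info_const_nonneg by (simp add: c_def)
  have C0: "0 < C" using C1 by simp
  \<comment> \<open>first \<open>h\<close>, for the term \<open>C h\<close>; then \<open>\<delta>\<close> in terms of \<open>h\<close>, for the term \<open>\<delta>\<^sup>2/h\<close>\<close>
  define h where "h = min (r / 4) (e / (4 * (1 + c * 2 * C)))"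
  have h: "0 < h" "h \<le> r / 4"
  proof -
    show "0 < h" using r e c0 C0 by (auto simp: h_def intro!: divide_pos_pos add_pos_nonneg)
    show "h \<le> r / 4" unfolding h_def by (rule min.cobounded1)
  qed
  have ch: "c * (2 * C * h) \<le> e / 4"
  proof -
    have "c * (2 * C * h) \<le> (1 + c * 2 * C) * h" using h by (simp add: algebra_simps)
    also have "\<dots> \<le> (1 + c * 2 * C) * (e / (4 * (1 + c * 2 * C)))"
      using c0 C0 by (intro mult_left_mono) (auto simp: h_def)
    also have "\<dots> = e / 4"
    proof -
      have "0 < 1 + c * 2 * C" using c0 C0 by (intro add_pos_nonneg) auto
      moreover have "D * (e / (4 * D)) = e / 4" if "0 < D" for D :: real using that by simp
      ultimately show ?thesis by blast
    qed
    finally show ?thesis .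
  qed
  define B where "B = 1 + c * (C + 3 + 2 / h)"
  have B: "0 < B" using c0 C0 h by (auto simp: B_def intro!: add_pos_nonneg)
  define \<delta> where "\<delta> = min (min 1 (r / 2)) (e / (4 * B))"
  have d: "0 < \<delta>" "\<delta> \<le> 1" "\<delta> \<le> r / 2" "B * \<delta> \<le> e / 4"
  proof -
    show "0 < \<delta>" using r e B by (simp add: \<delta>_def)
    show "B * \<delta> \<le> e / 4"
      using mult_left_mono[of \<delta> "e / (4 * B)" B] B by (simp add: \<delta>_def)
  qed (auto simp: \<delta>_def)
  have dC: "c * (C * \<delta>) \<le> e / 4"
  proof -
    have "c * (C * \<delta>) \<le> B * \<delta>" unfolding B_def using c0 d(1) h by (simp add: algebra_simps)
    thus ?thesis using d(4) by simp
  qed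
  have d3: "c * (\<delta> + 2 * \<delta>\<^sup>2 + 2 * \<delta>\<^sup>2 / h) \<le> e / 4"
  proof -
    have d2: "\<delta>\<^sup>2 \<le> \<delta>" using d(1,2) by (simp add: power2_eq_square mult_left_le)
    have "2 * \<delta>\<^sup>2 / h \<le> 2 * \<delta> / h" using d2 h by (intro divide_right_mono) auto
    hence "\<delta> + 2 * \<delta>\<^sup>2 + 2 * \<delta>\<^sup>2 / h \<le> \<delta> + 2 * \<delta> + 2 * \<delta> / h" using d2 by linarith
    hence "c * (\<delta> + 2 * \<delta>\<^sup>2 + 2 * \<delta>\<^sup>2 / h) \<le> c * (\<delta> + 2 * \<delta> + 2 * \<delta> / h)" by (rule mult_left_mono[OF _ c0])
    also have "\<dots> \<le> B * \<delta>" unfolding B_def using c0 d(1) h C0 by (simp add: algebra_simps)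
    finally show ?thesis using d(4) by (rule order_trans)
  qed
  show ?thesis
  proof (intro exI[of _ \<delta>] conjI d(1) allI impI)
    fix \<tau> T k s
    assume t: "\<bar>\<tau> - \<theta>0\<bar> < \<delta>" and Tm: "(\<lambda>x. T (x, \<tau>)) \<in> \<mu> \<rightarrow>\<^sub>M count_space (UNIV :: nat set)"
      and Tk: "\<forall>x\<in>space \<mu>. T (x, \<tau>) \<in> {1..k}" and s: "s \<tau> \<in> borel_measurable \<mu>" "AE x in \<mu>. s \<tau> x * p \<tau> x = p1 \<tau> x"
      and q: "quant_error \<mu> P p s T k \<tau> < \<delta>"
    have tb: "\<tau> \<in> ball \<theta>0 r" "\<tau> + h \<in> ball \<theta>0 r" "\<tau> - h \<in> ball \<theta>0 r"
      using t d(3) h r by (auto simp: dist_real_def)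
    obtain R where R: "R \<in> private_kernels \<alpha> (count_space {1..k}) (count_space {1..k})"
      "info I (\<lambda>i x. cell_mean T k \<tau> x0 (\<phi> i) (T (x, \<tau>))) \<tau>
       \<le> fisher_info \<Theta> (\<lambda>u. P u \<bind> (R \<circ> (\<lambda>x. T (x, \<tau>)))) \<tau>"
      using square_quantized_channel_info[OF rows x0 pos Tm tb(1), of k] Tk by auto
    have "\<bar>info I (\<lambda>i x. cell_mean T k \<tau> x0 (\<phi> i) (T (x, \<tau>))) \<tau> - info I \<phi> \<tau>\<bar>
      \<le> info_const \<alpha> * (exp \<alpha> * (\<delta> + 2 * \<delta>\<^sup>2 + 2 * \<delta>\<^sup>2 / h + 2 * C * h))"
      by (rule quantized_info_close[OF \<alpha> rows x0 Tm tb h(1) s less_imp_le[OF q]])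
    also have "\<dots> = c * (\<delta> + 2 * \<delta>\<^sup>2 + 2 * \<delta>\<^sup>2 / h) + c * (2 * C * h)" by (simp add: c_def algebra_simps)
    also have "\<dots> \<le> e / 4 + e / 4" using d3 ch by (rule add_mono)
    finally have 1: "\<bar>info I (\<lambda>i x. cell_mean T k \<tau> x0 (\<phi> i) (T (x, \<tau>))) \<tau> - info I \<phi> \<tau>\<bar> \<le> e / 2" by simp
    have "\<bar>info I \<phi> \<tau> - info I \<phi> \<theta>0\<bar> \<le> c * (C * \<bar>\<tau> - \<theta>0\<bar>)"
      using info_lipschitz[OF \<alpha> rows tb(1) center] by (simp add: c_def ac_simps)
    also have "\<dots> \<le> c * (C * \<delta>)" using t c0 C0 by (intro mult_left_mono) auto
    finally have 2: "\<bar>info I \<phi> \<tau> - info I \<phi> \<theta>0\<bar> \<le> e / 4" using dC by simp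
    show "\<exists>R\<in>private_kernels \<alpha> (count_space {1..k}) (count_space {1..k}).
        fisher_info \<Theta> (\<lambda>u. P u \<bind> K) \<theta>0 - e \<le> fisher_info \<Theta> (\<lambda>u. P u \<bind> (R \<circ> (\<lambda>x. T (x, \<tau>)))) \<tau>"
    proof (rule bexI[OF _ R(1)])
      show "fisher_info \<Theta> (\<lambda>u. P u \<bind> K) \<theta>0 - e \<le> fisher_info \<Theta> (\<lambda>u. P u \<bind> (R \<circ> (\<lambda>x. T (x, \<tau>)))) \<tau>"
        using R(2) 1 2 le' by linarith
    qed
  qed
qed

lemma optimal_info_bounds:
  assumes \<alpha>: "0 \<le> \<alpha>"
  shows "K \<in> private_kernels \<alpha> \<mu> (N :: 'w measure) \<Longrightarrow> fisher_info \<Theta> (\<lambda>u. P u \<bind> K) \<theta>0 \<le> optimal_info TYPE('w) \<alpha> \<mu> \<Theta> P \<theta>0"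
    and "0 < e \<Longrightarrow> \<exists>(N :: 'w measure) K. K \<in> private_kernels \<alpha> \<mu> N \<and> optimal_info TYPE('w) \<alpha> \<mu> \<Theta> P \<theta>0 - e < fisher_info \<Theta> (\<lambda>u. P u \<bind> K) \<theta>0"
proof -
  let ?S = "{fisher_info \<Theta> (\<lambda>t. P t \<bind> Q) \<theta>0 | (N :: 'w measure) Q. Q \<in> private_kernels \<alpha> \<mu> N}"
  have bdd: "bdd_above ?S"
    by (rule bdd_aboveI[of _ "(exp \<alpha> * C)^3 + 1"]) (use fisher_info_upper[OF \<alpha> _ center] in auto)
  show "fisher_info \<Theta> (\<lambda>u. P u \<bind> K) \<theta>0 \<le> optimal_info TYPE('w) \<alpha> \<mu> \<Theta> P \<theta>0"
    if "K \<in> private_kernels \<alpha> \<mu> (N :: 'w measure)"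
    unfolding optimal_info_def by (rule cSup_upper[OF _ bdd]) (use that in blast)
  \<comment> \<open>a channel with constant output shows that the supremum is over a nonempty set\<close>
  have "(\<lambda>_. return (count_space UNIV) (undefined :: 'w)) \<in> private_kernels \<alpha> \<mu> (count_space UNIV)"
  proof -
    have "m \<le> exp \<alpha> * m" if "0 \<le> m" for m :: real using mult_right_mono[of 1 "exp \<alpha>" m] \<alpha> that by simp
    thus ?thesis by (auto simp: private_kernels_def space_prob_algebra prob_space_return intro!: measurable_const)
  qed
  hence ne: "?S \<noteq> {}" by blast
  assume e: "0 < e"
  hence "Sup ?S - e < Sup ?S" by simp
  hence "\<exists>x\<in>?S. Sup ?S - e < x" using less_cSup_iff[OF ne bdd] by blast
  thus "\<exists>(N :: 'w measure) K. K \<in> private_kernels \<alpha> \<mu> N \<and> optimal_info TYPE('w) \<alpha> \<mu> \<Theta> P \<theta>0 - e < fisher_info \<Theta> (\<lambda>u. P u \<bind> K) \<theta>0"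
    unfolding optimal_info_def by blast
qed

text \<open>A finite output set embeds into the infinite type \<open>'w\<close>, and relabelling outputs preserves
  the information.\<close>

lemma finite_channel_info_le:
  assumes \<alpha>: "0 \<le> \<alpha>" and inf: "infinite (UNIV :: 'w set)" and K: "K \<in> private_kernels \<alpha> \<mu> (count_space S)" and S: "finite S"
  shows "info S (\<lambda>i x. measure (K x) {i}) \<theta>0 \<le> optimal_info TYPE('w) \<alpha> \<mu> \<Theta> P \<theta>0"
proof -
  obtain W :: "'w set" where W: "finite W" "card W = card S"
    using infinite_arbitrarily_large[OF inf] by blast
  obtain e where e: "bij_betw e S W" using finite_same_card_bij[OF S W(1)] W(2) by auto
  have inj: "inj_on e S" using e by (simp add: bij_betw_def)
  define K' where "K' x = distr (K x) (count_space W) e" for x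
  note D = private_kernelsD[OF K]
  have sp: "space (K x) = S" if "x \<in> space \<mu>" for x using sets_eq_imp_space_eq[OF D(4)[OF that]] by simp
  have eW: "e \<in> count_space S \<rightarrow>\<^sub>M count_space W" using e by (auto simp: bij_betw_def)
  have emW: "e \<in> K x \<rightarrow>\<^sub>M count_space W" if "x \<in> space \<mu>" for x
    using eW measurable_cong_sets[OF D(4)[OF that] refl] by blast
  have me: "measure (K' x) A = measure (K x) (e -` A \<inter> S)" if "x \<in> space \<mu>" "A \<subseteq> W" for x A
    unfolding K'_def using measure_distr[OF emW[OF that(1)], of A] sp that by simp
  have K': "K' \<in> private_kernels \<alpha> \<mu> (count_space W)"
  proof -
    have "K' \<in> \<mu> \<rightarrow>\<^sub>M prob_algebra (count_space W)"
      unfolding K'_def[abs_def] by (rule measurable_compose[OF D(1) measurable_distr_prob_space[OF eW]])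
    thus ?thesis unfolding private_kernels_def using D(6) by (auto simp: me)
  qed
  have eq: "measure (K' x) {e i} = measure (K x) {i}" if "x \<in> space \<mu>" "i \<in> S" for x i
  proof -
    have "e -` {e i} \<inter> S = {i}" using that(2) inj by (auto dest: inj_onD)
    moreover have "e i \<in> W" using e that(2) by (auto simp: bij_betw_def)
    ultimately show ?thesis using me[OF that(1), of "{e i}"] by simp
  qed
  have "fisher_info \<Theta> (\<lambda>u. P u \<bind> K') \<theta>0 = (\<Sum>i\<in>W. row_info (\<lambda>x. measure (K' x) {i}) \<theta>0)"
    by (rule fisher_info_discrete[OF K' W(1) center])
  also have "\<dots> = (\<Sum>i\<in>S. row_info (\<lambda>x. measure (K' x) {e i}) \<theta>0)"
    using sum.reindex_bij_betw[OF e, of "\<lambda>i. row_info (\<lambda>x. measure (K' x) {i}) \<theta>0"] by simp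
  also have "\<dots> = (\<Sum>i\<in>S. row_info (\<lambda>x. measure (K x) {i}) \<theta>0)"
  proof (rule sum.cong[OF refl])
    fix i assume i: "i \<in> S"
    have "(\<integral>x. measure (K' x) {e i} * f x \<partial>\<mu>) = (\<integral>x. measure (K x) {i} * f x \<partial>\<mu>)" for f
      using eq i by (intro Bochner_Integration.integral_cong) auto
    thus "row_info (\<lambda>x. measure (K' x) {e i}) \<theta>0 = row_info (\<lambda>x. measure (K x) {i}) \<theta>0"
      by (simp only: row_info_def)
  qed
  finally show ?thesis using optimal_info_bounds(1)[OF \<alpha> K'] by (simp add: info_def)
qed

lemma private_rows_discrete:
  assumes K: "K \<in> private_kernels \<alpha> \<mu> (count_space S)" and S: "finite S"
  shows "private_rows \<alpha> S (\<lambda>i x. measure (K x) {i})"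
proof -
  note D = private_kernelsD[OF K]
  have "(\<Sum>i\<in>S. measure (K x) {i}) = 1" if x: "x \<in> space \<mu>" for x
  proof -
    interpret Kx: prob_space "K x" by (rule D(3)[OF x])
    have "measure (K x) S = (\<Sum>i\<in>S. measure (K x) {i})"
      using D(4)[OF x] by (intro Kx.finite_measure_eq_sum_singleton[OF S]) auto
    thus ?thesis using Kx.prob_space sets_eq_imp_space_eq[OF D(4)[OF x]] by simp
  qed
  thus ?thesis using D(5,6) S by (auto simp: private_rows_def)
qed

end

section \<open>Products of kernels and the law of the two-step procedure\<close>

text \<open>The factors outside the finite index set may be arbitrary; they are replaced by a
  one-point probability space in order to apply the theory of product measures.\<close>

lemma emeasure_PiM_box:
  assumes I: "finite I" and M: "\<And>i. i \<in> I \<Longrightarrow> prob_space (M i)" and A: "\<And>i. i \<in> I \<Longrightarrow> A i \<in> sets (M i)"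
  shows "emeasure (PiM I M) (Pi\<^sub>E I A) = (\<Prod>i\<in>I. emeasure (M i) (A i))"
proof -
  let ?M = "\<lambda>i. if i \<in> I then M i else count_space {undefined}"
  interpret product_sigma_finite ?M
    using M by (auto simp: product_sigma_finite_def prob_space_imp_sigma_finite intro!: sigma_finite_measure_count_space_finite)
  have "PiM I M = PiM I ?M" by (rule PiM_cong) auto
  thus ?thesis using emeasure_PiM[OF I, of A] A by simp
qed

lemma measurable_PiM_kernel:
  assumes I: "finite I" and f: "\<And>i. i \<in> I \<Longrightarrow> f i \<in> L \<rightarrow>\<^sub>M prob_algebra (N i)"
  shows "(\<lambda>x. PiM I (\<lambda>i. f i x)) \<in> L \<rightarrow>\<^sub>M prob_algebra (PiM I N)"
proof (rule measurable_prob_algebra_generated[OF sets_PiM Int_stable_prod_algebra prod_algebra_sets_into_space])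
  have fs: "prob_space (f i x)" "sets (f i x) = sets (N i)" if "i \<in> I" "x \<in> space L" for i x
    using measurable_space[OF f[OF that(1)] that(2)] by (auto simp: space_prob_algebra)
  show "prob_space (PiM I (\<lambda>i. f i x))" if "x \<in> space L" for x
    using fs that by (intro prob_space_PiM) auto
  show "sets (PiM I (\<lambda>i. f i x)) = sets (PiM I N)" if "x \<in> space L" for x
    using fs that by (intro sets_PiM_cong) auto
  fix A assume "A \<in> prod_algebra I N"
  then obtain X where A: "A = Pi\<^sub>E I X" "\<And>i. i \<in> I \<Longrightarrow> X i \<in> sets (N i)"
    unfolding prod_algebra_eq_finite[OF I] by auto
  have "(\<lambda>x. \<Prod>i\<in>I. emeasure (f i x) (X i)) \<in> borel_measurable L"
    using measurable_prob_algebraD[OF f] A(2)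
    by (intro borel_measurable_prod_ennreal measurable_compose[OF _ measurable_emeasure_subprob_algebra]) auto
  thus "(\<lambda>x. emeasure (PiM I (\<lambda>i. f i x)) A) \<in> borel_measurable L"
  proof (rule measurable_cong[THEN iffD1, rotated])
    fix x assume x: "x \<in> space L"
    show "(\<Prod>i\<in>I. emeasure (f i x) (X i)) = emeasure (PiM I (\<lambda>i. f i x)) A"
      unfolding A(1) using fs x A(2) by (subst emeasure_PiM_box[OF I]) auto
  qed
qed

text \<open>On boxes, both sides are products over the coordinates of the integrals of \<open>K\<close>.\<close>

lemma bind_PiM:
  assumes I: "finite I" and P: "prob_space P" "sets P = sets M" and K: "K \<in> M \<rightarrow>\<^sub>M prob_algebra N"
  shows "PiM I (\<lambda>_. P) \<bind> (\<lambda>x. PiM I (\<lambda>i. K (x i))) = PiM I (\<lambda>_. P \<bind> K)"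
proof -
  have Pa: "P \<in> space (prob_algebra M)" using P by (simp add: space_prob_algebra)
  note B = prob_space_bind'[OF Pa K] sets_bind'[OF Pa K]
  interpret PK: product_prob_space "\<lambda>_. P \<bind> K" I
    using B(1) by (simp add: product_prob_space_def product_prob_space_axioms_def product_sigma_finite_def prob_space_imp_sigma_finite)
  interpret PP: product_prob_space "\<lambda>_. P" I
    using P(1) by (simp add: product_prob_space_def product_prob_space_axioms_def product_sigma_finite_def prob_space_imp_sigma_finite)
  have PI: "PiM I (\<lambda>_. P) \<in> space (prob_algebra (PiM I (\<lambda>_. M)))"
    using P by (auto simp: space_prob_algebra intro!: prob_space_PiM sets_PiM_cong)
  have ker: "(\<lambda>x. PiM I (\<lambda>i. K (x i))) \<in> PiM I (\<lambda>_. M) \<rightarrow>\<^sub>M prob_algebra (PiM I (\<lambda>_. N))"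
    by (rule measurable_PiM_kernel[OF I]) (intro measurable_compose[OF _ K] measurable_component_singleton)
  show ?thesis
  proof (rule PK.PiM_eqI[OF I])
    show "sets (PiM I (\<lambda>_. P) \<bind> (\<lambda>x. PiM I (\<lambda>i. K (x i)))) = sets (PiM I (\<lambda>_. P \<bind> K))"
      unfolding sets_bind'[OF PI ker] by (rule sets_PiM_cong) (auto simp: B)
    fix A assume "\<And>i. i \<in> I \<Longrightarrow> A i \<in> sets (P \<bind> K)"
    hence A: "\<And>i. i \<in> I \<Longrightarrow> A i \<in> sets N" using B by auto
    have Ks: "prob_space (K y)" "sets (K y) = sets N" if "y \<in> space M" for y
      using measurable_space[OF K that] by (auto simp: space_prob_algebra)
    have spP: "space P = space M" using P(2) by (rule sets_eq_imp_space_eq)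
    have xi: "x i \<in> space M" if "x \<in> space (PiM I (\<lambda>_. P))" "i \<in> I" for x i
      using that spP by (auto simp: space_PiM dest: PiE_mem)
    have "emeasure (PiM I (\<lambda>_. P) \<bind> (\<lambda>x. PiM I (\<lambda>i. K (x i)))) (Pi\<^sub>E I A)
      = (\<integral>\<^sup>+x. emeasure (PiM I (\<lambda>i. K (x i))) (Pi\<^sub>E I A) \<partial>PiM I (\<lambda>_. P))"
      by (rule emeasure_bind_prob_algebra[OF PI ker]) (rule sets_PiM_I_finite[OF I A])
    also have "\<dots> = (\<integral>\<^sup>+x. (\<Prod>i\<in>I. emeasure (K (x i)) (A i)) \<partial>PiM I (\<lambda>_. P))"
      using Ks A xi by (intro nn_integral_cong emeasure_PiM_box[OF I]) auto
    also have "\<dots> = (\<Prod>i\<in>I. (\<integral>\<^sup>+y. emeasure (K y) (A i) \<partial>P))"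
    proof (rule PP.product_nn_integral_prod[OF I])
      fix i assume i: "i \<in> I"
      have "(\<lambda>y. emeasure (K y) (A i)) \<in> borel_measurable M"
        using A[OF i] by (intro measurable_compose[OF measurable_prob_algebraD[OF K] measurable_emeasure_subprob_algebra]) auto
      thus "(\<lambda>y. emeasure (K y) (A i)) \<in> borel_measurable P" by (simp only: measurable_cong_sets[OF P(2) refl])
    qed
    also have "\<dots> = (\<Prod>i\<in>I. emeasure (P \<bind> K) (A i))"
      using A by (intro prod.cong refl emeasure_bind_prob_algebra[OF Pa K, symmetric]) auto
    finally show "emeasure (PiM I (\<lambda>_. P) \<bind> (\<lambda>x. PiM I (\<lambda>i. K (x i)))) (Pi\<^sub>E I A) = (\<Prod>i\<in>I. emeasure (P \<bind> K) (A i))" .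
  qed
qed

text \<open>Induction on the index set: integrate out one coordinate and apply the inequality to the
  inner integral, then use the induction hypothesis for the function that remains.\<close>

lemma PiM_chi_square:
  fixes c :: ennreal
  assumes I: "finite I" and A: "prob_space A" and B: "prob_space B" and s: "sets A = sets N" "sets B = sets N"
    and chi: "\<And>f. f \<in> borel_measurable N \<Longrightarrow> (\<integral>\<^sup>+z. f z \<partial>B)\<^sup>2 \<le> c * (\<integral>\<^sup>+z. (f z)\<^sup>2 \<partial>A)"
    and f: "f \<in> borel_measurable (PiM I (\<lambda>_. N))"
  shows "(\<integral>\<^sup>+z. f z \<partial>PiM I (\<lambda>_. B))\<^sup>2 \<le> c ^ card I * (\<integral>\<^sup>+z. (f z)\<^sup>2 \<partial>PiM I (\<lambda>_. A))"
  using I f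
proof (induction I arbitrary: f rule: finite_induct)
  case empty
  interpret PA: product_sigma_finite "\<lambda>_. A" using A by (simp add: product_sigma_finite_def prob_space_imp_sigma_finite)
  interpret PB: product_sigma_finite "\<lambda>_. B" using B by (simp add: product_sigma_finite_def prob_space_imp_sigma_finite)
  show ?case by (simp add: PA.nn_integral_empty PB.nn_integral_empty)
next
  case (insert i I)
  interpret PA: product_sigma_finite "\<lambda>_. A" using A by (simp add: product_sigma_finite_def prob_space_imp_sigma_finite)
  interpret PB: product_sigma_finite "\<lambda>_. B" using B by (simp add: product_sigma_finite_def prob_space_imp_sigma_finite)
  interpret B: prob_space B by fact
  interpret A: prob_space A by fact
  have sP: "sets (PiM J (\<lambda>_. A)) = sets (PiM J (\<lambda>_. N))" "sets (PiM J (\<lambda>_. B)) = sets (PiM J (\<lambda>_. N))" for J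
    using s by (auto intro!: sets_PiM_cong)
  have fm: "f \<in> borel_measurable (PiM (insert i I) (\<lambda>_. N))" by fact
  have fA: "f \<in> borel_measurable (PiM (insert i I) (\<lambda>_. A))" using fm by (simp only: measurable_cong_sets[OF sP(1) refl])
  have fB: "f \<in> borel_measurable (PiM (insert i I) (\<lambda>_. B))" using fm by (simp only: measurable_cong_sets[OF sP(2) refl])
  have pm[measurable]: "(\<lambda>(x, y). f (x(i := y))) \<in> borel_measurable (PiM I (\<lambda>_. N) \<Otimes>\<^sub>M N)"
    using measurable_compose[OF measurable_add_dim fm] by (simp add: split_def)
  have inner: "(\<lambda>y. f (x(i := y))) \<in> borel_measurable N" if "x \<in> space (PiM I (\<lambda>_. N))" for x
    using measurable_Pair2[OF pm that] by simp
  have mB: "(\<lambda>x. \<integral>\<^sup>+y. f (x(i := y)) \<partial>B) \<in> borel_measurable (PiM I (\<lambda>_. N))"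
  proof -
    have "(\<lambda>(x, y). f (x(i := y))) \<in> borel_measurable (PiM I (\<lambda>_. N) \<Otimes>\<^sub>M B)"
      using pm by (simp only: measurable_cong_sets[OF sets_pair_measure_cong[OF refl s(2)] refl])
    thus ?thesis by (rule sigma_finite_measure.borel_measurable_nn_integral[OF prob_space_imp_sigma_finite[OF B]])
  qed
  have "(\<integral>\<^sup>+z. f z \<partial>PiM (insert i I) (\<lambda>_. B))\<^sup>2 = (\<integral>\<^sup>+x. (\<integral>\<^sup>+y. f (x(i := y)) \<partial>B) \<partial>PiM I (\<lambda>_. B))\<^sup>2"
    by (subst PB.product_nn_integral_insert[OF insert.hyps fB]) simp
  also have "\<dots> \<le> c ^ card I * (\<integral>\<^sup>+x. (\<integral>\<^sup>+y. f (x(i := y)) \<partial>B)\<^sup>2 \<partial>PiM I (\<lambda>_. A))"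
    by (rule insert.IH[OF mB])
  also have "\<dots> \<le> c ^ card I * (\<integral>\<^sup>+x. c * (\<integral>\<^sup>+y. (f (x(i := y)))\<^sup>2 \<partial>A) \<partial>PiM I (\<lambda>_. A))"
  proof (intro mult_left_mono nn_integral_mono)
    fix x assume "x \<in> space (PiM I (\<lambda>_. A))"
    hence "x \<in> space (PiM I (\<lambda>_. N))" using sets_eq_imp_space_eq[OF sP(1)[of I]] by simp
    thus "(\<integral>\<^sup>+y. f (x(i := y)) \<partial>B)\<^sup>2 \<le> c * (\<integral>\<^sup>+y. (f (x(i := y)))\<^sup>2 \<partial>A)" by (intro chi inner)
  qed simp
  also have "(\<integral>\<^sup>+x. c * (\<integral>\<^sup>+y. (f (x(i := y)))\<^sup>2 \<partial>A) \<partial>PiM I (\<lambda>_. A)) = c * (\<integral>\<^sup>+x. (\<integral>\<^sup>+y. (f (x(i := y)))\<^sup>2 \<partial>A) \<partial>PiM I (\<lambda>_. A))"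
  proof (rule nn_integral_cmult)
    have "(\<lambda>(x, y). (f (x(i := y)))\<^sup>2) \<in> borel_measurable (PiM I (\<lambda>_. N) \<Otimes>\<^sub>M N)"
      using borel_measurable_power_ennreal[OF pm, of 2] by (simp add: split_def)
    hence "(\<lambda>(x, y). (f (x(i := y)))\<^sup>2) \<in> borel_measurable (PiM I (\<lambda>_. A) \<Otimes>\<^sub>M A)"
      by (simp only: measurable_cong_sets[OF sets_pair_measure_cong[OF sP(1) s(1)] refl])
    thus "(\<lambda>x. \<integral>\<^sup>+y. (f (x(i := y)))\<^sup>2 \<partial>A) \<in> borel_measurable (PiM I (\<lambda>_. A))" by (rule sigma_finite_measure.borel_measurable_nn_integral[OF prob_space_imp_sigma_finite[OF A]])
  qed
  also have "(\<integral>\<^sup>+x. (\<integral>\<^sup>+y. (f (x(i := y)))\<^sup>2 \<partial>A) \<partial>PiM I (\<lambda>_. A)) = (\<integral>\<^sup>+z. (f z)\<^sup>2 \<partial>PiM (insert i I) (\<lambda>_. A))"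
    by (subst PA.product_nn_integral_insert[OF insert.hyps]) (use fA in auto)
  finally show ?case using insert.hyps by (simp add: mult.assoc mult.left_commute)
qed

text \<open>The second stage uses only the coordinates of the data that the first stage does not use.
  Given the first output \<open>z\<close>, these coordinates are therefore still iid from \<open>P0\<close>, and the
  sensitive data can be integrated out in both stages separately.\<close>

lemma two_step_law_structure:
  fixes P0 :: "'x measure" and est :: "(nat \<Rightarrow> 'z) \<Rightarrow> real"
  assumes P: "prob_space P0" "sets P0 = sets \<mu>" and mn: "m \<le> n"
    and Q0: "Q0 \<in> \<mu> \<rightarrow>\<^sub>M prob_algebra Z0"
    and est: "est \<in> PiM {1..m} (\<lambda>_. Z0) \<rightarrow>\<^sub>M param_space \<Theta>"
    and T: "T \<in> \<mu> \<Otimes>\<^sub>M param_space \<Theta> \<rightarrow>\<^sub>M pos_nats"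
    and Q: "Q \<in> pos_nats \<Otimes>\<^sub>M param_space \<Theta> \<rightarrow>\<^sub>M prob_algebra pos_nats"
  defines "law \<equiv> two_step_law Z0 Q0 est T Q m n P0"
    and "R \<equiv> PiM {1..m} (\<lambda>_. P0 \<bind> Q0)"
    and "S \<equiv> \<lambda>z. PiM {m+1..n} (\<lambda>_. P0 \<bind> (\<lambda>x. Q (T (x, est z), est z)))"
  shows "sets law = sets (two_step_space Z0 m n)" "prob_space law"
    and "f \<in> borel_measurable (two_step_space Z0 m n) \<Longrightarrow>
      (\<integral>\<^sup>+y. f y \<partial>law) = (\<integral>\<^sup>+z. \<integral>\<^sup>+w. f (z, w) \<partial>S z \<partial>R)"
proof -
  let ?X = "PiM {1..n} (\<lambda>_. \<mu>)" and ?X1 = "PiM {1..m} (\<lambda>_. \<mu>)" and ?X2 = "PiM {m+1..n} (\<lambda>_. \<mu>)"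
  let ?Z = "PiM {1..m} (\<lambda>_. Z0)" and ?W = "PiM {m+1..n} (\<lambda>_. pos_nats)"
  let ?TS = "two_step_space Z0 m n"
  note [measurable] = Q0 est T Q
  have TS: "?TS = ?Z \<Otimes>\<^sub>M ?W" by (simp add: two_step_space_def)
  have QT[measurable]: "(\<lambda>(x, \<tau>). Q (T (x, \<tau>), \<tau>)) \<in> \<mu> \<Otimes>\<^sub>M param_space \<Theta> \<rightarrow>\<^sub>M prob_algebra pos_nats"
    by measurable
  have kA: "(\<lambda>x. PiM {1..m} (\<lambda>j. Q0 (x j))) \<in> PiM J (\<lambda>_. \<mu>) \<rightarrow>\<^sub>M prob_algebra ?Z" if "{1..m} \<subseteq> J" for J
    using that by (intro measurable_PiM_kernel measurable_compose[OF _ Q0] measurable_component_singleton) auto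
  define k2 where "k2 z x = PiM {m+1..n} (\<lambda>i. Q (T (x i, est z), est z))" for z and x :: "nat \<Rightarrow> 'x"
  have kB: "(\<lambda>(z, x). k2 z x) \<in> ?Z \<Otimes>\<^sub>M PiM J (\<lambda>_. \<mu>) \<rightarrow>\<^sub>M prob_algebra ?W" if J: "{m+1..n} \<subseteq> J" for J
    unfolding k2_def split_def
  proof (rule measurable_PiM_kernel)
    fix i assume "i \<in> {m+1..n}"
    hence [measurable]: "(\<lambda>y. snd y i) \<in> ?Z \<Otimes>\<^sub>M PiM J (\<lambda>_. \<mu>) \<rightarrow>\<^sub>M \<mu>"
      using J by (intro measurable_compose[OF measurable_snd measurable_component_singleton]) auto
    show "(\<lambda>y. Q (T (snd y i, est (fst y)), est (fst y))) \<in> ?Z \<Otimes>\<^sub>M PiM J (\<lambda>_. \<mu>) \<rightarrow>\<^sub>M prob_algebra pos_nats"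
      by measurable
  qed simp
  have ker: "two_step_kernel Z0 Q0 est T Q m n \<in> ?X \<rightarrow>\<^sub>M prob_algebra ?TS"
    unfolding two_step_kernel_def
  proof (rule measurable_bind_prob_space2[OF kA])
    have k2s: "(\<lambda>(x, z). k2 z x) \<in> ?X \<Otimes>\<^sub>M ?Z \<rightarrow>\<^sub>M prob_algebra ?W"
      using measurable_compose[OF measurable_pair_swap' kB[of "{1..n}"]] by (simp add: split_def)
    have "(\<lambda>y. distr (case y of (x, z) \<Rightarrow> k2 z x) ?TS (\<lambda>w. (snd y, w))) \<in> ?X \<Otimes>\<^sub>M ?Z \<rightarrow>\<^sub>M prob_algebra ?TS"
      by (rule measurable_distr_prob_space2[OF k2s]) (simp add: TS split_def)
    thus "(\<lambda>(x, z). distr (PiM {m+1..n} (\<lambda>i. Q (T (x i, est z), est z))) ?TS (\<lambda>w. (z, w))) \<in> ?X \<Otimes>\<^sub>M ?Z \<rightarrow>\<^sub>M prob_algebra ?TS"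
      by (simp add: k2_def split_def)
  qed (use mn in auto)
  have PI: "PiM J (\<lambda>_. P0) \<in> space (prob_algebra (PiM J (\<lambda>_. \<mu>)))" for J
    using P by (auto simp: space_prob_algebra intro!: prob_space_PiM sets_PiM_cong)
  show sl: "sets law = sets ?TS" and "prob_space law" unfolding law_def two_step_law_def
    using sets_bind'[OF PI ker] prob_space_bind'[OF PI ker] by auto
  assume f: "f \<in> borel_measurable ?TS"
  have [measurable]: "f \<in> borel_measurable (?Z \<Otimes>\<^sub>M ?W)" using f TS by simp
  have sP: "sets (PiM J (\<lambda>_. P0)) = sets (PiM J (\<lambda>_. \<mu>))" for J using P by (intro sets_PiM_cong) auto
  have spP: "space (PiM J (\<lambda>_. P0)) = space (PiM J (\<lambda>_. \<mu>))" for J by (rule sets_eq_imp_space_eq[OF sP])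
  have kerP: "two_step_kernel Z0 Q0 est T Q m n \<in> PiM {1..n} (\<lambda>_. P0) \<rightarrow>\<^sub>M subprob_algebra ?TS"
    using measurable_prob_algebraD[OF ker] by (simp only: measurable_cong_sets[OF sP refl])
  define g where "g z x = (\<integral>\<^sup>+w. f (z, w) \<partial>k2 z x)" for z x
  have gm: "(\<lambda>(z, x). g z x) \<in> borel_measurable (?Z \<Otimes>\<^sub>M PiM J (\<lambda>_. \<mu>))" if "{m+1..n} \<subseteq> J" for J
  proof -
    have 1: "(\<lambda>(y, w). f (fst y, w)) \<in> borel_measurable ((?Z \<Otimes>\<^sub>M PiM J (\<lambda>_. \<mu>)) \<Otimes>\<^sub>M ?W)" by measurable
    have 2: "(\<lambda>y. k2 (fst y) (snd y)) \<in> ?Z \<Otimes>\<^sub>M PiM J (\<lambda>_. \<mu>) \<rightarrow>\<^sub>M subprob_algebra ?W"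
      using kB[OF that, THEN measurable_prob_algebraD] by (simp only: split_def)
    show ?thesis unfolding g_def split_def by (rule nn_integral_measurable_subprob_algebra2[OF 1 2])
  qed
  let ?A = "\<lambda>x. PiM {1..m} (\<lambda>j. Q0 (x j))"
  have As: "sets (?A x) = sets ?Z" "prob_space (?A x)" if "x \<in> space (PiM J (\<lambda>_. \<mu>))" "{1..m} \<subseteq> J" for x J
    using measurable_space[OF kA[OF that(2)] that(1)] by (auto simp: space_prob_algebra)
  have inner: "(\<integral>\<^sup>+y. f y \<partial>two_step_kernel Z0 Q0 est T Q m n x) = (\<integral>\<^sup>+z. g z x \<partial>?A x)" if x: "x \<in> space ?X" for x
  proof -
    have xk: "(\<lambda>z. k2 z x) \<in> ?Z \<rightarrow>\<^sub>M prob_algebra ?W"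
      using measurable_compose[OF measurable_Pair2'[OF x] kB[of "{1..n}"]] by simp
    have "(\<lambda>z. distr (k2 z x) ?TS (\<lambda>w. (z, w))) \<in> ?Z \<rightarrow>\<^sub>M prob_algebra ?TS"
      by (rule measurable_distr_prob_space2[OF xk]) (simp add: TS split_def)
    hence dk: "(\<lambda>z. distr (k2 z x) ?TS (\<lambda>w. (z, w))) \<in> ?A x \<rightarrow>\<^sub>M subprob_algebra ?TS"
      using As(1)[OF x] mn by (subst measurable_cong_sets[OF As(1)[OF x] refl]) (auto dest: measurable_prob_algebraD)
    have "(\<integral>\<^sup>+y. f y \<partial>two_step_kernel Z0 Q0 est T Q m n x) = (\<integral>\<^sup>+z. \<integral>\<^sup>+y. f y \<partial>distr (k2 z x) ?TS (\<lambda>w. (z, w)) \<partial>?A x)"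
      unfolding two_step_kernel_def using nn_integral_bind[OF f dk] by (simp add: k2_def)
    also have "\<dots> = (\<integral>\<^sup>+z. g z x \<partial>?A x)"
    proof (rule nn_integral_cong)
      fix z assume "z \<in> space (?A x)"
      hence z: "z \<in> space ?Z" using sets_eq_imp_space_eq[OF As(1)[OF x]] mn by auto
      have sk: "sets (k2 z x) = sets ?W" using measurable_space[OF xk z] by (simp add: space_prob_algebra)
      have "(\<lambda>w. (z, w)) \<in> k2 z x \<rightarrow>\<^sub>M ?TS"
        unfolding TS by (subst measurable_cong_sets[OF sk refl]) (rule measurable_Pair1'[OF z])
      thus "(\<integral>\<^sup>+y. f y \<partial>distr (k2 z x) ?TS (\<lambda>w. (z, w))) = g z x"
        unfolding g_def by (rule nn_integral_distr) (use f in simp)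
    qed
    finally show ?thesis .
  qed
  interpret PP: product_sigma_finite "\<lambda>_. P0" using P by (simp add: product_sigma_finite_def prob_space_imp_sigma_finite)
  have split: "{1..n} = {1..m} \<union> {m+1..n}" using mn by auto
  have lm: "(\<lambda>x. \<integral>\<^sup>+z. g z x \<partial>?A x) \<in> borel_measurable ?X"
  proof -
    have "(\<lambda>(x, z). g z x) \<in> borel_measurable (?X \<Otimes>\<^sub>M ?Z)"
      using measurable_compose[OF measurable_pair_swap' gm[of "{1..n}"]] by (simp add: split_def)
    thus ?thesis using kA[of "{1..n}"] mn by (intro nn_integral_measurable_subprob_algebra2[where N = ?Z]) (auto dest: measurable_prob_algebraD)
  qed
  have "(\<integral>\<^sup>+y. f y \<partial>law) = (\<integral>\<^sup>+x. \<integral>\<^sup>+y. f y \<partial>two_step_kernel Z0 Q0 est T Q m n x \<partial>PiM {1..n} (\<lambda>_. P0))"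
    unfolding law_def two_step_law_def by (rule nn_integral_bind[OF f kerP])
  also have "\<dots> = (\<integral>\<^sup>+x. \<integral>\<^sup>+z. g z x \<partial>?A x \<partial>PiM {1..n} (\<lambda>_. P0))"
    using spP[of "{1..n}"] by (intro nn_integral_cong inner) simp
  also have "\<dots> = (\<integral>\<^sup>+x1. \<integral>\<^sup>+x2. (\<integral>\<^sup>+z. g z (merge {1..m} {m+1..n} (x1, x2)) \<partial>?A (merge {1..m} {m+1..n} (x1, x2)))
       \<partial>PiM {m+1..n} (\<lambda>_. P0) \<partial>PiM {1..m} (\<lambda>_. P0))"
    unfolding split by (rule PP.product_nn_integral_fold)
      (use lm split in \<open>auto simp: measurable_cong_sets[OF sP refl]\<close>)
  also have "\<dots> = (\<integral>\<^sup>+x1. \<integral>\<^sup>+x2. (\<integral>\<^sup>+z. g z x2 \<partial>?A x1) \<partial>PiM {m+1..n} (\<lambda>_. P0) \<partial>PiM {1..m} (\<lambda>_. P0))"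
  proof -
    have a: "?A (merge {1..m} {m+1..n} (x1, x2)) = ?A x1" for x1 x2 :: "nat \<Rightarrow> 'x"
      by (rule PiM_cong) (auto simp: merge_def)
    have b: "g z (merge {1..m} {m+1..n} (x1, x2)) = g z x2" for z x1 x2
    proof -
      have "k2 z (merge {1..m} {m+1..n} (x1, x2)) = k2 z x2"
        unfolding k2_def by (rule PiM_cong) (auto simp: merge_def)
      thus ?thesis by (simp add: g_def)
    qed
    show ?thesis by (simp only: a b)
  qed
  also have "\<dots> = (\<integral>\<^sup>+x1. \<integral>\<^sup>+z. (\<integral>\<^sup>+x2. g z x2 \<partial>PiM {m+1..n} (\<lambda>_. P0)) \<partial>?A x1 \<partial>PiM {1..m} (\<lambda>_. P0))"
  proof (rule nn_integral_cong)
    fix x1 assume "x1 \<in> space (PiM {1..m} (\<lambda>_. P0))"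
    hence x1: "x1 \<in> space ?X1" using spP[of "{1..m}"] by simp
    interpret A: prob_space "?A x1" by (rule As(2)[OF x1]) simp
    interpret X: sigma_finite_measure "PiM {m+1..n} (\<lambda>_. P0)" by (rule PP.sigma_finite) simp
    interpret pair_sigma_finite "?A x1" "PiM {m+1..n} (\<lambda>_. P0)" ..
    have "(\<lambda>(z, x). g z x) \<in> borel_measurable (?A x1 \<Otimes>\<^sub>M PiM {m+1..n} (\<lambda>_. P0))"
      using gm[of "{m+1..n}"] by (subst measurable_cong_sets[OF sets_pair_measure_cong[OF As(1)[OF x1 order_refl] sP] refl]) simp
    from Fubini'[OF this]
    show "(\<integral>\<^sup>+x2. (\<integral>\<^sup>+z. g z x2 \<partial>?A x1) \<partial>PiM {m+1..n} (\<lambda>_. P0)) = (\<integral>\<^sup>+z. (\<integral>\<^sup>+x2. g z x2 \<partial>PiM {m+1..n} (\<lambda>_. P0)) \<partial>?A x1)"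
      by simp
  qed
  also have "\<dots> = (\<integral>\<^sup>+z. (\<integral>\<^sup>+x2. g z x2 \<partial>PiM {m+1..n} (\<lambda>_. P0)) \<partial>(PiM {1..m} (\<lambda>_. P0) \<bind> ?A))"
  proof (rule nn_integral_bind[symmetric])
    interpret X: sigma_finite_measure "PiM {m+1..n} (\<lambda>_. P0)" by (rule PP.sigma_finite) simp
    have "(\<lambda>(z, x). g z x) \<in> borel_measurable (?Z \<Otimes>\<^sub>M PiM {m+1..n} (\<lambda>_. P0))"
      using gm[of "{m+1..n}"] by (subst measurable_cong_sets[OF sets_pair_measure_cong[OF refl sP] refl]) simp
    thus "(\<lambda>z. \<integral>\<^sup>+x2. g z x2 \<partial>PiM {m+1..n} (\<lambda>_. P0)) \<in> borel_measurable ?Z" by (rule X.borel_measurable_nn_integral)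
    show "?A \<in> PiM {1..m} (\<lambda>_. P0) \<rightarrow>\<^sub>M subprob_algebra ?Z"
      using measurable_prob_algebraD[OF kA[OF order_refl]] by (simp only: measurable_cong_sets[OF sP refl])
  qed
  also have "PiM {1..m} (\<lambda>_. P0) \<bind> ?A = R" unfolding R_def by (rule bind_PiM[OF _ P Q0]) simp
  also have "(\<integral>\<^sup>+z. (\<integral>\<^sup>+x2. g z x2 \<partial>PiM {m+1..n} (\<lambda>_. P0)) \<partial>R) = (\<integral>\<^sup>+z. \<integral>\<^sup>+w. f (z, w) \<partial>S z \<partial>R)"
  proof (rule nn_integral_cong)
    fix z assume "z \<in> space R"
    moreover have "sets (P0 \<bind> Q0) = sets Z0"
      using P Q0 by (intro sets_bind') (auto simp: space_prob_algebra)
    hence "sets R = sets ?Z" unfolding R_def by (intro sets_PiM_cong) auto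
    ultimately have z: "z \<in> space ?Z" using sets_eq_imp_space_eq by blast
    have e: "est z \<in> space (param_space \<Theta>)" by (rule measurable_space[OF est z])
    have K: "(\<lambda>x. Q (T (x, est z), est z)) \<in> \<mu> \<rightarrow>\<^sub>M prob_algebra pos_nats"
      using measurable_compose[OF measurable_Pair2'[OF e] QT] by simp
    have k2z: "k2 z \<in> PiM {m+1..n} (\<lambda>_. P0) \<rightarrow>\<^sub>M subprob_algebra ?W"
    proof -
      have "k2 z \<in> ?X2 \<rightarrow>\<^sub>M prob_algebra ?W"
        using measurable_compose[OF measurable_Pair1'[OF z] kB[OF order_refl]] by simp
      thus ?thesis using measurable_prob_algebraD by (simp only: measurable_cong_sets[OF sP refl])
    qed
    have "(\<integral>\<^sup>+x2. g z x2 \<partial>PiM {m+1..n} (\<lambda>_. P0)) = (\<integral>\<^sup>+w. f (z, w) \<partial>(PiM {m+1..n} (\<lambda>_. P0) \<bind> k2 z))"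
      unfolding g_def
      by (rule nn_integral_bind[symmetric, OF measurable_compose[OF measurable_Pair1'[OF z] f[unfolded TS]] k2z])
    also have "PiM {m+1..n} (\<lambda>_. P0) \<bind> k2 z = S z"
      unfolding S_def k2_def by (rule bind_PiM[OF _ P K]) simp
    finally show "(\<integral>\<^sup>+x2. g z x2 \<partial>PiM {m+1..n} (\<lambda>_. P0)) = (\<integral>\<^sup>+w. f (z, w) \<partial>S z)" .
  qed
  finally show "(\<integral>\<^sup>+y. f y \<partial>law) = (\<integral>\<^sup>+z. \<integral>\<^sup>+w. f (z, w) \<partial>S z \<partial>R)" .
qed

section \<open>The second-stage channel is asymptotically optimal\<close>

context l1_smooth_model
begin

text \<open>The second-stage channel is given in two forms: with outputs in all positive integers, as
  in the procedure, and restricted to \<open>{1..k \<tau>}\<close>, as in the maximization. The restricted one has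
  total mass one, so both carry the same probabilities.\<close>

lemma stage2_kernel:
  assumes mx: "measurable_info_maximizer \<alpha> \<Theta> P T k Q"
    and T: "T \<in> \<mu> \<Otimes>\<^sub>M param_space \<Theta> \<rightarrow>\<^sub>M pos_nats"
    and Tk: "\<And>x. x \<in> space \<mu> \<Longrightarrow> T (x, \<tau>) \<in> {1..k \<tau>}" and t: "\<tau> \<in> \<Theta>"
  shows "(\<lambda>x. T (x, \<tau>)) \<in> \<mu> \<rightarrow>\<^sub>M count_space UNIV"
    and "(\<lambda>y. restrict_space (Q (y, \<tau>)) {1..k \<tau>}) \<circ> (\<lambda>x. T (x, \<tau>)) \<in> private_kernels \<alpha> \<mu> (count_space {1..k \<tau>})"
    and "(\<lambda>x. Q (T (x, \<tau>), \<tau>)) \<in> private_kernels \<alpha> \<mu> pos_nats"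
    and "x \<in> space \<mu> \<Longrightarrow> i \<in> {1..k \<tau>} \<Longrightarrow>
      measure (((\<lambda>y. restrict_space (Q (y, \<tau>)) {1..k \<tau>}) \<circ> (\<lambda>x. T (x, \<tau>))) x) {i} = measure (Q (T (x, \<tau>), \<tau>)) {i}"
    and "x \<in> space \<mu> \<Longrightarrow> measure (Q (T (x, \<tau>), \<tau>)) {1..k \<tau>} = 1"
proof -
  let ?R = "\<lambda>y. restrict_space (Q (y, \<tau>)) {1..k \<tau>}"
  have Qm[measurable]: "Q \<in> pos_nats \<Otimes>\<^sub>M param_space \<Theta> \<rightarrow>\<^sub>M prob_algebra pos_nats"
    and R: "?R \<in> private_kernels \<alpha> (count_space {1..k \<tau>}) (count_space {1..k \<tau>})"
    using mx t by (auto simp: measurable_info_maximizer_def is_arg_max_def)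
  have tp: "\<tau> \<in> space (param_space \<Theta>)" using t by (simp add: space_restrict_space)
  have Tm: "(\<lambda>x. T (x, \<tau>)) \<in> \<mu> \<rightarrow>\<^sub>M pos_nats"
    using measurable_compose[OF measurable_Pair2'[OF tp] T] .
  show TU: "(\<lambda>x. T (x, \<tau>)) \<in> \<mu> \<rightarrow>\<^sub>M count_space UNIV"
    by (rule measurable_compose[OF Tm]) simp
  have T': "(\<lambda>x. T (x, \<tau>)) \<in> \<mu> \<rightarrow>\<^sub>M count_space {1..k \<tau>}"
    using TU Tk by (simp add: measurable_count_space_eq2_countable)
  show K': "?R \<circ> (\<lambda>x. T (x, \<tau>)) \<in> private_kernels \<alpha> \<mu> (count_space {1..k \<tau>})"
    by (rule private_kernels_comp[OF R T'])
  have Km: "(\<lambda>x. Q (T (x, \<tau>), \<tau>)) \<in> \<mu> \<rightarrow>\<^sub>M prob_algebra pos_nats"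
    using Tm tp by (intro measurable_compose[OF _ Qm] measurable_Pair measurable_const) auto
  have Ks: "sets (Q (T (x, \<tau>), \<tau>)) = Pow {1..}" "prob_space (Q (T (x, \<tau>), \<tau>))" if "x \<in> space \<mu>" for x
    using measurable_space[OF Km that] by (auto simp: space_prob_algebra)
  have res: "measure ((?R \<circ> (\<lambda>x. T (x, \<tau>))) x) A = measure (Q (T (x, \<tau>), \<tau>)) A" if "x \<in> space \<mu>" "A \<subseteq> {1..k \<tau>}" for x A
  proof -
    have "{1..k \<tau>} \<inter> space (Q (T (x, \<tau>), \<tau>)) \<in> sets (Q (T (x, \<tau>), \<tau>))"
      using Ks(1)[OF that(1)] by (intro sets.Int) auto
    thus ?thesis using that(2) by (simp add: measure_restrict_space)
  qed
  show "measure ((?R \<circ> (\<lambda>x. T (x, \<tau>))) x) {i} = measure (Q (T (x, \<tau>), \<tau>)) {i}" if "x \<in> space \<mu>" "i \<in> {1..k \<tau>}"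
    using that by (intro res) auto
  show one: "measure (Q (T (x, \<tau>), \<tau>)) {1..k \<tau>} = 1" if "x \<in> space \<mu>" for x
  proof -
    have "measure ((?R \<circ> (\<lambda>x. T (x, \<tau>))) x) {1..k \<tau>} = 1"
      using prob_space.prob_space[OF private_kernelsD(3)[OF K' that]]
        sets_eq_imp_space_eq[OF private_kernelsD(4)[OF K' that]] by simp
    thus ?thesis using res[OF that order_refl] by simp
  qed
  have cut: "measure (Q (T (x, \<tau>), \<tau>)) A = measure (Q (T (x, \<tau>), \<tau>)) (A \<inter> {1..k \<tau>})" if x: "x \<in> space \<mu>" and A: "A \<subseteq> {1..}" for x A
  proof -
    interpret q: prob_space "Q (T (x, \<tau>), \<tau>)" by (rule Ks[OF x])
    have sk: "{1..k \<tau>} \<in> sets (Q (T (x, \<tau>), \<tau>))" using Ks(1)[OF x] by auto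
    have ae: "AE y in Q (T (x, \<tau>), \<tau>). y \<in> {1..k \<tau>}" using one[OF x] sk by (simp add: q.prob_eq_1)
    show ?thesis
      by (rule measure_eq_AE) (use ae Ks(1)[OF x] A in auto)
  qed
  show "(\<lambda>x. Q (T (x, \<tau>), \<tau>)) \<in> private_kernels \<alpha> \<mu> pos_nats"
    unfolding private_kernels_def
  proof (intro CollectI conjI ballI Km)
    fix A x x' assume A: "A \<in> sets pos_nats" and x: "x \<in> space \<mu>" "x' \<in> space \<mu>"
    hence A': "A \<subseteq> {1..}" by simp
    have "measure ((?R \<circ> (\<lambda>x. T (x, \<tau>))) x) (A \<inter> {1..k \<tau>}) \<le> exp \<alpha> * measure ((?R \<circ> (\<lambda>x. T (x, \<tau>))) x') (A \<inter> {1..k \<tau>})"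
      using private_kernelsD(6)[OF K' _ x] by simp
    thus "measure (Q (T (x, \<tau>), \<tau>)) A \<le> exp \<alpha> * measure (Q (T (x', \<tau>), \<tau>)) A"
      unfolding cut[OF x(1) A'] cut[OF x(2) A'] using x by (simp only: res Int_lower2)
  qed
qed

lemma row_info_cong:
  assumes "\<And>x. x \<in> space \<mu> \<Longrightarrow> \<phi> x = \<psi> x"
  shows "row_info \<phi> t = row_info \<psi> t"
proof -
  have "(\<integral>x. \<phi> x * f x \<partial>\<mu>) = (\<integral>x. \<psi> x * f x \<partial>\<mu>)" for f
    using assms by (intro Bochner_Integration.integral_cong) auto
  thus ?thesis by (simp only: row_info_def)
qed

text \<open>The Fisher information at \<open>t\<close> of a second-stage observation when the preliminary estimate
  is \<open>\<tau>\<close>. The maximization concerns \<open>t = \<tau>\<close>, the limit law concerns \<open>t\<close> near \<open>\<theta>0\<close>.\<close>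

definition stage2_info :: "('a \<times> real \<Rightarrow> nat) \<Rightarrow> (real \<Rightarrow> nat) \<Rightarrow> (nat \<times> real \<Rightarrow> nat measure) \<Rightarrow> real \<Rightarrow> real \<Rightarrow> real" where
  "stage2_info T k Q \<tau> t = info {1..k \<tau>} (\<lambda>i x. measure (Q (T (x, \<tau>), \<tau>)) {i}) t"

lemma stage2_rows:
  assumes mx: "measurable_info_maximizer \<alpha> \<Theta> P T k Q"
    and T: "T \<in> \<mu> \<Otimes>\<^sub>M param_space \<Theta> \<rightarrow>\<^sub>M pos_nats"
    and Tk: "\<And>x. x \<in> space \<mu> \<Longrightarrow> T (x, \<tau>) \<in> {1..k \<tau>}" and t: "\<tau> \<in> \<Theta>"
  shows "private_rows \<alpha> {1..k \<tau>} (\<lambda>i x. measure (Q (T (x, \<tau>), \<tau>)) {i})"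
proof -
  note K = stage2_kernel[OF assms]
  show ?thesis using private_rows_discrete[OF K(2)] K(4)
    by (simp add: private_rows_def cong: measurable_cong)
qed

text \<open>The error \<open>e\<close> is split into the gap between the supremum and a nearly optimal channel, the
  cost of imitating this channel on the quantized data, and the change of the information from \<open>\<tau>\<close>
  to \<open>t\<close>.\<close>

lemma stage2_info_limit:
  assumes \<alpha>: "0 \<le> \<alpha>" and inf: "infinite (UNIV :: 'w set)"
    and quant: "consistent_quantizer \<mu> \<Theta> P p s T k"
    and mx: "\<And>m. 1 \<le> m \<Longrightarrow> measurable_info_maximizer \<alpha> \<Theta> P (T m) (k m) (Q m)"
    and s: "\<And>\<tau>. \<tau> \<in> ball \<theta>0 r \<Longrightarrow> s \<tau> \<in> borel_measurable \<mu>"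
       "\<And>\<tau>. \<tau> \<in> ball \<theta>0 r \<Longrightarrow> AE x in \<mu>. s \<tau> x * p \<tau> x = p1 \<tau> x"
    and e: "0 < e"
  shows "\<exists>\<delta>>0. \<delta> \<le> r \<and> (\<exists>M\<ge>1. \<forall>m\<ge>M. \<forall>\<tau> t. \<bar>\<tau> - \<theta>0\<bar> < \<delta> \<longrightarrow> \<bar>t - \<theta>0\<bar> < \<delta> \<longrightarrow>
      \<bar>stage2_info (T m) (k m) (Q m) \<tau> t - optimal_info TYPE('w) \<alpha> \<mu> \<Theta> P \<theta>0\<bar> \<le> e)"
proof -
  let ?I = "optimal_info TYPE('w) \<alpha> \<mu> \<Theta> P \<theta>0"
  have e4: "0 < e / 4" using e by simp
  obtain N :: "'w measure" and K where K: "K \<in> private_kernels \<alpha> \<mu> N" "?I - e / 4 < fisher_info \<Theta> (\<lambda>u. P u \<bind> K) \<theta>0"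
    using optimal_info_bounds(2)[OF \<alpha> e4] by blast
  obtain \<delta>1 where d1: "0 < \<delta>1" and low: "\<And>\<tau> T k s. \<bar>\<tau> - \<theta>0\<bar> < \<delta>1 \<Longrightarrow> (\<lambda>x. T (x, \<tau>)) \<in> \<mu> \<rightarrow>\<^sub>M count_space UNIV \<Longrightarrow>
     (\<forall>x\<in>space \<mu>. T (x, \<tau>) \<in> {1..k}) \<Longrightarrow> s \<tau> \<in> borel_measurable \<mu> \<Longrightarrow> (AE x in \<mu>. s \<tau> x * p \<tau> x = p1 \<tau> x) \<Longrightarrow>
     quant_error \<mu> P p s T k \<tau> < \<delta>1 \<Longrightarrow>
     (\<exists>R\<in>private_kernels \<alpha> (count_space {1..k}) (count_space {1..k}).
        fisher_info \<Theta> (\<lambda>u. P u \<bind> K) \<theta>0 - e / 4 \<le> fisher_info \<Theta> (\<lambda>u. P u \<bind> (R \<circ> (\<lambda>x. T (x, \<tau>)))) \<tau>)"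
    using fisher_info_lower[OF \<alpha> K(1) e4] by blast
  obtain \<delta>2 M where d2: "0 < \<delta>2" and qe: "\<And>m \<tau>. M \<le> m \<Longrightarrow> \<tau> \<in> \<Theta> \<Longrightarrow> \<bar>\<tau> - \<theta>0\<bar> < \<delta>2 \<Longrightarrow>
      quant_error \<mu> P p s (T m) (k m \<tau>) \<tau> < \<delta>1"
    using quant_error_uniform[OF quant in_ball_Theta[OF center] d1] by blast
  define L where "L = info_const \<alpha> * (exp \<alpha> * C)"
  have L0: "0 \<le> L" using info_const_nonneg C1 by (simp add: L_def)
  define \<delta> where "\<delta> = min (min \<delta>1 \<delta>2) (min r (e / (4 * (1 + L))))"
  have d: "0 < \<delta>" "\<delta> \<le> \<delta>1" "\<delta> \<le> \<delta>2" "\<delta> \<le> r" using d1 d2 r e L0 by (auto simp: \<delta>_def)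
  have Ld: "L * \<delta> \<le> e / 4"
  proof -
    have "L * \<delta> \<le> (1 + L) * \<delta>" using d(1) by (simp add: algebra_simps)
    also have "\<dots> \<le> (1 + L) * (e / (4 * (1 + L)))" using L0 by (intro mult_left_mono) (auto simp: \<delta>_def)
    also have "\<dots> = e / 4"
    proof -
      have "D * (e / (4 * D)) = e / 4" if "0 < D" for D :: real using that by simp
      from this[of "1 + L"] show ?thesis using L0 by linarith
    qed
    finally show ?thesis .
  qed
  show ?thesis
  proof (intro exI[of _ \<delta>] conjI d exI[of _ "max M 1"] allI impI)
    fix m \<tau> t assume m: "max M 1 \<le> m" and t: "\<bar>\<tau> - \<theta>0\<bar> < \<delta>" "\<bar>t - \<theta>0\<bar> < \<delta>"
    have m': "1 \<le> m" "M \<le> m" using m by auto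
    have tb: "\<tau> \<in> ball \<theta>0 r" "t \<in> ball \<theta>0 r" using t d(4) by (auto simp: dist_real_def)
    have tT: "\<tau> \<in> \<Theta>" using tb in_ball_Theta by auto
    have Tm: "T m \<in> \<mu> \<Otimes>\<^sub>M param_space \<Theta> \<rightarrow>\<^sub>M pos_nats" and Tk: "T m (x, \<tau>) \<in> {1..k m \<tau>}" if "x \<in> space \<mu>" for x
      using quant m' tT that unfolding consistent_quantizer_def by blast+
    have Tm: "T m \<in> \<mu> \<Otimes>\<^sub>M param_space \<Theta> \<rightarrow>\<^sub>M pos_nats"
      using quant m' unfolding consistent_quantizer_def by blast
    let ?R = "\<lambda>y. restrict_space (Q m (y, \<tau>)) {1..k m \<tau>}"
    let ?K = "?R \<circ> (\<lambda>x. T m (x, \<tau>))"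
    note S = stage2_kernel[OF mx[OF m'(1)] Tm Tk tT]
    note rows = stage2_rows[OF mx[OF m'(1)] Tm Tk tT]
    have si: "stage2_info (T m) (k m) (Q m) \<tau> u = (\<Sum>i\<in>{1..k m \<tau>}. row_info (\<lambda>x. measure (?K x) {i}) u)" for u
      unfolding stage2_info_def info_def using S(4) by (intro sum.cong refl row_info_cong) auto
    have lip: "\<bar>stage2_info (T m) (k m) (Q m) \<tau> u - stage2_info (T m) (k m) (Q m) \<tau> v\<bar> \<le> L * \<bar>u - v\<bar>"
      if "u \<in> ball \<theta>0 r" "v \<in> ball \<theta>0 r" for u v
      using info_lipschitz[OF \<alpha> rows that] by (simp add: stage2_info_def L_def mult.assoc)
    have "stage2_info (T m) (k m) (Q m) \<tau> \<theta>0 \<le> ?I"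
      using finite_channel_info_le[OF \<alpha> inf S(2) finite_atLeastAtMost] by (simp only: si info_def)
    moreover have "L * \<bar>t - \<theta>0\<bar> \<le> L * \<delta>" using t L0 by (intro mult_left_mono) auto
    hence "L * \<bar>t - \<theta>0\<bar> \<le> e / 4" using Ld by (rule order_trans)
    ultimately have up: "stage2_info (T m) (k m) (Q m) \<tau> t \<le> ?I + e / 4"
      using lip[OF tb(2) center] by linarith
    have "\<exists>R\<in>private_kernels \<alpha> (count_space {1..k m \<tau>}) (count_space {1..k m \<tau>}).
        fisher_info \<Theta> (\<lambda>u. P u \<bind> K) \<theta>0 - e / 4 \<le> fisher_info \<Theta> (\<lambda>u. P u \<bind> (R \<circ> (\<lambda>x. T m (x, \<tau>)))) \<tau>"
      by (rule low) (use t d S(1) Tk s tb qe[OF m'(2) tT] in auto)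
    then obtain R where R: "R \<in> private_kernels \<alpha> (count_space {1..k m \<tau>}) (count_space {1..k m \<tau>})"
      "fisher_info \<Theta> (\<lambda>u. P u \<bind> K) \<theta>0 - e / 4 \<le> fisher_info \<Theta> (\<lambda>u. P u \<bind> (R \<circ> (\<lambda>x. T m (x, \<tau>)))) \<tau>" by blast
    \<comment> \<open>the maximizer is at least as good as the imitation \<open>R\<close> of the nearly optimal channel\<close>
    have "\<not> fisher_info \<Theta> (\<lambda>u. P u \<bind> ?K) \<tau> < fisher_info \<Theta> (\<lambda>u. P u \<bind> (R \<circ> (\<lambda>x. T m (x, \<tau>)))) \<tau>"
      using mx[OF m'(1)] tT R(1) by (auto simp: measurable_info_maximizer_def is_arg_max_def)
    moreover have "fisher_info \<Theta> (\<lambda>u. P u \<bind> ?K) \<tau> = stage2_info (T m) (k m) (Q m) \<tau> \<tau>"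
      unfolding si by (rule fisher_info_discrete[OF S(2) finite_atLeastAtMost tb(1)])
    ultimately have lo: "?I - e / 2 \<le> stage2_info (T m) (k m) (Q m) \<tau> \<tau>" using R(2) K(2) by linarith
    have "\<bar>t - \<tau>\<bar> \<le> 2 * \<delta>" using t by linarith
    hence "L * \<bar>t - \<tau>\<bar> \<le> L * (2 * \<delta>)" using L0 by (rule mult_left_mono)
    hence "L * \<bar>t - \<tau>\<bar> \<le> e / 2" using Ld by simp
    hence "?I - e \<le> stage2_info (T m) (k m) (Q m) \<tau> t" using lo lip[OF tb(2,1)] by linarith
    with up show "\<bar>stage2_info (T m) (k m) (Q m) \<tau> t - ?I\<bar> \<le> e" using e by (auto simp: abs_le_iff)
  qed auto
qed

end

section \<open>Mixtures\<close>

lemma second_stage_kernel_measurable: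
  assumes P: "P0 \<in> space (prob_algebra \<mu>)"
    and est: "est \<in> MZ \<rightarrow>\<^sub>M param_space \<Theta>"
    and T: "T \<in> \<mu> \<Otimes>\<^sub>M param_space \<Theta> \<rightarrow>\<^sub>M pos_nats"
    and Q: "Q \<in> pos_nats \<Otimes>\<^sub>M param_space \<Theta> \<rightarrow>\<^sub>M prob_algebra pos_nats" and I: "finite I"
  shows "(\<lambda>z. PiM I (\<lambda>_. P0 \<bind> (\<lambda>x. Q (T (x, est z), est z)))) \<in> MZ \<rightarrow>\<^sub>M prob_algebra (PiM I (\<lambda>_. pos_nats))"
proof (rule measurable_PiM_kernel[OF I])
  note [measurable] = est T Q
  have "(\<lambda>(z, x). Q (T (x, est z), est z)) \<in> MZ \<Otimes>\<^sub>M \<mu> \<rightarrow>\<^sub>M prob_algebra pos_nats" by measurable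
  thus "(\<lambda>z. P0 \<bind> (\<lambda>x. Q (T (x, est z), est z))) \<in> MZ \<rightarrow>\<^sub>M prob_algebra pos_nats"
    by (rule measurable_bind_prob_space2[OF measurable_const[OF P]])
qed

text \<open>The law \<open>L\<close> of a pair whose first component has law \<open>R\<close> and whose second component has law
  \<open>S z\<close> given the first.\<close>

locale mixture =
  fixes L :: "('z \<times> 'w) measure" and R :: "'z measure" and S :: "'z \<Rightarrow> 'w measure" and MZ MW
  assumes sL: "sets L = sets (MZ \<Otimes>\<^sub>M MW)" and pL: "prob_space L" and sR: "sets R = sets MZ" and pR: "prob_space R"
    and S: "S \<in> MZ \<rightarrow>\<^sub>M prob_algebra MW"
    and nn: "\<And>f. f \<in> borel_measurable (MZ \<Otimes>\<^sub>M MW) \<Longrightarrow> (\<integral>\<^sup>+y. f y \<partial>L) = (\<integral>\<^sup>+z. \<integral>\<^sup>+w. f (z, w) \<partial>S z \<partial>R)"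
begin

lemma S_prob: "z \<in> space MZ \<Longrightarrow> prob_space (S z)" and S_sets: "z \<in> space MZ \<Longrightarrow> sets (S z) = sets MW"
  using measurable_space[OF S] by (auto simp: space_prob_algebra)

lemma spaces: "space R = space MZ" "space L = space MZ \<times> space MW" "z \<in> space MZ \<Longrightarrow> space (S z) = space MW"
  using sets_eq_imp_space_eq[OF sR] sets_eq_imp_space_eq[OF sL] sets_eq_imp_space_eq[OF S_sets] by (auto simp: space_pair_measure)

lemma section_measurable: "f \<in> MZ \<Otimes>\<^sub>M MW \<rightarrow>\<^sub>M N \<Longrightarrow> z \<in> space MZ \<Longrightarrow> (\<lambda>w. f (z, w)) \<in> S z \<rightarrow>\<^sub>M N"
  by (subst measurable_cong_sets[OF S_sets refl], assumption) (rule measurable_compose[OF measurable_Pair1'])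

lemma inner_measurable:
  fixes f :: "'z \<times> 'w \<Rightarrow> ennreal"
  assumes "f \<in> borel_measurable (MZ \<Otimes>\<^sub>M MW)"
  shows "(\<lambda>z. \<integral>\<^sup>+w. f (z, w) \<partial>S z) \<in> borel_measurable MZ"
  using nn_integral_measurable_subprob_algebra2[of "\<lambda>z w. f (z, w)", OF _ measurable_prob_algebraD[OF S]] assms by simp

text \<open>The disintegration holds for nonnegative functions; shifting by \<open>B\<close> extends it to bounded
  ones.\<close>

lemma integral_real:
  fixes f :: "'z \<times> 'w \<Rightarrow> real"
  assumes f: "f \<in> borel_measurable (MZ \<Otimes>\<^sub>M MW)" and b: "\<And>y. \<bar>f y\<bar> \<le> B"
  shows "(\<lambda>z. \<integral>w. f (z, w) \<partial>S z) \<in> borel_measurable MZ" "(\<integral>y. f y \<partial>L) = (\<integral>z. \<integral>w. f (z, w) \<partial>S z \<partial>R)"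
proof -
  interpret L: prob_space L by (rule pL)
  interpret R: prob_space R by (rule pR)
  have B0: "0 \<le> B" using b[of undefined] by linarith
  define g where "g y = f y + B" for y
  have g: "0 \<le> g y" "g y \<le> 2 * B" for y using b[of y] by (auto simp: g_def abs_le_iff)
  have gm: "g \<in> borel_measurable (MZ \<Otimes>\<^sub>M MW)" unfolding g_def using f by simp
  define G where "G z = (\<integral>w. g (z, w) \<partial>S z)" for z
  have Gn: "(\<integral>\<^sup>+w. ennreal (g (z, w)) \<partial>S z) = ennreal (G z)" and fG: "(\<integral>w. f (z, w) \<partial>S z) = G z - B"
    and Gb: "0 \<le> G z" "G z \<le> 2 * B" if z: "z \<in> space MZ" for z
  proof -
    interpret Sz: prob_space "S z" by (rule S_prob[OF z])
    have i: "integrable (S z) (\<lambda>w. g (z, w))"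
      using g section_measurable[OF gm z] by (intro Sz.integrable_const_bound[of _ "2 * B"]) auto
    show "(\<integral>\<^sup>+w. ennreal (g (z, w)) \<partial>S z) = ennreal (G z)"
      unfolding G_def using g by (intro nn_integral_eq_integral i) auto
    have "integrable (S z) (\<lambda>w. f (z, w))"
      using b section_measurable[OF f z] by (intro Sz.integrable_const_bound[of _ B]) auto
    thus "(\<integral>w. f (z, w) \<partial>S z) = G z - B" by (simp add: G_def g_def Sz.prob_space)
    show "0 \<le> G z" unfolding G_def using g by (intro integral_nonneg_AE) auto
    have "G z \<le> (\<integral>w. 2 * B \<partial>S z)" unfolding G_def by (rule integral_mono[OF i]) (use g in auto)
    thus "G z \<le> 2 * B" by (simp add: Sz.prob_space)
  qed
  have "(\<lambda>z. enn2real (\<integral>\<^sup>+w. ennreal (g (z, w)) \<partial>S z)) \<in> borel_measurable MZ"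
    using inner_measurable[of "\<lambda>y. ennreal (g y)"] gm by simp
  hence Gm: "G \<in> borel_measurable MZ"
    by (rule measurable_cong[THEN iffD1, rotated]) (simp add: Gn Gb)
  have "(\<lambda>z. G z - B) \<in> borel_measurable MZ" using Gm by simp
  thus "(\<lambda>z. \<integral>w. f (z, w) \<partial>S z) \<in> borel_measurable MZ"
    by (rule measurable_cong[THEN iffD1, rotated]) (simp add: fG)
  have GmR: "G \<in> borel_measurable R" using Gm by (simp only: measurable_cong_sets[OF sR refl])
  have GiR: "integrable R G" using Gb spaces GmR by (intro R.integrable_const_bound[of _ "2 * B"]) auto
  have gL1: "integrable L g"
    using g gm by (intro L.integrable_const_bound[of _ "2 * B"]) (auto simp: measurable_cong_sets[OF sL refl])
  have gL2: "integrable L f"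
    using b f by (intro L.integrable_const_bound[of _ B]) (auto simp: measurable_cong_sets[OF sL refl])
  note gL = gL1 gL2
  have "ennreal (\<integral>y. g y \<partial>L) = (\<integral>\<^sup>+y. ennreal (g y) \<partial>L)" using g by (intro nn_integral_eq_integral[symmetric] gL) auto
  also have "\<dots> = (\<integral>\<^sup>+z. \<integral>\<^sup>+w. ennreal (g (z, w)) \<partial>S z \<partial>R)" by (rule nn) (use gm in simp)
  also have "\<dots> = (\<integral>\<^sup>+z. ennreal (G z) \<partial>R)" using spaces by (intro nn_integral_cong Gn) simp
  also have "\<dots> = ennreal (\<integral>z. G z \<partial>R)" using Gb spaces by (intro nn_integral_eq_integral GiR) auto
  finally have "(\<integral>y. g y \<partial>L) = (\<integral>z. G z \<partial>R)"
    using g Gb spaces by (subst (asm) ennreal_inj) (auto intro!: integral_nonneg_AE)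
  moreover have "(\<integral>y. g y \<partial>L) = (\<integral>y. f y \<partial>L) + B" unfolding g_def using gL(2) by (simp add: L.prob_space)
  moreover have "(\<integral>z. \<integral>w. f (z, w) \<partial>S z \<partial>R) = (\<integral>z. G z - B \<partial>R)"
    using spaces by (intro Bochner_Integration.integral_cong) (auto simp: fG)
  ultimately show "(\<integral>y. f y \<partial>L) = (\<integral>z. \<integral>w. f (z, w) \<partial>S z \<partial>R)" using GiR by (simp add: R.prob_space)
qed

text \<open>Used to integrate a conditional central limit theorem that holds only for \<open>z\<close> outside
  \<open>A\<close>.\<close>

lemma integral_close:
  fixes F :: "'z \<times> 'w \<Rightarrow> complex"
  assumes F[measurable]: "F \<in> borel_measurable (MZ \<Otimes>\<^sub>M MW)" and b: "\<And>y. cmod (F y) \<le> 1" and c: "cmod c \<le> 1"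
    and A: "A \<in> sets MZ" and close: "\<And>z. z \<in> space MZ - A \<Longrightarrow> cmod ((\<integral>w. F (z, w) \<partial>S z) - c) \<le> \<epsilon>" and e: "0 \<le> \<epsilon>"
  shows "cmod ((\<integral>y. F y \<partial>L) - c) \<le> \<epsilon> + 2 * measure R A"
proof -
  interpret L: prob_space L by (rule pL)
  interpret R: prob_space R by (rule pR)
  have FL: "integrable L F" using b F by (intro L.integrable_const_bound[of _ 1]) (auto simp: measurable_cong_sets[OF sL refl])
  have Re: "\<bar>Re (F y)\<bar> \<le> 1" and Im: "\<bar>Im (F y)\<bar> \<le> 1" for y
    using b[of y] abs_Re_le_cmod[of "F y"] abs_Im_le_cmod[of "F y"] by linarith+
  have Rm: "(\<lambda>y. Re (F y)) \<in> borel_measurable (MZ \<Otimes>\<^sub>M MW)" and Imm: "(\<lambda>y. Im (F y)) \<in> borel_measurable (MZ \<Otimes>\<^sub>M MW)" by measurable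
  note I = integral_real[OF Rm Re] integral_real[OF Imm Im]
  define \<Phi> where "\<Phi> z = (\<integral>w. F (z, w) \<partial>S z)" for z
  have \<Phi>c: "\<Phi> z = Complex (\<integral>w. Re (F (z, w)) \<partial>S z) (\<integral>w. Im (F (z, w)) \<partial>S z)" and \<Phi>b: "cmod (\<Phi> z) \<le> 1" if z: "z \<in> space MZ" for z
  proof -
    interpret Sz: prob_space "S z" by (rule S_prob[OF z])
    have i: "integrable (S z) (\<lambda>w. F (z, w))"
      using b section_measurable[OF F z] by (intro Sz.integrable_const_bound[of _ 1]) auto
    thus "\<Phi> z = Complex (\<integral>w. Re (F (z, w)) \<partial>S z) (\<integral>w. Im (F (z, w)) \<partial>S z)" by (simp add: complex_eq_iff \<Phi>_def)
    have "cmod (\<Phi> z) \<le> (\<integral>w. cmod (F (z, w)) \<partial>S z)" unfolding \<Phi>_def by (rule integral_norm_bound)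
    also have "\<dots> \<le> (\<integral>w. 1 \<partial>S z)" using b i by (intro integral_mono) auto
    finally show "cmod (\<Phi> z) \<le> 1" by (simp add: Sz.prob_space)
  qed
  have "(\<lambda>z. Complex (\<integral>w. Re (F (z, w)) \<partial>S z) (\<integral>w. Im (F (z, w)) \<partial>S z)) \<in> borel_measurable MZ"
    unfolding Complex_eq using I(1,3) by simp
  hence \<Phi>m: "\<Phi> \<in> borel_measurable MZ" by (rule measurable_cong[THEN iffD1, rotated]) (simp add: \<Phi>c)
  have \<Phi>i: "integrable R \<Phi>"
    using \<Phi>b spaces \<Phi>m by (intro R.integrable_const_bound[of _ 1]) (auto simp: measurable_cong_sets[OF sR refl])
  have FP: "(\<integral>y. F y \<partial>L) = (\<integral>z. \<Phi> z \<partial>R)"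
  proof -
    have re: "Re (\<Phi> z) = (\<integral>w. Re (F (z, w)) \<partial>S z)" and im: "Im (\<Phi> z) = (\<integral>w. Im (F (z, w)) \<partial>S z)" if "z \<in> space R" for z
      using \<Phi>c[of z] that spaces by auto
    have "Re (\<integral>y. F y \<partial>L) = Re (\<integral>z. \<Phi> z \<partial>R)"
      using FL \<Phi>i I(2) re by (simp flip: integral_Re cong: Bochner_Integration.integral_cong)
    moreover have "Im (\<integral>y. F y \<partial>L) = Im (\<integral>z. \<Phi> z \<partial>R)"
      using FL \<Phi>i I(4) im by (simp flip: integral_Im cong: Bochner_Integration.integral_cong)
    ultimately show ?thesis by (simp add: complex_eq_iff)
  qed
  have i1: "integrable R (indicator A :: 'z \<Rightarrow> real)" using A sR by (intro integrable_real_indicator) (auto simp: less_top[symmetric])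
  hence iA: "integrable R (\<lambda>z. \<epsilon> + 2 * indicator A z)" by (intro Bochner_Integration.integrable_add integrable_mult_right) auto
  have "(\<integral>y. F y \<partial>L) - c = (\<integral>z. \<Phi> z - c \<partial>R)" using FP \<Phi>i by (simp add: R.prob_space)
  also have "cmod \<dots> \<le> (\<integral>z. cmod (\<Phi> z - c) \<partial>R)" by (rule integral_norm_bound)
  also have "\<dots> \<le> (\<integral>z. \<epsilon> + 2 * indicator A z \<partial>R)"
  proof (rule integral_mono[OF _ iA])
    fix z assume "z \<in> space R"
    hence z: "z \<in> space MZ" using spaces by simp
    show "cmod (\<Phi> z - c) \<le> \<epsilon> + 2 * indicator A z"
    proof (cases "z \<in> A")
      case True thus ?thesis using norm_triangle_ineq4[of "\<Phi> z" c] \<Phi>b[OF z] c e by simp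
    next
      case False thus ?thesis using close[of z] z by (simp add: \<Phi>_def)
    qed
  qed (use \<Phi>i in auto)
  also have "\<dots> = \<epsilon> + 2 * measure R A"
    using i1 A sR sets.sets_into_space[OF A] spaces(1) R.prob_space
    by (subst Bochner_Integration.integral_add) (auto simp: Int_absorb2)
  finally show ?thesis .
qed

lemma measure_le:
  assumes B: "B \<in> sets (MZ \<Otimes>\<^sub>M MW)" and A: "A \<in> sets MZ" and e: "0 \<le> \<epsilon>"
    and le: "\<And>z. z \<in> space MZ - A \<Longrightarrow> measure (S z) {w \<in> space MW. (z, w) \<in> B} \<le> \<epsilon>"
  shows "measure L B \<le> \<epsilon> + measure R A"
proof -
  interpret L: prob_space L by (rule pL)
  interpret R: prob_space R by (rule pR)
  have "emeasure L B = (\<integral>\<^sup>+y. indicator B y \<partial>L)" using B sL by simp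
  also have "\<dots> = (\<integral>\<^sup>+z. \<integral>\<^sup>+w. indicator B (z, w) \<partial>S z \<partial>R)" by (rule nn) (use B in simp)
  also have "\<dots> \<le> (\<integral>\<^sup>+z. ennreal \<epsilon> + indicator A z \<partial>R)"
  proof (rule nn_integral_mono)
    fix z assume "z \<in> space R"
    hence z: "z \<in> space MZ" using spaces by simp
    interpret Sz: prob_space "S z" by (rule S_prob[OF z])
    have Bz: "{w \<in> space MW. (z, w) \<in> B} \<in> sets (S z)"
    proof -
      have "{w \<in> space MW. (z, w) \<in> B} = Pair z -` B" using sets.sets_into_space[OF B] by (auto simp: space_pair_measure)
      thus ?thesis using sets_Pair1[OF B, of z] S_sets[OF z] by simp
    qed
    have "(\<integral>\<^sup>+w. indicator B (z, w) \<partial>S z) = (\<integral>\<^sup>+w. indicator {w \<in> space MW. (z, w) \<in> B} w \<partial>S z)"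
      using spaces(3)[OF z] by (intro nn_integral_cong) (auto simp: indicator_def)
    also have "\<dots> = ennreal (measure (S z) {w \<in> space MW. (z, w) \<in> B})" using Bz by (simp add: Sz.emeasure_eq_measure)
    finally have eq: "(\<integral>\<^sup>+w. indicator B (z, w) \<partial>S z) = ennreal (measure (S z) {w \<in> space MW. (z, w) \<in> B})" .
    show "(\<integral>\<^sup>+w. indicator B (z, w) \<partial>S z) \<le> ennreal \<epsilon> + indicator A z"
    proof (cases "z \<in> A")
      case True
      have "ennreal (measure (S z) {w \<in> space MW. (z, w) \<in> B}) \<le> 1" by (simp add: ennreal_le_1)
      thus ?thesis using True by (simp add: eq add_increasing)
    next
      case False thus ?thesis using le[of z] z by (simp add: eq ennreal_leI)
    qed
  qed
  also have "\<dots> = ennreal \<epsilon> + emeasure R A" using A sR R.emeasure_space_1 by (subst nn_integral_add) auto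
  also have "\<dots> = ennreal (\<epsilon> + measure R A)" using e by (simp add: R.emeasure_eq_measure)
  finally have "ennreal (measure L B) \<le> ennreal (\<epsilon> + measure R A)" by (simp only: L.emeasure_eq_measure)
  thus ?thesis using e by (subst (asm) ennreal_le_iff) auto
qed

lemma measure_fst:
  assumes A: "A \<in> sets MZ"
  shows "measure L {y \<in> space L. fst y \<in> A} = measure R A"
proof -
  interpret L: prob_space L by (rule pL)
  interpret R: prob_space R by (rule pR)
  have e: "{y \<in> space L. fst y \<in> A} = A \<times> space MW" using spaces sets.sets_into_space[OF A] by auto
  have s: "A \<times> space MW \<in> sets (MZ \<Otimes>\<^sub>M MW)" using A by simp
  have "emeasure L (A \<times> space MW) = (\<integral>\<^sup>+y. indicator (A \<times> space MW) y \<partial>L)" using s sL by simp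
  also have "\<dots> = (\<integral>\<^sup>+z. \<integral>\<^sup>+w. indicator (A \<times> space MW) (z, w) \<partial>S z \<partial>R)" by (rule nn) (use s in simp)
  also have "\<dots> = (\<integral>\<^sup>+z. indicator A z \<partial>R)"
  proof (rule nn_integral_cong)
    fix z assume "z \<in> space R"
    hence z: "z \<in> space MZ" using spaces by simp
    interpret Sz: prob_space "S z" by (rule S_prob[OF z])
    have "(\<integral>\<^sup>+w. indicator (A \<times> space MW) (z, w) \<partial>S z) = (\<integral>\<^sup>+w. indicator A z \<partial>S z)"
      using spaces(3)[OF z] by (intro nn_integral_cong) (auto simp: indicator_def)
    thus "(\<integral>\<^sup>+w. indicator (A \<times> space MW) (z, w) \<partial>S z) = indicator A z" by (simp add: Sz.emeasure_space_1)
  qed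
  finally show ?thesis using A sR by (simp add: e measure_def)
qed

end

text \<open>Iterate the two inequalities, starting from an indicator function, which equals its
  square.\<close>

lemma mixture_chi_square:
  fixes c1 c2 :: ennreal
  assumes A: "mixture LA RA SA MZ MW" and B: "mixture LB RB SB MZ MW"
    and c1: "\<And>f. f \<in> borel_measurable MZ \<Longrightarrow> (\<integral>\<^sup>+z. f z \<partial>RB)\<^sup>2 \<le> c1 * (\<integral>\<^sup>+z. (f z)\<^sup>2 \<partial>RA)"
    and c2: "\<And>z f. z \<in> space MZ \<Longrightarrow> f \<in> borel_measurable MW \<Longrightarrow> (\<integral>\<^sup>+w. f w \<partial>SB z)\<^sup>2 \<le> c2 * (\<integral>\<^sup>+w. (f w)\<^sup>2 \<partial>SA z)"
    and E: "E \<in> sets (MZ \<Otimes>\<^sub>M MW)"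
  shows "(emeasure LB E)\<^sup>2 \<le> c1 * c2 * emeasure LA E"
proof -
  interpret A: mixture LA RA SA MZ MW by fact
  interpret B: mixture LB RB SB MZ MW by fact
  let ?f = "indicator E :: _ \<Rightarrow> ennreal"
  have fm: "?f \<in> borel_measurable (MZ \<Otimes>\<^sub>M MW)" using E by simp
  have f2: "(?f y)\<^sup>2 = ?f y" for y by (simp add: indicator_def)
  have "(emeasure LB E)\<^sup>2 = (\<integral>\<^sup>+z. (\<integral>\<^sup>+w. ?f (z, w) \<partial>SB z) \<partial>RB)\<^sup>2"
    using B.nn[OF fm] E B.sL by simp
  also have "\<dots> \<le> c1 * (\<integral>\<^sup>+z. (\<integral>\<^sup>+w. ?f (z, w) \<partial>SB z)\<^sup>2 \<partial>RA)" by (rule c1[OF B.inner_measurable[OF fm]])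
  also have "\<dots> \<le> c1 * (\<integral>\<^sup>+z. c2 * (\<integral>\<^sup>+w. ?f (z, w) \<partial>SA z) \<partial>RA)"
  proof (intro mult_left_mono nn_integral_mono)
    fix z assume "z \<in> space RA"
    hence z: "z \<in> space MZ" using A.spaces by simp
    have "(\<lambda>w. ?f (z, w)) \<in> borel_measurable MW" using measurable_compose[OF measurable_Pair1'[OF z] fm] .
    from c2[OF z this] show "(\<integral>\<^sup>+w. ?f (z, w) \<partial>SB z)\<^sup>2 \<le> c2 * (\<integral>\<^sup>+w. ?f (z, w) \<partial>SA z)" by (simp only: f2)
  qed simp
  also have "(\<integral>\<^sup>+z. c2 * (\<integral>\<^sup>+w. ?f (z, w) \<partial>SA z) \<partial>RA) = c2 * (\<integral>\<^sup>+z. (\<integral>\<^sup>+w. ?f (z, w) \<partial>SA z) \<partial>RA)"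
    using A.inner_measurable[OF fm] by (intro nn_integral_cmult) (simp add: measurable_cong_sets[OF A.sR refl])
  also have "(\<integral>\<^sup>+z. (\<integral>\<^sup>+w. ?f (z, w) \<partial>SA z) \<partial>RA) = emeasure LA E" using A.nn[OF fm] E A.sL by simp
  finally show ?thesis by (simp add: mult.assoc)
qed

section \<open>Sums of bounded independent variables\<close>

text \<open>The statistic \<open>h\<close> is summed over an iid sample from \<open>M\<close>. Boundedness makes the constants
  in the estimates explicit, so that they are uniform in \<open>M\<close> and \<open>h\<close>.\<close>

locale bounded_iid = prob_space M for M :: "'a measure" +
  fixes h :: "'a \<Rightarrow> real" and B :: real
  assumes h_meas[measurable]: "h \<in> borel_measurable M" and h_bound: "\<And>x. \<bar>h x\<bar> \<le> B" and h_mean: "(\<integral>x. h x \<partial>M) = 0"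
begin

lemma B_nonneg: "0 \<le> B" using h_bound[of undefined] by linarith

lemma h_int: "integrable M h" using h_bound by (intro integrable_const_bound[of _ B]) auto

lemma h_sq: "(h x)\<^sup>2 \<le> B\<^sup>2" using power_mono[OF h_bound[of x] abs_ge_zero, of 2] by simp

lemma h_sq_int: "integrable M (\<lambda>x. (h x)\<^sup>2)" using h_sq by (intro integrable_const_bound[of _ "B\<^sup>2"]) auto

sublocale PS: product_sigma_finite "\<lambda>_. M"
  by (simp add: product_sigma_finite_def sigma_finite_measure_axioms)

lemma PiM_prob: "prob_space (PiM I (\<lambda>_. M))" by (rule prob_space_PiM) (rule prob_space_axioms)

lemma sum_meas: "(\<lambda>w. \<Sum>i\<in>I. h (w i)) \<in> borel_measurable (PiM I (\<lambda>_. M))"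
  by (intro borel_measurable_sum measurable_compose[OF _ h_meas] measurable_component_singleton)

lemma sum_bound: "\<bar>\<Sum>i\<in>I. h (w i)\<bar> \<le> real (card I) * B"
  using order_trans[OF sum_abs sum_bounded_above[of I "\<lambda>i. \<bar>h (w i)\<bar>" B]] h_bound by simp

lemma sum_sq_int: "integrable (PiM I (\<lambda>_. M)) (\<lambda>w. (\<Sum>i\<in>I. h (w i))\<^sup>2)"
proof -
  interpret P: prob_space "PiM I (\<lambda>_. M)" by (rule PiM_prob)
  have "(\<Sum>i\<in>I. h (w i))\<^sup>2 \<le> (real (card I) * B)\<^sup>2" for w
    using power_mono[OF sum_bound[of w I] abs_ge_zero, of 2] by simp
  thus ?thesis using sum_meas[of I] by (intro P.integrable_const_bound[of _ "(real (card I) * B)\<^sup>2"]) auto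
qed

lemma second_moment_sum: "finite I \<Longrightarrow> (\<integral>w. (\<Sum>i\<in>I. h (w i))\<^sup>2 \<partial>PiM I (\<lambda>_. M)) \<le> real (card I) * B\<^sup>2"
proof (induction I rule: finite_induct)
  case empty
  interpret P: prob_space "PiM {} (\<lambda>_. M)" by (rule PiM_prob)
  show ?case by simp
next
  case (insert i I)
  interpret P: prob_space "PiM I (\<lambda>_. M)" by (rule PiM_prob)
  have v: "(\<integral>y. (h y)\<^sup>2 \<partial>M) \<le> B\<^sup>2"
    using integral_mono[OF h_sq_int, of "\<lambda>_. B\<^sup>2"] h_sq by (simp add: prob_space)
  have "(\<integral>w. (\<Sum>j\<in>insert i I. h (w j))\<^sup>2 \<partial>PiM (insert i I) (\<lambda>_. M))
    = (\<integral>x. (\<integral>y. (\<Sum>j\<in>insert i I. h ((x(i := y)) j))\<^sup>2 \<partial>M) \<partial>PiM I (\<lambda>_. M))"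
    by (rule PS.product_integral_insert[OF insert.hyps sum_sq_int])
  also have "\<dots> = (\<integral>x. (\<Sum>j\<in>I. h (x j))\<^sup>2 + (\<integral>y. (h y)\<^sup>2 \<partial>M) \<partial>PiM I (\<lambda>_. M))"
  proof (rule Bochner_Integration.integral_cong[OF refl])
    fix x
    define s where "s = (\<Sum>j\<in>I. h (x j))"
    have "(\<Sum>j\<in>insert i I. h ((x(i := y)) j)) = h y + s" for y
    proof -
      have "(\<Sum>j\<in>I. h ((x(i := y)) j)) = s" unfolding s_def using insert.hyps by (intro sum.cong) auto
      thus ?thesis using insert.hyps by simp
    qed
    hence "(\<integral>y. (\<Sum>j\<in>insert i I. h ((x(i := y)) j))\<^sup>2 \<partial>M) = (\<integral>y. (h y)\<^sup>2 + s\<^sup>2 + 2 * s * h y \<partial>M)"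
      by (simp add: power2_sum mult.commute mult.left_commute)
    also have "\<dots> = s\<^sup>2 + (\<integral>y. (h y)\<^sup>2 \<partial>M)" using h_int h_sq_int h_mean by (simp add: prob_space)
    finally show "(\<integral>y. (\<Sum>j\<in>insert i I. h ((x(i := y)) j))\<^sup>2 \<partial>M) = (\<Sum>j\<in>I. h (x j))\<^sup>2 + (\<integral>y. (h y)\<^sup>2 \<partial>M)" by (simp add: s_def)
  qed
  also have "\<dots> = (\<integral>x. (\<Sum>j\<in>I. h (x j))\<^sup>2 \<partial>PiM I (\<lambda>_. M)) + (\<integral>y. (h y)\<^sup>2 \<partial>M)"
    using sum_sq_int[of I] by (simp add: P.prob_space)
  also have "\<dots> \<le> real (card I) * B\<^sup>2 + B\<^sup>2" using insert.IH v by simp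
  finally show ?case using insert.hyps by (simp add: algebra_simps)
qed

text \<open>Chebyshev's inequality.\<close>

lemma sum_tail:
  assumes I: "finite I" and a: "0 < a"
  shows "measure (PiM I (\<lambda>_. M)) {w \<in> space (PiM I (\<lambda>_. M)). a \<le> \<bar>\<Sum>i\<in>I. h (w i)\<bar>} \<le> real (card I) * B\<^sup>2 / a\<^sup>2"
proof -
  interpret P: prob_space "PiM I (\<lambda>_. M)" by (rule PiM_prob)
  let ?E = "{w \<in> space (PiM I (\<lambda>_. M)). a \<le> \<bar>\<Sum>i\<in>I. h (w i)\<bar>}"
  have Es: "?E \<in> sets (PiM I (\<lambda>_. M))" using sum_meas[of I] by measurable
  have "a\<^sup>2 * measure (PiM I (\<lambda>_. M)) ?E = (\<integral>w. a\<^sup>2 * indicator ?E w \<partial>PiM I (\<lambda>_. M))" using Es by simp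
  also have "\<dots> \<le> (\<integral>w. (\<Sum>i\<in>I. h (w i))\<^sup>2 \<partial>PiM I (\<lambda>_. M))"
  proof (rule integral_mono[OF _ sum_sq_int])
    show "integrable (PiM I (\<lambda>_. M)) (\<lambda>w. a\<^sup>2 * indicator ?E w)"
      using Es by (intro integrable_mult_right integrable_real_indicator) (auto simp: less_top[symmetric])
    fix w
    show "a\<^sup>2 * indicator ?E w \<le> (\<Sum>i\<in>I. h (w i))\<^sup>2"
    proof (cases "w \<in> ?E")
      case True
      hence "a\<^sup>2 \<le> \<bar>\<Sum>i\<in>I. h (w i)\<bar>\<^sup>2" using a by (intro power_mono) auto
      thus ?thesis using True by simp
    qed simp
  qed
  also have "\<dots> \<le> real (card I) * B\<^sup>2" by (rule second_moment_sum[OF I])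
  finally show ?thesis using a by (simp add: le_divide_eq mult.commute)
qed

text \<open>The third-order Taylor bound for characteristic functions, followed by \<open>\<bar>1 - x - e\<^sup>-\<^sup>x\<bar> \<le>
  x\<^sup>2\<close> at \<open>x = u\<^sup>2 v / 2\<close> with \<open>v\<close> the variance.\<close>

lemma char_close:
  "cmod ((\<integral>x. iexp (u * h x) \<partial>M) - complex_of_real (exp (- (u\<^sup>2 * (\<integral>x. (h x)\<^sup>2 \<partial>M) / 2)))) \<le> \<bar>u\<bar>^3 * B^3 + u^4 * B^4"
proof -
  define v where "v = (\<integral>x. (h x)\<^sup>2 \<partial>M)"
  have v: "0 \<le> v" "v \<le> B\<^sup>2"
    using integral_mono[OF h_sq_int, of "\<lambda>_. B\<^sup>2"] h_sq by (auto simp: prob_space v_def intro: integral_nonneg_AE)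
  have ch: "char (distr M borel h) u = (\<integral>x. iexp (u * h x) \<partial>M)"
    unfolding char_def by (rule integral_distr) auto
  have "cmod (char (distr M borel h) u - (1 - u^2 * v / 2)) \<le> (u^2 / 6) * expectation (\<lambda>x. min (6 * (h x)^2) (\<bar>u\<bar> * \<bar>h x\<bar>^3))"
    by (rule char_approx3') (auto simp: h_int h_sq_int h_mean v_def)
  also have "expectation (\<lambda>x. min (6 * (h x)^2) (\<bar>u\<bar> * \<bar>h x\<bar>^3)) \<le> expectation (\<lambda>x. \<bar>u\<bar> * B^3)"
  proof (rule integral_mono)
    show "integrable M (\<lambda>x. min (6 * (h x)^2) (\<bar>u\<bar> * \<bar>h x\<bar>^3))"
    proof (rule integrable_const_bound[of _ "6 * B\<^sup>2"])
      have "norm (min (6 * (h x)^2) (\<bar>u\<bar> * \<bar>h x\<bar>^3)) \<le> 6 * B\<^sup>2" for x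
      proof -
        have "0 \<le> min (6 * (h x)^2) (\<bar>u\<bar> * \<bar>h x\<bar>^3)" by simp
        moreover have "min (6 * (h x)^2) (\<bar>u\<bar> * \<bar>h x\<bar>^3) \<le> 6 * (h x)\<^sup>2" by (rule min.cobounded1)
        ultimately show ?thesis using h_sq[of x] by simp
      qed
      thus "AE x in M. norm (min (6 * (h x)^2) (\<bar>u\<bar> * \<bar>h x\<bar>^3)) \<le> 6 * B\<^sup>2" by simp
    qed measurable
    fix x
    have "\<bar>h x\<bar>^3 \<le> B^3" using h_bound by (intro power_mono) auto
    hence "\<bar>u\<bar> * \<bar>h x\<bar>^3 \<le> \<bar>u\<bar> * B^3" by (intro mult_left_mono) auto
    thus "min (6 * (h x)^2) (\<bar>u\<bar> * \<bar>h x\<bar>^3) \<le> \<bar>u\<bar> * B^3" by simp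
  qed auto
  also have "expectation (\<lambda>x. \<bar>u\<bar> * B^3) = \<bar>u\<bar> * B^3" by (simp add: prob_space)
  finally have 1: "cmod (char (distr M borel h) u - (1 - u^2 * v / 2)) \<le> (u^2 / 6) * (\<bar>u\<bar> * B^3)"
    by (simp add: mult_left_mono)
  have u3: "(u^2 / 6) * (\<bar>u\<bar> * B^3) \<le> \<bar>u\<bar>^3 * B^3"
  proof -
    have "(u^2 / 6) * (\<bar>u\<bar> * B^3) = (\<bar>u\<bar>^3 * B^3) / 6" by (simp add: power3_eq_cube power2_eq_square)
    also have "\<dots> \<le> \<bar>u\<bar>^3 * B^3" using B_nonneg by simp
    finally show ?thesis .
  qed
  define x where "x = u\<^sup>2 * v / 2"
  have x0: "0 \<le> x" using v by (simp add: x_def)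
  have e1: "1 - x \<le> exp (- x)" using exp_ge_add_one_self[of "- x"] by simp
  have e2: "exp (- x) \<le> 1 - x + x\<^sup>2"
  proof -
    have "exp (- x) \<le> 1 / (1 + x)"
      using exp_ge_add_one_self[of x] x0 by (simp add: exp_minus inverse_eq_divide frac_le)
    also have "1 / (1 + x) \<le> 1 - x + x\<^sup>2"
    proof -
      have "1 \<le> (1 - x + x\<^sup>2) * (1 + x)" using x0 by (simp add: algebra_simps power2_eq_square)
      thus ?thesis using x0 by (simp add: divide_le_eq)
    qed
    finally show ?thesis .
  qed
  have "x \<le> u\<^sup>2 * B\<^sup>2" using mult_left_mono[OF v(2) zero_le_power2[of u]] x0 unfolding x_def by linarith
  hence "x\<^sup>2 \<le> (u\<^sup>2 * B\<^sup>2)\<^sup>2" using x0 by (intro power_mono) auto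
  also have "\<dots> = u^4 * B^4" by (simp add: power_mult_distrib flip: power_mult)
  finally have x2: "x\<^sup>2 \<le> u^4 * B^4" .
  have "cmod (complex_of_real (1 - x) - complex_of_real (exp (- x))) = \<bar>(1 - x) - exp (- x)\<bar>"
    by (simp only: of_real_diff[symmetric] norm_of_real)
  also have "\<dots> \<le> x\<^sup>2" using e1 e2 by (auto simp: abs_le_iff)
  finally have 2: "cmod (complex_of_real (1 - x) - complex_of_real (exp (- x))) \<le> u^4 * B^4" using x2 by simp
  have eq: "1 - u\<^sup>2 * v / 2 = 1 - x" by (simp add: x_def)
  have "cmod ((\<integral>x. iexp (u * h x) \<partial>M) - complex_of_real (exp (- x)))
    \<le> cmod ((\<integral>x. iexp (u * h x) \<partial>M) - complex_of_real (1 - x)) + cmod (complex_of_real (1 - x) - complex_of_real (exp (- x)))"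
    using norm_triangle_ineq[of "(\<integral>x. iexp (u * h x) \<partial>M) - complex_of_real (1 - x)" "complex_of_real (1 - x) - complex_of_real (exp (- x))"]
    by simp
  also have "cmod ((\<integral>x. iexp (u * h x) \<partial>M) - complex_of_real (1 - x)) \<le> \<bar>u\<bar>^3 * B^3"
    using 1 u3 unfolding ch x_def by (simp add: of_real_diff)
  finally show ?thesis using 2 by (simp add: x_def v_def)
qed

text \<open>A Lindeberg-type bound: powers of numbers in the unit disc differ by at most the exponent
  times the difference of the bases. No limit is taken, as the distribution of the second-stage
  scores depends on the first sample.\<close>

lemma char_sum_close:
  assumes I: "finite I"
  shows "cmod ((\<integral>w. iexp (u * (\<Sum>i\<in>I. h (w i))) \<partial>PiM I (\<lambda>_. M))
      - complex_of_real (exp (- (real (card I) * u\<^sup>2 * (\<integral>x. (h x)\<^sup>2 \<partial>M) / 2))))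
    \<le> real (card I) * (\<bar>u\<bar>^3 * B^3 + u^4 * B^4)"
proof -
  define \<phi> where "\<phi> = (\<integral>x. iexp (u * h x) \<partial>M)"
  define \<psi> where "\<psi> = complex_of_real (exp (- (u\<^sup>2 * (\<integral>x. (h x)\<^sup>2 \<partial>M) / 2)))"
  have i: "integrable M (\<lambda>x. iexp (u * h x))" by (intro integrable_const_bound[of _ 1]) auto
  have "(\<integral>w. iexp (u * (\<Sum>i\<in>I. h (w i))) \<partial>PiM I (\<lambda>_. M)) = (\<integral>w. (\<Prod>i\<in>I. iexp (u * h (w i))) \<partial>PiM I (\<lambda>_. M))"
    by (simp add: sum_distrib_left exp_sum[OF I] of_real_sum)
  also have "\<dots> = \<phi> ^ card I" unfolding \<phi>_def using PS.product_integral_prod[OF I, of "\<lambda>_ x. iexp (u * h x)"] i by simp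
  finally have 1: "(\<integral>w. iexp (u * (\<Sum>i\<in>I. h (w i))) \<partial>PiM I (\<lambda>_. M)) = \<phi> ^ card I" .
  have 2: "complex_of_real (exp (- (real (card I) * u\<^sup>2 * (\<integral>x. (h x)\<^sup>2 \<partial>M) / 2))) = \<psi> ^ card I"
    unfolding \<psi>_def of_real_power[symmetric] exp_of_nat_mult[symmetric] by (simp add: algebra_simps)
  have "cmod \<phi> \<le> (\<integral>x. cmod (iexp (u * h x)) \<partial>M)" unfolding \<phi>_def by (rule integral_norm_bound)
  hence n1: "cmod \<phi> \<le> 1" by (simp add: prob_space)
  have n2: "cmod \<psi> \<le> 1" unfolding \<psi>_def norm_of_real by (auto intro!: mult_nonneg_nonneg integral_nonneg_AE)
  show ?thesis unfolding 1 2
    using norm_power_diff[OF n1 n2, of "card I"] mult_left_mono[OF char_close[of u], of "real (card I)"]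
    unfolding \<phi>_def \<psi>_def by linarith
qed

end

section \<open>Scores of the second stage\<close>

lemma DERIV_of_quadratic_remainder:
  fixes f :: "real \<Rightarrow> real"
  assumes t: "t \<in> ball \<theta>0 r" and q: "\<And>u. u \<in> ball \<theta>0 r \<Longrightarrow> \<bar>f u - f t - (u - t) * D\<bar> \<le> B * (u - t)\<^sup>2" and B: "0 \<le> B"
  shows "(f has_real_derivative D) (at t)"
proof -
  obtain e where e: "0 < e" "ball t e \<subseteq> ball \<theta>0 r" using t open_contains_ball[of "ball \<theta>0 r"] open_ball by blast
  have "((\<lambda>h. (f (t + h) - f t) / h) \<longlongrightarrow> D) (at 0)"
  proof (rule LIM_zero_cancel, rule tendsto_0_le[where K = B])
    show "((\<lambda>h. h) \<longlongrightarrow> 0) (at (0::real))" by simp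
    show "\<forall>\<^sub>F h in at 0. norm ((f (t + h) - f t) / h - D) \<le> norm h * B"
      unfolding eventually_at
    proof (intro exI[of _ e] conjI e(1) ballI impI)
      fix h :: real assume "h \<noteq> 0 \<and> dist h 0 < e"
      hence h: "h \<noteq> 0" "t + h \<in> ball \<theta>0 r" using e(2) by (auto simp: subset_eq dist_real_def)
      have "(f (t + h) - f t) / h - D = (f (t + h) - f t - h * D) / h" using h(1) by (simp add: field_simps)
      hence "norm ((f (t + h) - f t) / h - D) = \<bar>f (t + h) - f t - h * D\<bar> / \<bar>h\<bar>" by simp
      also have "\<dots> \<le> B * h\<^sup>2 / \<bar>h\<bar>" using q[OF h(2)] by (intro divide_right_mono) auto
      also have "\<dots> = norm h * B" using h(1) by (simp add: power2_eq_square abs_if)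
      finally show "norm ((f (t + h) - f t) / h - D) \<le> norm h * B" .
    qed
  qed
  thus ?thesis by (simp add: DERIV_def)
qed

context l1_smooth_model
begin

text \<open>With \<open>f = p t\<close> this is the probability that a second-stage observation equals \<open>i\<close>, and
  with \<open>f = p1 t\<close> or \<open>f = p2 t\<close> it is the first or second derivative of this probability.\<close>

definition obs :: "('a \<Rightarrow> nat measure) \<Rightarrow> ('a \<Rightarrow> real) \<Rightarrow> nat \<Rightarrow> real" where
  "obs K f i = (\<integral>x. measure (K x) {i} * f x \<partial>\<mu>)"

definition score :: "('a \<Rightarrow> nat measure) \<Rightarrow> real \<Rightarrow> nat \<Rightarrow> real" where
  "score K t i = obs K (p1 t) i / obs K (p t) i"

definition hess :: "('a \<Rightarrow> nat measure) \<Rightarrow> real \<Rightarrow> nat \<Rightarrow> real" where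
  "hess K t i = obs K (p2 t) i / obs K (p t) i - (score K t i)\<^sup>2"

text \<open>The total mass is constant in the parameter.\<close>

lemma mean_p1: assumes t: "t \<in> ball \<theta>0 r" shows "(\<integral>x. p1 t x \<partial>\<mu>) = 0"
proof -
  have "\<bar>1 - 1 - (u - t) * (\<integral>x. p1 t x \<partial>\<mu>)\<bar> \<le> C * (u - t)\<^sup>2" if u: "u \<in> ball \<theta>0 r" for u
  proof -
    note T = in_ball_Theta[OF t] in_ball_Theta[OF u]
    have "1 - 1 - (u - t) * (\<integral>x. p1 t x \<partial>\<mu>) = (\<integral>x. p u x - p t x - (u - t) * p1 t x \<partial>\<mu>)"
      using p_int[OF T(1)] p_int[OF T(2)] int1[OF t] by (simp add: p_total T)
    also have "\<bar>\<dots>\<bar> \<le> (\<integral>x. \<bar>p u x - p t x - (u - t) * p1 t x\<bar> \<partial>\<mu>)" by (rule integral_abs_bound)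
    finally show ?thesis using expand0[OF t u] by linarith
  qed
  hence "((\<lambda>_. 1) has_real_derivative (\<integral>x. p1 t x \<partial>\<mu>)) (at t)"
    using C1 by (intro DERIV_of_quadratic_remainder[OF t, where B = C]) auto
  from DERIV_unique[OF this DERIV_const] show ?thesis .
qed

lemma mean_p2: assumes t: "t \<in> ball \<theta>0 r" shows "(\<integral>x. p2 t x \<partial>\<mu>) = 0"
proof -
  have "\<bar>0 - 0 - (u - t) * (\<integral>x. p2 t x \<partial>\<mu>)\<bar> \<le> C * (u - t)\<^sup>2" if u: "u \<in> ball \<theta>0 r" for u
  proof -
    have "0 - 0 - (u - t) * (\<integral>x. p2 t x \<partial>\<mu>) = (\<integral>x. p1 u x - p1 t x - (u - t) * p2 t x \<partial>\<mu>)"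
      using int1[OF t] int1[OF u] int2[OF t] by (simp add: mean_p1[OF t] mean_p1[OF u])
    also have "\<bar>\<dots>\<bar> \<le> (\<integral>x. \<bar>p1 u x - p1 t x - (u - t) * p2 t x\<bar> \<partial>\<mu>)" by (rule integral_abs_bound)
    finally show ?thesis using expand1[OF t u] by linarith
  qed
  hence "((\<lambda>_. 0) has_real_derivative (\<integral>x. p2 t x \<partial>\<mu>)) (at t)"
    using C1 by (intro DERIV_of_quadratic_remainder[OF t, where B = C]) auto
  from DERIV_unique[OF this DERIV_const] show ?thesis .
qed

context
  fixes \<alpha> :: real and K :: "'a \<Rightarrow> nat measure"
  assumes \<alpha>: "0 \<le> \<alpha>" and K: "K \<in> private_kernels \<alpha> \<mu> pos_nats"
begin

lemma obs_diff:
  assumes "integrable \<mu> f" "integrable \<mu> g" and i: "1 \<le> i"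
  shows "obs K (\<lambda>x. f x - a * g x) i = obs K f i - a * obs K g i"
proof -
  note D = private_kernelsD[OF K]
  have m: "(\<lambda>x. measure (K x) {i}) \<in> borel_measurable \<mu>" using D(5)[of "{i}"] i by simp
  have b: "\<And>x. x \<in> space \<mu> \<Longrightarrow> \<bar>measure (K x) {i}\<bar> \<le> 1" using D(7) by simp
  note j = bounded_mult_int[OF assms(1) m b] bounded_mult_int[OF assms(2) m b]
  have "obs K (\<lambda>x. f x - a * g x) i = (\<integral>x. measure (K x) {i} * f x - a * (measure (K x) {i} * g x) \<partial>\<mu>)"
    by (simp add: obs_def algebra_simps)
  also have "\<dots> = obs K f i - a * obs K g i" using j by (simp add: obs_def)
  finally show ?thesis .
qed

text \<open>Uniform in the output \<open>i\<close>, by privacy: all quantities attached to \<open>i\<close> are bounded by a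
  multiple of the probability of \<open>i\<close>.\<close>

lemma obs_le:
  assumes f: "integrable \<mu> f" and i: "1 \<le> i" and t: "t \<in> ball \<theta>0 r" and c: "(\<integral>x. \<bar>f x\<bar> \<partial>\<mu>) \<le> c"
  shows "\<bar>obs K f i\<bar> \<le> exp \<alpha> * c * obs K (p t) i"
proof -
  note D = private_kernelsD[OF K]
  have m: "(\<lambda>x. measure (K x) {i}) \<in> borel_measurable \<mu>" using D(5)[of "{i}"] i by simp
  have tT: "t \<in> \<Theta>" using t in_ball_Theta by auto
  have q: "measure (P t \<bind> K) {i} = obs K (p t) i"
    using measure_bind_kernel[OF K tT, of "{i}"] i by (simp add: obs_def)
  have b: "\<And>x. x \<in> space \<mu> \<Longrightarrow> \<bar>measure (K x) {i}\<bar> \<le> exp \<alpha> * obs K (p t) i"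
    using kernel_le_bind[OF K tT, of "{i}"] i by (simp add: q)
  have "\<bar>obs K f i\<bar> \<le> exp \<alpha> * obs K (p t) i * (\<integral>x. \<bar>f x\<bar> \<partial>\<mu>)" unfolding obs_def by (rule bounded_mult_abs[OF f m b[unfolded obs_def]])
  also have "\<dots> \<le> exp \<alpha> * obs K (p t) i * c" using c measure_nonneg[of "P t \<bind> K" "{i}"] by (intro mult_left_mono) (auto simp: q)
  finally show ?thesis by (simp add: ac_simps)
qed

lemma obs_nonneg: "t \<in> ball \<theta>0 r \<Longrightarrow> 1 \<le> i \<Longrightarrow> 0 \<le> obs K (p t) i"
  using measure_bind_kernel[OF K in_ball_Theta[of t], of "{i}"] measure_nonneg[of "P t \<bind> K" "{i}"] by (simp add: obs_def)

text \<open>In particular, the outputs of probability zero are the same for all parameters in the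
  ball.\<close>

lemma obs_mono:
  assumes t: "t \<in> ball \<theta>0 r" and u: "u \<in> ball \<theta>0 r" and i: "1 \<le> i"
  shows "obs K (p u) i \<le> exp \<alpha> * obs K (p t) i"
  using obs_le[OF p_int[OF in_ball_Theta[OF u]] i t, of 1] p_norm[OF in_ball_Theta[OF u]] by simp

lemma score_bound:
  assumes t: "t \<in> ball \<theta>0 r" and i: "1 \<le> i"
  shows "\<bar>score K t i\<bar> \<le> exp \<alpha> * C"
proof (cases "obs K (p t) i = 0")
  case False
  hence "0 < obs K (p t) i" using obs_nonneg[OF t i] by simp
  thus ?thesis using obs_le[OF int1[OF t] i t norm1[OF t]] by (simp add: score_def divide_le_eq)
qed (use C1 in \<open>simp add: score_def\<close>)

lemma hess_bound:
  assumes t: "t \<in> ball \<theta>0 r" and i: "1 \<le> i"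
  shows "\<bar>hess K t i\<bar> \<le> exp \<alpha> * C + (exp \<alpha> * C)\<^sup>2"
proof -
  have "\<bar>obs K (p2 t) i / obs K (p t) i\<bar> \<le> exp \<alpha> * C"
  proof (cases "obs K (p t) i = 0")
    case False
    hence "0 < obs K (p t) i" using obs_nonneg[OF t i] by simp
    thus ?thesis using obs_le[OF int2[OF t] i t norm2[OF t]] by (simp add: divide_le_eq)
  qed (use C1 in simp)
  moreover have "(score K t i)\<^sup>2 \<le> (exp \<alpha> * C)\<^sup>2"
    using power_mono[OF score_bound[OF t i] abs_ge_zero, of 2] by simp
  moreover have "0 \<le> (score K t i)\<^sup>2" by simp
  ultimately show ?thesis unfolding hess_def by linarith
qed

lemma obs_DERIV:
  assumes t: "t \<in> ball \<theta>0 r" and i: "1 \<le> i"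
  shows "((\<lambda>t. obs K (p t) i) has_real_derivative obs K (p1 t) i) (at t)"
    and "((\<lambda>t. obs K (p1 t) i) has_real_derivative obs K (p2 t) i) (at t)"
proof -
  let ?B = "exp \<alpha> * C * obs K (p t) i"
  have B: "0 \<le> ?B" using obs_nonneg[OF t i] C1 by simp
  have tT: "t \<in> \<Theta>" using t in_ball_Theta by auto
  have "\<bar>obs K (p u) i - obs K (p t) i - (u - t) * obs K (p1 t) i\<bar> \<le> ?B * (u - t)\<^sup>2" if u: "u \<in> ball \<theta>0 r" for u
  proof -
    have uT: "u \<in> \<Theta>" using u in_ball_Theta by auto
    have fi: "integrable \<mu> (\<lambda>x. p u x - 1 * p t x)" using p_int tT uT by auto
    have "obs K (\<lambda>x. p u x - 1 * p t x - (u - t) * p1 t x) i = obs K (p u) i - obs K (p t) i - (u - t) * obs K (p1 t) i"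
      using obs_diff[OF fi int1[OF t] i, of "u - t"] obs_diff[OF p_int[OF uT] p_int[OF tT] i, of 1] by simp
    moreover have "\<bar>obs K (\<lambda>x. p u x - 1 * p t x - (u - t) * p1 t x) i\<bar> \<le> exp \<alpha> * (C * (u - t)\<^sup>2) * obs K (p t) i"
      using fi int1[OF t] expand0[OF t u] by (intro obs_le[OF _ i t]) auto
    ultimately show ?thesis by (simp add: ac_simps)
  qed
  thus "((\<lambda>t. obs K (p t) i) has_real_derivative obs K (p1 t) i) (at t)"
    by (rule DERIV_of_quadratic_remainder[OF t _ B])
  have "\<bar>obs K (p1 u) i - obs K (p1 t) i - (u - t) * obs K (p2 t) i\<bar> \<le> ?B * (u - t)\<^sup>2" if u: "u \<in> ball \<theta>0 r" for u
  proof -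
    have fi: "integrable \<mu> (\<lambda>x. p1 u x - 1 * p1 t x)" using int1 t u by auto
    have "obs K (\<lambda>x. p1 u x - 1 * p1 t x - (u - t) * p2 t x) i = obs K (p1 u) i - obs K (p1 t) i - (u - t) * obs K (p2 t) i"
      using obs_diff[OF fi int2[OF t] i, of "u - t"] obs_diff[OF int1[OF u] int1[OF t] i, of 1] by simp
    moreover have "\<bar>obs K (\<lambda>x. p1 u x - 1 * p1 t x - (u - t) * p2 t x) i\<bar> \<le> exp \<alpha> * (C * (u - t)\<^sup>2) * obs K (p t) i"
      using fi int2[OF t] expand1[OF t u] by (intro obs_le[OF _ i t]) auto
    ultimately show ?thesis by (simp add: ac_simps)
  qed
  thus "((\<lambda>t. obs K (p1 t) i) has_real_derivative obs K (p2 t) i) (at t)"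
    by (rule DERIV_of_quadratic_remainder[OF t _ B])
qed

lemma loglik_DERIV:
  assumes t: "t \<in> ball \<theta>0 r" and i: "1 \<le> i" and pos: "0 < obs K (p t) i"
  shows "((\<lambda>t. ln (obs K (p t) i)) has_real_derivative score K t i) (at t)"
    and "((\<lambda>t. score K t i) has_real_derivative hess K t i) (at t)"
proof -
  show "((\<lambda>t. ln (obs K (p t) i)) has_real_derivative score K t i) (at t)"
    using DERIV_chain2[OF DERIV_ln_divide[OF pos] obs_DERIV(1)[OF t i]] by (simp add: score_def)
  have "((\<lambda>t. obs K (p1 t) i / obs K (p t) i) has_real_derivative
      (obs K (p2 t) i * obs K (p t) i - obs K (p1 t) i * obs K (p1 t) i) / (obs K (p t) i * obs K (p t) i)) (at t)"
    using DERIV_divide[OF obs_DERIV(2)[OF t i] obs_DERIV(1)[OF t i]] pos by simp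
  also have "(obs K (p2 t) i * obs K (p t) i - obs K (p1 t) i * obs K (p1 t) i) / (obs K (p t) i * obs K (p t) i) = hess K t i"
    using pos by (simp add: hess_def score_def field_simps power2_eq_square)
  finally show "((\<lambda>t. score K t i) has_real_derivative hess K t i) (at t)" by (simp add: score_def[abs_def])
qed

text \<open>A Lipschitz constant for \<open>hess\<close>: the first factor is that of the ratios \<open>obs K (p1 t) i /
  obs K (p t) i\<close> and \<open>obs K (p2 t) i / obs K (p t) i\<close>, and \<open>2 e\<^sup>\<alpha> C\<close> comes from squaring the
  former.\<close>

definition hess_lip :: real where "hess_lip = (exp \<alpha> * C + (exp \<alpha> * C)\<^sup>2) * (1 + 2 * (exp \<alpha> * C))"

lemma ratio_lipschitz:
  assumes t: "t \<in> ball \<theta>0 r" and u: "u \<in> ball \<theta>0 r" and i: "1 \<le> i" and pos: "0 < obs K (p t) i" "0 < obs K (p u) i"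
    and f: "integrable \<mu> f" "integrable \<mu> g" and l: "(\<integral>x. \<bar>f x - g x\<bar> \<partial>\<mu>) \<le> C * \<bar>u - t\<bar>" and n: "(\<integral>x. \<bar>g x\<bar> \<partial>\<mu>) \<le> C"
  shows "\<bar>obs K f i / obs K (p u) i - obs K g i / obs K (p t) i\<bar> \<le> (exp \<alpha> * C + (exp \<alpha> * C)\<^sup>2) * \<bar>u - t\<bar>"
proof -
  have T: "t \<in> \<Theta>" "u \<in> \<Theta>" using t u in_ball_Theta by auto
  let ?a = "obs K f i" and ?b = "obs K g i" and ?p = "obs K (p u) i" and ?q = "obs K (p t) i"
  have c0: "0 \<le> exp \<alpha> * C" using C1 by simp
  have "\<bar>?a - ?b\<bar> \<le> exp \<alpha> * (C * \<bar>u - t\<bar>) * ?p"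
    using obs_le[of "\<lambda>x. f x - 1 * g x", OF _ i u, of "C * \<bar>u - t\<bar>"] obs_diff[OF f i, of 1] f l by simp
  hence 1: "\<bar>?a - ?b\<bar> / ?p \<le> exp \<alpha> * C * \<bar>u - t\<bar>" using pos by (simp add: divide_le_eq ac_simps)
  have "\<bar>?p - ?q\<bar> \<le> exp \<alpha> * (C * \<bar>u - t\<bar>) * ?p"
    using obs_le[of "\<lambda>x. p u x - 1 * p t x", OF _ i u, of "C * \<bar>u - t\<bar>"] obs_diff[OF p_int[OF T(2)] p_int[OF T(1)] i, of 1]
      p_int[OF T(2)] p_int[OF T(1)] lip0[OF t u] by simp
  hence 2: "\<bar>?p - ?q\<bar> / ?p \<le> exp \<alpha> * C * \<bar>u - t\<bar>" using pos by (simp add: divide_le_eq ac_simps)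
  have 3: "\<bar>?b\<bar> / ?q \<le> exp \<alpha> * C" using obs_le[OF f(2) i t n] pos by (simp add: divide_le_eq)
  have "?a / ?p - ?b / ?q = (?a - ?b) / ?p - (?b / ?q) * ((?p - ?q) / ?p)" using pos by (simp add: field_simps)
  hence "\<bar>?a / ?p - ?b / ?q\<bar> \<le> \<bar>(?a - ?b) / ?p\<bar> + \<bar>(?b / ?q) * ((?p - ?q) / ?p)\<bar>" by (simp only: abs_triangle_ineq4)
  also have "\<dots> = \<bar>?a - ?b\<bar> / ?p + (\<bar>?b\<bar> / ?q) * (\<bar>?p - ?q\<bar> / ?p)" using pos by (simp add: abs_mult)
  also have "\<dots> \<le> exp \<alpha> * C * \<bar>u - t\<bar> + (exp \<alpha> * C) * (exp \<alpha> * C * \<bar>u - t\<bar>)"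
    using 1 2 3 pos c0 by (intro add_mono mult_mono) auto
  finally show ?thesis by (simp add: algebra_simps power2_eq_square)
qed

lemma hess_lipschitz:
  assumes t: "t \<in> ball \<theta>0 r" and u: "u \<in> ball \<theta>0 r" and i: "1 \<le> i" and pos: "0 < obs K (p t) i" "0 < obs K (p u) i"
  shows "\<bar>hess K u i - hess K t i\<bar> \<le> hess_lip * \<bar>u - t\<bar>"
proof -
  define A where "A = exp \<alpha> * C + (exp \<alpha> * C)\<^sup>2"
  have A0: "0 \<le> A" using C1 by (simp add: A_def)
  have 1: "\<bar>obs K (p2 u) i / obs K (p u) i - obs K (p2 t) i / obs K (p t) i\<bar> \<le> A * \<bar>u - t\<bar>"
    unfolding A_def by (rule ratio_lipschitz[OF t u i pos int2[OF u] int2[OF t] lip2[OF t u] norm2[OF t]])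
  have 2: "\<bar>score K u i - score K t i\<bar> \<le> A * \<bar>u - t\<bar>"
    unfolding A_def score_def by (rule ratio_lipschitz[OF t u i pos int1[OF u] int1[OF t] lip1[OF t u] norm1[OF t]])
  have "\<bar>(score K u i)\<^sup>2 - (score K t i)\<^sup>2\<bar> = \<bar>score K u i - score K t i\<bar> * \<bar>score K u i + score K t i\<bar>"
    by (simp add: abs_mult[symmetric] power2_eq_square algebra_simps)
  also have "\<dots> \<le> (A * \<bar>u - t\<bar>) * (2 * (exp \<alpha> * C))"
    using 2 score_bound[OF t i] score_bound[OF u i] A0 by (intro mult_mono) auto
  finally have 3: "\<bar>(score K u i)\<^sup>2 - (score K t i)\<^sup>2\<bar> \<le> A * \<bar>u - t\<bar> * (2 * (exp \<alpha> * C))" .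
  have "\<bar>hess K u i - hess K t i\<bar> \<le> A * \<bar>u - t\<bar> + A * \<bar>u - t\<bar> * (2 * (exp \<alpha> * C))"
    using 1 3 unfolding hess_def by linarith
  also have "\<dots> = hess_lip * \<bar>u - t\<bar>" by (simp add: hess_lip_def A_def algebra_simps)
  finally show ?thesis .
qed

context
  fixes k :: nat
  assumes one: "\<And>x. x \<in> space \<mu> \<Longrightarrow> measure (K x) {1..k} = 1"
begin

lemma obs_sum:
  assumes f: "integrable \<mu> f"
  shows "(\<Sum>i\<in>{1..k}. obs K f i) = (\<integral>x. f x \<partial>\<mu>)"
proof -
  note D = private_kernelsD[OF K]
  have "(\<Sum>i\<in>{1..k}. obs K f i) = (\<integral>x. (\<Sum>i\<in>{1..k}. measure (K x) {i} * f x) \<partial>\<mu>)"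
    unfolding obs_def using D(5,7) by (intro Bochner_Integration.integral_sum[symmetric] bounded_mult_int[OF f, of _ 1]) auto
  also have "\<dots> = (\<integral>x. f x \<partial>\<mu>)"
  proof (rule Bochner_Integration.integral_cong[OF refl])
    fix x assume x: "x \<in> space \<mu>"
    interpret Kx: prob_space "K x" by (rule D(3)[OF x])
    have "measure (K x) {1..k} = (\<Sum>i\<in>{1..k}. measure (K x) {i})"
      using D(4)[OF x] by (intro Kx.finite_measure_eq_sum_singleton) auto
    thus "(\<Sum>i\<in>{1..k}. measure (K x) {i} * f x) = f x" using one[OF x] by (simp flip: sum_distrib_right)
  qed
  finally show ?thesis .
qed

lemma stage2_expectation:
  assumes t: "t \<in> ball \<theta>0 r"
  shows "(\<integral>i. h i \<partial>(P t \<bind> K)) = (\<Sum>i\<in>{1..k}. h i * obs K (p t) i)"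
proof -
  have tT: "t \<in> \<Theta>" using t in_ball_Theta by auto
  interpret M: prob_space "P t \<bind> K" by (rule bind_alg[OF K tT])
  have s: "sets (P t \<bind> K) = Pow {1..}" using bind_alg(3)[OF K tT] by simp
  have mi: "measure (P t \<bind> K) {i} = obs K (p t) i" if "1 \<le> i" for i
    using measure_bind_kernel[OF K tT, of "{i}"] that by (simp add: obs_def)
  have "measure (P t \<bind> K) {1..k} = (\<Sum>i\<in>{1..k}. measure (P t \<bind> K) {i})"
    using s by (intro M.finite_measure_eq_sum_singleton) auto
  also have "\<dots> = 1" using obs_sum[OF p_int[OF tT]] p_total[OF tT] by (simp add: mi)
  finally have "AE z in P t \<bind> K. z \<in> {1..k}" using s by (subst (asm) M.prob_eq_1) auto
  hence "(\<integral>i. h i \<partial>(P t \<bind> K)) = (\<Sum>i\<in>{1..k}. h i * measure (P t \<bind> K) {i})"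
    using s bind_alg(4)[OF K tT] by (intro integral_finite_support M.finite_measure_axioms) (auto simp: measurable_def)
  thus ?thesis by (simp add: mi)
qed

text \<open>The Bartlett identities. Terms with zero probability vanish also in the numerators, by
  privacy.\<close>

lemma score_mean: "t \<in> ball \<theta>0 r \<Longrightarrow> (\<integral>i. score K t i \<partial>(P t \<bind> K)) = 0"
  and score_variance: "t \<in> ball \<theta>0 r \<Longrightarrow> (\<integral>i. (score K t i)\<^sup>2 \<partial>(P t \<bind> K)) = info {1..k} (\<lambda>i x. measure (K x) {i}) t"
  and hess_mean: "t \<in> ball \<theta>0 r \<Longrightarrow> (\<integral>i. hess K t i \<partial>(P t \<bind> K)) = - info {1..k} (\<lambda>i x. measure (K x) {i}) t"
proof -
  assume t: "t \<in> ball \<theta>0 r"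
  have can: "obs K f i / obs K (p t) i * obs K (p t) i = obs K f i" if f: "integrable \<mu> f" and i: "i \<in> {1..k}" for f i
  proof (cases "obs K (p t) i = 0")
    case True
    thus ?thesis using obs_le[OF f _ t order_refl, of i] i by simp
  qed simp
  have "(\<Sum>i\<in>{1..k}. score K t i * obs K (p t) i) = (\<Sum>i\<in>{1..k}. obs K (p1 t) i)"
    unfolding score_def using can[OF int1[OF t]] by (intro sum.cong) auto
  thus "(\<integral>i. score K t i \<partial>(P t \<bind> K)) = 0"
    using stage2_expectation[OF t] obs_sum[OF int1[OF t]] mean_p1[OF t] by simp
  have ri: "(score K t i)\<^sup>2 * obs K (p t) i = row_info (\<lambda>x. measure (K x) {i}) t" for i
    unfolding score_def row_info_def obs_def[symmetric]
    by (cases "obs K (p t) i = 0") (auto simp: power2_eq_square)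
  thus v: "(\<integral>i. (score K t i)\<^sup>2 \<partial>(P t \<bind> K)) = info {1..k} (\<lambda>i x. measure (K x) {i}) t"
    using stage2_expectation[OF t] by (simp add: info_def)
  have "(\<Sum>i\<in>{1..k}. hess K t i * obs K (p t) i) = (\<Sum>i\<in>{1..k}. obs K (p2 t) i - row_info (\<lambda>x. measure (K x) {i}) t)"
    unfolding hess_def using can[OF int2[OF t]] ri by (intro sum.cong) (auto simp: left_diff_distrib)
  also have "\<dots> = - info {1..k} (\<lambda>i x. measure (K x) {i}) t"
    using obs_sum[OF int2[OF t]] mean_p2[OF t] by (simp add: sum_subtractf info_def)
  finally show "(\<integral>i. hess K t i \<partial>(P t \<bind> K)) = - info {1..k} (\<lambda>i x. measure (K x) {i}) t"
    using stage2_expectation[OF t] by simp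
qed

end

end

end

section \<open>Expansion of the maximum likelihood estimator\<close>

text \<open>The two-step procedure at fixed sample sizes, with \<open>m\<close> the size of the first sample and
  \<open>n\<close> the total size.\<close>

locale two_step = l1_smooth_model \<mu> \<Theta> P p p1 p2 \<theta>0 r C
  for \<mu> :: "'a measure" and \<Theta> P p p1 p2 \<theta>0 r C +
  fixes \<alpha> :: real and Z0 :: "'z measure" and Q0 :: "'a \<Rightarrow> 'z measure" and est :: "(nat \<Rightarrow> 'z) \<Rightarrow> real"
    and T :: "'a \<times> real \<Rightarrow> nat" and k :: "real \<Rightarrow> nat" and Q :: "nat \<times> real \<Rightarrow> nat measure" and m n :: nat
  assumes \<alpha>: "0 \<le> \<alpha>" and Q0: "Q0 \<in> private_kernels \<alpha> \<mu> Z0"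
    and est: "est \<in> PiM {1..m} (\<lambda>_. Z0) \<rightarrow>\<^sub>M param_space \<Theta>"
    and T: "T \<in> \<mu> \<Otimes>\<^sub>M param_space \<Theta> \<rightarrow>\<^sub>M pos_nats"
    and Tk: "x \<in> space \<mu> \<Longrightarrow> \<tau> \<in> \<Theta> \<Longrightarrow> T (x, \<tau>) \<in> {1..k \<tau>}"
    and mx: "measurable_info_maximizer \<alpha> \<Theta> P T k Q"
    and mn: "m < n"
begin

abbreviation "MZ \<equiv> PiM {1..m} (\<lambda>_. Z0)"
abbreviation "MW \<equiv> PiM {m+1..n} (\<lambda>_. pos_nats)"
abbreviation "law t \<equiv> two_step_law Z0 Q0 est T Q m n (P t)"
abbreviation "stage1 t \<equiv> PiM {1..m} (\<lambda>_. P t \<bind> Q0)"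

definition K :: "real \<Rightarrow> 'a \<Rightarrow> nat measure" where "K \<tau> x = Q (T (x, \<tau>), \<tau>)"

abbreviation "stage2 t z \<equiv> PiM {m+1..n} (\<lambda>_. P t \<bind> K (est z))"
abbreviation "v t z \<equiv> stage2_info T k Q (est z) t"
definition N :: real where "N = real (n - m)"

lemma N_pos: "0 < N" using mn by (simp add: N_def)

lemma Qm: "Q \<in> pos_nats \<Otimes>\<^sub>M param_space \<Theta> \<rightarrow>\<^sub>M prob_algebra pos_nats"
  using mx by (simp add: measurable_info_maximizer_def)

lemma K_private: "\<tau> \<in> \<Theta> \<Longrightarrow> K \<tau> \<in> private_kernels \<alpha> \<mu> pos_nats"
  using stage2_kernel(3)[OF mx T Tk] by (simp add: K_def[abs_def])

lemma K_one: "\<tau> \<in> \<Theta> \<Longrightarrow> x \<in> space \<mu> \<Longrightarrow> measure (K \<tau> x) {1..k \<tau>} = 1"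
  using stage2_kernel(5)[OF mx T Tk] by (simp add: K_def)

lemma v_eq: "v t z = info {1..k (est z)} (\<lambda>i x. measure (K (est z) x) {i}) t"
  by (simp add: stage2_info_def K_def)

lemma est_in: "z \<in> space MZ \<Longrightarrow> est z \<in> \<Theta>"
  using measurable_space[OF est] by (simp add: space_restrict_space)

lemma TS: "two_step_space Z0 m n = MZ \<Otimes>\<^sub>M MW" by (simp add: two_step_space_def)

lemma law_mixture:
  assumes t: "t \<in> ball \<theta>0 r"
  shows "mixture (law t) (stage1 t) (stage2 t) MZ MW"
proof -
  have tT: "t \<in> \<Theta>" using t in_ball_Theta by auto
  note S = two_step_law_structure[OF P_prob[OF tT] P_sets[OF tT] less_imp_le[OF mn] private_kernelsD(1)[OF Q0] est T Qm]
  show ?thesis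
  proof (rule mixture.intro)
    show "sets (law t) = sets (MZ \<Otimes>\<^sub>M MW)" using S(1) by (simp add: TS)
    show "prob_space (law t)" by (rule S(2))
    show "sets (stage1 t) = sets MZ" by (rule sets_PiM_cong) (simp_all add: bind_alg[OF Q0 tT])
    show "prob_space (stage1 t)" by (rule prob_space_PiM) (rule bind_alg[OF Q0 tT])
    show "stage2 t \<in> MZ \<rightarrow>\<^sub>M prob_algebra MW"
      using second_stage_kernel_measurable[OF P_alg[OF tT] est T Qm, of "{m+1..n}"] by (simp add: K_def[abs_def])
    show "(\<integral>\<^sup>+y. f y \<partial>law t) = (\<integral>\<^sup>+z. \<integral>\<^sup>+w. f (z, w) \<partial>stage2 t z \<partial>stage1 t)" if "f \<in> borel_measurable (MZ \<Otimes>\<^sub>M MW)" for f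
      using S(3)[of f] that by (simp add: TS K_def[abs_def])
  qed
qed

text \<open>With \<open>u - t\<close> of order \<open>1/\<surd>n\<close> the factor stays bounded, so that events that are
  asymptotically negligible at \<open>t\<close> are negligible at \<open>u\<close>.\<close>

lemma law_contiguous:
  assumes t: "t \<in> ball \<theta>0 r" and u: "u \<in> ball \<theta>0 r" and E: "E \<in> sets (MZ \<Otimes>\<^sub>M MW)"
  shows "measure (law u) E \<le> sqrt ((1 + (exp \<alpha> * C * (u - t))\<^sup>2) ^ n * measure (law t) E)"
proof -
  have T': "t \<in> \<Theta>" "u \<in> \<Theta>" using t u in_ball_Theta by auto
  interpret A: mixture "law t" "stage1 t" "stage2 t" MZ MW by (rule law_mixture[OF t])
  interpret B: mixture "law u" "stage1 u" "stage2 u" MZ MW by (rule law_mixture[OF u])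
  interpret LA: prob_space "law t" by (rule A.pL)
  interpret LB: prob_space "law u" by (rule B.pL)
  define d where "d = 1 + (exp \<alpha> * C * (u - t))\<^sup>2"
  have d0: "0 \<le> d" by (simp add: d_def)
  have "(emeasure (law u) E)\<^sup>2 \<le> (ennreal d) ^ m * (ennreal d) ^ (n - m) * emeasure (law t) E"
  proof (rule mixture_chi_square[OF A.mixture_axioms B.mixture_axioms _ _ E])
    fix f :: "(nat \<Rightarrow> 'z) \<Rightarrow> ennreal" assume "f \<in> borel_measurable MZ"
    thus "(\<integral>\<^sup>+z. f z \<partial>stage1 u)\<^sup>2 \<le> ennreal d ^ m * (\<integral>\<^sup>+z. (f z)\<^sup>2 \<partial>stage1 t)"
      using PiM_chi_square[of "{1..m}" "P t \<bind> Q0" "P u \<bind> Q0" Z0 "ennreal d" f] bind_alg[OF Q0 T'(1)] bind_alg[OF Q0 T'(2)]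
        channel_chi_square[OF Q0 t u] by (simp add: d_def)
  next
    fix z and f :: "(nat \<Rightarrow> nat) \<Rightarrow> ennreal" assume z: "z \<in> space MZ" and f: "f \<in> borel_measurable MW"
    note Kp = K_private[OF est_in[OF z]]
    have "(\<integral>\<^sup>+w. f w \<partial>stage2 u z)\<^sup>2 \<le> ennreal d ^ card {m+1..n} * (\<integral>\<^sup>+w. (f w)\<^sup>2 \<partial>stage2 t z)"
    proof (rule PiM_chi_square[OF _ _ _ _ _ _ f])
      show "(\<integral>\<^sup>+i. g i \<partial>(P u \<bind> K (est z)))\<^sup>2 \<le> ennreal d * (\<integral>\<^sup>+i. (g i)\<^sup>2 \<partial>(P t \<bind> K (est z)))"
        if "g \<in> borel_measurable pos_nats" for g
        using channel_chi_square[OF Kp t u that] by (simp add: d_def)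
    qed (use bind_alg[OF Kp T'(1)] bind_alg[OF Kp T'(2)] in auto)
    thus "(\<integral>\<^sup>+w. f w \<partial>stage2 u z)\<^sup>2 \<le> ennreal d ^ (n - m) * (\<integral>\<^sup>+w. (f w)\<^sup>2 \<partial>stage2 t z)" by simp
  qed
  also have "ennreal d ^ m * ennreal d ^ (n - m) = ennreal (d ^ n)"
    using mn d0 by (simp add: ennreal_power ennreal_mult[symmetric] power_add[symmetric])
  finally have "ennreal ((measure (law u) E)\<^sup>2) \<le> ennreal (d ^ n * measure (law t) E)"
    using d0 by (simp add: LA.emeasure_eq_measure LB.emeasure_eq_measure ennreal_power ennreal_mult)
  hence "(measure (law u) E)\<^sup>2 \<le> d ^ n * measure (law t) E" using d0 by (subst (asm) ennreal_le_iff) auto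
  thus ?thesis unfolding d_def[symmetric] by (rule real_le_rsqrt)
qed

lemma obs_measurable:
  assumes f[measurable]: "f \<in> borel_measurable \<mu>" and i: "i \<in> {m+1..n}"
  shows "(\<lambda>(z, w). obs (K (est z)) f (w i)) \<in> borel_measurable (MZ \<Otimes>\<^sub>M MW)"
proof -
  interpret \<mu>: sigma_finite_measure \<mu> by (rule sf)
  note [measurable] = T Qm est
  have QT[measurable]: "(\<lambda>(\<tau>, x). Q (T (x, \<tau>), \<tau>)) \<in> param_space \<Theta> \<Otimes>\<^sub>M \<mu> \<rightarrow>\<^sub>M prob_algebra pos_nats" by measurable
  have j: "(\<lambda>\<tau>. obs (K \<tau>) f j) \<in> borel_measurable (param_space \<Theta>)" if "j \<in> {1..}" for j
    unfolding obs_def K_def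
  proof (rule \<mu>.borel_measurable_lebesgue_integral)
    have "(\<lambda>y. measure (case y of (\<tau>, x) \<Rightarrow> Q (T (x, \<tau>), \<tau>)) {j}) \<in> borel_measurable (param_space \<Theta> \<Otimes>\<^sub>M \<mu>)"
      by (rule measurable_compose[OF QT measurable_measure_prob_algebra]) (use that in simp)
    thus "(\<lambda>(\<tau>, x). measure (Q (T (x, \<tau>), \<tau>)) {j} * f x) \<in> borel_measurable (param_space \<Theta> \<Otimes>\<^sub>M \<mu>)"
      unfolding split_def by measurable
  qed
  have G: "(\<lambda>(j, \<tau>). obs (K \<tau>) f j) \<in> borel_measurable (pos_nats \<Otimes>\<^sub>M param_space \<Theta>)"
    by (rule measurable_pair_measure_countable1) (use j in auto)
  have "(\<lambda>y. (snd y i, est (fst y))) \<in> MZ \<Otimes>\<^sub>M MW \<rightarrow>\<^sub>M pos_nats \<Otimes>\<^sub>M param_space \<Theta>"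
    by (intro measurable_Pair measurable_compose[OF measurable_snd measurable_component_singleton] measurable_compose[OF measurable_fst est] i)
  from measurable_compose[OF this G] show ?thesis by (simp add: split_def)
qed

lemma score_measurable:
  assumes t: "t \<in> ball \<theta>0 r" and i: "i \<in> {m+1..n}"
  shows "(\<lambda>y. score (K (est (fst y))) t (snd y i)) \<in> borel_measurable (MZ \<Otimes>\<^sub>M MW)"
    and "(\<lambda>y. hess (K (est (fst y))) t (snd y i)) \<in> borel_measurable (MZ \<Otimes>\<^sub>M MW)"
proof -
  have [measurable]: "p t \<in> borel_measurable \<mu>" "p1 t \<in> borel_measurable \<mu>" "p2 t \<in> borel_measurable \<mu>"
    using p_meas in_ball_Theta[OF t] int1[OF t] int2[OF t] by auto
  have [measurable]: "(\<lambda>y. obs (K (est (fst y))) f (snd y i)) \<in> borel_measurable (MZ \<Otimes>\<^sub>M MW)" if "f \<in> borel_measurable \<mu>" for f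
    using obs_measurable[OF that i] by (simp add: split_def)
  show 1[measurable]: "(\<lambda>y. score (K (est (fst y))) t (snd y i)) \<in> borel_measurable (MZ \<Otimes>\<^sub>M MW)"
    unfolding score_def by measurable
  show "(\<lambda>y. hess (K (est (fst y))) t (snd y i)) \<in> borel_measurable (MZ \<Otimes>\<^sub>M MW)"
    unfolding hess_def by measurable
qed

lemma stage2_prob_eq:
  assumes \<tau>: "\<tau> \<in> \<Theta>" and t: "t \<in> \<Theta>" and i: "1 \<le> i"
  shows "stage2_prob T k Q \<tau> (P t) i = obs (K \<tau>) (p t) i"
proof -
  note TU = stage2_kernel(1)[OF mx T Tk \<tau>, OF _ \<tau>]
  have cell: "quant_cell (P t) T \<tau> j = quant_cell \<mu> T \<tau> j" for j by (simp add: quant_cell_def P_space[OF t])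
  have cs: "quant_cell \<mu> T \<tau> j \<in> sets \<mu>" for j by (rule cell_sets[OF TU])
  have mc: "measure (P t) (quant_cell \<mu> T \<tau> j) = (\<integral>x. indicator (quant_cell \<mu> T \<tau> j) x * p t x \<partial>\<mu>)" for j
    using integral_P[OF t, of "indicator (quant_cell \<mu> T \<tau> j)"] cs[of j] P_sets[OF t] P_space[OF t]
      sets.sets_into_space[OF cs[of j]] by (simp add: Int_absorb2)
  have ci: "integrable \<mu> (\<lambda>x. indicator (quant_cell \<mu> T \<tau> j) x * p t x)" for j
    using cs[of j] by (intro bounded_mult_int[OF p_int[OF t], of _ 1]) (auto simp: indicator_def)
  have "stage2_prob T k Q \<tau> (P t) i = (\<Sum>j=1..k \<tau>. measure (Q (j, \<tau>)) {i} * (\<integral>x. indicator (quant_cell \<mu> T \<tau> j) x * p t x \<partial>\<mu>))"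
    by (simp add: stage2_prob_def cell mc)
  also have "\<dots> = (\<integral>x. (\<Sum>j=1..k \<tau>. measure (Q (j, \<tau>)) {i} * (indicator (quant_cell \<mu> T \<tau> j) x * p t x)) \<partial>\<mu>)"
    using ci by (subst Bochner_Integration.integral_sum) auto
  also have "\<dots> = obs (K \<tau>) (p t) i"
    unfolding obs_def
  proof (rule Bochner_Integration.integral_cong[OF refl])
    fix x assume x: "x \<in> space \<mu>"
    have "(\<Sum>j=1..k \<tau>. measure (Q (j, \<tau>)) {i} * (indicator (quant_cell \<mu> T \<tau> j) x * p t x))
      = (\<Sum>j=1..k \<tau>. if j = T (x, \<tau>) then measure (Q (j, \<tau>)) {i} * p t x else 0)"
      using x by (intro sum.cong) (auto simp: quant_cell_def)
    also have "\<dots> = measure (K \<tau> x) {i} * p t x"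
      using Tk[OF x \<tau>] by (subst sum.delta) (auto simp: K_def)
    finally show "(\<Sum>j=1..k \<tau>. measure (Q (j, \<tau>)) {i} * (indicator (quant_cell \<mu> T \<tau> j) x * p t x)) = measure (K \<tau> x) {i} * p t x" .
  qed
  finally show ?thesis .
qed

text \<open>An interior maximizer is a stationary point of the log-likelihood. If all observations
  have positive probability at one parameter of the ball, they do at all of them, and the
  log-likelihood is finite and smooth on the ball.\<close>

lemma mle_score_equation:
  assumes z: "z \<in> space MZ" and w: "\<And>i. i \<in> {m+1..n} \<Longrightarrow> 1 \<le> w i" and t: "t \<in> ball \<theta>0 r"
    and pos: "\<And>i. i \<in> {m+1..n} \<Longrightarrow> 0 < obs (K (est z)) (p t) (w i)"
    and mle: "is_arg_max (two_step_loglik P est T k Q m n (z, w)) (\<lambda>\<theta>. \<theta> \<in> \<Theta>) u" and u: "u \<in> ball \<theta>0 r"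
  shows "(\<Sum>i\<in>{m+1..n}. score (K (est z)) u (w i)) = 0"
proof -
  note Kp = K_private[OF est_in[OF z]]
  let ?K = "K (est z)"
  have pos': "0 < obs ?K (p y) (w i)" if "y \<in> ball \<theta>0 r" "i \<in> {m+1..n}" for y i
  proof -
    have "0 < exp \<alpha> * obs ?K (p y) (w i)"
      using obs_mono[OF \<alpha> Kp that(1) t w[OF that(2)]] pos[OF that(2)] by linarith
    thus ?thesis by (simp add: zero_less_mult_iff)
  qed
  define F where "F y = (\<Sum>i\<in>{m+1..n}. ln (obs ?K (p y) (w i)))" for y
  \<comment> \<open>on the ball, the extended logarithms are ordinary ones\<close>
  have ll: "two_step_loglik P est T k Q m n (z, w) y = ereal (1 / N * F y)" if y: "y \<in> ball \<theta>0 r" for y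
  proof -
    have "(\<Sum>i=m+1..n. ext_ln (stage2_prob T k Q (est z) (P y) (w i))) = (\<Sum>i=m+1..n. ereal (ln (obs ?K (p y) (w i))))"
      using pos'[OF y] w in_ball_Theta[OF y] est_in[OF z]
      by (intro sum.cong refl) (simp add: stage2_prob_eq ext_ln_def)
    also have "\<dots> = ereal (F y)" by (simp add: F_def)
    finally show ?thesis by (simp add: two_step_loglik_def N_def)
  qed
  have Fle: "F y \<le> F u" if y: "y \<in> ball \<theta>0 r" for y
  proof -
    have "\<not> two_step_loglik P est T k Q m n (z, w) u < two_step_loglik P est T k Q m n (z, w) y"
      using mle in_ball_Theta[OF y] by (auto simp: is_arg_max_def)
    hence "1 / N * F y \<le> 1 / N * F u" by (simp only: ll[OF u] ll[OF y] less_ereal.simps not_less)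
    thus ?thesis using N_pos by (simp add: divide_le_cancel)
  qed
  have "(F has_real_derivative (\<Sum>i\<in>{m+1..n}. score ?K u (w i))) (at u)"
    unfolding F_def[abs_def] using pos'[OF u] w by (intro DERIV_sum loglik_DERIV(1)[OF \<alpha> Kp u]) auto
  moreover obtain e where "0 < e" "ball u e \<subseteq> ball \<theta>0 r" using u open_contains_ball[of "ball \<theta>0 r"] open_ball by blast
  ultimately show ?thesis
    using Fle by (intro DERIV_local_max[of F _ u e]) (auto simp: subset_eq dist_real_def)
qed

text \<open>The mean value theorem for the sum of the scores between \<open>t\<close> and \<open>u\<close>; the Lipschitz bound
  replaces the derivative at the intermediate point by the one at \<open>t\<close>.\<close>

lemma mle_expansion:
  assumes z: "z \<in> space MZ" and w: "\<And>i. i \<in> {m+1..n} \<Longrightarrow> 1 \<le> w i" and t: "t \<in> ball \<theta>0 r"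
    and pos: "\<And>i. i \<in> {m+1..n} \<Longrightarrow> 0 < obs (K (est z)) (p t) (w i)"
    and mle: "is_arg_max (two_step_loglik P est T k Q m n (z, w)) (\<lambda>\<theta>. \<theta> \<in> \<Theta>) u" and u: "u \<in> ball \<theta>0 r"
  obtains \<rho> where "\<bar>\<rho>\<bar> \<le> hess_lip \<alpha> * \<bar>u - t\<bar>"
    "(\<Sum>i\<in>{m+1..n}. score (K (est z)) t (w i)) + (u - t) * ((\<Sum>i\<in>{m+1..n}. hess (K (est z)) t (w i)) + N * \<rho>) = 0"
proof -
  note Kp = K_private[OF est_in[OF z]]
  let ?K = "K (est z)"
  have pos': "0 < obs ?K (p y) (w i)" if "y \<in> ball \<theta>0 r" "i \<in> {m+1..n}" for y i
  proof -
    have "0 < exp \<alpha> * obs ?K (p y) (w i)"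
      using obs_mono[OF \<alpha> Kp that(1) t w[OF that(2)]] pos[OF that(2)] by linarith
    thus ?thesis by (simp add: zero_less_mult_iff)
  qed
  define g where "g y = (\<Sum>i\<in>{m+1..n}. score ?K y (w i))" for y
  define g' where "g' y = (\<Sum>i\<in>{m+1..n}. hess ?K y (w i))" for y
  have D: "(g has_real_derivative g' y) (at y)" if "y \<in> ball \<theta>0 r" for y
    unfolding g_def[abs_def] g'_def using pos'[OF that] w by (intro DERIV_sum loglik_DERIV(2)[OF \<alpha> Kp that]) auto
  have gu: "g u = 0" unfolding g_def by (rule mle_score_equation[OF z w t pos mle u])
  have seg: "y \<in> ball \<theta>0 r" if "y \<in> closed_segment t u" for y
    using closed_segment_subset[OF t u convex_ball] that by auto
  have "\<exists>\<xi>\<in>closed_segment t u. g u - g t = (u - t) * g' \<xi>"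
  proof -
    consider "t < u" | "u < t" | "t = u" by linarith
    thus ?thesis
    proof cases
      case 1
      have "\<exists>\<xi>>t. \<xi> < u \<and> g u - g t = (u - t) * g' \<xi>"
        by (rule MVT2[OF 1]) (use D seg 1 in \<open>auto simp: closed_segment_eq_real_ivl\<close>)
      thus ?thesis using 1 by (force simp: closed_segment_eq_real_ivl)
    next
      case 2
      have "\<exists>\<xi>>u. \<xi> < t \<and> g t - g u = (t - u) * g' \<xi>"
        by (rule MVT2[OF 2]) (use D seg 2 in \<open>auto simp: closed_segment_eq_real_ivl\<close>)
      then obtain \<xi> where "u < \<xi>" "\<xi> < t" "g t - g u = (t - u) * g' \<xi>" by blast
      thus ?thesis using 2 by (intro bexI[of _ \<xi>]) (auto simp: closed_segment_eq_real_ivl algebra_simps)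
    qed auto
  qed
  then obtain \<xi> where \<xi>: "\<xi> \<in> closed_segment t u" "g u - g t = (u - t) * g' \<xi>" by blast
  have \<xi>b: "\<xi> \<in> ball \<theta>0 r" by (rule seg[OF \<xi>(1)])
  have \<xi>t: "\<bar>\<xi> - t\<bar> \<le> \<bar>u - t\<bar>" using \<xi>(1) by (auto simp: closed_segment_eq_real_ivl split: if_splits)
  have lip0: "0 \<le> hess_lip \<alpha>" using C1 by (simp add: hess_lip_def[OF \<alpha> Kp])
  have "\<bar>g' \<xi> - g' t\<bar> \<le> (\<Sum>i\<in>{m+1..n}. \<bar>hess ?K \<xi> (w i) - hess ?K t (w i)\<bar>)"
    unfolding g'_def sum_subtractf[symmetric] by (rule sum_abs)
  also have "\<dots> \<le> (\<Sum>i\<in>{m+1..n}. hess_lip \<alpha> * \<bar>u - t\<bar>)"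
  proof (rule sum_mono)
    fix i assume i: "i \<in> {m+1..n}"
    have "\<bar>hess ?K \<xi> (w i) - hess ?K t (w i)\<bar> \<le> hess_lip \<alpha> * \<bar>\<xi> - t\<bar>"
      by (rule hess_lipschitz[OF \<alpha> Kp t \<xi>b w[OF i] pos[OF i] pos'[OF \<xi>b i]])
    also have "\<dots> \<le> hess_lip \<alpha> * \<bar>u - t\<bar>" by (rule mult_left_mono[OF \<xi>t lip0])
    finally show "\<bar>hess ?K \<xi> (w i) - hess ?K t (w i)\<bar> \<le> hess_lip \<alpha> * \<bar>u - t\<bar>" .
  qed
  also have "\<dots> = N * (hess_lip \<alpha> * \<bar>u - t\<bar>)" by (simp add: N_def)
  finally have le: "\<bar>g' \<xi> - g' t\<bar> \<le> N * (hess_lip \<alpha> * \<bar>u - t\<bar>)" .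
  show thesis
  proof (rule that[of "(g' \<xi> - g' t) / N"])
    show "\<bar>(g' \<xi> - g' t) / N\<bar> \<le> hess_lip \<alpha> * \<bar>u - t\<bar>" using le N_pos by (simp add: abs_divide divide_le_eq mult.commute)
    have "N * ((g' \<xi> - g' t) / N) = g' \<xi> - g' t" using N_pos by simp
    thus "(\<Sum>i\<in>{m+1..n}. score ?K t (w i)) + (u - t) * ((\<Sum>i\<in>{m+1..n}. hess ?K t (w i)) + N * ((g' \<xi> - g' t) / N)) = 0"
      using \<xi>(2) gu unfolding g_def[symmetric] g'_def[symmetric] by (simp only:) simp
  qed
qed

end

section \<open>The characteristic function for fixed sample sizes\<close>

lemma cmod_iexp_diff: "cmod (iexp a - iexp b) \<le> \<bar>a - b\<bar>"
proof -
  have "iexp a - iexp b = iexp b * (iexp (a - b) - 1)"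
    by (simp add: right_diff_distrib exp_add[symmetric] algebra_simps)
  hence "cmod (iexp a - iexp b) = cmod (iexp (a - b) - 1)" by (simp add: norm_mult)
  also have "\<dots> \<le> \<bar>a - b\<bar>" using iexp_approx1[of "a - b" 0] by simp
  finally show ?thesis .
qed

lemma exp_minus_lipschitz:
  fixes a b :: real
  assumes "0 \<le> a" "0 \<le> b"
  shows "\<bar>exp (- a) - exp (- b)\<bar> \<le> \<bar>a - b\<bar>"
proof -
  have *: "exp (- a) - exp (- b) \<le> b - a" if "a \<le> b" "0 \<le> a" for a b :: real
  proof -
    have "exp (- a) - exp (- b) = exp (- a) * (1 - exp (- (b - a)))" by (simp add: algebra_simps flip: exp_add)
    also have "1 - exp (- (b - a)) \<le> b - a" using exp_ge_add_one_self[of "- (b - a)"] by linarith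
    hence "exp (- a) * (1 - exp (- (b - a))) \<le> 1 * (b - a)" using that by (intro mult_mono) auto
    finally show ?thesis by simp
  qed
  show ?thesis using *[of a b] *[of b a] assms by (cases "a \<le> b") (auto simp: abs_if)
qed

context two_step
begin

abbreviation "B1 \<equiv> exp \<alpha> * C"
abbreviation "B2 \<equiv> 2 * (B1 + B1\<^sup>2)"

lemma obs_zero:
  assumes \<tau>: "\<tau> \<in> \<Theta>" shows "obs (K \<tau>) f 0 = 0"
proof -
  have "measure (K \<tau> x) {0} = 0" if "x \<in> space \<mu>" for x
    using private_kernelsD(4)[OF K_private[OF \<tau>] that] by (intro measure_notin_sets) auto
  thus ?thesis unfolding obs_def by (intro integral_eq_zero_AE) auto
qed

lemma stage2_sets: "\<tau> \<in> \<Theta> \<Longrightarrow> t \<in> \<Theta> \<Longrightarrow> sets (P t \<bind> K \<tau>) = Pow {1..}"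
  using bind_alg(3)[OF K_private] by simp

lemma stage2_meas:
  fixes h :: "nat \<Rightarrow> real"
  assumes "\<tau> \<in> \<Theta>" "t \<in> \<Theta>" shows "h \<in> borel_measurable (P t \<bind> K \<tau>)"
  using stage2_sets[OF assms] bind_alg(4)[OF K_private[OF assms(1)] assms(2)] by (auto simp: measurable_def)

lemma score_iid:
  assumes z: "z \<in> space MZ" and t: "t \<in> ball \<theta>0 r"
  shows "bounded_iid (P t \<bind> K (est z)) (score (K (est z)) t) B1"
proof (rule bounded_iid.intro, rule bind_alg(2)[OF K_private[OF est_in[OF z]] in_ball_Theta[OF t]], unfold_locales)
  note \<tau> = est_in[OF z]
  note Kp = K_private[OF \<tau>]
  show "score (K (est z)) t \<in> borel_measurable (P t \<bind> K (est z))" by (rule stage2_meas[OF \<tau> in_ball_Theta[OF t]])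
  show "\<bar>score (K (est z)) t i\<bar> \<le> B1" for i
    using score_bound[OF \<alpha> Kp t, of i] C1 obs_zero[OF \<tau>] by (cases "i = 0") (auto simp: score_def)
  show "(\<integral>i. score (K (est z)) t i \<partial>(P t \<bind> K (est z))) = 0"
    by (rule score_mean[OF \<alpha> Kp K_one[OF \<tau>] t])
qed

text \<open>Centred by its mean \<open>- v t z\<close>, the negative information.\<close>

lemma hess_iid:
  assumes z: "z \<in> space MZ" and t: "t \<in> ball \<theta>0 r"
  shows "bounded_iid (P t \<bind> K (est z)) (\<lambda>i. hess (K (est z)) t i + v t z) B2"
proof (rule bounded_iid.intro, rule bind_alg(2)[OF K_private[OF est_in[OF z]] in_ball_Theta[OF t]], unfold_locales)
  note \<tau> = est_in[OF z]
  note Kp = K_private[OF \<tau>]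
  interpret M: prob_space "P t \<bind> K (est z)" by (rule bind_alg(2)[OF Kp in_ball_Theta[OF t]])
  have c0: "0 \<le> B1" using C1 by simp
  show m: "(\<lambda>i. hess (K (est z)) t i + v t z) \<in> borel_measurable (P t \<bind> K (est z))" by (rule stage2_meas[OF \<tau> in_ball_Theta[OF t]])
  have hb: "\<bar>hess (K (est z)) t i\<bar> \<le> B1 + B1\<^sup>2" for i
    using hess_bound[OF \<alpha> Kp t, of i] c0 obs_zero[OF \<tau>] by (cases "i = 0") (auto simp: hess_def score_def)
  have hi: "integrable (P t \<bind> K (est z)) (hess (K (est z)) t)"
    using hb by (intro M.integrable_const_bound[of _ "B1 + B1\<^sup>2"] stage2_meas[OF \<tau> in_ball_Theta[OF t]]) auto
  have hm: "(\<integral>i. hess (K (est z)) t i \<partial>(P t \<bind> K (est z))) = - v t z"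
    using hess_mean[OF \<alpha> Kp K_one[OF \<tau>] t] by (simp add: v_eq)
  have "\<bar>v t z\<bar> \<le> (\<integral>i. \<bar>hess (K (est z)) t i\<bar> \<partial>(P t \<bind> K (est z)))"
    using integral_abs_bound[of "P t \<bind> K (est z)" "hess (K (est z)) t"] hm by simp
  also have "\<dots> \<le> (\<integral>i. B1 + B1\<^sup>2 \<partial>(P t \<bind> K (est z)))" using hi hb by (intro integral_mono) auto
  finally have vb: "\<bar>v t z\<bar> \<le> B1 + B1\<^sup>2" by (simp add: M.prob_space)
  show "\<bar>hess (K (est z)) t i + v t z\<bar> \<le> B2" for i
    by (rule order_trans[OF abs_triangle_ineq]) (use add_mono[OF hb[of i] vb] in \<open>simp only: mult_2\<close>)
  show "(\<integral>i. hess (K (est z)) t i + v t z \<partial>(P t \<bind> K (est z))) = 0" using hi hm by (simp add: M.prob_space)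
qed

lemma obs_positive_AE:
  assumes z: "z \<in> space MZ" and t: "t \<in> ball \<theta>0 r"
  shows "AE w in stage2 t z. \<forall>i\<in>{m+1..n}. 0 < obs (K (est z)) (p t) (w i)"
proof -
  note \<tau> = est_in[OF z]
  note Kp = K_private[OF \<tau>]
  have tT: "t \<in> \<Theta>" using t in_ball_Theta by auto
  interpret M: prob_space "P t \<bind> K (est z)" by (rule bind_alg(2)[OF Kp tT])
  let ?Z = "{j \<in> {1..}. obs (K (est z)) (p t) j = 0}"
  have "{j} \<in> null_sets (P t \<bind> K (est z))" if "j \<in> ?Z" for j
  proof -
    have "measure (P t \<bind> K (est z)) {j} = obs (K (est z)) (p t) j"
      using measure_bind_kernel[OF Kp tT, of "{j}"] that by (simp add: obs_def)
    thus ?thesis using that stage2_sets[OF \<tau> tT] by (auto simp: null_sets_def M.emeasure_eq_measure)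
  qed
  hence "(\<Union>j\<in>?Z. {j}) \<in> null_sets (P t \<bind> K (est z))" by (intro null_sets_UN') auto
  hence "AE j in P t \<bind> K (est z). j \<notin> ?Z" by (intro AE_not_in) simp
  hence "AE j in P t \<bind> K (est z). 0 < obs (K (est z)) (p t) j"
  proof (rule AE_mp, intro AE_I2 impI)
    fix j assume "j \<in> space (P t \<bind> K (est z))" "j \<notin> ?Z"
    thus "0 < obs (K (est z)) (p t) j"
      using obs_nonneg[OF \<alpha> Kp t, of j] bind_alg(4)[OF Kp tT] by (auto simp: less_le)
  qed
  hence "AE w in stage2 t z. 0 < obs (K (est z)) (p t) (w i)" if "i \<in> {m+1..n}" for i
    using that by (intro AE_PiM_component M.prob_space_axioms)
  thus ?thesis by (intro eventually_ball_finite) auto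
qed

text \<open>Here \<open>u\<close> is the estimator and \<open>I\<close> the limit information, and \<open>A\<close> and \<open>E\<close> are exceptional
  events: outside \<open>A\<close> the first stage leads to a channel whose information is within \<open>\<eta>\<close> of \<open>I\<close>,
  and outside \<open>E\<close> the estimator is a maximizer within \<open>\<kappa>\<close> of \<open>t\<close>. First, \<open>\<surd>n(u - t)\<close> is replaced
  by the linear statistic \<open>V\<close>, which costs the terms in the first line. Then \<open>V\<close> is, given the
  first stage, a sum of iid scores, and its characteristic function is close to the Gaussian one.\<close>

lemma char_bound:
  assumes t: "t \<in> ball \<theta>0 r" and A: "A \<in> sets MZ" and \<eta>: "0 < \<eta>" "6 * \<eta> \<le> I" and lam: "0 < \<zeta>"
    and vA: "\<And>z. z \<in> space MZ - A \<Longrightarrow> \<bar>v t z - I\<bar> \<le> \<eta>"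
    and E: "E \<in> sets (MZ \<Otimes>\<^sub>M MW)"
    and u[measurable]: "u \<in> borel_measurable (MZ \<Otimes>\<^sub>M MW)"
    and mle: "\<And>y. y \<in> space MZ \<times> space MW \<Longrightarrow> y \<notin> E \<Longrightarrow>
       is_arg_max (two_step_loglik P est T k Q m n y) (\<lambda>\<theta>. \<theta> \<in> \<Theta>) (u y) \<and> u y \<in> ball \<theta>0 r \<and> \<bar>u y - t\<bar> \<le> \<kappa>"
    and \<kappa>: "hess_lip \<alpha> * \<kappa> \<le> \<eta>" and n4: "real n \<le> 4 * N"
  shows "cmod ((\<integral>y. iexp (x * (sqrt n * (u y - t))) \<partial>law t) - complex_of_real (exp (- (x\<^sup>2 / (2 * I)))))
    \<le> \<bar>x\<bar> * (12 * \<zeta> * \<eta> / I\<^sup>2) + 2 * (measure (law t) E + measure (stage1 t) A + (B2\<^sup>2 / (\<eta>\<^sup>2 * N) + B1\<^sup>2 / \<zeta>\<^sup>2))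
      + (8 * \<bar>x\<bar>^3 * B1^3 / (I^3 * sqrt N) + 16 * x^4 * B1^4 / (I^4 * N) + x\<^sup>2 / (2 * I\<^sup>2) * (\<bar>real n / N - 1\<bar> * (I + \<eta>) + \<eta>))
      + 2 * measure (stage1 t) A"
proof -
  interpret mixture "law t" "stage1 t" "stage2 t" MZ MW by (rule law_mixture[OF t])
  interpret L: prob_space "law t" by (rule pL)
  have tT: "t \<in> \<Theta>" using t in_ball_Theta by auto
  have I: "0 < I" using \<eta> by linarith
  have c0: "0 \<le> B1" using C1 by simp
  let ?J = "{m+1..n}"
  have cJ: "real (card ?J) = N" by (simp add: N_def)
  define s where "s = sqrt N"
  have s: "0 < s" "s * s = N" using N_pos by (auto simp: s_def)
  have n4': "sqrt n \<le> 2 * s"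
    using real_sqrt_le_mono[OF n4] by (simp add: s_def real_sqrt_mult)
  define S1 where "S1 y = (\<Sum>i\<in>?J. score (K (est (fst y))) t (snd y i))" for y
  define S2 where "S2 y = (\<Sum>i\<in>?J. hess (K (est (fst y))) t (snd y i))" for y
  have S1m[measurable]: "S1 \<in> borel_measurable (MZ \<Otimes>\<^sub>M MW)" unfolding S1_def by (intro borel_measurable_sum score_measurable(1)[OF t])
  have S2m[measurable]: "S2 \<in> borel_measurable (MZ \<Otimes>\<^sub>M MW)" unfolding S2_def by (intro borel_measurable_sum score_measurable(2)[OF t])
  have obm: "(\<lambda>y. obs (K (est (fst y))) (p t) (snd y i)) \<in> borel_measurable (MZ \<Otimes>\<^sub>M MW)" if "i \<in> ?J" for i
    using obs_measurable[OF p_meas[OF tT] that] by (simp add: split_def)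
  \<comment> \<open>exceptional events: \<open>E2\<close> that the averaged second derivative is off by \<open>2 \<eta>\<close>, \<open>E1\<close> that the
  score sum exceeds \<open>\<zeta> \<surd>N\<close>, \<open>E0\<close> that an impossible output is observed\<close>
  define E2 where "E2 = {y \<in> space (MZ \<Otimes>\<^sub>M MW). 2 * \<eta> * N \<le> \<bar>S2 y + N * I\<bar>}"
  define E1 where "E1 = {y \<in> space (MZ \<Otimes>\<^sub>M MW). \<zeta> * s \<le> \<bar>S1 y\<bar>}"
  define E0 where "E0 = {y \<in> space (MZ \<Otimes>\<^sub>M MW). \<exists>i\<in>?J. \<not> 0 < obs (K (est (fst y))) (p t) (snd y i)}"
  have E2s: "E2 \<in> sets (MZ \<Otimes>\<^sub>M MW)" unfolding E2_def by measurable
  have E1s: "E1 \<in> sets (MZ \<Otimes>\<^sub>M MW)" unfolding E1_def by measurable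
  have E0s: "E0 \<in> sets (MZ \<Otimes>\<^sub>M MW)"
    unfolding E0_def
  proof (rule sets.sets_Collect_finite_Ex)
    fix i assume "i \<in> ?J"
    from obm[OF this] show "{y \<in> space (MZ \<Otimes>\<^sub>M MW). \<not> 0 < obs (K (est (fst y))) (p t) (snd y i)} \<in> sets (MZ \<Otimes>\<^sub>M MW)"
      by measurable
  qed simp
  define \<epsilon>1 where "\<epsilon>1 = B2\<^sup>2 / (\<eta>\<^sup>2 * N) + B1\<^sup>2 / \<zeta>\<^sup>2"
  have \<epsilon>1: "0 \<le> \<epsilon>1" using N_pos by (simp add: \<epsilon>1_def)
  have bad': "measure (law t) (E0 \<union> E1 \<union> E2) \<le> \<epsilon>1 + measure (stage1 t) A"
  proof (rule measure_le[OF _ A \<epsilon>1])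
    show "E0 \<union> E1 \<union> E2 \<in> sets (MZ \<Otimes>\<^sub>M MW)" using E0s E1s E2s by auto
    fix z assume zA: "z \<in> space MZ - A"
    hence z: "z \<in> space MZ" by simp
    interpret Sz: prob_space "stage2 t z" by (rule S_prob[OF z])
    interpret sc: bounded_iid "P t \<bind> K (est z)" "score (K (est z)) t" B1 by (rule score_iid[OF z t])
    interpret he: bounded_iid "P t \<bind> K (est z)" "\<lambda>i. hess (K (est z)) t i + v t z" B2 by (rule hess_iid[OF z t])
    let ?sec = "\<lambda>E. {w \<in> space MW. (z, w) \<in> E}"
    have sec: "?sec E \<in> sets (stage2 t z)" if "E \<in> sets (MZ \<Otimes>\<^sub>M MW)" for E
    proof -
      have "?sec E = Pair z -` E" using sets.sets_into_space[OF that] by (auto simp: space_pair_measure)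
      thus ?thesis using sets_Pair1[OF that, of z] S_sets[OF z] by simp
    qed
    have spz: "space (stage2 t z) = space MW" by (rule spaces(3)[OF z])
    have h0: "measure (stage2 t z) (?sec E0) = 0"
    proof -
      have "AE w in stage2 t z. w \<notin> ?sec E0"
        using obs_positive_AE[OF z t] by eventually_elim (auto simp: E0_def)
      thus ?thesis unfolding Sz.prob_eq_0[OF sec[OF E0s]] .
    qed
    have h1: "measure (stage2 t z) (?sec E1) \<le> B1\<^sup>2 / \<zeta>\<^sup>2"
    proof -
      have eq: "?sec E1 = {w \<in> space (stage2 t z). \<zeta> * s \<le> \<bar>\<Sum>i\<in>?J. score (K (est z)) t (w i)\<bar>}"
        unfolding spz using z by (auto simp: E1_def S1_def space_pair_measure)
      have "measure (stage2 t z) (?sec E1) \<le> real (card ?J) * B1\<^sup>2 / (\<zeta> * s)\<^sup>2"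
        unfolding eq using lam s by (intro sc.sum_tail) auto
      also have "\<dots> = B1\<^sup>2 / \<zeta>\<^sup>2"
        using s lam N_pos unfolding cJ by (simp add: power_mult_distrib power2_eq_square[of s] s(2))
      finally show ?thesis .
    qed
    have h2: "measure (stage2 t z) (?sec E2) \<le> B2\<^sup>2 / (\<eta>\<^sup>2 * N)"
    proof -
      have sub: "?sec E2 \<subseteq> {w \<in> space (stage2 t z). \<eta> * N \<le> \<bar>\<Sum>i\<in>?J. hess (K (est z)) t (w i) + v t z\<bar>}"
      proof
        fix w assume "w \<in> ?sec E2"
        hence w: "w \<in> space MW" "2 * \<eta> * N \<le> \<bar>(\<Sum>i\<in>?J. hess (K (est z)) t (w i)) + N * I\<bar>" by (auto simp: E2_def S2_def)
        have "(\<Sum>i\<in>?J. hess (K (est z)) t (w i) + v t z) = (\<Sum>i\<in>?J. hess (K (est z)) t (w i)) + N * I + N * (v t z - I)"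
          by (simp add: sum.distrib algebra_simps N_def)
        moreover have "\<bar>N * (v t z - I)\<bar> \<le> N * \<eta>" using mult_left_mono[OF vA[OF zA], of N] N_pos by (simp add: abs_mult)
        moreover have "c \<le> \<bar>X + Y\<bar>" if "2 * c \<le> \<bar>X\<bar>" "\<bar>Y\<bar> \<le> c" for c X Y :: real using that by linarith
        ultimately have "\<eta> * N \<le> \<bar>\<Sum>i\<in>?J. hess (K (est z)) t (w i) + v t z\<bar>"
          using w(2) by (simp only: mult.assoc mult.commute[of N \<eta>])
        thus "w \<in> {w \<in> space (stage2 t z). \<eta> * N \<le> \<bar>\<Sum>i\<in>?J. hess (K (est z)) t (w i) + v t z\<bar>}" using w(1) spz by simp
      qed
      have ms: "{w \<in> space (stage2 t z). \<eta> * N \<le> \<bar>\<Sum>i\<in>?J. hess (K (est z)) t (w i) + v t z\<bar>} \<in> sets (stage2 t z)"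
        using he.sum_meas[of ?J] by measurable
      have "measure (stage2 t z) (?sec E2) \<le> measure (stage2 t z) {w \<in> space (stage2 t z). \<eta> * N \<le> \<bar>\<Sum>i\<in>?J. hess (K (est z)) t (w i) + v t z\<bar>}"
        by (rule Sz.finite_measure_mono[OF sub ms])
      also have "\<dots> \<le> real (card ?J) * B2\<^sup>2 / (\<eta> * N)\<^sup>2" using \<eta> N_pos by (intro he.sum_tail) auto
      also have "\<dots> = B2\<^sup>2 / (\<eta>\<^sup>2 * N)"
      proof -
        have "N' * b / (\<eta> * N')\<^sup>2 = b / (\<eta>\<^sup>2 * N')" if "0 < N'" for N' b :: real
          using that \<eta> by (simp add: power2_eq_square)
        thus ?thesis unfolding cJ using N_pos by blast
      qed
      finally show ?thesis .
    qed
    have "?sec (E0 \<union> E1 \<union> E2) = (?sec E0 \<union> ?sec E1) \<union> ?sec E2" by auto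
    hence "measure (stage2 t z) (?sec (E0 \<union> E1 \<union> E2)) \<le> measure (stage2 t z) (?sec E0 \<union> ?sec E1) + measure (stage2 t z) (?sec E2)"
      using sec[OF E0s] sec[OF E1s] sec[OF E2s] by (simp only:) (intro measure_Un_le, auto)
    also have "measure (stage2 t z) (?sec E0 \<union> ?sec E1) \<le> measure (stage2 t z) (?sec E0) + measure (stage2 t z) (?sec E1)"
      using sec[OF E0s] sec[OF E1s] by (intro measure_Un_le) auto
    finally show "measure (stage2 t z) (?sec (E0 \<union> E1 \<union> E2)) \<le> \<epsilon>1" using h0 h1 h2 by (simp add: \<epsilon>1_def)
  qed
  define Bad where "Bad = E \<union> (E0 \<union> E1 \<union> E2)"
  have Bads: "Bad \<in> sets (MZ \<Otimes>\<^sub>M MW)" unfolding Bad_def using E E0s E1s E2s by auto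
  have LBad: "measure (law t) Bad \<le> measure (law t) E + (\<epsilon>1 + measure (stage1 t) A)"
  proof -
    have "measure (law t) Bad \<le> measure (law t) E + measure (law t) (E0 \<union> E1 \<union> E2)"
      unfolding Bad_def using E E0s E1s E2s sL by (intro measure_Un_le) auto
    thus ?thesis using bad' by linarith
  qed
  define U where "U y = sqrt n * (u y - t)" for y
  \<comment> \<open>the linear approximation of the estimation error \<open>U\<close>\<close>
  define V where "V y = sqrt n * S1 y / (N * I)" for y
  have Um[measurable]: "U \<in> borel_measurable (MZ \<Otimes>\<^sub>M MW)" unfolding U_def by measurable
  have Vm[measurable]: "V \<in> borel_measurable (MZ \<Otimes>\<^sub>M MW)" unfolding V_def by measurable
  have close: "\<bar>U y - V y\<bar> \<le> 12 * \<zeta> * \<eta> / I\<^sup>2" if y: "y \<in> space MZ \<times> space MW" "y \<notin> Bad" for y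
  proof -
    obtain z w where yzw: "y = (z, w)" by (cases y)
    have z: "z \<in> space MZ" and w: "w \<in> space MW" using y(1) by (auto simp: yzw)
    have w1: "1 \<le> w i" if "i \<in> ?J" for i using w that by (auto simp: space_PiM PiE_def Pi_def)
    have sp: "y \<in> space (MZ \<Otimes>\<^sub>M MW)" using y(1) by (simp add: space_pair_measure)
    have n0: "0 < obs (K (est z)) (p t) (w i)" if "i \<in> ?J" for i using y(2) sp that by (auto simp: Bad_def E0_def yzw)
    have n1: "\<bar>S1 y\<bar> \<le> \<zeta> * s" and n2: "\<bar>S2 y + N * I\<bar> \<le> 2 * \<eta> * N" using y(2) sp by (auto simp: Bad_def E1_def E2_def)
    note M = mle[OF y(1)]
    have yE: "y \<notin> E" using y(2) by (simp add: Bad_def)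
    have am: "is_arg_max (two_step_loglik P est T k Q m n (z, w)) (\<lambda>\<theta>. \<theta> \<in> \<Theta>) (u y)" "u y \<in> ball \<theta>0 r"
      using M[OF yE] by (auto simp: yzw)
    obtain \<rho> where \<rho>: "\<bar>\<rho>\<bar> \<le> hess_lip \<alpha> * \<bar>u y - t\<bar>" "S1 y + (u y - t) * (S2 y + N * \<rho>) = 0"
      by (rule mle_expansion[where z = z and w = w and t = t and u = "u y", OF z w1 t n0 am])
        (simp_all add: S1_def S2_def yzw)
    have lip0: "0 \<le> hess_lip \<alpha>" using C1 by (simp add: hess_lip_def[OF \<alpha> K_private[OF est_in[OF z]]])
    have \<rho>b: "\<bar>\<rho>\<bar> \<le> \<eta>" using \<rho>(1) mult_left_mono[OF conjunct2[OF conjunct2[OF M[OF yE]]] lip0] \<kappa> by linarith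
    \<comment> \<open>the random slope that divides the score sum; it is within \<open>3 \<eta> \<le> I/2\<close> of \<open>I\<close>\<close>
    define D where "D = - (S2 y + N * \<rho>) / N"
    have DI: "\<bar>D - I\<bar> \<le> 3 * \<eta>"
    proof -
      define X where "X = (S2 y + N * I) / N"
      have "D - I = - (X + \<rho>)" using N_pos by (simp add: D_def X_def field_simps)
      moreover have "\<bar>X\<bar> \<le> 2 * \<eta>" unfolding X_def using n2 N_pos by (simp add: abs_divide divide_le_eq)
      ultimately show ?thesis using \<rho>b by linarith
    qed
    have D2: "I / 2 \<le> D" using DI \<eta> by linarith
    hence D0: "0 < D" using I by linarith
    have "N' * (- X / N') = - X" if "0 < N'" for N' X :: real using that by simp
    from this[OF N_pos] have ND: "N * D = - (S2 y + N * \<rho>)" unfolding D_def .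
    have "S1 y = (u y - t) * (N * D)" unfolding ND using \<rho>(2) by (simp only: mult_minus_right eq_neg_iff_add_eq_0)
    hence Ueq: "U y = sqrt n * S1 y / (N * D)" using N_pos D0 by (simp add: U_def)
    have "U y - V y = sqrt n * S1 y / N * ((I - D) / (D * I))"
      unfolding Ueq V_def using N_pos D0 I by (simp add: field_simps)
    hence "\<bar>U y - V y\<bar> = sqrt n * \<bar>S1 y\<bar> / N * (\<bar>D - I\<bar> / (D * I))"
      using N_pos D0 I by (simp add: abs_mult abs_divide abs_minus_commute)
    also have "\<dots> \<le> (2 * s) * (\<zeta> * s) / N * ((3 * \<eta>) / ((I / 2) * I))"
      using n4' n1 DI D2 D0 I s N_pos lam \<eta> by (intro mult_mono divide_right_mono frac_le divide_nonneg_nonneg mult_nonneg_nonneg mult_right_mono) auto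
    also have "(2 * s) * (\<zeta> * s) / N = 2 * \<zeta>" using s(1) by (simp add: s(2)[symmetric])
    also have "2 * \<zeta> * ((3 * \<eta>) / ((I / 2) * I)) = 12 * \<zeta> * \<eta> / I\<^sup>2" by (simp add: power2_eq_square)
    finally show ?thesis .
  qed
  have iexp_int: "integrable (law t) (\<lambda>y. iexp (x * W y))" if W[measurable]: "W \<in> borel_measurable (MZ \<Otimes>\<^sub>M MW)" for W
  proof (rule L.integrable_const_bound[of _ 1])
    show "(\<lambda>y. iexp (x * W y)) \<in> borel_measurable (law t)"
      by (subst measurable_cong_sets[OF sL refl]) measurable
  qed simp
  note iU = iexp_int[OF Um] and iV = iexp_int[OF Vm]
  have iB: "integrable (law t) (indicator Bad :: _ \<Rightarrow> real)" using Bads sL by (intro integrable_real_indicator) (auto simp: less_top[symmetric])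
  define q where "q = \<bar>x\<bar> * (12 * \<zeta> * \<eta> / I\<^sup>2)"
  have q0: "0 \<le> q" using lam \<eta> by (simp add: q_def)
  \<comment> \<open>\<open>U\<close> and \<open>V\<close> are close outside \<open>Bad\<close>, and on \<open>Bad\<close> the integrands differ by at most \<open>2\<close>\<close>
  have step1: "cmod ((\<integral>y. iexp (x * U y) \<partial>law t) - (\<integral>y. iexp (x * V y) \<partial>law t)) \<le> q + 2 * measure (law t) Bad"
  proof -
    have "(\<integral>y. iexp (x * U y) \<partial>law t) - (\<integral>y. iexp (x * V y) \<partial>law t) = (\<integral>y. iexp (x * U y) - iexp (x * V y) \<partial>law t)"
      by (rule Bochner_Integration.integral_diff[OF iU iV, symmetric])
    also have "cmod \<dots> \<le> (\<integral>y. cmod (iexp (x * U y) - iexp (x * V y)) \<partial>law t)" by (rule integral_norm_bound)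
    also have "\<dots> \<le> (\<integral>y. q + 2 * indicator Bad y \<partial>law t)"
    proof (rule integral_mono)
      show "integrable (law t) (\<lambda>y. cmod (iexp (x * U y) - iexp (x * V y)))" using iU iV by auto
      show "integrable (law t) (\<lambda>y. q + 2 * indicator Bad y)" using iB by (intro Bochner_Integration.integrable_add integrable_mult_right) auto
      fix y assume "y \<in> space (law t)"
      hence y: "y \<in> space MZ \<times> space MW" using spaces(2) by simp
      show "cmod (iexp (x * U y) - iexp (x * V y)) \<le> q + 2 * indicator Bad y"
      proof (cases "y \<in> Bad")
        case True
        have "cmod (iexp (x * U y) - iexp (x * V y)) \<le> cmod (iexp (x * U y)) + cmod (iexp (x * V y))" by (rule norm_triangle_ineq4)
        thus ?thesis using True q0 by simp
      next
        case False
        have "cmod (iexp (x * U y) - iexp (x * V y)) \<le> \<bar>x * U y - x * V y\<bar>" by (rule cmod_iexp_diff)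
        also have "\<dots> = \<bar>x\<bar> * \<bar>U y - V y\<bar>" by (simp add: abs_mult flip: right_diff_distrib)
        also have "\<dots> \<le> q" unfolding q_def by (rule mult_left_mono[OF close[OF y False]]) simp
        finally show ?thesis using False by simp
      qed
    qed
    also have "\<dots> = q + 2 * measure (law t) Bad"
      using iB Bads sL sets.sets_into_space[OF Bads] spaces(2) L.prob_space
      by (subst Bochner_Integration.integral_add) (auto simp: Int_absorb2 space_pair_measure)
    finally show ?thesis .
  qed
  define \<epsilon>2 where "\<epsilon>2 = 8 * \<bar>x\<bar>^3 * B1^3 / (I^3 * sqrt N) + 16 * x^4 * B1^4 / (I^4 * N) + x\<^sup>2 / (2 * I\<^sup>2) * (\<bar>real n / N - 1\<bar> * (I + \<eta>) + \<eta>)"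
  have \<epsilon>2: "0 \<le> \<epsilon>2" unfolding \<epsilon>2_def using I \<eta> N_pos c0 by (intro add_nonneg_nonneg mult_nonneg_nonneg divide_nonneg_nonneg) auto
  have step2: "cmod ((\<integral>y. iexp (x * V y) \<partial>law t) - complex_of_real (exp (- (x\<^sup>2 / (2 * I))))) \<le> \<epsilon>2 + 2 * measure (stage1 t) A"
  proof (rule integral_close[OF _ _ _ A _ \<epsilon>2])
    show "(\<lambda>y. iexp (x * V y)) \<in> borel_measurable (MZ \<Otimes>\<^sub>M MW)" by measurable
    show "cmod (complex_of_real (exp (- (x\<^sup>2 / (2 * I))))) \<le> 1" unfolding norm_of_real using I by simp
    fix z assume zA: "z \<in> space MZ - A"
    hence z: "z \<in> space MZ" by simp
    interpret sc: bounded_iid "P t \<bind> K (est z)" "score (K (est z)) t" B1 by (rule score_iid[OF z t])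
    define b where "b = x * sqrt n / (N * I)"
    have Vz: "x * V (z, w) = b * (\<Sum>i\<in>?J. score (K (est z)) t (w i))" for w by (simp add: V_def S1_def b_def)
    have var: "(\<integral>i. (score (K (est z)) t i)\<^sup>2 \<partial>(P t \<bind> K (est z))) = v t z"
      using score_variance[OF \<alpha> K_private[OF est_in[OF z]] K_one[OF est_in[OF z]] t] by (simp add: v_eq)
    have v0: "0 \<le> v t z" unfolding var[symmetric] by (intro integral_nonneg_AE) auto
    have 1: "cmod ((\<integral>w. iexp (x * V (z, w)) \<partial>stage2 t z) - complex_of_real (exp (- (N * b\<^sup>2 * v t z / 2)))) \<le> N * (\<bar>b\<bar>^3 * B1^3 + b^4 * B1^4)"
      using sc.char_sum_close[of ?J b] unfolding var cJ Vz by simp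
    have bb: "\<bar>b\<bar> \<le> 2 * \<bar>x\<bar> / (I * s)"
    proof -
      have "\<bar>b\<bar> = \<bar>x\<bar> * sqrt n / (N * I)" using N_pos I by (simp add: b_def abs_mult)
      also have "\<dots> \<le> \<bar>x\<bar> * (2 * s) / (N * I)" using n4' N_pos I by (intro divide_right_mono mult_left_mono) auto
      also have "\<dots> = 2 * \<bar>x\<bar> / (I * s)" using s(1) I by (simp add: s(2)[symmetric] mult.commute)
      finally show ?thesis .
    qed
    have b3: "N * (\<bar>b\<bar>^3 * B1^3) \<le> 8 * \<bar>x\<bar>^3 * B1^3 / (I^3 * sqrt N)"
    proof -
      have "N * (\<bar>b\<bar>^3 * B1^3) \<le> N * ((2 * \<bar>x\<bar> / (I * s))^3 * B1^3)"
        using bb N_pos c0 by (intro mult_left_mono mult_right_mono power_mono) auto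
      also have "\<dots> = 8 * \<bar>x\<bar>^3 * B1^3 / (I^3 * s)"
        using s(1) I by (simp add: s(2)[symmetric] power3_eq_cube)
      finally show ?thesis by (simp add: s_def)
    qed
    have b4: "N * (b^4 * B1^4) \<le> 16 * x^4 * B1^4 / (I^4 * N)"
    proof -
      have "b^4 = \<bar>b\<bar>^4" by simp
      hence "N * (b^4 * B1^4) \<le> N * ((2 * \<bar>x\<bar> / (I * s))^4 * B1^4)"
        using bb N_pos c0 by (simp only:) (intro mult_left_mono mult_right_mono power_mono, auto)
      also have "\<dots> = 16 * x^4 * B1^4 / (I^4 * N)"
      proof -
        have "(s * s) * ((2 * a / (I * s))^4 * b) = 16 * a^4 * b / (I^4 * (s * s))" for a b :: real
          using s(1) I by (simp add: power4_eq_xxxx field_simps)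
        from this[of "\<bar>x\<bar>" "B1^4"] show ?thesis by (simp only: s(2) power_even_abs even_numeral)
      qed
      finally show ?thesis .
    qed
    have Nb: "N * b\<^sup>2 * v t z / 2 - x\<^sup>2 / (2 * I) = x\<^sup>2 / (2 * I\<^sup>2) * (real n / N * v t z - I)"
    proof -
      have "N * b\<^sup>2 = x\<^sup>2 * real n / (N * I\<^sup>2)" using N_pos by (simp add: b_def power_mult_distrib power_divide power2_eq_square[of N])
      thus ?thesis using I N_pos by (simp add: field_simps power2_eq_square)
    qed
    have "\<bar>real n / N * v t z - I\<bar> \<le> \<bar>real n / N - 1\<bar> * (I + \<eta>) + \<eta>"
    proof -
      have "real n / N * v t z - I = (real n / N - 1) * v t z + (v t z - I)" by (simp add: algebra_simps)
      hence "\<bar>real n / N * v t z - I\<bar> \<le> \<bar>(real n / N - 1) * v t z\<bar> + \<bar>v t z - I\<bar>" by (simp only: abs_triangle_ineq)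
      also have "\<bar>(real n / N - 1) * v t z\<bar> \<le> \<bar>real n / N - 1\<bar> * (I + \<eta>)"
        using vA[OF zA] v0 by (simp add: abs_mult) (intro mult_left_mono, auto)
      finally show ?thesis using vA[OF zA] by linarith
    qed
    moreover have "\<bar>c * y\<bar> \<le> c * b" if "\<bar>y\<bar> \<le> b" "0 \<le> c" for c y b :: real
      using that by (simp add: abs_mult mult_left_mono)
    ultimately have Nb': "\<bar>N * b\<^sup>2 * v t z / 2 - x\<^sup>2 / (2 * I)\<bar> \<le> x\<^sup>2 / (2 * I\<^sup>2) * (\<bar>real n / N - 1\<bar> * (I + \<eta>) + \<eta>)"
      unfolding Nb by (meson divide_nonneg_nonneg mult_nonneg_nonneg zero_le_numeral zero_le_power2)
    have 2: "cmod (complex_of_real (exp (- (N * b\<^sup>2 * v t z / 2))) - complex_of_real (exp (- (x\<^sup>2 / (2 * I)))))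
      \<le> x\<^sup>2 / (2 * I\<^sup>2) * (\<bar>real n / N - 1\<bar> * (I + \<eta>) + \<eta>)"
    proof -
      have "0 \<le> N * b\<^sup>2 * v t z / 2" "0 \<le> x\<^sup>2 / (2 * I)" using N_pos v0 I by auto
      from exp_minus_lipschitz[OF this] Nb' show ?thesis
        unfolding of_real_diff[symmetric] norm_of_real by linarith
    qed
    have "cmod ((\<integral>w. iexp (x * V (z, w)) \<partial>stage2 t z) - complex_of_real (exp (- (x\<^sup>2 / (2 * I)))))
       \<le> N * (\<bar>b\<bar>^3 * B1^3 + b^4 * B1^4) + x\<^sup>2 / (2 * I\<^sup>2) * (\<bar>real n / N - 1\<bar> * (I + \<eta>) + \<eta>)"
      using norm_triangle_ineq[of "(\<integral>w. iexp (x * V (z, w)) \<partial>stage2 t z) - complex_of_real (exp (- (N * b\<^sup>2 * v t z / 2)))"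
         "complex_of_real (exp (- (N * b\<^sup>2 * v t z / 2))) - complex_of_real (exp (- (x\<^sup>2 / (2 * I))))"] 1 2 by simp
    also have "\<dots> \<le> \<epsilon>2" unfolding \<epsilon>2_def distrib_left using b3 b4 by linarith
    finally show "cmod ((\<integral>w. iexp (x * V (z, w)) \<partial>stage2 t z) - complex_of_real (exp (- (x\<^sup>2 / (2 * I))))) \<le> \<epsilon>2" .
  qed simp
  have "cmod ((\<integral>y. iexp (x * U y) \<partial>law t) - complex_of_real (exp (- (x\<^sup>2 / (2 * I)))))
    \<le> (q + 2 * measure (law t) Bad) + (\<epsilon>2 + 2 * measure (stage1 t) A)"
    using norm_triangle_ineq[of "(\<integral>y. iexp (x * U y) \<partial>law t) - (\<integral>y. iexp (x * V y) \<partial>law t)"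
       "(\<integral>y. iexp (x * V y) \<partial>law t) - complex_of_real (exp (- (x\<^sup>2 / (2 * I))))"] step1 step2 by simp
  also have "\<dots> \<le> q + 2 * (measure (law t) E + measure (stage1 t) A + \<epsilon>1) + \<epsilon>2 + 2 * measure (stage1 t) A"
    using LBad by (simp add: algebra_simps)
  finally show ?thesis unfolding q_def \<epsilon>1_def \<epsilon>2_def U_def .
qed

end

section \<open>The limit law\<close>

text \<open>A rescaled standard normal distribution.\<close>

lemma normal_distribution_char:
  assumes I: "0 < I"
  defines "M \<equiv> density lborel (\<lambda>x. ennreal (normal_density 0 (sqrt (1 / I)) x))"
  shows "real_distribution M" "char M t = complex_of_real (exp (- (t\<^sup>2 / (2 * I))))"
proof -
  interpret std: real_distribution std_normal_distribution by (rule real_dist_normal_dist)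
  define \<sigma> where "\<sigma> = sqrt (1 / I)"
  have \<sigma>: "0 < \<sigma>" "\<sigma>\<^sup>2 = 1 / I" using I by (auto simp: \<sigma>_def)
  have "distributed std_normal_distribution lborel (\<lambda>x. x) (\<lambda>x. ennreal (normal_density 0 1 x))"
    by (auto simp: distributed_def intro!: measure_eqI simp: emeasure_distr)
  from std.normal_density_affine[OF this, of \<sigma> 0] \<sigma>
  have "distributed std_normal_distribution lborel (\<lambda>x. \<sigma> * x) (\<lambda>x. ennreal (normal_density 0 \<sigma> x))" by simp
  hence d: "distr std_normal_distribution lborel (\<lambda>x. \<sigma> * x) = M"
    by (simp add: distributed_def M_def \<sigma>_def)
  have M: "M = distr std_normal_distribution borel (\<lambda>x. \<sigma> * x)"
    unfolding d[symmetric] by (rule distr_cong) auto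
  show "real_distribution M" unfolding M by (rule std.real_distribution_distr) simp
  have "char M t = (\<integral>x. iexp (t * (\<sigma> * x)) \<partial>std_normal_distribution)"
    unfolding M char_def by (rule integral_distr) auto
  also have "\<dots> = char std_normal_distribution (t * \<sigma>)" by (simp add: char_def mult.assoc)
  also have "\<dots> = complex_of_real (exp (- (t\<^sup>2 / (2 * I))))"
    using \<sigma> by (simp add: char_std_normal_distribution power_mult_distrib)
  finally show "char M t = complex_of_real (exp (- (t\<^sup>2 / (2 * I))))" .
qed

text \<open>The laws in question are known to be probability measures for large \<open>n\<close> only; the others
  are replaced by the limit.\<close>

lemma levy_continuity_eventually:
  assumes M: "\<forall>\<^sub>F n in sequentially. real_distribution (M n)" and M': "real_distribution M'"
    and c: "\<And>t. (\<lambda>n. char (M n) t) \<longlonglongrightarrow> char M' t"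
  shows "weak_conv_m M M'"
proof -
  define D where "D n = (if real_distribution (M n) then M n else M')" for n
  have ev: "\<forall>\<^sub>F n in sequentially. D n = M n" using M by eventually_elim (simp add: D_def)
  have "weak_conv_m D M'"
  proof (rule levy_continuity)
    show "real_distribution (D n)" for n using M' by (simp add: D_def)
    show "(\<lambda>n. char (D n) t) \<longlonglongrightarrow> char M' t" for t
      by (rule Lim_transform_eventually[OF c]) (use ev in \<open>eventually_elim, simp\<close>)
  qed (rule M')
  thus ?thesis
    unfolding weak_conv_m_def weak_conv_def
  proof (intro allI impI)
    fix x assume w: "\<forall>x. isCont (cdf M') x \<longrightarrow> (\<lambda>n. cdf (D n) x) \<longlonglongrightarrow> cdf M' x" and "isCont (cdf M') x"
    hence "(\<lambda>n. cdf (D n) x) \<longlonglongrightarrow> cdf M' x" by blast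
    thus "(\<lambda>n. cdf (M n) x) \<longlonglongrightarrow> cdf M' x"
      by (rule Lim_transform_eventually) (use ev in \<open>eventually_elim, simp\<close>)
  qed
qed

lemma local_likelihood_constant:
  assumes "0 < n"
  shows "(1 + (b * (h / sqrt (real n)))\<^sup>2) ^ n \<le> exp ((b * h)\<^sup>2)"
proof -
  have "(1 + (b * (h / sqrt (real n)))\<^sup>2) ^ n \<le> (exp ((b * (h / sqrt (real n)))\<^sup>2)) ^ n"
    by (intro power_mono exp_ge_add_one_self) simp
  also have "\<dots> = exp (real n * (b * (h / sqrt (real n)))\<^sup>2)" by (simp add: exp_of_nat_mult)
  also have "real n * (b * (h / sqrt (real n)))\<^sup>2 = (b * h)\<^sup>2" using assms by (simp add: power_mult_distrib power_divide)
  finally show ?thesis .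
qed

theorem theorem4p12:
  fixes \<mu> :: "'x::euclidean_space measure"
    and \<Theta> :: "real set" and \<alpha> :: real
    and P :: "real \<Rightarrow> 'x measure"
    and p s p1 p2 p3 :: "real \<Rightarrow> 'x \<Rightarrow> real"
    and Z0 :: "'z measure" and Q0 :: "'x \<Rightarrow> 'z measure"
    and est :: "nat \<Rightarrow> (nat \<Rightarrow> 'z) \<Rightarrow> real"
    and T :: "nat \<Rightarrow> 'x \<times> real \<Rightarrow> nat" and k :: "nat \<Rightarrow> real \<Rightarrow> nat"
    and Q :: "nat \<Rightarrow> nat \<times> real \<Rightarrow> nat measure"
    and n1 :: "nat \<Rightarrow> nat"
    and \<theta>hat :: "nat \<Rightarrow> (nat \<Rightarrow> 'z) \<times> (nat \<Rightarrow> nat) \<Rightarrow> real"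
    and \<theta>0 :: real
  defines "law \<equiv> \<lambda>n \<theta>. two_step_law Z0 Q0 (est (n1 n)) (T (n1 n)) (Q (n1 n)) (n1 n) n (P \<theta>)"
  defines "Istar \<equiv> optimal_info TYPE('w) \<alpha> \<mu> \<Theta> P \<theta>0"
  assumes \<alpha>: "0 < \<alpha>"
    and model: "dominated_model \<mu> \<Theta> p P"
    and C1: "\<forall>\<theta>\<in>\<Theta>. dqm_at \<mu> \<Theta> p (s \<theta>) \<theta>"
    and C2: "(\<lambda>(x, \<theta>). p \<theta> x) \<in> borel_measurable (\<mu> \<Otimes>\<^sub>M param_space \<Theta>)"
            "(\<lambda>(x, \<theta>). s \<theta> x) \<in> borel_measurable (\<mu> \<Otimes>\<^sub>M param_space \<Theta>)"
    and C3: "\<forall>\<theta>\<in>\<Theta>. ((\<lambda>t. \<integral>\<^sup>+x. ennreal ((s t x * sqrt (p t x) - s \<theta> x * sqrt (p \<theta> x))\<^sup>2) \<partial>\<mu>)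
                       \<longlongrightarrow> 0) (at \<theta> within \<Theta>)"
    and deriv1: "\<forall>x\<in>space \<mu>. \<forall>\<theta>\<in>\<Theta>. ((\<lambda>t. p t x) has_real_derivative p1 \<theta> x) (at \<theta>)"
    and deriv2: "\<forall>x\<in>space \<mu>. \<forall>\<theta>\<in>\<Theta>. ((\<lambda>t. p1 t x) has_real_derivative p2 \<theta> x) (at \<theta>)"
    and deriv3: "\<forall>x\<in>space \<mu>. \<forall>\<theta>\<in>\<Theta>. ((\<lambda>t. p2 t x) has_real_derivative p3 \<theta> x) (at \<theta>)"
    and deriv3_cont: "\<forall>x\<in>space \<mu>. continuous_on \<Theta> (\<lambda>\<theta>. p3 \<theta> x)"
    and L1_finite: "\<forall>\<theta>\<in>\<Theta>. integrable \<mu> (p1 \<theta>) \<and> integrable \<mu> (p2 \<theta>) \<and> integrable \<mu> (p3 \<theta>)"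
    and L1_norm_cont: "continuous_on \<Theta> (\<lambda>\<theta>. \<integral>x. \<bar>p1 \<theta> x\<bar> \<partial>\<mu>)"
                      "continuous_on \<Theta> (\<lambda>\<theta>. \<integral>x. \<bar>p2 \<theta> x\<bar> \<partial>\<mu>)"
                      "continuous_on \<Theta> (\<lambda>\<theta>. \<integral>x. \<bar>p3 \<theta> x\<bar> \<partial>\<mu>)"
    and L1_cont: "\<forall>\<theta>\<in>\<Theta>. ((\<lambda>t. \<integral>x. \<bar>p3 t x - p3 \<theta> x\<bar> \<partial>\<mu>) \<longlongrightarrow> 0) (at \<theta> within \<Theta>)"
    and Q0: "Q0 \<in> private_kernels \<alpha> \<mu> Z0"
    and identifiable: "inj_on (\<lambda>\<theta>. P \<theta> \<bind> Q0) \<Theta>"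
    and preliminary: "consistent_preliminary_estimator \<Theta> Z0 (\<lambda>\<theta>. P \<theta> \<bind> Q0) est"
    and quantizer: "consistent_quantizer \<mu> \<Theta> P p s T k"
    and Q: "\<forall>m\<ge>1. measurable_info_maximizer \<alpha> \<Theta> P (T m) (k m) (Q m)"
    and mle: "\<forall>n. 1 \<le> n1 n \<and> n1 n < n \<longrightarrow>
                two_step_mle \<Theta> P Z0 (est (n1 n)) (T (n1 n)) (k (n1 n)) (Q (n1 n)) (n1 n) n (\<theta>hat n)"
    and "\<theta>0 \<in> \<Theta>"
    and infinite_outputs: "infinite (UNIV :: 'w set)"
    and "0 < Istar"
    and "filterlim n1 at_top sequentially"
    and "(\<lambda>n. real (n1 n) / real n) \<longlonglongrightarrow> 0"
    and mle_exists: "(\<lambda>n. measure (law n \<theta>0) {zw \<in> space (law n \<theta>0).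
            two_step_mle_exists \<Theta> P (est (n1 n)) (T (n1 n)) (k (n1 n)) (Q (n1 n)) (n1 n) n zw})
          \<longlonglongrightarrow> 1"
    and consistent: "\<forall>\<epsilon>>0. (\<lambda>n. measure (law n \<theta>0)
            {zw \<in> space (law n \<theta>0). \<bar>\<theta>hat n zw - \<theta>0\<bar> > \<epsilon>}) \<longlonglongrightarrow> 0"
  shows "\<forall>h :: real.
      weak_conv_m
        (\<lambda>n. distr (law n (\<theta>0 + h / sqrt (real n))) borel
               (\<lambda>zw. sqrt (real n) * (\<theta>hat n zw - (\<theta>0 + h / sqrt (real n)))))
        (density lborel (\<lambda>x. ennreal (normal_density 0 (sqrt (1 / Istar)) x)))"
proof (intro allI)
  fix h :: real
  note th0 = \<open>\<theta>0 \<in> \<Theta>\<close> and Ipos = \<open>0 < Istar\<close> and n1_inf = \<open>filterlim n1 at_top sequentially\<close>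
    and n1_small = \<open>(\<lambda>n. real (n1 n) / real n) \<longlonglongrightarrow> 0\<close>
  have op: "open \<Theta>"
  proof -
    have "\<Theta> \<subseteq> interior \<Theta>" using C1 by (auto simp: dqm_at_def)
    thus ?thesis by (metis interior_subset open_interior subset_antisym)
  qed
  have d1: "\<And>x t. x \<in> space \<mu> \<Longrightarrow> t \<in> \<Theta> \<Longrightarrow> ((\<lambda>t. p t x) has_real_derivative p1 t x) (at t)"
    and d2: "\<And>x t. x \<in> space \<mu> \<Longrightarrow> t \<in> \<Theta> \<Longrightarrow> ((\<lambda>t. p1 t x) has_real_derivative p2 t x) (at t)"
    and d3: "\<And>x t. x \<in> space \<mu> \<Longrightarrow> t \<in> \<Theta> \<Longrightarrow> ((\<lambda>t. p2 t x) has_real_derivative p3 t x) (at t)"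
    and c3: "\<And>x. x \<in> space \<mu> \<Longrightarrow> continuous_on \<Theta> (\<lambda>t. p3 t x)"
    using deriv1 deriv2 deriv3 deriv3_cont by auto
  have i1: "\<And>t. t \<in> \<Theta> \<Longrightarrow> integrable \<mu> (p1 t)" and i2: "\<And>t. t \<in> \<Theta> \<Longrightarrow> integrable \<mu> (p2 t)"
    and i3: "\<And>t. t \<in> \<Theta> \<Longrightarrow> integrable \<mu> (p3 t)" using L1_finite by auto
  obtain r C where lm: "l1_smooth_model \<mu> \<Theta> P p p1 p2 \<theta>0 r C"
    using l1_smooth_model_near[OF model op th0 C2(1) d1 d2 d3 c3 i1 i2 i3 L1_norm_cont] by blast
  \<comment> \<open>the locale interpreted next has a fact of the same name\<close>
  note dqm_all = C1
  interpret l1_smooth_model \<mu> \<Theta> P p p1 p2 \<theta>0 r C by (rule lm)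
  have sm: "s \<tau> \<in> borel_measurable \<mu>" "AE x in \<mu>. s \<tau> x * p \<tau> x = p1 \<tau> x" if "\<tau> \<in> \<Theta>" for \<tau>
  proof -
    have dq: "dqm_at \<mu> \<Theta> p (s \<tau>) \<tau>" using dqm_all that by blast
    thus "s \<tau> \<in> borel_measurable \<mu>" by (simp add: dqm_at_def)
    show "AE x in \<mu>. s \<tau> x * p \<tau> x = p1 \<tau> x"
      by (rule dqm_score_eq_derivative[OF model dq d1]) (use that i1 in auto)
  qed
  have \<alpha>0: "0 \<le> \<alpha>" using \<alpha> by simp
  define \<theta>n where "\<theta>n n = \<theta>0 + h / sqrt (real n)" for n :: nat
  have \<theta>lim: "\<theta>n \<longlonglongrightarrow> \<theta>0"
  proof -
    have "(\<lambda>n. \<theta>0 + h / sqrt (real n)) \<longlonglongrightarrow> \<theta>0 + 0"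
      by (intro tendsto_add tendsto_const tendsto_divide_0[OF tendsto_const]
          filterlim_at_top_imp_at_infinity filterlim_compose[OF sqrt_at_top] filterlim_real_sequentially)
    thus ?thesis by (simp add: \<theta>n_def[abs_def])
  qed
  define N where "N n = real (n - n1 n)" for n
  have early: "\<forall>\<^sub>F n in sequentially. 1 \<le> n1 n" using n1_inf by (simp add: filterlim_at_top)
  have half: "\<forall>\<^sub>F n in sequentially. real (n1 n) / real n < 1 / 2" by (rule order_tendstoD(2)[OF n1_small]) simp
  have Npos: "\<forall>\<^sub>F n in sequentially. 0 < n \<and> n1 n < n \<and> real n \<le> 2 * N n"
    using half eventually_gt_at_top[of 0]
  proof eventually_elim
    fix n :: nat assume a: "real (n1 n) / real n < 1 / 2" "0 < n"
    hence b: "2 * real (n1 n) < real n" by (simp add: divide_less_eq)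
    hence "n1 n < n" using a(2) by linarith
    thus "0 < n \<and> n1 n < n \<and> real n \<le> 2 * N n" using a(2) b by (auto simp: N_def of_nat_diff)
  qed
  have Ninf: "filterlim N at_top sequentially"
  proof (rule filterlim_at_top_mono)
    show "filterlim (\<lambda>n. real n / 2) at_top sequentially"
      using filterlim_tendsto_pos_mult_at_top[OF tendsto_const _ filterlim_real_sequentially, of "1 / 2"] by simp
    show "\<forall>\<^sub>F n in sequentially. real n / 2 \<le> N n" using Npos by eventually_elim auto
  qed
  have ratio: "(\<lambda>n. real n / N n) \<longlonglongrightarrow> 1"
  proof -
    have "(\<lambda>n. 1 / (1 - real (n1 n) / real n)) \<longlonglongrightarrow> 1 / (1 - 0)" by (intro tendsto_intros n1_small) simp
    hence "(\<lambda>n. 1 / (1 - real (n1 n) / real n)) \<longlonglongrightarrow> 1" by simp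
    thus ?thesis
      by (rule Lim_transform_eventually)
        (use Npos in \<open>eventually_elim, auto simp: N_def of_nat_diff field_simps\<close>)
  qed
  have inst: "\<forall>\<^sub>F n in sequentially. two_step \<mu> \<Theta> P p p1 p2 \<theta>0 r C \<alpha> Z0 Q0 (est (n1 n)) (T (n1 n)) (k (n1 n)) (Q (n1 n)) (n1 n) n"
    using early Npos
  proof eventually_elim
    fix n assume n: "1 \<le> n1 n" "0 < n \<and> n1 n < n \<and> real n \<le> 2 * N n"
    show "two_step \<mu> \<Theta> P p p1 p2 \<theta>0 r C \<alpha> Z0 Q0 (est (n1 n)) (T (n1 n)) (k (n1 n)) (Q (n1 n)) (n1 n) n"
    proof (rule two_step.intro[OF lm], rule two_step_axioms.intro)
      show "est (n1 n) \<in> PiM {1..n1 n} (\<lambda>_. Z0) \<rightarrow>\<^sub>M param_space \<Theta>"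
        using preliminary n(1) by (auto simp: consistent_preliminary_estimator_def)
      show "T (n1 n) \<in> \<mu> \<Otimes>\<^sub>M param_space \<Theta> \<rightarrow>\<^sub>M pos_nats"
        using quantizer n(1) unfolding consistent_quantizer_def by blast
      show "\<And>x \<tau>. x \<in> space \<mu> \<Longrightarrow> \<tau> \<in> \<Theta> \<Longrightarrow> T (n1 n) (x, \<tau>) \<in> {1..k (n1 n) \<tau>}"
        using quantizer n(1) unfolding consistent_quantizer_def by blast
    qed (use \<alpha>0 Q0 Q n in auto)
  qed
  have ball_ev: "\<forall>\<^sub>F n in sequentially. \<bar>\<theta>n n - \<theta>0\<bar> < e" if "0 < e" for e
    using tendstoD[OF \<theta>lim that] by (simp add: dist_real_def)
  have in_ball_ev: "\<forall>\<^sub>F n in sequentially. \<theta>n n \<in> ball \<theta>0 r"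
    using ball_ev[OF r] by eventually_elim (simp add: dist_real_def abs_minus_commute)
  define U where "U n zw = sqrt (real n) * (\<theta>hat n zw - \<theta>n n)" for n zw
  have \<theta>m: "\<forall>\<^sub>F n in sequentially. \<theta>hat n \<in> borel_measurable (two_step_space Z0 (n1 n) n)"
    using early Npos by eventually_elim (use mle in \<open>auto simp: two_step_mle_def\<close>)
  have law_ev: "\<forall>\<^sub>F n in sequentially. prob_space (law n (\<theta>n n)) \<and> sets (law n (\<theta>n n)) = sets (two_step_space Z0 (n1 n) n)
      \<and> prob_space (law n \<theta>0) \<and> sets (law n \<theta>0) = sets (two_step_space Z0 (n1 n) n)"
    using inst in_ball_ev
  proof eventually_elim
    fix n assume a: "two_step \<mu> \<Theta> P p p1 p2 \<theta>0 r C \<alpha> Z0 Q0 (est (n1 n)) (T (n1 n)) (k (n1 n)) (Q (n1 n)) (n1 n) n"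
      and b: "\<theta>n n \<in> ball \<theta>0 r"
    interpret ts: two_step \<mu> \<Theta> P p p1 p2 \<theta>0 r C \<alpha> Z0 Q0 "est (n1 n)" "T (n1 n)" "k (n1 n)" "Q (n1 n)" "n1 n" n by (rule a)
    note m1 = ts.law_mixture[OF b] and m0 = ts.law_mixture[OF center]
    show "prob_space (law n (\<theta>n n)) \<and> sets (law n (\<theta>n n)) = sets (two_step_space Z0 (n1 n) n)
      \<and> prob_space (law n \<theta>0) \<and> sets (law n \<theta>0) = sets (two_step_space Z0 (n1 n) n)"
      using mixture.pL[OF m1] mixture.sL[OF m1] mixture.pL[OF m0] mixture.sL[OF m0] by (simp add: law_def ts.TS)
  qed
  have U_meas: "\<forall>\<^sub>F n in sequentially. U n \<in> borel_measurable (law n (\<theta>n n))"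
    using \<theta>m law_ev
  proof eventually_elim
    fix n assume [measurable]: "\<theta>hat n \<in> borel_measurable (two_step_space Z0 (n1 n) n)"
      and a: "prob_space (law n (\<theta>n n)) \<and> sets (law n (\<theta>n n)) = sets (two_step_space Z0 (n1 n) n)
      \<and> prob_space (law n \<theta>0) \<and> sets (law n \<theta>0) = sets (two_step_space Z0 (n1 n) n)"
    hence s: "sets (law n (\<theta>n n)) = sets (two_step_space Z0 (n1 n) n)" by simp
    show "U n \<in> borel_measurable (law n (\<theta>n n))"
      unfolding measurable_cong_sets[OF s refl] U_def by measurable
  qed
  \<comment> \<open>bounds the factor in the contiguity inequality for all \<open>n\<close> at once\<close>
  define \<Gamma> where "\<Gamma> = exp ((exp \<alpha> * C * h)\<^sup>2)"
  have transfer: "(\<lambda>n. measure (law n (\<theta>n n)) (E n)) \<longlonglongrightarrow> 0"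
    if E: "\<forall>\<^sub>F n in sequentially. E n \<in> sets (two_step_space Z0 (n1 n) n)" and z: "(\<lambda>n. measure (law n \<theta>0) (E n)) \<longlonglongrightarrow> 0" for E
  proof (rule tendsto_sandwich[OF _ _ tendsto_const])
    show "\<forall>\<^sub>F n in sequentially. measure (law n (\<theta>n n)) (E n) \<le> sqrt (\<Gamma> * measure (law n \<theta>0) (E n))"
      using inst in_ball_ev Npos E
    proof eventually_elim
      fix n assume a: "two_step \<mu> \<Theta> P p p1 p2 \<theta>0 r C \<alpha> Z0 Q0 (est (n1 n)) (T (n1 n)) (k (n1 n)) (Q (n1 n)) (n1 n) n"
        and b: "\<theta>n n \<in> ball \<theta>0 r" and n: "0 < n \<and> n1 n < n \<and> real n \<le> 2 * N n" and En: "E n \<in> sets (two_step_space Z0 (n1 n) n)"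
      interpret ts: two_step \<mu> \<Theta> P p p1 p2 \<theta>0 r C \<alpha> Z0 Q0 "est (n1 n)" "T (n1 n)" "k (n1 n)" "Q (n1 n)" "n1 n" n by (rule a)
      have "measure (law n (\<theta>n n)) (E n) \<le> sqrt ((1 + (exp \<alpha> * C * (\<theta>n n - \<theta>0))\<^sup>2) ^ n * measure (law n \<theta>0) (E n))"
        unfolding law_def using En ts.TS by (intro ts.law_contiguous[OF center b]) simp
      also have "\<dots> \<le> sqrt (\<Gamma> * measure (law n \<theta>0) (E n))"
        using local_likelihood_constant[of n "exp \<alpha> * C" h] n by (intro real_sqrt_le_mono mult_right_mono) (auto simp: \<theta>n_def \<Gamma>_def)
      finally show "measure (law n (\<theta>n n)) (E n) \<le> sqrt (\<Gamma> * measure (law n \<theta>0) (E n))" .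
    qed
    show "(\<lambda>n. sqrt (\<Gamma> * measure (law n \<theta>0) (E n))) \<longlonglongrightarrow> 0"
      using tendsto_real_sqrt[OF tendsto_mult[OF tendsto_const z], of \<Gamma>] by simp
  qed simp
  define ex where "ex n = {zw \<in> space (two_step_space Z0 (n1 n) n).
      two_step_mle_exists \<Theta> P (est (n1 n)) (T (n1 n)) (k (n1 n)) (Q (n1 n)) (n1 n) n zw}" for n
  have ex_lim: "(\<lambda>n. measure (law n \<theta>0) (ex n)) \<longlonglongrightarrow> 1"
    by (rule Lim_transform_eventually[OF mle_exists])
      (use law_ev in \<open>eventually_elim, auto simp: ex_def dest!: sets_eq_imp_space_eq\<close>)
  \<comment> \<open>sets outside the sigma-algebra have measure \<open>0\<close>, so that a probability above \<open>1/2\<close> entails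
  measurability of the existence event\<close>
  have ex_half: "\<forall>\<^sub>F n in sequentially. 1 / 2 < measure (law n \<theta>0) (ex n)"
    by (rule order_tendstoD(1)[OF ex_lim]) simp
  have ex_sets: "\<forall>\<^sub>F n in sequentially. ex n \<in> sets (two_step_space Z0 (n1 n) n)"
    using ex_half law_ev
  proof eventually_elim
    fix n assume a: "1 / 2 < measure (law n \<theta>0) (ex n)" and b: "prob_space (law n (\<theta>n n)) \<and> sets (law n (\<theta>n n)) = sets (two_step_space Z0 (n1 n) n)
      \<and> prob_space (law n \<theta>0) \<and> sets (law n \<theta>0) = sets (two_step_space Z0 (n1 n) n)"
    have "ex n \<in> sets (law n \<theta>0)" by (rule ccontr) (use a in \<open>simp add: measure_notin_sets\<close>)
    thus "ex n \<in> sets (two_step_space Z0 (n1 n) n)" using b by simp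
  qed
  have char_lim: "(\<lambda>n. char (distr (law n (\<theta>n n)) borel (U n)) x) \<longlonglongrightarrow> complex_of_real (exp (- (x\<^sup>2 / (2 * Istar))))" for x
  proof (rule tendstoI)
    fix \<epsilon> :: real assume \<epsilon>: "0 < \<epsilon>"
    define b where "b = exp \<alpha> * C"
    define b2 where "b2 = 2 * (b + b\<^sup>2)"
    have b0: "0 < b" using C1 by (simp add: b_def)
    \<comment> \<open>\<open>\<zeta>\<close> bounds the normalized score sum up to probability \<open>\<epsilon>/16\<close>; it is fixed before \<open>\<eta>\<close>,
    because the linearization error is of order \<open>\<zeta> \<eta>\<close>\<close>
    define \<zeta> where "\<zeta> = 4 * b / sqrt \<epsilon>"
    have \<zeta>: "0 < \<zeta>" "b\<^sup>2 / \<zeta>\<^sup>2 \<le> \<epsilon> / 16" using b0 \<epsilon> by (auto simp: \<zeta>_def power_divide power_mult_distrib)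
    define D where "D = 1 + \<bar>x\<bar> * (12 * \<zeta> / Istar\<^sup>2) + x\<^sup>2 / (2 * Istar\<^sup>2)"
    have D: "0 < D" using \<zeta> by (auto simp: D_def intro!: add_pos_nonneg)
    define \<eta> where "\<eta> = min (Istar / 6) (\<epsilon> / (8 * D))"
    have \<eta>: "0 < \<eta>" "6 * \<eta> \<le> Istar" "D * \<eta> \<le> \<epsilon> / 8"
    proof -
      show "0 < \<eta>" using Ipos \<epsilon> D by (simp add: \<eta>_def)
      show "6 * \<eta> \<le> Istar" unfolding \<eta>_def by linarith
      show "D * \<eta> \<le> \<epsilon> / 8" using mult_left_mono[of \<eta> "\<epsilon> / (8 * D)" D] D by (simp add: \<eta>_def)
    qed
    obtain \<delta> M where \<delta>: "0 < \<delta>" "\<delta> \<le> r" and M: "\<And>m \<tau> t. M \<le> m \<Longrightarrow> \<bar>\<tau> - \<theta>0\<bar> < \<delta> \<Longrightarrow> \<bar>t - \<theta>0\<bar> < \<delta> \<Longrightarrow>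
        \<bar>stage2_info (T m) (k m) (Q m) \<tau> t - Istar\<bar> \<le> \<eta>"
    proof -
      have "\<exists>\<delta>>0. \<delta> \<le> r \<and> (\<exists>M\<ge>1. \<forall>m\<ge>M. \<forall>\<tau> t. \<bar>\<tau> - \<theta>0\<bar> < \<delta> \<longrightarrow> \<bar>t - \<theta>0\<bar> < \<delta> \<longrightarrow>
        \<bar>stage2_info (T m) (k m) (Q m) \<tau> t - optimal_info TYPE('w) \<alpha> \<mu> \<Theta> P \<theta>0\<bar> \<le> \<eta>)"
        by (rule stage2_info_limit[OF \<alpha>0 infinite_outputs quantizer _ _ _ \<eta>(1)])
          (use Q sm in_ball_Theta in auto)
      thus thesis using that unfolding Istar_def by blast
    qed
    \<comment> \<open>within this distance, the averaged second derivative of the log-likelihood varies by at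
    most \<open>\<eta>\<close>\<close>
    define \<kappa> where "\<kappa> = min (\<delta> / 2) (\<eta> / (1 + \<bar>hess_lip \<alpha>\<bar>))"
    have \<kappa>: "0 < \<kappa>" "\<kappa> < r" "hess_lip \<alpha> * \<kappa> \<le> \<eta>"
    proof -
      show "0 < \<kappa>" using \<delta> \<eta> by (auto simp: \<kappa>_def intro!: divide_pos_pos)
      show "\<kappa> < r" using \<delta> by (auto simp: \<kappa>_def)
      have "hess_lip \<alpha> * \<kappa> \<le> (1 + \<bar>hess_lip \<alpha>\<bar>) * \<kappa>" using \<open>0 < \<kappa>\<close> by (intro mult_right_mono) auto
      also have "\<dots> \<le> (1 + \<bar>hess_lip \<alpha>\<bar>) * (\<eta> / (1 + \<bar>hess_lip \<alpha>\<bar>))" by (intro mult_left_mono) (auto simp: \<kappa>_def)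
      finally show "hess_lip \<alpha> * \<kappa> \<le> \<eta>" by simp
    qed
    \<comment> \<open>the exceptional events of \<open>char_bound\<close>\<close>
    define A where "A n = {z \<in> space (PiM {1..n1 n} (\<lambda>_. Z0)). \<delta> \<le> \<bar>est (n1 n) z - \<theta>0\<bar>}" for n
    define far where "far n = {zw \<in> space (two_step_space Z0 (n1 n) n). \<bar>\<theta>hat n zw - \<theta>0\<bar> > \<kappa> / 2}" for n
    define E where "E n = (space (two_step_space Z0 (n1 n) n) - ex n) \<union> far n" for n
    have far_sets: "\<forall>\<^sub>F n in sequentially. far n \<in> sets (two_step_space Z0 (n1 n) n)"
      using \<theta>m by eventually_elim (simp add: far_def)
    have E_sets: "\<forall>\<^sub>F n in sequentially. E n \<in> sets (two_step_space Z0 (n1 n) n)"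
      using far_sets ex_sets by eventually_elim (auto simp: E_def)
    have far_lim: "(\<lambda>n. measure (law n \<theta>0) (far n)) \<longlonglongrightarrow> 0"
    proof -
      have "(\<lambda>n. measure (law n \<theta>0) {zw \<in> space (law n \<theta>0). \<bar>\<theta>hat n zw - \<theta>0\<bar> > \<kappa> / 2}) \<longlonglongrightarrow> 0"
        by (rule consistent[rule_format]) (use \<kappa>(1) in simp)
      thus ?thesis by (rule Lim_transform_eventually)
        (use law_ev in \<open>eventually_elim, auto simp: far_def dest!: sets_eq_imp_space_eq\<close>)
    qed
    have E_lim0: "(\<lambda>n. measure (law n \<theta>0) (E n)) \<longlonglongrightarrow> 0"
    proof (rule tendsto_sandwich[OF _ _ tendsto_const])
      show "\<forall>\<^sub>F n in sequentially. measure (law n \<theta>0) (E n) \<le> (1 - measure (law n \<theta>0) (ex n)) + measure (law n \<theta>0) (far n)"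
        using far_sets ex_sets law_ev
      proof eventually_elim
        fix n assume s: "far n \<in> sets (two_step_space Z0 (n1 n) n)" "ex n \<in> sets (two_step_space Z0 (n1 n) n)"
          and l: "prob_space (law n (\<theta>n n)) \<and> sets (law n (\<theta>n n)) = sets (two_step_space Z0 (n1 n) n)
      \<and> prob_space (law n \<theta>0) \<and> sets (law n \<theta>0) = sets (two_step_space Z0 (n1 n) n)"
        interpret L: prob_space "law n \<theta>0" using l by simp
        have sp: "space (law n \<theta>0) = space (two_step_space Z0 (n1 n) n)" using l by (intro sets_eq_imp_space_eq) simp
        have "measure (law n \<theta>0) (E n) \<le> measure (law n \<theta>0) (space (law n \<theta>0) - ex n) + measure (law n \<theta>0) (far n)"
          unfolding E_def sp[symmetric] using s l by (intro measure_Un_le) auto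
        thus "measure (law n \<theta>0) (E n) \<le> (1 - measure (law n \<theta>0) (ex n)) + measure (law n \<theta>0) (far n)"
          using L.prob_compl[of "ex n"] s l by simp
      qed
      have "(\<lambda>n. (1 - measure (law n \<theta>0) (ex n)) + measure (law n \<theta>0) (far n)) \<longlonglongrightarrow> (1 - 1) + 0"
        by (intro tendsto_intros ex_lim far_lim)
      thus "(\<lambda>n. (1 - measure (law n \<theta>0) (ex n)) + measure (law n \<theta>0) (far n)) \<longlonglongrightarrow> 0" by simp
    qed simp
    have E_lim: "(\<lambda>n. measure (law n (\<theta>n n)) (E n)) \<longlonglongrightarrow> 0" by (rule transfer[OF E_sets E_lim0])
    define F where "F n = A n \<times> space (PiM {n1 n+1..n} (\<lambda>_. pos_nats))" for n
    have A_sets: "\<forall>\<^sub>F n in sequentially. A n \<in> sets (PiM {1..n1 n} (\<lambda>_. Z0))"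
      using inst
    proof eventually_elim
      fix n assume "two_step \<mu> \<Theta> P p p1 p2 \<theta>0 r C \<alpha> Z0 Q0 (est (n1 n)) (T (n1 n)) (k (n1 n)) (Q (n1 n)) (n1 n) n"
      then interpret ts: two_step \<mu> \<Theta> P p p1 p2 \<theta>0 r C \<alpha> Z0 Q0 "est (n1 n)" "T (n1 n)" "k (n1 n)" "Q (n1 n)" "n1 n" n .
      have [measurable]: "est (n1 n) \<in> borel_measurable (PiM {1..n1 n} (\<lambda>_. Z0))"
        using ts.est by (simp add: measurable_restrict_space2_iff)
      show "A n \<in> sets (PiM {1..n1 n} (\<lambda>_. Z0))" unfolding A_def by measurable
    qed
    define RA where "RA t n = measure (PiM {1..n1 n} (\<lambda>_. P t \<bind> Q0)) (A n)" for t n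
    have fst_eq: "\<forall>\<^sub>F n in sequentially. F n \<in> sets (two_step_space Z0 (n1 n) n) \<and>
        measure (law n (\<theta>n n)) (F n) = RA (\<theta>n n) n \<and> measure (law n \<theta>0) (F n) = RA \<theta>0 n"
      using inst in_ball_ev A_sets
    proof eventually_elim
      fix n assume a: "two_step \<mu> \<Theta> P p p1 p2 \<theta>0 r C \<alpha> Z0 Q0 (est (n1 n)) (T (n1 n)) (k (n1 n)) (Q (n1 n)) (n1 n) n"
        and bb: "\<theta>n n \<in> ball \<theta>0 r" and As: "A n \<in> sets (PiM {1..n1 n} (\<lambda>_. Z0))"
      interpret ts: two_step \<mu> \<Theta> P p p1 p2 \<theta>0 r C \<alpha> Z0 Q0 "est (n1 n)" "T (n1 n)" "k (n1 n)" "Q (n1 n)" "n1 n" n by (rule a)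
      have e: "measure (law n t) (F n) = RA t n" if t: "t \<in> ball \<theta>0 r" for t
      proof -
        interpret mixture "ts.law t" "ts.stage1 t" "ts.stage2 t" ts.MZ ts.MW by (rule ts.law_mixture[OF t])
        have "F n = {y \<in> space (ts.law t). fst y \<in> A n}"
          using spaces(2) sets.sets_into_space[OF As] by (auto simp: F_def)
        thus ?thesis using measure_fst[OF As] by (simp add: law_def RA_def)
      qed
      show "F n \<in> sets (two_step_space Z0 (n1 n) n) \<and>
        measure (law n (\<theta>n n)) (F n) = RA (\<theta>n n) n \<and> measure (law n \<theta>0) (F n) = RA \<theta>0 n"
        using e[OF bb] e[OF center] As by (auto simp: F_def two_step_space_def intro!: pair_measureI)
    qed
    have RA_lim: "(\<lambda>n. RA (\<theta>n n) n) \<longlonglongrightarrow> 0"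
    proof -
      have "(\<lambda>m. measure (PiM {1..m} (\<lambda>_. P \<theta>0 \<bind> Q0)) {z \<in> space (PiM {1..m} (\<lambda>_. P \<theta>0 \<bind> Q0)). \<bar>est m z - \<theta>0\<bar> > \<delta> / 2}) \<longlonglongrightarrow> 0"
        by (rule preliminary[unfolded consistent_preliminary_estimator_def, THEN conjunct2, rule_format, OF th0]) (use \<delta>(1) in simp)
      from filterlim_compose[OF this n1_inf]
      have lim: "(\<lambda>n. measure (PiM {1..n1 n} (\<lambda>_. P \<theta>0 \<bind> Q0)) {z \<in> space (PiM {1..n1 n} (\<lambda>_. P \<theta>0 \<bind> Q0)). \<bar>est (n1 n) z - \<theta>0\<bar> > \<delta> / 2}) \<longlonglongrightarrow> 0" .
      have "(\<lambda>n. RA \<theta>0 n) \<longlonglongrightarrow> 0"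
      proof (rule tendsto_sandwich[OF _ _ tendsto_const lim])
        show "\<forall>\<^sub>F n in sequentially. RA \<theta>0 n \<le> measure (PiM {1..n1 n} (\<lambda>_. P \<theta>0 \<bind> Q0)) {z \<in> space (PiM {1..n1 n} (\<lambda>_. P \<theta>0 \<bind> Q0)). \<bar>est (n1 n) z - \<theta>0\<bar> > \<delta> / 2}"
          using inst
        proof eventually_elim
          fix n assume a: "two_step \<mu> \<Theta> P p p1 p2 \<theta>0 r C \<alpha> Z0 Q0 (est (n1 n)) (T (n1 n)) (k (n1 n)) (Q (n1 n)) (n1 n) n"
          interpret ts: two_step \<mu> \<Theta> P p p1 p2 \<theta>0 r C \<alpha> Z0 Q0 "est (n1 n)" "T (n1 n)" "k (n1 n)" "Q (n1 n)" "n1 n" n by (rule a)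
          interpret mx: mixture "ts.law \<theta>0" "ts.stage1 \<theta>0" "ts.stage2 \<theta>0" ts.MZ ts.MW by (rule ts.law_mixture[OF center])
          interpret R: prob_space "ts.stage1 \<theta>0" by (rule mx.pR)
          have sp: "space (ts.stage1 \<theta>0) = space ts.MZ" by (rule mx.spaces(1))
          have em: "est (n1 n) \<in> borel_measurable (ts.stage1 \<theta>0)"
            using ts.est by (subst measurable_cong_sets[OF mx.sR refl]) (simp add: measurable_restrict_space2_iff)
          show "RA \<theta>0 n \<le> measure (ts.stage1 \<theta>0) {z \<in> space (ts.stage1 \<theta>0). \<bar>est (n1 n) z - \<theta>0\<bar> > \<delta> / 2}"
            unfolding RA_def
          proof (rule R.finite_measure_mono)
            show "A n \<subseteq> {z \<in> space (ts.stage1 \<theta>0). \<bar>est (n1 n) z - \<theta>0\<bar> > \<delta> / 2}"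
              unfolding sp A_def using \<delta>(1) by auto
            show "{z \<in> space (ts.stage1 \<theta>0). \<bar>est (n1 n) z - \<theta>0\<bar> > \<delta> / 2} \<in> sets (ts.stage1 \<theta>0)"
              using em by measurable
          qed
        qed
      qed (simp add: RA_def)
      hence "(\<lambda>n. measure (law n \<theta>0) (F n)) \<longlonglongrightarrow> 0"
        by (rule Lim_transform_eventually) (use fst_eq in \<open>eventually_elim, simp\<close>)
      hence "(\<lambda>n. measure (law n (\<theta>n n)) (F n)) \<longlonglongrightarrow> 0"
        by (intro transfer) (use fst_eq in \<open>eventually_elim, simp\<close>)
      thus ?thesis by (rule Lim_transform_eventually) (use fst_eq in \<open>eventually_elim, simp\<close>)
    qed
    \<comment> \<open>all error terms of \<open>char_bound\<close> that vanish as \<open>n\<close> grows\<close>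
    define rem where "rem n = 2 * measure (law n (\<theta>n n)) (E n) + 4 * RA (\<theta>n n) n
       + 2 * b2\<^sup>2 / \<eta>\<^sup>2 * (1 / N n) + 8 * \<bar>x\<bar>^3 * b^3 / Istar^3 * (1 / sqrt (N n)) + 16 * x^4 * b^4 / Istar^4 * (1 / N n)
       + x\<^sup>2 / (2 * Istar\<^sup>2) * (\<bar>real n / N n - 1\<bar> * (Istar + \<eta>))" for n
    have rem_lim: "rem \<longlonglongrightarrow> 0"
    proof -
      have N1: "(\<lambda>n. 1 / N n) \<longlonglongrightarrow> 0" by (rule tendsto_divide_0[OF tendsto_const filterlim_at_top_imp_at_infinity[OF Ninf]])
      have N2: "(\<lambda>n. 1 / sqrt (N n)) \<longlonglongrightarrow> 0"
        by (rule tendsto_divide_0[OF tendsto_const filterlim_at_top_imp_at_infinity[OF filterlim_compose[OF sqrt_at_top Ninf]]])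
      have "rem \<longlonglongrightarrow> 2 * 0 + 4 * 0 + 2 * b2\<^sup>2 / \<eta>\<^sup>2 * 0 + 8 * \<bar>x\<bar>^3 * b^3 / Istar^3 * 0 + 16 * x^4 * b^4 / Istar^4 * 0
         + x\<^sup>2 / (2 * Istar\<^sup>2) * (\<bar>1 - 1\<bar> * (Istar + \<eta>))"
        unfolding rem_def by (intro tendsto_intros E_lim RA_lim N1 N2 ratio)
      thus ?thesis by simp
    qed
    have rem_small: "\<forall>\<^sub>F n in sequentially. rem n < \<epsilon> / 2" by (rule order_tendstoD(2)[OF rem_lim]) (use \<epsilon> in simp)
    have M_ev: "\<forall>\<^sub>F n in sequentially. M \<le> n1 n" using n1_inf by (simp add: filterlim_at_top)
    have \<theta>\<delta>: "\<forall>\<^sub>F n in sequentially. \<bar>\<theta>n n - \<theta>0\<bar> < min \<delta> (\<kappa> / 2)" using \<delta> \<kappa> by (intro ball_ev) simp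
    show "\<forall>\<^sub>F n in sequentially. dist (char (distr (law n (\<theta>n n)) borel (U n)) x) (complex_of_real (exp (- (x\<^sup>2 / (2 * Istar))))) < \<epsilon>"
      using inst in_ball_ev early Npos A_sets E_sets \<theta>m U_meas rem_small M_ev \<theta>\<delta>
    proof eventually_elim
      fix n assume a: "two_step \<mu> \<Theta> P p p1 p2 \<theta>0 r C \<alpha> Z0 Q0 (est (n1 n)) (T (n1 n)) (k (n1 n)) (Q (n1 n)) (n1 n) n"
        and tb: "\<theta>n n \<in> ball \<theta>0 r" and n1n: "1 \<le> n1 n" and n: "0 < n \<and> n1 n < n \<and> real n \<le> 2 * N n"
        and As: "A n \<in> sets (PiM {1..n1 n} (\<lambda>_. Z0))" and Es: "E n \<in> sets (two_step_space Z0 (n1 n) n)"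
        and um: "\<theta>hat n \<in> borel_measurable (two_step_space Z0 (n1 n) n)" and Um: "U n \<in> borel_measurable (law n (\<theta>n n))"
        and rs: "rem n < \<epsilon> / 2" and Mn: "M \<le> n1 n" and td: "\<bar>\<theta>n n - \<theta>0\<bar> < min \<delta> (\<kappa> / 2)"
      interpret ts: two_step \<mu> \<Theta> P p p1 p2 \<theta>0 r C \<alpha> Z0 Q0 "est (n1 n)" "T (n1 n)" "k (n1 n)" "Q (n1 n)" "n1 n" n by (rule a)
      have Neq: "ts.N = N n" by (simp add: ts.N_def N_def)
      have ch: "char (distr (law n (\<theta>n n)) borel (U n)) x = (\<integral>y. iexp (x * (sqrt n * (\<theta>hat n y - \<theta>n n))) \<partial>ts.law (\<theta>n n))"
        unfolding char_def using Um by (subst integral_distr) (auto simp: U_def law_def)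
      have "cmod ((\<integral>y. iexp (x * (sqrt n * (\<theta>hat n y - \<theta>n n))) \<partial>ts.law (\<theta>n n)) - complex_of_real (exp (- (x\<^sup>2 / (2 * Istar)))))
        \<le> \<bar>x\<bar> * (12 * \<zeta> * \<eta> / Istar\<^sup>2) + 2 * (measure (ts.law (\<theta>n n)) (E n) + measure (ts.stage1 (\<theta>n n)) (A n) + (ts.B2\<^sup>2 / (\<eta>\<^sup>2 * ts.N) + ts.B1\<^sup>2 / \<zeta>\<^sup>2))
          + (8 * \<bar>x\<bar>^3 * ts.B1^3 / (Istar^3 * sqrt ts.N) + 16 * x^4 * ts.B1^4 / (Istar^4 * ts.N) + x\<^sup>2 / (2 * Istar\<^sup>2) * (\<bar>real n / ts.N - 1\<bar> * (Istar + \<eta>) + \<eta>))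
          + 2 * measure (ts.stage1 (\<theta>n n)) (A n)"
      proof (rule ts.char_bound[OF tb As \<eta>(1,2) \<zeta>(1) _ _ _ _ \<kappa>(3)])
        show "\<bar>ts.v (\<theta>n n) z - Istar\<bar> \<le> \<eta>" if "z \<in> space ts.MZ - A n" for z
          using that td by (intro M[OF Mn]) (auto simp: A_def)
        show "E n \<in> sets (ts.MZ \<Otimes>\<^sub>M ts.MW)" using Es ts.TS by simp
        show "\<theta>hat n \<in> borel_measurable (ts.MZ \<Otimes>\<^sub>M ts.MW)" using um ts.TS by simp
        show "real n \<le> 4 * ts.N" unfolding Neq using n by linarith
        fix y assume y: "y \<in> space ts.MZ \<times> space ts.MW" "y \<notin> E n"
        have ys: "y \<in> space (two_step_space Z0 (n1 n) n)" using y(1) by (simp add: ts.TS space_pair_measure)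
        hence e: "y \<in> ex n" "\<bar>\<theta>hat n y - \<theta>0\<bar> \<le> \<kappa> / 2" using y(2) by (auto simp: E_def far_def)
        have "two_step_mle \<Theta> P Z0 (est (n1 n)) (T (n1 n)) (k (n1 n)) (Q (n1 n)) (n1 n) n (\<theta>hat n)" using mle n1n n by blast
        hence "is_arg_max (two_step_loglik P (est (n1 n)) (T (n1 n)) (k (n1 n)) (Q (n1 n)) (n1 n) n y) (\<lambda>\<theta>. \<theta> \<in> \<Theta>) (\<theta>hat n y)"
          using e(1) ys by (simp add: two_step_mle_def ex_def)
        moreover have "\<theta>hat n y \<in> ball \<theta>0 r" using e(2) \<kappa> by (auto simp: dist_real_def abs_minus_commute)
        moreover have "\<bar>\<theta>hat n y - \<theta>n n\<bar> \<le> \<kappa>" using e(2) td by linarith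
        ultimately show "is_arg_max (two_step_loglik P (est (n1 n)) (T (n1 n)) (k (n1 n)) (Q (n1 n)) (n1 n) n y) (\<lambda>\<theta>. \<theta> \<in> \<Theta>) (\<theta>hat n y)
            \<and> \<theta>hat n y \<in> ball \<theta>0 r \<and> \<bar>\<theta>hat n y - \<theta>n n\<bar> \<le> \<kappa>" by blast
      qed
      also have "\<dots> = rem n + (\<bar>x\<bar> * (12 * \<zeta> / Istar\<^sup>2) + x\<^sup>2 / (2 * Istar\<^sup>2)) * \<eta> + 2 * (b\<^sup>2 / \<zeta>\<^sup>2)"
        unfolding Neq rem_def RA_def b2_def b_def law_def by (simp add: algebra_simps)
      also have "(\<bar>x\<bar> * (12 * \<zeta> / Istar\<^sup>2) + x\<^sup>2 / (2 * Istar\<^sup>2)) * \<eta> \<le> D * \<eta>" using \<eta>(1) by (simp add: D_def mult_right_mono)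
      finally have "cmod ((\<integral>y. iexp (x * (sqrt n * (\<theta>hat n y - \<theta>n n))) \<partial>ts.law (\<theta>n n)) - complex_of_real (exp (- (x\<^sup>2 / (2 * Istar)))))
         \<le> rem n + D * \<eta> + 2 * (b\<^sup>2 / \<zeta>\<^sup>2)" by simp
      also have "\<dots> < \<epsilon>" using rs \<eta>(3) \<zeta>(2) \<epsilon> by linarith
      finally show "dist (char (distr (law n (\<theta>n n)) borel (U n)) x) (complex_of_real (exp (- (x\<^sup>2 / (2 * Istar))))) < \<epsilon>"
        by (simp only: ch dist_norm)
    qed
  qed
  have "weak_conv_m (\<lambda>n. distr (law n (\<theta>n n)) borel (U n)) (density lborel (\<lambda>x. ennreal (normal_density 0 (sqrt (1 / Istar)) x)))"
  proof (rule levy_continuity_eventually)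
    show "\<forall>\<^sub>F n in sequentially. real_distribution (distr (law n (\<theta>n n)) borel (U n))"
      using U_meas law_ev by eventually_elim (auto intro: prob_space.real_distribution_distr)
    show "real_distribution (density lborel (\<lambda>x. ennreal (normal_density 0 (sqrt (1 / Istar)) x)))"
      by (rule normal_distribution_char(1)[OF Ipos])
    show "(\<lambda>n. char (distr (law n (\<theta>n n)) borel (U n)) t) \<longlonglongrightarrow> char (density lborel (\<lambda>x. ennreal (normal_density 0 (sqrt (1 / Istar)) x))) t" for t
      unfolding normal_distribution_char(2)[OF Ipos] by (rule char_lim)
  qed
  thus "weak_conv_m (\<lambda>n. distr (law n (\<theta>0 + h / sqrt (real n))) borel
               (\<lambda>zw. sqrt (real n) * (\<theta>hat n zw - (\<theta>0 + h / sqrt (real n)))))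
        (density lborel (\<lambda>x. ennreal (normal_density 0 (sqrt (1 / Istar)) x)))"
    by (simp add: U_def[abs_def] \<theta>n_def)
qed

end
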